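(* Let $G$ be a compact metric graph equipped with standard vertex conditions, fix a finite family $\mathcal{P}$ of paths in $G$, a tree subgraph $T \subset G$, and $M>0$. Let $\Lambda$ be either $C_{G,\mathcal{P},M}$ or $SW_{G,T,M}$. Then there exist potentials $q_\ast, q^\ast \in \Lambda$ such that $$\Gamma[q_\ast] = \min\{\Gamma[q] : q \in \Lambda\}, \qquad \Gamma[q^\ast] = \max\{\Gamma[q] : q \in \Lambda\}.$$
   Context: A compact metric graph $G$ consists of finitely many edges $e\in\mathcal{E}$, each identified with a compact interval $[0,|e|]$, $|e|>0$, whose endpoints are partitioned into finitely many classes (vertices $v\in\mathcal{V}$) and glued accordingly; $G$ is always assumed connected. $W^{1,2}(G)$ is the space of continuous functions on $G$ whose restriction to each edge is in $W^{1,2}$. For a real potential $q$ on $G$, $H u=-u''+qu$ is the self-adjoint Schrödinger operator on $L^2(G)$ with standard (Kirchhoff) vertex conditions: continuity at each vertex and, at each vertex, the sum of the normal derivatives along all incident edge ends (pointing into the vertex) equals $0$. Equivalently it is the operator associated with the form $\int_G |u'|^2+q|u|^2\,dx$ on $W^{1,2}(G)$. Its spectrum is discrete; eigenvalues counted with multiplicity are $\lambda_1(q)<\lambda_2(q)\le\dots$ (the first is always simple). The fundamental gap is $\Gamma[q]=\lambda_2(q)-\lambda_1(q)$. A path $P\subset G$ is the image of a continuous map $\gamma:[0,1]\to G$ which is injective except that $\gamma(0)=\gamma(1)$ is allowed. $C_{G,\mathcal{P},M}$ is the set of (measurable) $q:G\to\mathbb{R}$ with $0\le q\le M$ on $G$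 such that $q$ is convex on each $P\in\mathcal{P}$, where $P$ is regarded as an interval. A tree is a connected metric graph without cycles; a leaf is a vertex of degree one, and the boundary of a tree is the set of its leaves. A function $u$ on a compact metric tree $T$ is single-well on $T$ if there exists $a\in T$ such that $u$ is nonincreasing along every path from a boundary vertex of $T$ to $a$. $SW_{G,T,M}$ is the set of (measurable) $q:G\to\mathbb{R}$ with $0\le q\le M$ on $G$ whose restriction to $T$ is single-well on $T$; functions agreeing almost everywhere are identified. *)

theory Defs
  imports "HOL-Analysis.Analysis" "HOL-Library.Function_Algebras"
begin

section \<open>Compact metric graphs\<close>

text \<open>
  Edge \<open>e\<close> is the interval \<open>[0, len G e]\<close>; its endpoint \<open>0\<close> belongs to the vertex \<open>src G e\<close> and its
  endpoint \<open>len G e\<close> to the vertex \<open>tgt G e\<close>. The partition of the endpoints into vertices is given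
  by the fibres of \<open>src\<close> and \<open>tgt\<close>; loops and multiple edges are allowed.
\<close>

record ('v, 'e) metric_graph =
  edges :: "'e set"
  len :: "'e \<Rightarrow> real"
  src :: "'e \<Rightarrow> 'v"
  tgt :: "'e \<Rightarrow> 'v"

definition vertices :: "('v, 'e) metric_graph \<Rightarrow> 'v set" where
  "vertices G = src G ` edges G \<union> tgt G ` edges G"

text \<open>
  The glued space: one point for each vertex and one for each interior point of an edge.
  \<open>place G e\<close> is the canonical map of the interval \<open>[0, len G e]\<close> into it.
\<close>

datatype ('v, 'e) point = Vertex 'v | Interior 'e real

definition place :: "('v, 'e) metric_graph \<Rightarrow> 'e \<Rightarrow> real \<Rightarrow> ('v, 'e) point" where
  "place G e x =
     (if x = 0 then Vertex (src G e) else if x = len G e then Vertex (tgt G e) else Interior e x)"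

definition points :: "('v, 'e) metric_graph \<Rightarrow> ('v, 'e) point set" where
  "points G = (\<Union>e\<in>edges G. place G e ` {0..len G e})"

text \<open>The quotient topology of the disjoint union of the edges.\<close>

definition graph_topology :: "('v, 'e) metric_graph \<Rightarrow> ('v, 'e) point topology" where
  "graph_topology G = topology (\<lambda>U. U \<subseteq> points G \<and>
     (\<forall>e\<in>edges G. openin (top_of_set {0..len G e}) {x \<in> {0..len G e}. place G e x \<in> U}))"

lemma openin_graph_topology:
  "openin (graph_topology G) U \<longleftrightarrow> U \<subseteq> points G \<and>
     (\<forall>e\<in>edges G. openin (top_of_set {0..len G e}) {x \<in> {0..len G e}. place G e x \<in> U})"
proof -
  let ?P = "\<lambda>U. U \<subseteq> points G \<and>
     (\<forall>e\<in>edges G. openin (top_of_set {0..len G e}) {x \<in> {0..len G e}. place G e x \<in> U})"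
  have "?P (S \<inter> T)" if "?P S" "?P T" for S T
  proof (intro conjI ballI)
    show "S \<inter> T \<subseteq> points G" using that by blast
    fix e assume e: "e \<in> edges G"
    have "{x \<in> {0..len G e}. place G e x \<in> S \<inter> T} =
        {x \<in> {0..len G e}. place G e x \<in> S} \<inter> {x \<in> {0..len G e}. place G e x \<in> T}" by auto
    with that e show "openin (top_of_set {0..len G e}) {x \<in> {0..len G e}. place G e x \<in> S \<inter> T}"
      by (metis (lifting) openin_Int)
  qed
  moreover have "?P (\<Union>\<K>)" if "\<forall>K\<in>\<K>. ?P K" for \<K>
  proof (intro conjI ballI)
    show "\<Union>\<K> \<subseteq> points G" using that by blast
    fix e assume e: "e \<in> edges G"
    have "{x \<in> {0..len G e}. place G e x \<in> \<Union>\<K>} =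
        \<Union>((\<lambda>K. {x \<in> {0..len G e}. place G e x \<in> K}) ` \<K>)" by auto
    moreover have "openin (top_of_set {0..len G e})
        (\<Union>((\<lambda>K. {x \<in> {0..len G e}. place G e x \<in> K}) ` \<K>))"
      by (rule openin_Union) (use that e in blast)
    ultimately show "openin (top_of_set {0..len G e}) {x \<in> {0..len G e}. place G e x \<in> \<Union>\<K>}"
      by (simp only:)
  qed
  ultimately have "istopology ?P"
    unfolding istopology_def by blast
  then show ?thesis
    unfolding graph_topology_def by (simp only: topology_inverse')
qed

definition compact_metric_graph :: "('v, 'e) metric_graph \<Rightarrow> bool" where
  "compact_metric_graph G \<longleftrightarrow>
     finite (edges G) \<and> edges G \<noteq> {} \<and> (\<forall>e\<in>edges G. 0 < len G e) \<and>
     connected_space (graph_topology G)"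

section \<open>The Schroedinger operator with standard vertex conditions\<close>

text \<open>
  \<open>sobolev L f g\<close>: \<open>f\<close> is the continuous representative of an element of \<open>W\<^sup>1\<^sup>,\<^sup>2(0,L)\<close>, and \<open>g \<in> L\<^sup>2\<close>
  is its weak derivative.
\<close>

definition sobolev :: "real \<Rightarrow> (real \<Rightarrow> complex) \<Rightarrow> (real \<Rightarrow> complex) \<Rightarrow> bool" where
  "sobolev L f g \<longleftrightarrow>
     g \<in> borel_measurable (lebesgue_on {0..L}) \<and>
     integrable (lebesgue_on {0..L}) (\<lambda>x. (cmod (g x))\<^sup>2) \<and>
     (\<forall>x\<in>{0..L}. f x = f 0 + (LINT t|lebesgue_on {0..x}. g t))"

text \<open>
  \<open>schroedinger G q u f\<close>: \<open>u\<close> is in the domain of the operator \<open>H\<close> with potential \<open>q\<close>, and \<open>H u = f\<close>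
  in \<open>L\<^sup>2\<close>. Functions in the domain are given by their continuous representatives, which are functions
  on the glued space; this incorporates the continuity at the vertices. \<open>u1 e\<close> and \<open>u2 e\<close> are the
  first and second derivatives on the edge \<open>e\<close> in its parametrization, so that the derivative pointing
  into the vertex is \<open>u1 e (len G e)\<close> at the end \<open>len G e\<close> and \<open>- u1 e 0\<close> at the end \<open>0\<close>.
\<close>

definition schroedinger ::
  "('v, 'e) metric_graph \<Rightarrow> (('v, 'e) point \<Rightarrow> real) \<Rightarrow> (('v, 'e) point \<Rightarrow> complex) \<Rightarrow>
   (('v, 'e) point \<Rightarrow> complex) \<Rightarrow> bool" where
  "schroedinger G q u f \<longleftrightarrow> (\<exists>u1 u2.
     (\<forall>e\<in>edges G. sobolev (len G e) (\<lambda>x. u (place G e x)) (u1 e) \<and>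
                  sobolev (len G e) (u1 e) (u2 e)) \<and>
     (\<forall>v\<in>vertices G. (\<Sum>e | e \<in> edges G \<and> tgt G e = v. u1 e (len G e)) +
                     (\<Sum>e | e \<in> edges G \<and> src G e = v. - u1 e 0) = 0) \<and>
     (\<forall>e\<in>edges G. AE x in lebesgue_on {0..len G e}.
        f (place G e x) = - u2 e x + of_real (q (place G e x)) * u (place G e x)))"

definition fun_scale :: "complex \<Rightarrow> ('a \<Rightarrow> complex) \<Rightarrow> 'a \<Rightarrow> complex" where
  "fun_scale c u = (\<lambda>p. c * u p)"

global_interpretation cfun: vector_space fun_scale
  by standard (auto simp: fun_scale_def fun_eq_iff algebra_simps)

text \<open>
  Functions on \<open>G\<close> are normalized to be \<open>0\<close> off \<open>points G\<close>, so that the dimension is not affected by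
  values outside of the graph.
\<close>

definition eigenspace ::
  "('v, 'e) metric_graph \<Rightarrow> (('v, 'e) point \<Rightarrow> real) \<Rightarrow> real \<Rightarrow> (('v, 'e) point \<Rightarrow> complex) set" where
  "eigenspace G q \<mu> =
     {u. (\<forall>p. p \<notin> points G \<longrightarrow> u p = 0) \<and> schroedinger G q u (fun_scale (of_real \<mu>) u)}"

definition multiplicity ::
  "('v, 'e) metric_graph \<Rightarrow> (('v, 'e) point \<Rightarrow> real) \<Rightarrow> real \<Rightarrow> nat" where
  "multiplicity G q \<mu> = cfun.dim (eigenspace G q \<mu>)"

text \<open>
  The \<open>k\<close>-th eigenvalue (\<open>k \<ge> 1\<close>) counted with multiplicity: the smallest \<open>l\<close> for which the total
  multiplicity of the eigenvalues in \<open>(-\<infinity>, l]\<close> is at least \<open>k\<close>. Numbers \<open>\<mu>\<close> which are not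
  eigenvalues have multiplicity \<open>0\<close>.
\<close>

definition eigenvalue ::
  "('v, 'e) metric_graph \<Rightarrow> (('v, 'e) point \<Rightarrow> real) \<Rightarrow> nat \<Rightarrow> real" where
  "eigenvalue G q k =
     Inf {l. \<exists>S. finite S \<and> S \<subseteq> {..l} \<and> k \<le> (\<Sum>\<mu>\<in>S. multiplicity G q \<mu>)}"

definition fundamental_gap :: "('v, 'e) metric_graph \<Rightarrow> (('v, 'e) point \<Rightarrow> real) \<Rightarrow> real" where
  "fundamental_gap G q = eigenvalue G q 2 - eigenvalue G q 1"

section \<open>Classes of potentials\<close>

definition bounded_potentials ::
  "('v, 'e) metric_graph \<Rightarrow> real \<Rightarrow> (('v, 'e) point \<Rightarrow> real) set" where
  "bounded_potentials G M =
     {q. (\<forall>p\<in>points G. 0 \<le> q p \<and> q p \<le> M) \<and>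
         (\<forall>e\<in>edges G. (\<lambda>x. q (place G e x)) \<in> borel_measurable (lebesgue_on {0..len G e}))}"

definition graph_path :: "('v, 'e) metric_graph \<Rightarrow> (real \<Rightarrow> ('v, 'e) point) \<Rightarrow> bool" where
  "graph_path G \<gamma> \<longleftrightarrow> pathin (graph_topology G) \<gamma> \<and>
     (\<forall>s\<in>{0..1}. \<forall>t\<in>{0..1}. \<gamma> s = \<gamma> t \<longrightarrow> s = t \<or> {s, t} = {0, 1})"

text \<open>
  As a path is injective (up to its endpoints), the arc length of its part up to \<open>t\<close> is the length
  measure of the image of that part.
\<close>

definition arc_length :: "('v, 'e) metric_graph \<Rightarrow> (real \<Rightarrow> ('v, 'e) point) \<Rightarrow> real \<Rightarrow> real" where
  "arc_length G \<gamma> t =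
     (\<Sum>e\<in>edges G. measure lebesgue {x \<in> {0..len G e}. place G e x \<in> \<gamma> ` {0..t}})"

text \<open>
  Convexity on a path, identified by arc length with the interval \<open>[0, arc_length G \<gamma> 1]\<close>. A path is
  given by its map \<open>\<gamma>\<close> and not by its image, since for a closed path the identification with an interval
  depends on the base point \<open>\<gamma> 0 = \<gamma> 1\<close>.
\<close>

definition convex_on_path ::
  "('v, 'e) metric_graph \<Rightarrow> (real \<Rightarrow> ('v, 'e) point) \<Rightarrow> (('v, 'e) point \<Rightarrow> real) \<Rightarrow> bool" where
  "convex_on_path G \<gamma> q \<longleftrightarrow>
     (\<exists>f. convex_on {0..arc_length G \<gamma> 1} f \<and> (\<forall>t\<in>{0..1}. q (\<gamma> t) = f (arc_length G \<gamma> t)))"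

definition convex_potentials ::
  "('v, 'e) metric_graph \<Rightarrow> (real \<Rightarrow> ('v, 'e) point) set \<Rightarrow> real \<Rightarrow> (('v, 'e) point \<Rightarrow> real) set" where
  "convex_potentials G \<P> M = {q \<in> bounded_potentials G M. \<forall>\<gamma>\<in>\<P>. convex_on_path G \<gamma> q}"

text \<open>
  A subgraph need not consist of full edges of \<open>G\<close>: since points of degree two may be inserted as
  vertices, any finite union of closed segments of edges is a subgraph. Degenerate segments are
  allowed, so that a single point is a tree (with empty boundary).
\<close>

definition subgraph :: "('v, 'e) metric_graph \<Rightarrow> ('v, 'e) point set \<Rightarrow> bool" where
  "subgraph G T \<longleftrightarrow> (\<exists>S. finite S \<and>
     (\<forall>(e, a, b)\<in>S. e \<in> edges G \<and> 0 \<le> a \<and> a \<le> b \<and> b \<le> len G e) \<and>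
     T = (\<Union>(e, a, b)\<in>S. place G e ` {a..b}))"

definition tree_subgraph :: "('v, 'e) metric_graph \<Rightarrow> ('v, 'e) point set \<Rightarrow> bool" where
  "tree_subgraph G T \<longleftrightarrow> subgraph G T \<and> T \<noteq> {} \<and> connectedin (graph_topology G) T \<and>
     \<not> (\<exists>\<gamma>. graph_path G \<gamma> \<and> \<gamma> 0 = \<gamma> 1 \<and> \<gamma> ` {0..1} \<subseteq> T)"

text \<open>
  The degree of a point \<open>p\<close> in a subgraph \<open>T\<close> is the number of directions \<open>\<sigma> = \<plusminus>1\<close> at the positions
  \<open>x\<close> of \<open>p\<close> on the edges \<open>e\<close> in which \<open>T\<close> contains an initial segment. A loop counts twice.
\<close>

definition degree_in ::
  "('v, 'e) metric_graph \<Rightarrow> ('v, 'e) point set \<Rightarrow> ('v, 'e) point \<Rightarrow> nat" where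
  "degree_in G T p = card {(e, x, \<sigma>).
     e \<in> edges G \<and> x \<in> {0..len G e} \<and> place G e x = p \<and> \<sigma> \<in> {-1, 1} \<and>
     (\<exists>\<epsilon>>0. \<forall>t\<in>{0<..<\<epsilon>}. x + \<sigma> * t \<in> {0..len G e} \<and> place G e (x + \<sigma> * t) \<in> T)}"

definition boundary_of :: "('v, 'e) metric_graph \<Rightarrow> ('v, 'e) point set \<Rightarrow> ('v, 'e) point set" where
  "boundary_of G T = {p \<in> T. degree_in G T p = 1}"

definition single_well ::
  "('v, 'e) metric_graph \<Rightarrow> ('v, 'e) point set \<Rightarrow> (('v, 'e) point \<Rightarrow> real) \<Rightarrow> bool" where
  "single_well G T u \<longleftrightarrow> (\<exists>a\<in>T. \<forall>\<gamma>.
     graph_path G \<gamma> \<and> \<gamma> ` {0..1} \<subseteq> T \<and> \<gamma> 0 \<in> boundary_of G T \<and> \<gamma> 1 = a \<longrightarrow>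
     antimono_on {0..1} (\<lambda>t. u (\<gamma> t)))"

text \<open>
  Potentials are represented by functions, not by classes of functions modulo almost everywhere
  equality; their operators only depend on the class.
\<close>

definition single_well_potentials ::
  "('v, 'e) metric_graph \<Rightarrow> ('v, 'e) point set \<Rightarrow> real \<Rightarrow> (('v, 'e) point \<Rightarrow> real) set" where
  "single_well_potentials G T M = {q \<in> bounded_potentials G M. single_well G T q}"

end

theory Submission
  imports Defs "HOL-Library.Diagonal_Subsequence"
begin

text \<open>
  Both classes are sequentially compact for the weak convergence of potentials on the edges, and the
  gap is continuous for it, so its values on a class form a nonempty compact set of reals.

  Continuity. Subdivide the edges into pieces so short that on each of them the equation
  \<open>- u'' + q u = \<mu> u\<close> is uniquely solvable for given boundary values. The map from the boundary values
  to the derivatives at the ends is a symmetric 2x2 matrix, and \<open>\<mu>\<close> is an eigenvalue iff the quadratic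
  form on the nodes assembled from these matrices is degenerate, with the same multiplicity. The form
  decreases strictly with \<open>\<mu>\<close>, so the first and second eigenvalue are the least \<open>\<mu>\<close> for which the form is
  nonpositive on some subspace of dimension one and two. The matrices depend continuously on \<open>\<mu>\<close> and,
  by Green's formula, on \<open>q\<close> with respect to weak convergence, hence so do these thresholds.

  Compactness. Bounded potentials have weakly convergent subsequences. For potentials convex on the
  paths, the functions of arc length converge pointwise along a subsequence. For single-well
  potentials, the centres converge along a subsequence, within one segment of \<open>T\<close>; a path from the
  boundary to the limit centre can be rerouted at its end to the nearby centres, so the potentials are
  eventually nonincreasing along it away from the end, and by Helly selection on intervals with
  rational ends they converge at all points of all such paths. In both cases the weak limit is changed
  on a null set to the pointwise limit where that exists.
\<close>

section \<open>The equation \<open>u'' = V u\<close> on a short interval\<close>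

text \<open>Eigenvalues are defined by counting solutions of the equation; a finite quadratic form,
  whose size does not depend on the potential, plays the role of a variational principle. One
  subdivision must therefore serve all potentials with values in [0,M] and all parameters up to a
  common bound for the second eigenvalue. Such a bound comes from two tents over the halves of one
  edge: for a large parameter the form is nonpositive on their span. On a piece of length L with |V|
  \<le> K the requirement K L^2 \<le> 1/100 keeps every solution within a few percent of the chord
  through its boundary values. This yields unique solvability, strict monotonicity in the parameter
  and the estimate for the tents, all with explicit constants. Potentials are functions and not
  classes modulo null sets, and convexity and monotonicity are required at every point of a path. A
  weak limit alone is thus not enough: the selections must converge at each point of the relevant
  paths, except at the centre of a single well, where the value may be lowered freely.\<close>

definition primitive :: "real \<Rightarrow> (real \<Rightarrow> real) \<Rightarrow> (real \<Rightarrow> real) \<Rightarrow> bool" where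
  "primitive L f g \<longleftrightarrow> (\<forall>x\<in>{0..L}. (g has_integral (f x - f 0)) {0..x})"

lemma primitive_integrable:
  assumes "primitive L f g" "0 \<le> x" "y \<le> L"
  shows "g integrable_on {x..y}"
proof (cases "x \<le> y")
  case True
  have "g integrable_on {0..y}" using assms True unfolding primitive_def by fastforce
  then show ?thesis by (rule integrable_subinterval_real) (use assms in auto)
qed (use integrable_on_empty in auto)

lemma primitive_diff:
  assumes "primitive L f g" "0 \<le> x" "x \<le> y" "y \<le> L"
  shows "(g has_integral (f y - f x)) {x..y}"
proof -
  have 1: "integral {0..x} g = f x - f 0" "integral {0..y} g = f y - f 0"
    using assms unfolding primitive_def by (auto intro!: integral_unique)
  have "integral {0..x} g + integral {x..y} g = integral {0..y} g"
    by (rule Henstock_Kurzweil_Integration.integral_combine) (use assms primitive_integrable[OF assms(1), of 0 y] in auto)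
  then have "integral {x..y} g = f y - f x" using 1 by simp
  then show ?thesis using primitive_integrable[OF assms(1,2,4)] by (metis integrable_integral)
qed

lemma primitive_Lipschitz:
  assumes "primitive L f g" "\<And>t. t \<in> {0..L} \<Longrightarrow> \<bar>g t\<bar> \<le> C" "x \<in> {0..L}" "y \<in> {0..L}"
  shows "\<bar>f y - f x\<bar> \<le> C * \<bar>y - x\<bar>"
proof -
  have C: "0 \<le> C" using assms(2)[OF assms(3)] by linarith
  have *: "\<bar>f y - f x\<bar> \<le> C * (y - x)" if "x \<le> y" "x \<in> {0..L}" "y \<in> {0..L}" for x y
    using has_integral_bound_real[OF C finite.emptyI primitive_diff[OF assms(1), of x y]] that assms(2) by auto
  show ?thesis using *[of x y] *[of y x] assms by (cases "x \<le> y") (auto simp: abs_minus_commute)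
qed

lemma primitive_continuous:
  assumes "primitive L f g"
  shows "continuous_on {0..L} f"
proof (cases "0 \<le> L")
  case True
  have "continuous_on {0..L} (\<lambda>x. f 0 + integral {0..x} g)"
    by (intro continuous_intros indefinite_integral_continuous_1 primitive_integrable[OF assms]) auto
  moreover have "f 0 + integral {0..x} g = f x" if "x \<in> {0..L}" for x
    using integral_unique[of g "f x - f 0" "{0..x}"] assms that unfolding primitive_def by auto
  ultimately show ?thesis by (metis (no_types, lifting) continuous_on_cong)
qed auto

lemma integrable_mult_bounded:
  fixes f g :: "real \<Rightarrow> real"
  assumes f: "f integrable_on {a..b}" "\<And>t. t \<in> {a..b} \<Longrightarrow> \<bar>f t\<bar> \<le> C"
    and g: "g integrable_on {a..b}" "\<And>t. t \<in> {a..b} \<Longrightarrow> \<bar>g t\<bar> \<le> D"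
  shows "(\<lambda>t. f t * g t) integrable_on {a..b}"
proof (rule measurable_bounded_by_integrable_imp_integrable_real)
  show "(\<lambda>t. f t * g t) \<in> borel_measurable (lebesgue_on {a..b})"
    by (intro borel_measurable_times integrable_imp_measurable f g)
  show "(\<lambda>t. C * D) integrable_on {a..b}" by (rule integrable_const_ivl)
  show "\<bar>f t * g t\<bar> \<le> C * D" if "t \<in> {a..b}" for t
    unfolding abs_mult by (rule mult_mono[OF f(2)[OF that] g(2)[OF that]]) (use f(2)[OF that] in auto)
qed auto

lemma bounded_on_interval:
  assumes "continuous_on {0..L::real} f"
  obtains C where "C \<ge> 0" "\<And>t. t \<in> {0..L} \<Longrightarrow> \<bar>f t :: real\<bar> \<le> C"
proof -
  have "bounded (f ` {0..L})" by (intro compact_imp_bounded compact_continuous_image assms) auto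
  then obtain C where C: "\<forall>x\<in>f ` {0..L}. norm x \<le> C" by (auto simp: bounded_iff)
  show ?thesis by (rule that[of "max C 0"]) (use C in \<open>auto simp: le_max_iff_disj\<close>)
qed

text \<open>The defect \<open>f F - \<integral>(g F + f G)\<close> has increments of order \<open>(y - x)\<^sup>2\<close>, hence is constant.\<close>

lemma primitive_mult:
  assumes f: "primitive L f g" and F: "primitive L F G"
    and g: "\<And>t. t \<in> {0..L} \<Longrightarrow> \<bar>g t\<bar> \<le> C" and G: "\<And>t. t \<in> {0..L} \<Longrightarrow> \<bar>G t\<bar> \<le> C"
  shows "primitive L (\<lambda>x. f x * F x) (\<lambda>t. g t * F t + f t * G t)"
  unfolding primitive_def
proof
  fix z assume z: "z \<in> {0..L}"
  have C: "0 \<le> C" using g[OF z] by linarith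
  obtain A where A: "\<And>t. t \<in> {0..L} \<Longrightarrow> \<bar>f t\<bar> \<le> A"
    using bounded_on_interval[OF primitive_continuous[OF f]] by blast
  obtain B where B: "\<And>t. t \<in> {0..L} \<Longrightarrow> \<bar>F t\<bar> \<le> B"
    using bounded_on_interval[OF primitive_continuous[OF F]] by blast
  have f_int: "f integrable_on {x..y}" and F_int: "F integrable_on {x..y}" if "0 \<le> x" "y \<le> L" for x y
    by (rule integrable_continuous_interval, rule continuous_on_subset[OF primitive_continuous[OF f]],
        use that in auto)
       (rule integrable_continuous_interval, rule continuous_on_subset[OF primitive_continuous[OF F]],
        use that in auto)
  have gF_int: "(\<lambda>t. g t * F t) integrable_on {x..y}" if "0 \<le> x" "y \<le> L" for x y
    by (rule integrable_mult_bounded[OF primitive_integrable[OF f that] g F_int[OF that] B]) (use that in auto)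
  have fG_int: "(\<lambda>t. f t * G t) integrable_on {x..y}" if "0 \<le> x" "y \<le> L" for x y
    by (rule integrable_mult_bounded[OF f_int[OF that] A primitive_integrable[OF F that] G]) (use that in auto)
  let ?h = "\<lambda>t. g t * F t + f t * G t"
  have h_int: "?h integrable_on {x..y}" if "0 \<le> x" "y \<le> L" for x y
    by (intro integrable_add gF_int fG_int that)
  define D where "D x = f x * F x - integral {0..x} ?h" for x
  have step: "\<bar>D y - D x\<bar> \<le> 2 * C\<^sup>2 * (y - x)\<^sup>2" if xy: "0 \<le> x" "x \<le> y" "y \<le> L" for x y
  proof -
    have "integral {0..x} ?h + integral {x..y} ?h = integral {0..y} ?h"
      by (rule Henstock_Kurzweil_Integration.integral_combine) (use xy h_int in auto)
    then have D: "D y - D x = f y * F y - f x * F x - integral {x..y} ?h" by (simp add: D_def)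
    \<comment> \<open>The increment of f F is split as (f y - f x) F y + f x (F y - F x), so that
      after subtracting the integrals every integrand contains a difference F y - F t or f x - f t,
      which is of order y - x.\<close>
    have "((\<lambda>t. g t * F y - g t * F t) has_integral ((f y - f x) * F y - integral {x..y} (\<lambda>t. g t * F t))) {x..y}"
      using xy by (intro has_integral_diff has_integral_mult_left primitive_diff[OF f] integrable_integral gF_int) auto
    moreover have "((\<lambda>t. f x * G t - f t * G t) has_integral (f x * (F y - F x) - integral {x..y} (\<lambda>t. f t * G t))) {x..y}"
      using xy by (intro has_integral_diff has_integral_mult_right primitive_diff[OF F] integrable_integral fG_int) auto
    ultimately have I: "((\<lambda>t. (g t * F y - g t * F t) + (f x * G t - f t * G t)) has_integral
       (((f y - f x) * F y - integral {x..y} (\<lambda>t. g t * F t)) + (f x * (F y - F x) - integral {x..y} (\<lambda>t. f t * G t)))) {x..y}"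
      by (rule has_integral_add)
    have "integral {x..y} ?h = integral {x..y} (\<lambda>t. g t * F t) + integral {x..y} (\<lambda>t. f t * G t)"
      by (rule integral_add) (use xy gF_int fG_int in auto)
    then have eq: "((f y - f x) * F y - integral {x..y} (\<lambda>t. g t * F t)) + (f x * (F y - F x) - integral {x..y} (\<lambda>t. f t * G t)) = D y - D x"
      by (simp add: D algebra_simps)
    have bd: "\<bar>(g t * F y - g t * F t) + (f x * G t - f t * G t)\<bar> \<le> 2 * C\<^sup>2 * (y - x)" if t: "t \<in> {x..y}" for t
    proof -
      have "\<bar>F y - F t\<bar> \<le> C * (y - x)"
        using primitive_Lipschitz[OF F G, of t y] t xy C mult_left_mono[of "\<bar>y - t\<bar>" "y - x" C] by fastforce
      moreover have "\<bar>f x - f t\<bar> \<le> C * (y - x)"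
        using primitive_Lipschitz[OF f g, of t x] t xy C mult_left_mono[of "\<bar>x - t\<bar>" "y - x" C] by fastforce
      moreover have "\<bar>g t\<bar> \<le> C" "\<bar>G t\<bar> \<le> C" using t xy g G by auto
      ultimately have "\<bar>g t * (F y - F t)\<bar> \<le> C * (C * (y - x))" "\<bar>(f x - f t) * G t\<bar> \<le> (C * (y - x)) * C"
        unfolding abs_mult using C xy by (auto intro!: mult_mono)
      moreover have "(C * (y - x)) * C = C * (C * (y - x))" "2 * C\<^sup>2 * (y - x) = 2 * (C * (C * (y - x)))"
        by (simp_all add: power2_eq_square)
      moreover have "(g t * F y - g t * F t) + (f x * G t - f t * G t) = g t * (F y - F t) + (f x - f t) * G t"
        by (simp add: algebra_simps)
      ultimately show ?thesis using abs_triangle_ineq[of "g t * (F y - F t)" "(f x - f t) * G t"] by linarith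
    qed
    have "\<bar>D y - D x\<bar> \<le> 2 * C\<^sup>2 * (y - x) * (y - x)"
      using has_integral_bound_real[where B = "2 * C\<^sup>2 * (y - x)", OF _ finite.emptyI I] bd xy
      unfolding eq by auto
    then show ?thesis by (simp add: power2_eq_square mult.assoc)
  qed
  have "(D has_field_derivative 0) (at x within {0..L})" if x: "x \<in> {0..L}" for x
    unfolding has_field_derivative_iff
  proof (rule Lim_null_comparison)
    show "\<forall>\<^sub>F y in at x within {0..L}. norm ((D y - D x) / (y - x)) \<le> 2 * C\<^sup>2 * \<bar>y - x\<bar>"
      unfolding eventually_at_topological
    proof (intro exI[of _ UNIV] conjI ballI impI)
      fix y assume "y \<noteq> x" "y \<in> {0..L}"
      have "\<bar>D y - D x\<bar> \<le> 2 * C\<^sup>2 * (y - x)\<^sup>2"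
        using step[of x y] step[of y x] x \<open>y \<in> {0..L}\<close>
        by (cases "x \<le> y") (auto simp: abs_minus_commute power2_commute)
      then show "norm ((D y - D x) / (y - x)) \<le> 2 * C\<^sup>2 * \<bar>y - x\<bar>"
        using \<open>y \<noteq> x\<close> by (simp add: abs_divide pos_divide_le_eq power2_eq_square mult.assoc)
    qed auto
    have "((\<lambda>y. 2 * C\<^sup>2 * \<bar>y - x\<bar>) \<longlongrightarrow> 2 * C\<^sup>2 * \<bar>x - x\<bar>) (at x within {0..L})"
      by (intro tendsto_intros)
    then show "((\<lambda>y. 2 * C\<^sup>2 * \<bar>y - x\<bar>) \<longlongrightarrow> 0) (at x within {0..L})" by simp
  qed
  then obtain c where c: "\<And>x. x \<in> {0..L} \<Longrightarrow> D x = c"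
    using has_field_derivative_zero_constant[of "{0..L}" D] by auto
  have "D z = D 0" using c[of 0] c[of z] z by auto
  then have "integral {0..z} ?h = f z * F z - f 0 * F 0" by (simp add: D_def)
  then show "(?h has_integral (f z * F z - f 0 * F 0)) {0..z}"
    using h_int[of 0 z] z by (metis atLeastAtMost_iff integrable_integral order_refl)
qed

section \<open>Solutions of u'' = V u in integrated form and Green's identity\<close>

definition solution :: "(real \<Rightarrow> real) \<Rightarrow> real \<Rightarrow> (real \<Rightarrow> real) \<Rightarrow> (real \<Rightarrow> real) \<Rightarrow> bool" where
  "solution V L u w \<longleftrightarrow> primitive L u w \<and> primitive L w (\<lambda>t. V t * u t)"

definition potential :: "real \<Rightarrow> real \<Rightarrow> (real \<Rightarrow> real) \<Rightarrow> bool" where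
  "potential L K V \<longleftrightarrow> V \<in> borel_measurable (lebesgue_on {0..L}) \<and> (\<forall>x\<in>{0..L}. \<bar>V x\<bar> \<le> K)"

lemma primitive_linear:
  assumes "primitive L f g" "primitive L F G"
  shows "primitive L (\<lambda>x. a * f x + b * F x) (\<lambda>x. a * g x + b * G x)"
  unfolding primitive_def
proof
  fix x assume "x \<in> {0..L}"
  then have "((\<lambda>x. a * g x + b * G x) has_integral a * (f x - f 0) + b * (F x - F 0)) {0..x}"
    using assms unfolding primitive_def by (intro has_integral_add has_integral_mult_right) auto
  then show "((\<lambda>x. a * g x + b * G x) has_integral a * f x + b * F x - (a * f 0 + b * F 0)) {0..x}"
    by (simp add: algebra_simps)
qed

lemma solution_linear:
  assumes "solution V L u w" "solution V L u' w'"
  shows "solution V L (\<lambda>x. a * u x + b * u' x) (\<lambda>x. a * w x + b * w' x)"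
  using primitive_linear[of L u w u' w' a b] primitive_linear[of L w "\<lambda>t. V t * u t" w' "\<lambda>t. V t * u' t" a b] assms
  unfolding solution_def by (simp add: algebra_simps)

text \<open>The product rule \<open>primitive_mult\<close> asks for bounded functions; continuity of
  u and w and the bound on V supply them, with one constant for all three.\<close>

lemma solution_bounds:
  assumes "solution V L u w" "potential L K V"
  obtains C where "\<And>t. t \<in> {0..L} \<Longrightarrow> \<bar>u t\<bar> \<le> C" "\<And>t. t \<in> {0..L} \<Longrightarrow> \<bar>w t\<bar> \<le> C"
    "\<And>t. t \<in> {0..L} \<Longrightarrow> \<bar>V t * u t\<bar> \<le> C"
proof -
  obtain A where A: "A \<ge> 0" "\<And>t. t \<in> {0..L} \<Longrightarrow> \<bar>u t\<bar> \<le> A"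
    using bounded_on_interval primitive_continuous assms unfolding solution_def by metis
  obtain B where B: "B \<ge> 0" "\<And>t. t \<in> {0..L} \<Longrightarrow> \<bar>w t\<bar> \<le> B"
    using bounded_on_interval primitive_continuous assms unfolding solution_def by metis
  show ?thesis
  proof (rule that[of "A + B + \<bar>K\<bar> * A"])
    fix t assume t: "t \<in> {0..L}"
    show "\<bar>u t\<bar> \<le> A + B + \<bar>K\<bar> * A" "\<bar>w t\<bar> \<le> A + B + \<bar>K\<bar> * A"
      using A(2)[OF t] B(2)[OF t] A(1) B(1) mult_nonneg_nonneg[OF abs_ge_zero A(1), of K] by linarith+
    have "\<bar>V t * u t\<bar> \<le> \<bar>K\<bar> * A"
      unfolding abs_mult using A t assms(2) by (intro mult_mono) (auto simp: potential_def intro: order_trans[OF _ abs_ge_self])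
    then show "\<bar>V t * u t\<bar> \<le> A + B + \<bar>K\<bar> * A" using A B by linarith
  qed
qed

text \<open>Subtract the product rules for w1 u2 and w2 u1: the terms w1 w2 cancel. With V1 = V2
  this yields the symmetry of the boundary matrix, with different potentials its dependence on the
  potential.\<close>

lemma Green_identity:
  assumes u1: "solution V1 L u1 w1" "potential L K1 V1" and u2: "solution V2 L u2 w2" "potential L K2 V2"
    and L: "0 \<le> L"
  shows "((\<lambda>t. (V1 t - V2 t) * (u1 t * u2 t)) has_integral
     (w1 L * u2 L - u1 L * w2 L - (w1 0 * u2 0 - u1 0 * w2 0))) {0..L}"
proof -
  obtain C1 where C1: "\<And>t. t \<in> {0..L} \<Longrightarrow> \<bar>u1 t\<bar> \<le> C1" "\<And>t. t \<in> {0..L} \<Longrightarrow> \<bar>w1 t\<bar> \<le> C1"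
    "\<And>t. t \<in> {0..L} \<Longrightarrow> \<bar>V1 t * u1 t\<bar> \<le> C1" using solution_bounds[OF u1] by blast
  obtain C2 where C2: "\<And>t. t \<in> {0..L} \<Longrightarrow> \<bar>u2 t\<bar> \<le> C2" "\<And>t. t \<in> {0..L} \<Longrightarrow> \<bar>w2 t\<bar> \<le> C2"
    "\<And>t. t \<in> {0..L} \<Longrightarrow> \<bar>V2 t * u2 t\<bar> \<le> C2" using solution_bounds[OF u2] by blast
  have "primitive L (\<lambda>x. w1 x * u2 x) (\<lambda>t. (V1 t * u1 t) * u2 t + w1 t * w2 t)"
    using u1 u2 C1 C2 unfolding solution_def
    by (intro primitive_mult[where C="max C1 C2"]) (auto simp: le_max_iff_disj)
  moreover have "primitive L (\<lambda>x. w2 x * u1 x) (\<lambda>t. (V2 t * u2 t) * u1 t + w2 t * w1 t)"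
    using u1 u2 C1 C2 unfolding solution_def
    by (intro primitive_mult[where C="max C1 C2"]) (auto simp: le_max_iff_disj)
  ultimately have "((\<lambda>t. ((V1 t * u1 t) * u2 t + w1 t * w2 t) - ((V2 t * u2 t) * u1 t + w2 t * w1 t))
     has_integral ((w1 L * u2 L - w1 0 * u2 0) - (w2 L * u1 L - w2 0 * u1 0))) {0..L}"
    unfolding primitive_def using L by (intro has_integral_diff) auto
  then show ?thesis by (simp add: algebra_simps)
qed

text \<open>The product rule for w u. It turns the quadratic form of the boundary values into the
  energy of the solution.\<close>

lemma energy_identity:
  assumes u: "solution V L u w" "potential L K V" and L: "0 \<le> L"
  shows "((\<lambda>t. V t * (u t)\<^sup>2 + (w t)\<^sup>2) has_integral (w L * u L - w 0 * u 0)) {0..L}"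
proof -
  obtain C where C: "\<And>t. t \<in> {0..L} \<Longrightarrow> \<bar>u t\<bar> \<le> C" "\<And>t. t \<in> {0..L} \<Longrightarrow> \<bar>w t\<bar> \<le> C"
    "\<And>t. t \<in> {0..L} \<Longrightarrow> \<bar>V t * u t\<bar> \<le> C" using solution_bounds[OF u] by blast
  have "primitive L (\<lambda>x. w x * u x) (\<lambda>t. (V t * u t) * u t + w t * w t)"
    using u C unfolding solution_def by (intro primitive_mult[where C=C]) auto
  then show ?thesis unfolding primitive_def using L by (auto simp: power2_eq_square algebra_simps)
qed

section \<open>Short intervals: solvability and comparison with the chord\<close>

definition short :: "real \<Rightarrow> real \<Rightarrow> (real \<Rightarrow> real) \<Rightarrow> bool" where
  "short L K V \<longleftrightarrow> 0 < L \<and> potential L K V \<and> K * L\<^sup>2 \<le> 1 / 100"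

lemma potential_nonneg: "potential L K V \<Longrightarrow> 0 \<le> L \<Longrightarrow> 0 \<le> K"
  unfolding potential_def by (metis abs_ge_zero atLeastAtMost_iff order_refl order_trans)

lemma potential_integrable:
  assumes "potential L K V" "0 \<le> x" "y \<le> L"
  shows "V integrable_on {x..y}"
proof -
  have "V integrable_on {0..L}"
    by (rule measurable_bounded_by_integrable_imp_integrable_real[where g = "\<lambda>_. K"])
       (use assms in \<open>auto simp: potential_def integrable_const_ivl\<close>)
  then show ?thesis by (rule integrable_subinterval_real) (use assms in auto)
qed

lemma potential_mult_integrable:
  assumes "potential L K V" "continuous_on {0..L} f" "0 \<le> x" "y \<le> L"
  shows "(\<lambda>t. V t * f t) integrable_on {x..y}"
proof -
  obtain C where "\<And>t. t \<in> {0..L} \<Longrightarrow> \<bar>f t\<bar> \<le> C" using bounded_on_interval[OF assms(2)] by blast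
  then have "(\<lambda>t. V t * f t) integrable_on {0..L}"
    using assms(1) by (intro integrable_mult_bounded[where C=K and D=C] potential_integrable[OF assms(1)]
        integrable_continuous_interval assms(2)) (auto simp: potential_def)
  then show ?thesis by (rule integrable_subinterval_real) (use assms in auto)
qed

lemma has_integral_bound_on:
  fixes f :: "real \<Rightarrow> real"
  assumes "(f has_integral I) {a..b}" "\<And>t. t \<in> {a..b} \<Longrightarrow> \<bar>f t\<bar> \<le> B" "a \<le> b"
  shows "\<bar>I\<bar> \<le> B * (b - a)"
proof -
  have "0 \<le> B" using assms(2)[of a] assms(3) by auto
  then show ?thesis using has_integral_bound_real[OF _ finite.emptyI assms(1)] assms(2,3) by auto
qed

text \<open>Picard iteration for the integral equation u(x) = a + b x + double integral of V u. One
  application contracts the supremum norm by K L^2 < 1, so a single fixed point argument covers the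
  whole interval.\<close>

lemma solution_exists:
  assumes V: "short L K V"
  obtains u w where "solution V L u w" "u 0 = a" "w 0 = b"
proof -
  have L: "0 < L" and pot: "potential L K V" and KL: "K * L\<^sup>2 < 1" and K: "0 \<le> K"
    using V potential_nonneg[of L K V] by (auto simp: short_def)
  \<comment> \<open>Bounded continuous functions live on the whole line. Clamping the argument to
    [0,L] makes the image of the map constant on both sides of the interval, so that only V on [0,L]
    enters.\<close>
  define y where "y x = max 0 (min L x)" for x :: real
  have y: "y x \<in> {0..L}" "x \<in> {0..L} \<Longrightarrow> y x = x" "continuous_on UNIV y" for x
    using L by (auto simp: y_def[abs_def] intro!: continuous_intros)
  define I where "I \<phi> t = integral {0..t} (\<lambda>r. V r * apply_bcontfun \<phi> r)" for \<phi> t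
  define J where "J \<phi> x = integral {0..x} (I \<phi>)" for \<phi> x
  define F where "F \<phi> x = a + b * y x + J \<phi> (y x)" for \<phi> x
  have int1: "(\<lambda>r. V r * apply_bcontfun \<phi> r) integrable_on {0..t}" if "t \<le> L" for \<phi> t
    by (rule potential_mult_integrable[OF pot]) (use that in auto)
  have contI: "continuous_on {0..L} (I \<phi>)" for \<phi>
    unfolding I_def by (rule indefinite_integral_continuous_1) (use int1 in auto)
  have int2: "I \<phi> integrable_on {0..t}" if "t \<le> L" for \<phi> t
    by (rule integrable_continuous_interval, rule continuous_on_subset[OF contI]) (use that in auto)
  have contJ: "continuous_on {0..L} (J \<phi>)" for \<phi>
    unfolding J_def by (rule indefinite_integral_continuous_1) (use int2 in auto)
  have Fb: "F \<phi> \<in> bcontfun" for \<phi>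
  proof -
    have c: "continuous_on {0..L} (\<lambda>x. a + b * x + J \<phi> x)" by (intro continuous_intros contJ)
    obtain C where C: "\<And>t. t \<in> {0..L} \<Longrightarrow> \<bar>a + b * t + J \<phi> t\<bar> \<le> C" using bounded_on_interval[OF c] by blast
    have "continuous_on UNIV (\<lambda>x. a + b * y x + J \<phi> (y x))"
      by (rule continuous_on_compose2[OF c y(3)]) (use y in auto)
    then show ?thesis using C[OF y(1)] by (intro bcontfun_normI[where b=C]) (auto simp: F_def[abs_def])
  qed
  define T where "T \<phi> = Bcontfun (F \<phi>)" for \<phi>
  have T: "apply_bcontfun (T \<phi>) = F \<phi>" for \<phi> unfolding T_def by (rule Bcontfun_inverse[OF Fb])
  have "\<exists>!\<phi>. T \<phi> = \<phi>"
  proof (rule banach_fix_type[of "K * L\<^sup>2"])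
    show "0 \<le> K * L\<^sup>2" "K * L\<^sup>2 < 1" using K KL by auto
    show "\<forall>\<phi> \<psi>. dist (T \<phi>) (T \<psi>) \<le> K * L\<^sup>2 * dist \<phi> \<psi>"
    proof (intro allI dist_bound)
      fix \<phi> \<psi> x
      have V: "\<bar>V r\<bar> \<le> K" if "r \<in> {0..L}" for r using pot that by (auto simp: potential_def)
      have 1: "\<bar>I \<phi> t - I \<psi> t\<bar> \<le> K * L * dist \<phi> \<psi>" if t: "t \<in> {0..L}" for t
      proof -
        have "((\<lambda>r. V r * \<phi> r - V r * \<psi> r) has_integral (I \<phi> t - I \<psi> t)) {0..t}"
          unfolding I_def by (intro has_integral_diff integrable_integral int1) (use t in auto)
        moreover have "\<bar>V r * \<phi> r - V r * \<psi> r\<bar> \<le> K * dist \<phi> \<psi>" if "r \<in> {0..t}" for r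
        proof -
          have "\<bar>V r\<bar> * \<bar>\<phi> r - \<psi> r\<bar> \<le> K * dist \<phi> \<psi>"
            using V[of r] dist_bounded[of \<phi> r \<psi>] that t K by (intro mult_mono) (auto simp: dist_real_def)
          then show ?thesis by (simp add: abs_mult[symmetric] right_diff_distrib)
        qed
        ultimately have "\<bar>I \<phi> t - I \<psi> t\<bar> \<le> K * dist \<phi> \<psi> * (t - 0)"
          by (intro has_integral_bound_on) (use t in auto)
        also have "\<dots> \<le> K * dist \<phi> \<psi> * L" using t K by (intro mult_left_mono) auto
        finally show ?thesis by (simp add: mult_ac)
      qed
      have "((\<lambda>r. I \<phi> r - I \<psi> r) has_integral (J \<phi> (y x) - J \<psi> (y x))) {0..y x}"
        unfolding J_def by (intro has_integral_diff integrable_integral int2) (use y in auto)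
      then have "\<bar>J \<phi> (y x) - J \<psi> (y x)\<bar> \<le> K * L * dist \<phi> \<psi> * (y x - 0)"
        by (rule has_integral_bound_on) (use 1 y(1)[of x] in auto)
      also have "\<dots> \<le> K * L * dist \<phi> \<psi> * L" using y(1)[of x] K L by (intro mult_left_mono) auto
      finally show "dist (T \<phi> x) (T \<psi> x) \<le> K * L\<^sup>2 * dist \<phi> \<psi>"
        by (simp add: T F_def dist_real_def power2_eq_square mult_ac)
    qed
  qed
  then obtain \<phi> where "T \<phi> = \<phi>" by blast
  then have fixpoint: "apply_bcontfun \<phi> x = F \<phi> x" for x using T by metis
  have J0: "J \<phi> 0 = 0" "I \<phi> 0 = 0" by (simp_all add: J_def I_def)
  have u0: "\<phi> 0 = a" using y(2)[of 0] L J0 fixpoint by (simp add: F_def)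
  have "primitive L \<phi> (\<lambda>x. b + I \<phi> x)"
    unfolding primitive_def
  proof
    fix x assume x: "x \<in> {0..L}"
    have "((\<lambda>x. b + I \<phi> x) has_integral (x * b + J \<phi> x)) {0..x}"
      unfolding J_def by (intro has_integral_add integrable_integral int2)
        (use x has_integral_const_real[of b 0 x] in auto)
    then show "((\<lambda>x. b + I \<phi> x) has_integral (\<phi> x - \<phi> 0)) {0..x}"
      using x u0 fixpoint[of x] y(2)[OF x] by (simp add: F_def mult.commute)
  qed
  moreover have "primitive L (\<lambda>x. b + I \<phi> x) (\<lambda>t. V t * \<phi> t)"
    unfolding primitive_def using J0 int1 by (auto simp: I_def intro!: integrable_integral)
  ultimately show ?thesis using that[of \<phi> "\<lambda>x. b + I \<phi> x"] u0 J0 by (simp add: solution_def)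
qed

lemma linear_interpolation_bound:
  fixes a b L t :: real
  assumes "0 < L" "t \<in> {0..L}" "\<bar>a\<bar> \<le> B" "\<bar>b\<bar> \<le> B"
  shows "\<bar>a + (b - a) * t / L\<bar> \<le> B"
proof -
  have "a + (b - a) * t / L = (1 - t / L) * a + (t / L) * b" using assms by (simp add: field_simps)
  moreover have "\<bar>(1 - t / L) * a\<bar> \<le> (1 - t / L) * B" "\<bar>(t / L) * b\<bar> \<le> (t / L) * B"
    using assms mult_left_mono[of "\<bar>b\<bar>" B "t / L"] mult_left_mono[of "\<bar>a\<bar>" B "1 - t / L"] by (simp_all add: abs_mult)
  moreover have "(1 - t / L) * B + (t / L) * B = B" by (simp add: algebra_simps)
  moreover have "\<bar>p + q\<bar> \<le> x + y" if "\<bar>p\<bar> \<le> x" "\<bar>q\<bar> \<le> y" for p q x y :: real using that by linarith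
  ultimately show ?thesis by metis
qed

text \<open>Let m be the maximum of |u|. Then w varies by at most K m L, so u stays within K m L^2
  \<le> m/100 of its tangent at 0 and within m/50 of the chord. Hence m \<le> B + m/50, that is m
  \<le> (50/49) B, and the deviation from the chord is at most B/49. The case B = 0 is
  uniqueness.\<close>

lemma solution_near_linear:
  assumes V: "short L K V" and u: "solution V L u w" and x: "x \<in> {0..L}"
    and B: "\<bar>u 0\<bar> \<le> B" "\<bar>u L\<bar> \<le> B"
  shows "\<bar>u x - (u 0 + (u L - u 0) * x / L)\<bar> \<le> B / 49" "\<bar>w x\<bar> \<le> 3 * B / L" "\<bar>u x\<bar> \<le> 2 * B"
proof -
  have L: "0 < L" and pot: "potential L K V" and KL: "K * L\<^sup>2 \<le> 1/100" and K: "0 \<le> K"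
    using V potential_nonneg[of L K V] by (auto simp: short_def)
  have pu: "primitive L u w" and pw: "primitive L w (\<lambda>t. V t * u t)" using u by (auto simp: solution_def)
  have "continuous_on {0..L} (\<lambda>x. \<bar>u x\<bar>)" by (intro continuous_intros primitive_continuous[OF pu])
  then obtain z where z: "z \<in> {0..L}" "\<And>t. t \<in> {0..L} \<Longrightarrow> \<bar>u t\<bar> \<le> \<bar>u z\<bar>"
    using continuous_attains_sup[of "{0..L}" "\<lambda>x. \<bar>u x\<bar>"] L by auto
  define m where "m = \<bar>u z\<bar>"
  have m: "0 \<le> m" "\<And>t. t \<in> {0..L} \<Longrightarrow> \<bar>u t\<bar> \<le> m" using z by (auto simp: m_def)
  have Vu: "\<bar>V t * u t\<bar> \<le> K * m" if "t \<in> {0..L}" for t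
    unfolding abs_mult using pot that m K by (intro mult_mono) (auto simp: potential_def)
  have w0: "\<bar>w t - w 0\<bar> \<le> K * m * L" if t: "t \<in> {0..L}" for t
  proof -
    have "\<bar>w t - w 0\<bar> \<le> K * m * \<bar>t - 0\<bar>" using t L by (intro primitive_Lipschitz[OF pw Vu]) auto
    also have "\<dots> \<le> K * m * L" using t K m by (intro mult_left_mono) auto
    finally show ?thesis .
  qed
  have KLm: "K * m * L * L \<le> m / 100"
    using mult_right_mono[OF KL m(1)] by (simp add: power2_eq_square mult_ac)
  have u0: "\<bar>u t - u 0 - w 0 * t\<bar> \<le> m / 100" if t: "t \<in> {0..L}" for t
  proof -
    have "((\<lambda>s. w s - w 0) has_integral (u t - u 0 - w 0 * t)) {0..t}"
      using pu t has_integral_const_real[of "w 0" 0 t]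
      by (intro has_integral_diff) (auto simp: primitive_def mult.commute)
    then have "\<bar>u t - u 0 - w 0 * t\<bar> \<le> K * m * L * (t - 0)"
      by (rule has_integral_bound_on) (use w0 t in auto)
    also have "\<dots> \<le> K * m * L * L" using t K m L by (intro mult_left_mono) auto
    finally show ?thesis using KLm by linarith
  qed
  \<comment> \<open>Replacing the slope w 0 by the slope of the chord costs the deviation at L once
    more, scaled by t/L.\<close>
  have lin: "\<bar>u t - (u 0 + (u L - u 0) * t / L)\<bar> \<le> m / 50" if t: "t \<in> {0..L}" for t
  proof -
    have "\<bar>(t / L) * (u L - u 0 - w 0 * L)\<bar> \<le> 1 * (m / 100)"
      unfolding abs_mult using t L u0[of L] by (intro mult_mono) auto
    moreover have "u t - (u 0 + (u L - u 0) * t / L) = (u t - u 0 - w 0 * t) - (t / L) * (u L - u 0 - w 0 * L)"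
      using L by (simp add: field_simps)
    moreover have "\<bar>x\<bar> \<le> m / 50" if "x = a - b" "\<bar>a\<bar> \<le> m / 100" "\<bar>b\<bar> \<le> 1 * (m / 100)" for x a b using that by linarith
    ultimately show ?thesis using u0[OF t] by blast
  qed
  have linB: "\<bar>u 0 + (u L - u 0) * t / L\<bar> \<le> B" if t: "t \<in> {0..L}" for t
    by (rule linear_interpolation_bound[OF L t B])
  have "\<bar>p\<bar> \<le> B + m / 50" if "\<bar>p - q\<bar> \<le> m / 50" "\<bar>q\<bar> \<le> B" for p q using that by linarith
  from this[OF lin[OF z(1)] linB[OF z(1)]] have mB: "m \<le> 50 / 49 * B" by (simp add: m_def)
  show "\<bar>u x - (u 0 + (u L - u 0) * x / L)\<bar> \<le> B / 49" using lin[OF x] mB by linarith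
  show "\<bar>u x\<bar> \<le> 2 * B" using m(2)[OF x] mB m(1) by linarith
  have "\<bar>y\<bar> \<le> 2 * B + m / 100" if "\<bar>u L - u 0 - y\<bar> \<le> m / 100" for y using that B by linarith
  from this[OF u0[of L]] have "\<bar>w 0 * L\<bar> \<le> 2 * B + m / 100" using L by simp
  moreover have "\<bar>(w x - w 0) * L\<bar> \<le> m / 100"
    using order_trans[OF mult_right_mono[OF w0[OF x], of L] KLm] L by (simp add: abs_mult)
  moreover have "w x * L = w 0 * L + (w x - w 0) * L" by (simp add: left_diff_distrib)
  moreover have "\<bar>p\<bar> \<le> 3 * B" if "\<bar>q\<bar> \<le> 2 * B + m / 100" "\<bar>r\<bar> \<le> m / 100" "p = q + r" for p q r
    using that mB m(1) by linarith
  ultimately have "\<bar>w x * L\<bar> \<le> 3 * B" by blast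
  then show "\<bar>w x\<bar> \<le> 3 * B / L" using L by (simp add: abs_mult field_simps)
qed

lemma dirichlet_unique:
  assumes V: "short L K V" and u: "solution V L u w" "solution V L u' w'"
    and b: "u 0 = u' 0" "u L = u' L" and x: "x \<in> {0..L}"
  shows "u x = u' x" "w x = w' x"
proof -
  have s: "solution V L (\<lambda>x. 1 * u x + (- 1) * u' x) (\<lambda>x. 1 * w x + (- 1) * w' x)"
    by (rule solution_linear[OF u])
  show "u x = u' x" "w x = w' x"
    using solution_near_linear(2,3)[OF V s x, of 0] b by auto
qed

text \<open>Take the solutions s and c with initial data (0,1) and (1,0). If s vanished at L, the
  bound on the derivative with B = 0 would contradict the slope 1 at 0. So the value at L can be
  prescribed through the coefficient of s.\<close>

lemma dirichlet_exists:
  assumes V: "short L K V"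
  obtains u w where "solution V L u w" "u 0 = a" "u L = b"
proof -
  obtain s s1 where s: "solution V L s s1" "s 0 = 0" "s1 0 = 1" using solution_exists[OF V] by blast
  obtain c c1 where c: "solution V L c c1" "c 0 = 1" "c1 0 = 0" using solution_exists[OF V] by blast
  have "s L \<noteq> 0"
    using solution_near_linear(2)[OF V s(1), of 0 0] s V by (auto simp: short_def)
  then show ?thesis
    by (intro that[OF solution_linear[OF c(1) s(1), of a "(b - a * c L) / s L"]]) (use s c in auto)
qed

section \<open>The boundary matrix (Dirichlet-to-Neumann map) of a short interval\<close>

definition dirichlet_slope :: "(real \<Rightarrow> real) \<Rightarrow> real \<Rightarrow> real \<Rightarrow> real \<Rightarrow> real \<Rightarrow> real" where
  "dirichlet_slope V L a b = (SOME w. \<exists>u. solution V L u w \<and> u 0 = a \<and> u L = b)"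

text \<open>Uniqueness for the boundary value problem makes the choice in
  \<open>dirichlet_slope\<close> immaterial on [0,L]; outside of the interval its values carry no
  information.\<close>

lemma dirichlet_slope_eq:
  assumes V: "short L K V" and u: "solution V L u w" and x: "x \<in> {0..L}"
  shows "dirichlet_slope V L (u 0) (u L) x = w x"
proof -
  have "\<exists>u'. solution V L u' (dirichlet_slope V L (u 0) (u L)) \<and> u' 0 = u 0 \<and> u' L = u L"
    unfolding dirichlet_slope_def
    by (rule someI[where P = "\<lambda>w'. \<exists>u'. solution V L u' w' \<and> u' 0 = u 0 \<and> u' L = u L" and x = w]) (use u in blast)
  then show ?thesis using dirichlet_unique(2)[OF V _ u _ _ x] by metis
qed

text \<open>The entries of the symmetric matrix that maps the boundary values of a solution to its
  derivatives pointing into the endpoints.\<close>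

definition stiffness :: "(real \<Rightarrow> real) \<Rightarrow> real \<Rightarrow> nat \<Rightarrow> real" where
  "stiffness V L i = (if i = 0 then - dirichlet_slope V L 1 0 0
     else if i = 1 then - dirichlet_slope V L 0 1 0 else dirichlet_slope V L 0 1 L)"

text \<open>Green's identity for the solutions with boundary values (1,0) and (0,1) and one
  potential: the integrand is 0, and the boundary terms are the two off-diagonal entries.\<close>

lemma stiffness_symmetric:
  assumes V: "short L K V"
  shows "dirichlet_slope V L 1 0 L = stiffness V L 1"
proof -
  have L: "0 < L" and pot: "potential L K V" using V by (auto simp: short_def)
  obtain u w where u: "solution V L u w" "u 0 = 1" "u L = 0" using dirichlet_exists[OF V] by blast
  obtain v z where v: "solution V L v z" "v 0 = 0" "v L = 1" using dirichlet_exists[OF V] by blast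
  have "((\<lambda>t. 0) has_integral w L + z 0) {0..L}"
    using Green_identity[OF u(1) pot v(1) pot] u v L by simp
  then have "w L + z 0 = 0" using has_integral_unique has_integral_0 by blast
  moreover have "dirichlet_slope V L 1 0 L = w L" "dirichlet_slope V L 0 1 0 = z 0"
    using dirichlet_slope_eq[OF V u(1), of L] dirichlet_slope_eq[OF V v(1), of 0] u v L by auto
  ultimately show ?thesis by (simp add: stiffness_def)
qed

text \<open>By uniqueness the solution is u 0 times the one with boundary values (1,0) plus u L
  times the one with (0,1). The minus sign at 0 makes the derivative point into the
  endpoint.\<close>

lemma stiffness_flux:
  assumes V: "short L K V" and u: "solution V L u w"
  shows "- w 0 = stiffness V L 0 * u 0 + stiffness V L 1 * u L"
    and "w L = stiffness V L 1 * u 0 + stiffness V L 2 * u L"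
proof -
  have L: "0 < L" using V by (auto simp: short_def)
  obtain p p1 where p: "solution V L p p1" "p 0 = 1" "p L = 0" using dirichlet_exists[OF V] by blast
  obtain r r1 where r: "solution V L r r1" "r 0 = 0" "r L = 1" using dirichlet_exists[OF V] by blast
  have w: "w x = u 0 * p1 x + u L * r1 x" if "x \<in> {0..L}" for x
    using dirichlet_unique(2)[OF V u solution_linear[OF p(1) r(1), of "u 0" "u L"] _ _ that] p r by auto
  have "dirichlet_slope V L 1 0 x = p1 x" "dirichlet_slope V L 0 1 x = r1 x" if "x \<in> {0..L}" for x
    using dirichlet_slope_eq[OF V p(1) that] dirichlet_slope_eq[OF V r(1) that] p r by auto
  then show "- w 0 = stiffness V L 0 * u 0 + stiffness V L 1 * u L"
    "w L = stiffness V L 1 * u 0 + stiffness V L 2 * u L"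
    using w[of 0] w[of L] L stiffness_symmetric[OF V] by (auto simp: stiffness_def)
qed

definition stiffness_form :: "(real \<Rightarrow> real) \<Rightarrow> real \<Rightarrow> real \<Rightarrow> real \<Rightarrow> real \<Rightarrow> real \<Rightarrow> real" where
  "stiffness_form V L a b a' b' = stiffness V L 0 * (a * a') + stiffness V L 1 * (b * a' + a * b') + stiffness V L 2 * (b * b')"

lemma stiffness_form_solution:
  assumes V: "short L K V" and u: "solution V L u w"
  shows "stiffness_form V L (u 0) (u L) a b = w L * b - w 0 * a"
    and "stiffness_form V L a b (u 0) (u L) = w L * b - w 0 * a"
proof -
  have "w L * b = (stiffness V L 1 * u 0 + stiffness V L 2 * u L) * b"
    "(- w 0) * a = (stiffness V L 0 * u 0 + stiffness V L 1 * u L) * a"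
    using stiffness_flux[OF V u] by simp_all
  then show "stiffness_form V L (u 0) (u L) a b = w L * b - w 0 * a"
    "stiffness_form V L a b (u 0) (u L) = w L * b - w 0 * a"
    unfolding stiffness_form_def by (simp_all add: algebra_simps)
qed

text \<open>The central perturbation formula. The two solutions may have different boundary values
  and solve different equations; the boundary term of Green's identity is still the difference of
  the two forms at the same arguments. It drives the monotonicity in the parameter, the upper bound,
  and the continuity in the potential.\<close>

lemma stiffness_form_diff:
  assumes V1: "short L K1 V1" and u1: "solution V1 L u1 w1" and V2: "short L K2 V2" and u2: "solution V2 L u2 w2"
  shows "((\<lambda>t. (V1 t - V2 t) * (u1 t * u2 t)) has_integral
    (stiffness_form V1 L (u1 0) (u1 L) (u2 0) (u2 L) - stiffness_form V2 L (u1 0) (u1 L) (u2 0) (u2 L))) {0..L}"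
proof -
  have "((\<lambda>t. (V1 t - V2 t) * (u1 t * u2 t)) has_integral
     (w1 L * u2 L - u1 L * w2 L - (w1 0 * u2 0 - u1 0 * w2 0))) {0..L}"
    using V1 V2 u1 u2 by (intro Green_identity) (auto simp: short_def)
  moreover have "w1 L * u2 L - u1 L * w2 L - (w1 0 * u2 0 - u1 0 * w2 0) =
    stiffness_form V1 L (u1 0) (u1 L) (u2 0) (u2 L) - stiffness_form V2 L (u1 0) (u1 L) (u2 0) (u2 L)"
    unfolding stiffness_form_solution(1)[OF V1 u1] stiffness_form_solution(2)[OF V2 u2] by (simp add: algebra_simps)
  ultimately show ?thesis by simp
qed

abbreviation stiffness_quad :: "(real \<Rightarrow> real) \<Rightarrow> real \<Rightarrow> real \<Rightarrow> real \<Rightarrow> real" where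
  "stiffness_quad V L a b \<equiv> stiffness_form V L a b a b"

lemma sum_of_squares_bounds:
  fixes a b :: real
  assumes "\<bar>a\<bar> \<le> B" "\<bar>b\<bar> \<le> B" "\<bar>a\<bar> = B \<or> \<bar>b\<bar> = B"
  shows "B\<^sup>2 \<le> a\<^sup>2 + b\<^sup>2"
  using assms by (metis add.commute le_add_same_cancel1 power2_abs zero_le_power2)

text \<open>By the energy identity the form is at least the integral of \<kappa> u^2. If it were not
  positive, the continuous function u would vanish identically, against its boundary values.\<close>

lemma stiffness_pos:
  assumes V: "short L K V" and "\<kappa> > 0" "\<And>t. t \<in> {0..L} \<Longrightarrow> \<kappa> \<le> V t" and ab: "a \<noteq> 0 \<or> b \<noteq> 0"
  shows "0 < stiffness_quad V L a b"
proof (rule ccontr)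
  assume neg: "\<not> 0 < stiffness_quad V L a b"
  have L: "0 < L" and pot: "potential L K V" using V by (auto simp: short_def)
  obtain u w where u: "solution V L u w" "u 0 = a" "u L = b" using dirichlet_exists[OF V] by blast
  have c: "continuous_on {0..L} u" using u primitive_continuous by (auto simp: solution_def)
  have e: "((\<lambda>t. V t * (u t)\<^sup>2 + (w t)\<^sup>2) has_integral stiffness_quad V L a b) {0..L}"
    using energy_identity[OF u(1) pot] stiffness_form_solution(1)[OF V u(1), of a b] u L by simp
  have i: "(\<lambda>t. \<kappa> * (u t)\<^sup>2) integrable_on {0..L}"
    by (intro integrable_continuous_interval continuous_intros c)
  have "integral {0..L} (\<lambda>t. \<kappa> * (u t)\<^sup>2) \<le> stiffness_quad V L a b"
    using assms(3) by (intro has_integral_le[OF integrable_integral[OF i] e])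
      (auto intro!: add_increasing2 mult_right_mono)
  moreover have "0 \<le> integral {0..L} (\<lambda>t. \<kappa> * (u t)\<^sup>2)"
    using assms(2) by (intro integral_nonneg[OF i]) auto
  ultimately have "integral {0..L} (\<lambda>t. \<kappa> * (u t)\<^sup>2) = 0" using neg by linarith
  then have "((\<lambda>t. \<kappa> * (u t)\<^sup>2) has_integral 0) (cbox 0 L)"
    using integrable_integral[OF i] unfolding interval_cbox by metis
  moreover have "continuous_on (cbox 0 L) (\<lambda>t. \<kappa> * (u t)\<^sup>2)"
    unfolding interval_cbox[symmetric] by (intro continuous_intros c)
  ultimately have "\<kappa> * (u x)\<^sup>2 = 0" if "x \<in> cbox 0 L" for x
    by (intro has_integral_0_cbox_imp_0[of 0 L "\<lambda>t. \<kappa> * (u t)\<^sup>2"]) (use that assms(2) L in auto)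
  then show False using ab u L assms(2) by (metis atLeastAtMost_iff box_real(2) less_eq_real_def mult_eq_0_iff power_eq_0_iff less_irrefl)
qed

lemma integral_square_linear:
  fixes a b L :: real
  assumes L: "0 < L"
  shows "((\<lambda>t. (a + (b - a) * t / L)\<^sup>2) has_integral L / 3 * (a\<^sup>2 + a * b + b\<^sup>2)) {0..L}"
proof -
  let ?F = "\<lambda>t. a\<^sup>2 * t + a * (b - a) / L * t\<^sup>2 + (b - a)\<^sup>2 / (3 * L\<^sup>2) * t ^ 3"
  have "((\<lambda>t. (a + (b - a) * t / L)\<^sup>2) has_integral ?F L - ?F 0) {0..L}"
  proof (rule fundamental_theorem_of_calculus)
    show "(?F has_vector_derivative (a + (b - a) * t / L)\<^sup>2) (at t within {0..L})" for t
      unfolding has_real_derivative_iff_has_vector_derivative[symmetric]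
      by (rule derivative_eq_intros refl)+ (use L in \<open>simp add: field_simps power2_eq_square\<close>)
  qed (use L in auto)
  moreover have "?F L - ?F 0 = L / 3 * (a\<^sup>2 + a * b + b\<^sup>2)"
    using L by (simp add: field_simps power2_eq_square power3_eq_cube)
  ultimately show ?thesis by (simp only:)
qed

lemma cross_term_bound: "(a::real)\<^sup>2 + b\<^sup>2 \<le> 2 * (a\<^sup>2 + a * b + b\<^sup>2)"
proof -
  have "0 \<le> (a + b)\<^sup>2" by simp
  then show ?thesis by (simp add: power2_eq_square algebra_simps)
qed

text \<open>In the application l is the value of a chord and u, v are those of two solutions near
  it. The terms with deviations contribute at most 2/49 + 1/2401 < 1/16 in units of B^2.\<close>

lemma product_near_square:
  fixes l u v B :: real
  assumes "\<bar>l\<bar> \<le> B" "\<bar>u - l\<bar> \<le> B / 49" "\<bar>v - l\<bar> \<le> B / 49"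
  shows "l\<^sup>2 - B\<^sup>2 / 16 \<le> u * v"
proof -
  have "\<bar>l * (u - l)\<bar> \<le> B * (B / 49)" "\<bar>l * (v - l)\<bar> \<le> B * (B / 49)"
    "\<bar>(u - l) * (v - l)\<bar> \<le> B / 49 * (B / 49)"
    unfolding abs_mult
    using mult_mono[OF assms(1,2)] mult_mono[OF assms(1,3)] mult_mono[OF assms(2,3)] order_trans[OF abs_ge_zero assms(1)]
      order_trans[OF abs_ge_zero assms(2)] abs_ge_zero by blast+
  moreover have "u * v = l\<^sup>2 + l * (u - l) + l * (v - l) + (u - l) * (v - l)"
    by (simp add: power2_eq_square algebra_simps)
  moreover have "B * (B / 49) = B\<^sup>2 / 49" "B / 49 * (B / 49) = B\<^sup>2 / 2401" by (simp_all add: power2_eq_square)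
  moreover have "l\<^sup>2 - C / 16 \<le> w" if "\<bar>x\<bar> \<le> C / 49" "\<bar>y\<bar> \<le> C / 49" "\<bar>z\<bar> \<le> C / 2401" "w = l\<^sup>2 + x + y + z" "0 \<le> C"
    for w x y z C :: real using that by linarith
  ultimately show ?thesis using zero_le_power2[of B] by metis
qed

text \<open>The difference of the forms is \<delta> times the integral of u v, where u and v have
  the same boundary values but solve different equations, so that the integrand is not a square.
  Both are close to the common chord, whose square has integral at least L B^2 / 6, while the error
  is at most L B^2 / 16.\<close>

lemma stiffness_strict_mono:
  assumes V: "short L K V" and V': "short L K' (\<lambda>t. V t - \<delta>)" and "\<delta> > 0" and ab: "a \<noteq> 0 \<or> b \<noteq> 0"
  shows "stiffness_quad (\<lambda>t. V t - \<delta>) L a b < stiffness_quad V L a b"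
proof -
  have L: "0 < L" using V by (auto simp: short_def)
  obtain u w where u: "solution V L u w" "u 0 = a" "u L = b" using dirichlet_exists[OF V] by blast
  obtain v z where v: "solution (\<lambda>t. V t - \<delta>) L v z" "v 0 = a" "v L = b" using dirichlet_exists[OF V'] by blast
  let ?l = "\<lambda>t. a + (b - a) * t / L"
  define B where "B = max \<bar>a\<bar> \<bar>b\<bar>"
  have B: "\<bar>a\<bar> \<le> B" "\<bar>b\<bar> \<le> B" "\<bar>a\<bar> = B \<or> \<bar>b\<bar> = B" "0 < B" using ab by (auto simp: B_def)
  have low: "(?l t)\<^sup>2 - B\<^sup>2 / 16 \<le> u t * v t" if t: "t \<in> {0..L}" for t
  proof -
    have e1: "\<bar>u t - ?l t\<bar> \<le> B / 49" using solution_near_linear(1)[OF V u(1) t, of B] u B by simp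
    have e2: "\<bar>v t - ?l t\<bar> \<le> B / 49" using solution_near_linear(1)[OF V' v(1) t, of B] v B by simp
    show ?thesis
      by (rule product_near_square[OF linear_interpolation_bound[OF L t B(1,2)] e1 e2])
  qed
  have "((\<lambda>t. (V t - (V t - \<delta>)) * (u t * v t)) has_integral
     (stiffness_quad V L a b - stiffness_quad (\<lambda>t. V t - \<delta>) L a b)) {0..L}"
    using stiffness_form_diff[OF V u(1) V' v(1)] u v by simp
  then have I: "((\<lambda>t. \<delta> * (u t * v t)) has_integral
     (stiffness_quad V L a b - stiffness_quad (\<lambda>t. V t - \<delta>) L a b)) {0..L}" by simp
  have J: "((\<lambda>t. \<delta> * ((?l t)\<^sup>2 - B\<^sup>2 / 16)) has_integral \<delta> * (L / 3 * (a\<^sup>2 + a * b + b\<^sup>2) - L * (B\<^sup>2 / 16))) {0..L}"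
    using has_integral_const_real[of "B\<^sup>2 / 16" 0 L] L
    by (intro has_integral_mult_right has_integral_diff integral_square_linear) auto
  have "\<delta> * (L / 3 * (a\<^sup>2 + a * b + b\<^sup>2) - L * (B\<^sup>2 / 16)) \<le> stiffness_quad V L a b - stiffness_quad (\<lambda>t. V t - \<delta>) L a b"
    by (rule has_integral_le[OF J I]) (use low \<open>\<delta> > 0\<close> in \<open>auto intro!: mult_left_mono\<close>)
  moreover have "0 < \<delta> * (L / 3 * (a\<^sup>2 + a * b + b\<^sup>2) - L * (B\<^sup>2 / 16))"
  proof -
    have "0 < B\<^sup>2" using B by simp
    then have "B\<^sup>2 / 16 < (a\<^sup>2 + a * b + b\<^sup>2) / 3"
      using sum_of_squares_bounds[OF B(1-3)] cross_term_bound[of a b] by linarith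
    then have "L * (B\<^sup>2 / 16) < L * ((a\<^sup>2 + a * b + b\<^sup>2) / 3)" using L by (rule mult_strict_left_mono)
    then show ?thesis using \<open>\<delta> > 0\<close> by simp
  qed
  ultimately show ?thesis by linarith
qed

text \<open>Comparison with the potential 0, whose solution is the chord and whose form is (b - a)^2
  / L. Replacing u by the chord in the integral of V u times the chord costs at most \<Lambda> L B^2
  / 49. The factor 1/20 is what remains: (a^2 + a b + b^2) / 6 is at least (a^2 + b^2) / 12, and
  1/12 - 1/49 exceeds 1/20.\<close>

lemma stiffness_upper:
  assumes V: "short L \<Lambda> V" and \<Lambda>: "\<And>t. t \<in> {0..L} \<Longrightarrow> V t \<le> - \<Lambda> / 2"
  shows "stiffness_quad V L a b \<le> (b - a)\<^sup>2 / L - \<Lambda> * L * (a\<^sup>2 + b\<^sup>2) / 20"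
proof -
  have L: "0 < L" and pot: "potential L \<Lambda> V" and LL: "\<Lambda> * L\<^sup>2 \<le> 1/100" and \<Lambda>0: "0 \<le> \<Lambda>"
    using V potential_nonneg[of L \<Lambda> V] by (auto simp: short_def)
  obtain u w where u: "solution V L u w" "u 0 = a" "u L = b" using dirichlet_exists[OF V] by blast
  let ?l = "\<lambda>t. a + (b - a) * t / L"
  have V0: "short L \<Lambda> (\<lambda>_. 0)" using L LL \<Lambda>0 by (auto simp: short_def potential_def)
  have l: "solution (\<lambda>_. 0) L ?l (\<lambda>_. (b - a) / L)"
    unfolding solution_def primitive_def
  proof (intro conjI ballI)
    fix x assume "x \<in> {0..L}"
    then show "((\<lambda>_. (b - a) / L) has_integral ?l x - ?l 0) {0..x}"
      using has_integral_const_real[of "(b - a) / L" 0 x] by (simp add: field_simps)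
  qed auto
  define B where "B = max \<bar>a\<bar> \<bar>b\<bar>"
  have B: "\<bar>a\<bar> \<le> B" "\<bar>b\<bar> \<le> B" "\<bar>a\<bar> = B \<or> \<bar>b\<bar> = B" "0 \<le> B" by (auto simp: B_def)
  have "((\<lambda>t. (V t - 0) * (u t * ?l t)) has_integral (stiffness_quad V L a b - stiffness_quad (\<lambda>_. 0) L a b)) {0..L}"
    using stiffness_form_diff[OF V u(1) V0 l] u L by simp
  moreover have "stiffness_quad (\<lambda>_. 0) L a b = (b - a)\<^sup>2 / L"
    using stiffness_form_solution(1)[OF V0 l, of a b] L
    by (simp add: power2_eq_square diff_divide_distrib left_diff_distrib right_diff_distrib add_divide_distrib)
  ultimately have I: "((\<lambda>t. V t * (u t * ?l t)) has_integral (stiffness_quad V L a b - (b - a)\<^sup>2 / L)) {0..L}"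
    by simp
  have J: "((\<lambda>t. - (\<Lambda> / 2) * (?l t)\<^sup>2 + \<Lambda> * (B\<^sup>2 / 49)) has_integral
      (- (\<Lambda> / 2) * (L / 3 * (a\<^sup>2 + a * b + b\<^sup>2)) + \<Lambda> * (L * (B\<^sup>2 / 49)))) {0..L}"
    using has_integral_const_real[of "B\<^sup>2 / 49" 0 L] L
    by (intro has_integral_add has_integral_mult_right integral_square_linear) (auto simp: mult_ac)
  have "stiffness_quad V L a b - (b - a)\<^sup>2 / L \<le> - (\<Lambda> / 2) * (L / 3 * (a\<^sup>2 + a * b + b\<^sup>2)) + \<Lambda> * (L * (B\<^sup>2 / 49))"
  proof (rule has_integral_le[OF I J])
    fix t assume t: "t \<in> {0..L}"
    have e1: "\<bar>u t - ?l t\<bar> \<le> B / 49" using solution_near_linear(1)[OF V u(1) t, of B] u B by simp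
    have lB: "\<bar>?l t\<bar> \<le> B" by (rule linear_interpolation_bound[OF L t B(1,2)])
    have e: "\<bar>V t * ((u t - ?l t) * ?l t)\<bar> \<le> \<Lambda> * (B / 49 * B)"
      unfolding abs_mult using e1 lB B pot t \<Lambda>0 by (intro mult_mono) (auto simp: potential_def)
    have "V t * ((u t - ?l t) * ?l t) \<le> \<Lambda> * (B / 49 * B)" by (rule order_trans[OF abs_ge_self e])
    moreover have "V t * (?l t)\<^sup>2 \<le> - \<Lambda> / 2 * (?l t)\<^sup>2" using \<Lambda>[OF t] by (intro mult_right_mono) auto
    moreover have "V t * (u t * ?l t) = V t * ((u t - ?l t) * ?l t) + V t * (?l t)\<^sup>2"
      by (simp add: power2_eq_square algebra_simps)
    moreover have "B / 49 * B = B\<^sup>2 / 49" by (simp add: power2_eq_square)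
    moreover have "w \<le> - (\<Lambda> / 2) * q + \<Lambda> * r" if "x \<le> \<Lambda> * r" "y \<le> - \<Lambda> / 2 * q" "w = x + y" for w x y q r
      using that by simp
    ultimately show "V t * (u t * ?l t) \<le> - (\<Lambda> / 2) * (?l t)\<^sup>2 + \<Lambda> * (B\<^sup>2 / 49)" by metis
  qed
  moreover have "- (\<Lambda> / 2) * (L / 3 * (a\<^sup>2 + a * b + b\<^sup>2)) + \<Lambda> * (L * (B\<^sup>2 / 49)) =
    (\<Lambda> * L) * (B\<^sup>2 / 49 - (a\<^sup>2 + a * b + b\<^sup>2) / 6)" by (simp add: field_simps)
  moreover have "(\<Lambda> * L) * (B\<^sup>2 / 49 - (a\<^sup>2 + a * b + b\<^sup>2) / 6) \<le> (\<Lambda> * L) * (- (a\<^sup>2 + b\<^sup>2) / 20)"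
  proof (rule mult_left_mono)
    show "B\<^sup>2 / 49 - (a\<^sup>2 + a * b + b\<^sup>2) / 6 \<le> - (a\<^sup>2 + b\<^sup>2) / 20"
    proof -
      have *: "x / 49 - q / 6 \<le> - y / 20" if "x \<le> y" "y \<le> 2 * q" "0 \<le> y" for x y q :: real using that by linarith
      show ?thesis by (rule *[OF sum_of_squares_bounds[OF B(1-3)] cross_term_bound]) simp
    qed
    show "0 \<le> \<Lambda> * L" using \<Lambda>0 L by simp
  qed
  ultimately show ?thesis by (simp add: field_simps)
qed

text \<open>The test functions f n may vary with n as long as they share a bound and a Lipschitz
  constant. Freezing f n at the left end of each of m equal cells costs at most K C L^2 / m in
  total; what remains are finitely many integrals of D n over fixed cells.\<close>

lemma weak_convergence_uniform:
  fixes D f :: "nat \<Rightarrow> real \<Rightarrow> real"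
  assumes L: "0 < L" and D: "\<And>n. potential L K (D n)"
    and weak: "\<And>x. x \<in> {0..L} \<Longrightarrow> (\<lambda>n. integral {0..x} (D n)) \<longlonglongrightarrow> 0"
    and f: "\<And>n x. x \<in> {0..L} \<Longrightarrow> \<bar>f n x\<bar> \<le> C"
    and lip: "\<And>n x y. x \<in> {0..L} \<Longrightarrow> y \<in> {0..L} \<Longrightarrow> \<bar>f n x - f n y\<bar> \<le> C * \<bar>x - y\<bar>"
  shows "(\<lambda>n. integral {0..L} (\<lambda>t. D n t * f n t)) \<longlonglongrightarrow> 0"
proof (rule LIMSEQ_I)
  fix \<epsilon> :: real assume \<epsilon>: "\<epsilon> > 0"
  have C: "0 \<le> C" using f[of 0 0] L by force
  have K: "0 \<le> K" using potential_nonneg[OF D] L by auto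
  \<comment> \<open>This number of cells makes the freezing error smaller than \<epsilon> / 2,
    uniformly in n.\<close>
  obtain m :: nat where m: "m > 0" "2 * (K * C * L\<^sup>2) / \<epsilon> < m"
    using reals_Archimedean2[of "max (2 * (K * C * L\<^sup>2) / \<epsilon>) 0"] by (auto simp: max_def split: if_splits)
  define h where "h = L / m"
  have h: "0 < h" "m * h = L" using L m by (auto simp: h_def)
  have jh: "real j * h \<in> {0..L}" if "j \<le> m" for j
    using that h by (metis atLeastAtMost_iff less_eq_real_def mult_nonneg_nonneg mult_right_mono of_nat_0_le_iff of_nat_mono)
  have fcont: "continuous_on {0..L} (f n)" for n
    by (rule lipschitz_on_continuous_on[of C]) (use lip C in \<open>auto simp: lipschitz_on_def dist_real_def\<close>)
  have part: "\<bar>integral {0..real j * h} (\<lambda>t. D n t * f n t)\<bar> \<le> j * (K * C * h\<^sup>2) + C * (\<Sum>i<j. \<bar>integral {real i * h..real (Suc i) * h} (D n)\<bar>)"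
    if "j \<le> m" for j n using that
  proof (induction j)
    case (Suc j)
    let ?a = "real j * h" and ?b = "real (Suc j) * h"
    have ab: "0 \<le> ?a" "?a \<le> ?b" "?b \<le> L" "?b - ?a = h" using jh[of j] jh[of "Suc j"] Suc h by (auto simp: algebra_simps)
    have iDf: "(\<lambda>t. D n t * f n t) integrable_on {x..y}" if "0 \<le> x" "y \<le> L" for x y
      by (rule potential_mult_integrable[OF D fcont that])
    have iD: "D n integrable_on {x..y}" if "0 \<le> x" "y \<le> L" for x y
      by (rule potential_integrable[OF D that])
    have split: "integral {0..?a} (\<lambda>t. D n t * f n t) + integral {?a..?b} (\<lambda>t. D n t * f n t) = integral {0..?b} (\<lambda>t. D n t * f n t)"
      by (rule Henstock_Kurzweil_Integration.integral_combine) (use ab iDf in auto)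
    have "((\<lambda>t. D n t * f n t - D n t * f n ?a) has_integral
      (integral {?a..?b} (\<lambda>t. D n t * f n t) - integral {?a..?b} (D n) * f n ?a)) {?a..?b}"
      using ab by (intro has_integral_diff has_integral_mult_left integrable_integral iDf iD) auto
    then have "\<bar>integral {?a..?b} (\<lambda>t. D n t * f n t) - integral {?a..?b} (D n) * f n ?a\<bar> \<le> K * (C * h) * (?b - ?a)"
    proof (rule has_integral_bound_on)
      fix t assume t: "t \<in> {?a..?b}"
      have tL: "t \<in> {0..L}" unfolding atLeastAtMost_iff using ab(1,3) t[unfolded atLeastAtMost_iff] by linarith
      have "\<bar>f n t - f n ?a\<bar> \<le> C * \<bar>t - ?a\<bar>" using ab by (intro lip tL) auto
      also have "\<dots> \<le> C * h" using t[unfolded atLeastAtMost_iff] ab C by (intro mult_left_mono) linarith+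
      finally have "\<bar>D n t\<bar> * \<bar>f n t - f n ?a\<bar> \<le> K * (C * h)"
        using D[of n] tL K by (intro mult_mono) (auto simp: potential_def)
      then show "\<bar>D n t * f n t - D n t * f n ?a\<bar> \<le> K * (C * h)"
        by (simp add: abs_mult[symmetric] right_diff_distrib)
    qed (use ab in auto)
    moreover have "K * (C * h) * (?b - ?a) = K * C * h\<^sup>2" using ab by (simp add: power2_eq_square)
    moreover have "\<bar>integral {?a..?b} (D n) * f n ?a\<bar> \<le> C * \<bar>integral {?a..?b} (D n)\<bar>"
      using f[of ?a n] jh[of j] Suc mult_right_mono[of "\<bar>f n ?a\<bar>" C "\<bar>integral {?a..?b} (D n)\<bar>"]
      by (simp add: abs_mult mult.commute)
    moreover have "\<bar>integral {0..?a} (\<lambda>t. D n t * f n t)\<bar> \<le> j * (K * C * h\<^sup>2) + C * (\<Sum>i<j. \<bar>integral {real i * h..real (Suc i) * h} (D n)\<bar>)"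
      using Suc by simp
    ultimately have "\<bar>integral {0..?b} (\<lambda>t. D n t * f n t)\<bar> \<le> j * (K * C * h\<^sup>2) + K * C * h\<^sup>2 +
      (C * (\<Sum>i<j. \<bar>integral {real i * h..real (Suc i) * h} (D n)\<bar>) + C * \<bar>integral {?a..?b} (D n)\<bar>)"
      using split by linarith
    then show ?case by (simp only: sum.lessThan_Suc distrib_left of_nat_Suc distrib_right mult_1 add.commute add.left_commute)
  qed simp
  have "(\<lambda>n. integral {real i * h..real (Suc i) * h} (D n)) \<longlonglongrightarrow> 0" if "i < m" for i
  proof -
    have ab: "0 \<le> real i * h" "real i * h \<le> real (Suc i) * h" "real (Suc i) * h \<le> L"
      using jh[of i] jh[of "Suc i"] that h by (auto simp: algebra_simps)
    have "integral {real i * h..real (Suc i) * h} (D n) = integral {0..real (Suc i) * h} (D n) - integral {0..real i * h} (D n)" for n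
      using Henstock_Kurzweil_Integration.integral_combine[of 0 "real i * h" "real (Suc i) * h" "D n"] ab potential_integrable[OF D, of 0 "real (Suc i) * h"] by auto
    moreover have "(\<lambda>n. integral {0..real (Suc i) * h} (D n) - integral {0..real i * h} (D n)) \<longlonglongrightarrow> 0 - 0"
      using ab by (intro tendsto_diff weak) auto
    ultimately show ?thesis by simp
  qed
  then have "(\<lambda>n. \<Sum>i<m. \<bar>integral {real i * h..real (Suc i) * h} (D n)\<bar>) \<longlonglongrightarrow> (\<Sum>i<m. 0)"
    by (intro tendsto_sum) (auto intro: tendsto_rabs_zero)
  then have "(\<lambda>n. C * (\<Sum>i<m. \<bar>integral {real i * h..real (Suc i) * h} (D n)\<bar>)) \<longlonglongrightarrow> C * 0"
    by (intro tendsto_mult tendsto_const) simp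
  then have "(\<lambda>n. C * (\<Sum>i<m. \<bar>integral {real i * h..real (Suc i) * h} (D n)\<bar>)) \<longlonglongrightarrow> 0" by simp
  then have "\<forall>\<^sub>F n in sequentially. C * (\<Sum>i<m. \<bar>integral {real i * h..real (Suc i) * h} (D n)\<bar>) < \<epsilon> / 2"
    by (rule order_tendstoD) (use \<epsilon> in auto)
  then obtain N where N: "\<And>n. n \<ge> N \<Longrightarrow> C * (\<Sum>i<m. \<bar>integral {real i * h..real (Suc i) * h} (D n)\<bar>) < \<epsilon> / 2"
    by (auto simp: eventually_sequentially)
  have "m * (K * C * h\<^sup>2) = K * C * L\<^sup>2 / m" using m by (simp add: h_def power2_eq_square field_simps)
  also have "\<dots> < \<epsilon> / 2" using m \<epsilon> by (simp add: field_simps)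
  finally have "\<bar>integral {0..L} (\<lambda>t. D n t * f n t)\<bar> < \<epsilon>" if "n \<ge> N" for n
    using part[of m n] N[OF that] h by simp
  then show "\<exists>no. \<forall>n\<ge>no. norm (integral {0..L} (\<lambda>t. D n t * f n t) - 0) < \<epsilon>" by auto
qed

text \<open>In the perturbation formula the solution u n for the n-th potential is paired with a
  fixed solution v. The estimates for short intervals bound u n and its derivative uniformly in n,
  so the integral of (Vn n - V) u n v tends to 0 without any knowledge about convergence of u
  n.\<close>

lemma stiffness_form_continuous:
  assumes Vn: "\<And>n. short L K (Vn n)" and V: "short L K V"
    and weak: "\<And>x. x \<in> {0..L} \<Longrightarrow> (\<lambda>n. integral {0..x} (Vn n)) \<longlonglongrightarrow> integral {0..x} V"
  shows "(\<lambda>n. stiffness_form (Vn n) L a b a' b') \<longlonglongrightarrow> stiffness_form V L a b a' b'"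
proof -
  have L: "0 < L" using V by (auto simp: short_def)
  have pn: "potential L K (Vn n)" and p: "potential L K V" for n using Vn V by (auto simp: short_def)
  have "\<forall>n. \<exists>u w. solution (Vn n) L u w \<and> u 0 = a \<and> u L = b" using dirichlet_exists[OF Vn] by metis
  then obtain u w where u: "\<And>n. solution (Vn n) L (u n) (w n)" "\<And>n. u n 0 = a" "\<And>n. u n L = b" by metis
  obtain v z where v: "solution V L v z" "v 0 = a'" "v L = b'" using dirichlet_exists[OF V] by blast
  define B where "B = \<bar>a\<bar> + \<bar>b\<bar> + \<bar>a'\<bar> + \<bar>b'\<bar>"
  have B0: "0 \<le> B" by (simp add: B_def)
  have ub: "\<bar>u n x\<bar> \<le> 2 * B" "\<bar>w n x\<bar> \<le> 3 * B / L" if "x \<in> {0..L}" for n x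
    using solution_near_linear(2,3)[OF Vn u(1) that, where B = B] u by (auto simp: B_def)
  have vb: "\<bar>v x\<bar> \<le> 2 * B" "\<bar>z x\<bar> \<le> 3 * B / L" if "x \<in> {0..L}" for x
    using solution_near_linear(2,3)[OF V v(1) that, where B = B] v by (auto simp: B_def)
  have ulip: "\<bar>u n x - u n y\<bar> \<le> 3 * B / L * \<bar>x - y\<bar>" if "x \<in> {0..L}" "y \<in> {0..L}" for n x y
    using primitive_Lipschitz[of L "u n" "w n" "3 * B / L" y x] u ub that by (auto simp: solution_def)
  have vlip: "\<bar>v x - v y\<bar> \<le> 3 * B / L * \<bar>x - y\<bar>" if "x \<in> {0..L}" "y \<in> {0..L}" for x y
    using primitive_Lipschitz[of L v z "3 * B / L" y x] v vb that by (auto simp: solution_def)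
  define C where "C = 4 * B\<^sup>2 + 12 * B\<^sup>2 / L"
  have "(\<lambda>n. integral {0..L} (\<lambda>t. (Vn n t - V t) * (u n t * v t))) \<longlonglongrightarrow> 0"
  proof (rule weak_convergence_uniform[OF L, where K = "2 * K" and C = C])
    show "potential L (2 * K) (\<lambda>t. Vn n t - V t)" for n
      unfolding potential_def
    proof (intro conjI ballI)
      show "(\<lambda>t. Vn n t - V t) \<in> borel_measurable (lebesgue_on {0..L})"
        using pn[of n] p by (auto simp: potential_def)
      show "\<bar>Vn n x - V x\<bar> \<le> 2 * K" if "x \<in> {0..L}" for x
      proof -
        have "\<bar>Vn n x\<bar> \<le> K" "\<bar>V x\<bar> \<le> K" using pn[of n] p that by (auto simp: potential_def)
        then show ?thesis by linarith
      qed
    qed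
    show "(\<lambda>n. integral {0..x} (\<lambda>t. Vn n t - V t)) \<longlonglongrightarrow> 0" if x: "x \<in> {0..L}" for x
    proof -
      have "integral {0..x} (\<lambda>t. Vn n t - V t) = integral {0..x} (Vn n) - integral {0..x} V" for n
        using x by (intro integral_diff potential_integrable[OF pn] potential_integrable[OF p]) auto
      moreover have "(\<lambda>n. integral {0..x} (Vn n) - integral {0..x} V) \<longlonglongrightarrow> integral {0..x} V - integral {0..x} V"
        by (intro tendsto_diff weak x tendsto_const)
      ultimately show ?thesis by simp
    qed
    show "\<bar>u n x * v x\<bar> \<le> C" if "x \<in> {0..L}" for n x
    proof -
      have "\<bar>u n x * v x\<bar> \<le> 2 * B * (2 * B)" unfolding abs_mult using ub vb that B0 by (intro mult_mono) auto
      then show ?thesis using L by (simp add: C_def power2_eq_square add_increasing2)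
    qed
    show "\<bar>u n x * v x - u n y * v y\<bar> \<le> C * \<bar>x - y\<bar>" if xy: "x \<in> {0..L}" "y \<in> {0..L}" for n x y
    proof -
      have "u n x * v x - u n y * v y = (u n x - u n y) * v x + u n y * (v x - v y)" by (simp add: algebra_simps)
      moreover have "\<bar>(u n x - u n y) * v x\<bar> \<le> (3 * B / L * \<bar>x - y\<bar>) * (2 * B)"
        unfolding abs_mult using ulip[OF xy, of n] vb xy B0 L by (intro mult_mono) auto
      moreover have "\<bar>u n y * (v x - v y)\<bar> \<le> (2 * B) * (3 * B / L * \<bar>x - y\<bar>)"
        unfolding abs_mult using vlip[OF xy] ub xy B0 L by (intro mult_mono) auto
      moreover have "(3 * B / L * \<bar>x - y\<bar>) * (2 * B) + (2 * B) * (3 * B / L * \<bar>x - y\<bar>) = 12 * B\<^sup>2 / L * \<bar>x - y\<bar>"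
        by (simp add: power2_eq_square)
      ultimately have "\<bar>u n x * v x - u n y * v y\<bar> \<le> 12 * B\<^sup>2 / L * \<bar>x - y\<bar>" by linarith
      also have "\<dots> \<le> C * \<bar>x - y\<bar>" by (intro mult_right_mono) (auto simp: C_def)
      finally show ?thesis .
    qed
  qed
  moreover have "integral {0..L} (\<lambda>t. (Vn n t - V t) * (u n t * v t)) = stiffness_form (Vn n) L a b a' b' - stiffness_form V L a b a' b'" for n
    using integral_unique[OF stiffness_form_diff[OF Vn u(1) V v(1)]] u v by simp
  ultimately show ?thesis by (simp add: LIM_zero_iff)
qed

lemma stiffness_continuous:
  assumes Vn: "\<And>n. short L K (Vn n)" and V: "short L K V"
    and weak: "\<And>x. x \<in> {0..L} \<Longrightarrow> (\<lambda>n. integral {0..x} (Vn n)) \<longlonglongrightarrow> integral {0..x} V"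
  shows "(\<lambda>n. stiffness (Vn n) L i) \<longlonglongrightarrow> stiffness V L i"
proof -
  have "stiffness V L i = (if i = 0 then stiffness_form V L 1 0 1 0 else if i = 1 then stiffness_form V L 1 0 0 1 else stiffness_form V L 0 1 0 1)" for V
    by (auto simp: stiffness_form_def stiffness_def)
  then show ?thesis using stiffness_form_continuous[OF assms] by simp
qed

section \<open>Symmetric forms on finite networks\<close>

locale network =
  fixes E :: "'p set" and s t :: "'p \<Rightarrow> 'n" and N :: "'n set"
  assumes finite_E: "finite E" and finite_N: "finite N" and ends: "p \<in> E \<Longrightarrow> s p \<in> N" "p \<in> E \<Longrightarrow> t p \<in> N"
begin

definition form :: "(nat \<Rightarrow> 'p \<Rightarrow> real) \<Rightarrow> ('n \<Rightarrow> real) \<Rightarrow> ('n \<Rightarrow> real) \<Rightarrow> real" where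
  "form b x y = (\<Sum>p\<in>E. b 0 p * (x (s p) * y (s p)) + b 1 p * (x (t p) * y (s p) + x (s p) * y (t p)) + b 2 p * (x (t p) * y (t p)))"

text \<open>The component at v of the assembled symmetric matrix applied to x, that is, half the
  gradient of the quadratic form. With the entries of \<open>stiffness\<close> it is the sum of the
  derivatives pointing into v over all pieces that meet there; a piece with both ends at v enters
  twice.\<close>

definition flux :: "(nat \<Rightarrow> 'p \<Rightarrow> real) \<Rightarrow> ('n \<Rightarrow> real) \<Rightarrow> 'n \<Rightarrow> real" where
  "flux b x v = (\<Sum>p\<in>E. (if s p = v then b 0 p * x (s p) + b 1 p * x (t p) else 0) +
     (if t p = v then b 1 p * x (s p) + b 2 p * x (t p) else 0))"

definition ip :: "('n \<Rightarrow> real) \<Rightarrow> ('n \<Rightarrow> real) \<Rightarrow> real" where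
  "ip x y = (\<Sum>v\<in>N. x v * y v)"

lemma form_flux: "form b x y = ip (flux b x) y"
proof -
  have "ip (flux b x) y = (\<Sum>p\<in>E. \<Sum>v\<in>N. (if s p = v then b 0 p * x (s p) + b 1 p * x (t p) else 0) * y v +
     (if t p = v then b 1 p * x (s p) + b 2 p * x (t p) else 0) * y v)"
    unfolding ip_def flux_def sum_distrib_right distrib_right by (rule sum.swap)
  also have "\<dots> = form b x y"
    unfolding form_def
  proof (rule sum.cong[OF refl])
    fix p assume p: "p \<in> E"
    have *: "(\<Sum>v\<in>N. (if w = v then c else 0) * y v) = c * y w" if "w \<in> N" for w and c :: real
      using finite_N that by (simp add: if_distrib[of "\<lambda>c. c * _"] sum.delta cong: if_cong)
    show "(\<Sum>v\<in>N. (if s p = v then b 0 p * x (s p) + b 1 p * x (t p) else 0) * y v +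
       (if t p = v then b 1 p * x (s p) + b 2 p * x (t p) else 0) * y v) =
       b 0 p * (x (s p) * y (s p)) + b 1 p * (x (t p) * y (s p) + x (s p) * y (t p)) + b 2 p * (x (t p) * y (t p))"
      unfolding sum.distrib *[OF ends(1)[OF p]] *[OF ends(2)[OF p]] by (simp add: algebra_simps)
  qed
  finally show ?thesis by simp
qed

definition comb :: "real \<Rightarrow> ('n \<Rightarrow> real) \<Rightarrow> real \<Rightarrow> ('n \<Rightarrow> real) \<Rightarrow> 'n \<Rightarrow> real" where
  "comb \<alpha> x \<beta> y = (\<lambda>v. \<alpha> * x v + \<beta> * y v)"

lemma form_comb:
  "form b (comb \<alpha> x \<beta> y) z = \<alpha> * form b x z + \<beta> * form b y z"
  "form b z (comb \<alpha> x \<beta> y) = \<alpha> * form b z x + \<beta> * form b z y"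
  unfolding form_def comb_def sum_distrib_left sum.distrib[symmetric] by (auto intro!: sum.cong simp: algebra_simps)

lemma form_scale: "form b (comb c x 0 y) (comb c x 0 y) = c\<^sup>2 * form b x x"
  by (simp add: form_comb power2_eq_square)

lemma form_sym: "form b x y = form b y x"
  unfolding form_def by (auto intro!: sum.cong simp: algebra_simps)

lemma ip_comb:
  "ip (comb \<alpha> x \<beta> y) z = \<alpha> * ip x z + \<beta> * ip y z"
  "ip z (comb \<alpha> x \<beta> y) = \<alpha> * ip z x + \<beta> * ip z y"
  unfolding ip_def comb_def sum_distrib_left sum.distrib[symmetric] by (auto intro!: sum.cong simp: algebra_simps)

lemma ip_sym: "ip x y = ip y x"
  unfolding ip_def by (auto intro!: sum.cong)

lemma ip_nonneg: "0 \<le> ip x x"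
  unfolding ip_def by (auto intro!: sum_nonneg)

lemma ip_zero: "ip x x = 0 \<longleftrightarrow> (\<forall>v\<in>N. x v = 0)"
  unfolding ip_def using finite_N by (subst sum_nonneg_eq_0_iff) auto

lemma form_cong:
  assumes "\<And>v. v \<in> N \<Longrightarrow> x v = x' v" "\<And>v. v \<in> N \<Longrightarrow> y v = y' v"
  shows "form b x y = form b x' y'"
  unfolding form_def by (intro sum.cong refl) (use assms ends in auto)

lemma flux_cong:
  assumes "\<And>v. v \<in> N \<Longrightarrow> x v = x' v"
  shows "flux b x = flux b x'"
  unfolding flux_def by (intro ext sum.cong refl) (use assms ends in auto)

lemma form_tendsto:
  assumes "\<And>i p. p \<in> E \<Longrightarrow> (\<lambda>n. b n i p) \<longlonglongrightarrow> b' i p" "\<And>v. v \<in> N \<Longrightarrow> (\<lambda>n. x n v) \<longlonglongrightarrow> x' v"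
    "\<And>v. v \<in> N \<Longrightarrow> (\<lambda>n. y n v) \<longlonglongrightarrow> y' v"
  shows "(\<lambda>n. form (b n) (x n) (y n)) \<longlonglongrightarrow> form b' x' y'"
  unfolding form_def by (intro tendsto_intros assms ends) auto

lemma ip_tendsto:
  assumes "\<And>v. v \<in> N \<Longrightarrow> (\<lambda>n. x n v) \<longlonglongrightarrow> x' v" "\<And>v. v \<in> N \<Longrightarrow> (\<lambda>n. y n v) \<longlonglongrightarrow> y' v"
  shows "(\<lambda>n. ip (x n) (y n)) \<longlonglongrightarrow> ip x' y'"
  unfolding ip_def by (intro tendsto_intros assms) auto

text \<open>\<open>frame d x y\<close> encodes an orthonormal basis of a subspace of dimension \<open>1 + d\<close>, where \<open>d\<close> is \<open>0\<close>
  (then \<open>y = 0\<close> on \<open>N\<close>) or \<open>1\<close>.\<close>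

definition frame :: "real \<Rightarrow> ('n \<Rightarrow> real) \<Rightarrow> ('n \<Rightarrow> real) \<Rightarrow> bool" where
  "frame d x y \<longleftrightarrow> ip x x = 1 \<and> ip y y = d \<and> ip x y = 0"

text \<open>The weak inequality makes the condition survive limits, while its strict version
  \<open>negative\<close> survives small perturbations. For nondegenerate forms
  \<open>nonpos_imp_negative\<close> leads from the first to the second.\<close>

definition nonpos :: "real \<Rightarrow> (nat \<Rightarrow> 'p \<Rightarrow> real) \<Rightarrow> bool" where
  "nonpos d b \<longleftrightarrow> (\<exists>x y. frame d x y \<and> (\<forall>\<alpha> \<beta>. form b (comb \<alpha> x \<beta> y) (comb \<alpha> x \<beta> y) \<le> 0))"

definition negative :: "real \<Rightarrow> (nat \<Rightarrow> 'p \<Rightarrow> real) \<Rightarrow> bool" where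
  "negative d b \<longleftrightarrow> (\<exists>x y. frame d x y \<and> (\<forall>\<alpha> \<beta>. (\<exists>v\<in>N. comb \<alpha> x \<beta> y v \<noteq> 0) \<longrightarrow> form b (comb \<alpha> x \<beta> y) (comb \<alpha> x \<beta> y) < 0))"

lemma frame_comb:
  assumes "frame d x y"
  shows "ip (comb \<alpha> x \<beta> y) (comb \<alpha> x \<beta> y) = \<alpha>\<^sup>2 + d * \<beta>\<^sup>2"
  using assms unfolding frame_def ip_comb by (simp add: ip_sym[of y x] power2_eq_square)

section \<open>Closed and open sign conditions\<close>

lemma bounded_subsequence:
  fixes x :: "nat \<Rightarrow> 'n \<Rightarrow> real"
  assumes "finite S" "\<And>n v. v \<in> S \<Longrightarrow> \<bar>x n v\<bar> \<le> B"
  shows "\<exists>r x'. strict_mono (r :: nat \<Rightarrow> nat) \<and> (\<forall>v\<in>S. (\<lambda>n. x (r n) v) \<longlonglongrightarrow> x' v)"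
  using assms
proof (induction S rule: finite_induct)
  case empty
  then show ?case by (auto intro!: exI[of _ id] strict_mono_id)
next
  case (insert a S)
  then obtain r x' where r: "strict_mono (r :: nat \<Rightarrow> nat)" "\<forall>v\<in>S. (\<lambda>n. x (r n) v) \<longlonglongrightarrow> x' v" by force
  have "bounded (range (\<lambda>n. x (r n) a))"
    using insert.prems[of a] by (auto simp: bounded_iff)
  then obtain l q where q: "strict_mono (q :: nat \<Rightarrow> nat)" "((\<lambda>n. x (r n) a) \<circ> q) \<longlonglongrightarrow> l"
    using bounded_imp_convergent_subsequence by blast
  have "(\<lambda>n. x (r (q n)) v) \<longlonglongrightarrow> (if v = a then l else x' v)" if "v \<in> insert a S" for v
    using that q r(2) LIMSEQ_subseq_LIMSEQ[OF _ q(1), of "\<lambda>n. x (r n) v" "x' v"] by (auto simp: o_def)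
  then show ?case using strict_mono_o[OF r(1) q(1)] by (intro exI[of _ "r \<circ> q"] exI) (auto simp: o_def)
qed

lemma ip_bound: "ip x x \<le> 1 \<Longrightarrow> v \<in> N \<Longrightarrow> \<bar>x v\<bar> \<le> 1"
proof -
  assume a: "ip x x \<le> 1" "v \<in> N"
  have "x v * x v \<le> ip x x" unfolding ip_def using a finite_N by (intro member_le_sum) auto
  then show ?thesis using a by (simp add: abs_le_square_iff[of "x v" 1, simplified] power2_eq_square)
qed

text \<open>Orthonormal frames have coordinates bounded by 1 on N, so a subsequence converges there.
  The orthonormality relations pass to the limit, hence the dimension does not drop, and the
  inequality passes to the limit for each fixed pair of coefficients.\<close>

lemma nonpos_closed:
  assumes d: "d \<le> 1" and b: "\<And>i p. p \<in> E \<Longrightarrow> (\<lambda>n. b n i p) \<longlonglongrightarrow> b' i p" and neg: "\<And>n. nonpos d (b n)"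
  shows "nonpos d b'"
proof -
  obtain x y where xy: "\<And>n. frame d (x n) (y n)"
    "\<And>n \<alpha> \<beta>. form (b n) (comb \<alpha> (x n) \<beta> (y n)) (comb \<alpha> (x n) \<beta> (y n)) \<le> 0"
    using neg unfolding nonpos_def by metis
  obtain r x' where r: "strict_mono r" "\<forall>v\<in>N. (\<lambda>n. x (r n) v) \<longlonglongrightarrow> x' v"
    using bounded_subsequence[OF finite_N, of x 1] ip_bound xy(1) unfolding frame_def by (metis order_refl)
  obtain q y' where q: "strict_mono q" "\<forall>v\<in>N. (\<lambda>n. y (r (q n)) v) \<longlonglongrightarrow> y' v"
    using bounded_subsequence[OF finite_N, of "\<lambda>n. y (r n)" 1] ip_bound xy(1) d unfolding frame_def by metis
  have x: "(\<lambda>n. x (r (q n)) v) \<longlonglongrightarrow> x' v" if "v \<in> N" for v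
    using LIMSEQ_subseq_LIMSEQ[OF bspec[OF r(2) that] q(1)] by (simp add: o_def)
  have y: "(\<lambda>n. y (r (q n)) v) \<longlonglongrightarrow> y' v" if "v \<in> N" for v using q that by simp
  have b'': "(\<lambda>n. b (r (q n)) i p) \<longlonglongrightarrow> b' i p" if "p \<in> E" for i p
    using LIMSEQ_subseq_LIMSEQ[OF b[OF that] strict_mono_o[OF r(1) q(1)]] by (simp add: o_def)
  have "(\<lambda>n. ip (x (r (q n))) (x (r (q n)))) \<longlonglongrightarrow> ip x' x'" "(\<lambda>n. ip (y (r (q n))) (y (r (q n)))) \<longlonglongrightarrow> ip y' y'"
    "(\<lambda>n. ip (x (r (q n))) (y (r (q n)))) \<longlonglongrightarrow> ip x' y'"
    by (intro ip_tendsto x y; assumption)+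
  then have "frame d x' y'" using xy(1) unfolding frame_def by (simp add: LIMSEQ_const_iff)
  moreover have "form b' (comb \<alpha> x' \<beta> y') (comb \<alpha> x' \<beta> y') \<le> 0" for \<alpha> \<beta>
  proof (rule LIMSEQ_le_const2)
    show "(\<lambda>n. form (b (r (q n))) (comb \<alpha> (x (r (q n))) \<beta> (y (r (q n)))) (comb \<alpha> (x (r (q n))) \<beta> (y (r (q n)))))
      \<longlonglongrightarrow> form b' (comb \<alpha> x' \<beta> y') (comb \<alpha> x' \<beta> y')"
      by (rule form_tendsto) (auto simp: comb_def intro!: tendsto_intros b'' x y)
  qed (use xy(2) in auto)
  ultimately show ?thesis unfolding nonpos_def by blast
qed

text \<open>The negative subspace of the limit form is kept fixed. If no b n were nonpositive on it,
  each would be positive at some unit vector of the subspace; an accumulation point of these vectors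
  is a unit vector at which the limit form is nonnegative.\<close>

lemma negative_open:
  assumes d: "d \<in> {0, 1}" and b: "\<And>i p. p \<in> E \<Longrightarrow> (\<lambda>n. b n i p) \<longlonglongrightarrow> b' i p" and neg: "negative d b'"
  shows "\<exists>n. nonpos d (b n)"
proof (rule ccontr)
  assume no: "\<not> (\<exists>n. nonpos d (b n))"
  obtain x y where xy: "frame d x y"
    "\<And>\<alpha> \<beta>. \<exists>v\<in>N. comb \<alpha> x \<beta> y v \<noteq> 0 \<Longrightarrow> form b' (comb \<alpha> x \<beta> y) (comb \<alpha> x \<beta> y) < 0"
    using neg unfolding negative_def by blast
  have "\<exists>\<alpha> \<beta>. \<alpha>\<^sup>2 + d * \<beta>\<^sup>2 = 1 \<and> \<bar>\<beta>\<bar> \<le> 1 \<and> 0 < form (b n) (comb \<alpha> x \<beta> y) (comb \<alpha> x \<beta> y)" for n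
  proof -
    obtain \<alpha> \<beta> where ab: "0 < form (b n) (comb \<alpha> x \<beta> y) (comb \<alpha> x \<beta> y)"
      using no xy(1) unfolding nonpos_def by (meson not_le)
    define k where "k = sqrt (\<alpha>\<^sup>2 + d * \<beta>\<^sup>2)"
    have "ip (comb \<alpha> x \<beta> y) (comb \<alpha> x \<beta> y) \<noteq> 0"
    proof
      assume "ip (comb \<alpha> x \<beta> y) (comb \<alpha> x \<beta> y) = 0"
      then have "form (b n) (comb \<alpha> x \<beta> y) (comb \<alpha> x \<beta> y) = form (b n) (\<lambda>_. 0) (\<lambda>_. 0)"
        unfolding ip_zero by (intro form_cong) auto
      then show False using ab by (simp add: form_def)
    qed
    then have "0 < \<alpha>\<^sup>2 + d * \<beta>\<^sup>2"
      using ip_nonneg[of "comb \<alpha> x \<beta> y"] unfolding frame_comb[OF xy(1)] by linarith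
    then have k: "0 < k" "k\<^sup>2 = \<alpha>\<^sup>2 + d * \<beta>\<^sup>2" by (simp_all add: k_def)
    \<comment> \<open>The factor d discards the coefficient of y when d = 0: y is then 0 on N, and
      the normalization would not bound its coefficient.\<close>
    define \<beta>' where "\<beta>' = d * \<beta> / k"
    have y0: "y v = 0" if "d = 0" "v \<in> N" for v
      using xy(1) ip_zero[of y] that unfolding frame_def by auto
    have *: "comb (\<alpha> / k) x \<beta>' y v = (1 / k) * comb \<alpha> x \<beta> y v" if "v \<in> N" for v
      using d y0 that k by (auto simp: comb_def \<beta>'_def field_simps)
    have "form (b n) (comb (\<alpha> / k) x \<beta>' y) (comb (\<alpha> / k) x \<beta>' y) =
       form (b n) (comb (1 / k) (comb \<alpha> x \<beta> y) 0 y) (comb (1 / k) (comb \<alpha> x \<beta> y) 0 y)"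
      by (rule form_cong) (use * in \<open>auto simp: comb_def\<close>)
    also have "\<dots> = (1 / k)\<^sup>2 * form (b n) (comb \<alpha> x \<beta> y) (comb \<alpha> x \<beta> y)"
      by (rule form_scale)
    finally have "0 < form (b n) (comb (\<alpha> / k) x \<beta>' y) (comb (\<alpha> / k) x \<beta>' y)" using ab k by simp
    moreover have one: "(\<alpha> / k)\<^sup>2 + d * \<beta>'\<^sup>2 = 1"
    proof -
      have "(\<alpha> / k)\<^sup>2 + d * \<beta>'\<^sup>2 = (\<alpha>\<^sup>2 + d * \<beta>\<^sup>2) / k\<^sup>2"
        using d by (auto simp: \<beta>'_def power_divide add_divide_distrib)
      moreover have "k\<^sup>2 \<noteq> 0" using k(1) by simp
      ultimately show ?thesis unfolding k(2)[symmetric] by simp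
    qed
    moreover have "\<bar>\<beta>'\<bar> \<le> 1"
    proof (cases "d = 0")
      case False
      then have d1: "d = 1" using d by simp
      have "\<beta>'\<^sup>2 \<le> 1" using one[unfolded d1] zero_le_power2[of "\<alpha> / k"] by linarith
      then show ?thesis using abs_le_square_iff[of \<beta>' 1] by simp
    qed (simp add: \<beta>'_def)
    ultimately show ?thesis by blast
  qed
  then obtain \<alpha> \<beta> where ab: "\<And>n. (\<alpha> n)\<^sup>2 + d * (\<beta> n)\<^sup>2 = 1" "\<And>n. \<bar>\<beta> n\<bar> \<le> 1"
    "\<And>n. 0 < form (b n) (comb (\<alpha> n) x (\<beta> n) y) (comb (\<alpha> n) x (\<beta> n) y)" by metis
  have "(\<alpha> n)\<^sup>2 \<le> 1" for n
  proof -
    have "0 \<le> d * (\<beta> n)\<^sup>2" using d by auto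
    then show ?thesis using ab(1)[of n] by linarith
  qed
  then have "\<bar>\<alpha> n\<bar> \<le> 1" for n using abs_le_square_iff[of "\<alpha> n" 1] by simp
  then have "bounded (range \<alpha>)" by (auto simp: bounded_iff)
  then obtain \<alpha>' r where r: "strict_mono r" "(\<alpha> \<circ> r) \<longlonglongrightarrow> \<alpha>'" using bounded_imp_convergent_subsequence by blast
  have "bounded (range (\<beta> \<circ> r))" using ab(2) by (auto simp: bounded_iff)
  then obtain \<beta>' q where q: "strict_mono q" "((\<beta> \<circ> r) \<circ> q) \<longlonglongrightarrow> \<beta>'" using bounded_imp_convergent_subsequence by blast
  have A: "(\<lambda>n. \<alpha> (r (q n))) \<longlonglongrightarrow> \<alpha>'" using LIMSEQ_subseq_LIMSEQ[OF r(2) q(1)] by (simp add: o_def)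
  have B: "(\<lambda>n. \<beta> (r (q n))) \<longlonglongrightarrow> \<beta>'" using q by (simp add: o_def)
  have b'': "(\<lambda>n. b (r (q n)) i p) \<longlonglongrightarrow> b' i p" if "p \<in> E" for i p
    using LIMSEQ_subseq_LIMSEQ[OF b[OF that] strict_mono_o[OF r(1) q(1)]] by (simp add: o_def)
  have "(\<lambda>n. (\<alpha> (r (q n)))\<^sup>2 + d * (\<beta> (r (q n)))\<^sup>2) \<longlonglongrightarrow> \<alpha>'\<^sup>2 + d * \<beta>'\<^sup>2" by (intro tendsto_intros A B)
  then have "\<alpha>'\<^sup>2 + d * \<beta>'\<^sup>2 = 1" unfolding ab(1) by (simp add: LIMSEQ_const_iff)
  then have "ip (comb \<alpha>' x \<beta>' y) (comb \<alpha>' x \<beta>' y) \<noteq> 0" unfolding frame_comb[OF xy(1)] by simp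
  then have "form b' (comb \<alpha>' x \<beta>' y) (comb \<alpha>' x \<beta>' y) < 0" unfolding ip_zero by (intro xy(2)) blast
  moreover have "0 \<le> form b' (comb \<alpha>' x \<beta>' y) (comb \<alpha>' x \<beta>' y)"
  proof (rule LIMSEQ_le_const)
    show "(\<lambda>n. form (b (r (q n))) (comb (\<alpha> (r (q n))) x (\<beta> (r (q n))) y) (comb (\<alpha> (r (q n))) x (\<beta> (r (q n))) y))
      \<longlonglongrightarrow> form b' (comb \<alpha>' x \<beta>' y) (comb \<alpha>' x \<beta>' y)"
      by (rule form_tendsto) (auto simp: comb_def intro!: tendsto_intros b'' A B)
  qed (use ab(3) less_imp_le in blast)
  ultimately show False by simp
qed

text \<open>Gram-Schmidt. For d = 0 the second vector is replaced by 0, which is why the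
  independence hypothesis only controls \<open>d * \<beta>\<close>.\<close>

lemma frame_span:
  assumes d: "d \<in> {0, 1}" and indep: "\<And>\<alpha> \<beta>. \<forall>v\<in>N. comb \<alpha> x \<beta> y v = 0 \<Longrightarrow> \<alpha> = 0 \<and> d * \<beta> = 0"
  obtains x' y' where "frame d x' y'" "\<And>\<alpha> \<beta>. \<exists>\<alpha>' \<beta>'. comb \<alpha> x' \<beta> y' = comb \<alpha>' x \<beta>' y"
proof -
  have x0: "ip x x > 0"
  proof -
    have "ip x x \<noteq> 0" unfolding ip_zero using indep[of 1 0] by (auto simp: comb_def)
    then show ?thesis using ip_nonneg[of x] by linarith
  qed
  define k where "k = 1 / sqrt (ip x x)"
  have k: "k > 0" "k * k * ip x x = 1" using x0 by (simp_all add: k_def)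
  define c where "c = - (ip x y / ip x x)"
  define z where "z = comb 1 y c x"
  have xz: "ip x z = 0" using x0 by (simp add: z_def ip_comb c_def)
  show ?thesis
  proof (cases "d = 0")
    case True
    show ?thesis
    proof (rule that)
      show "frame d (comb k x 0 x) (comb 0 x 0 x)" using k True by (simp add: frame_def ip_comb)
      show "\<exists>\<alpha>' \<beta>'. comb \<alpha> (comb k x 0 x) \<beta> (comb 0 x 0 x) = comb \<alpha>' x \<beta>' y" for \<alpha> \<beta>
        by (rule exI[of _ "\<alpha> * k"], rule exI[of _ 0]) (auto simp: comb_def)
    qed
  next
    case False
    then have d1: "d = 1" using d by simp
    have "ip z z \<noteq> 0"
    proof
      assume "ip z z = 0"
      then have "\<forall>v\<in>N. comb c x 1 y v = 0" unfolding ip_zero z_def comb_def by (auto simp: add.commute)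
      from indep[OF this] d1 show False by simp
    qed
    then have z0: "ip z z > 0" using ip_nonneg[of z] by linarith
    define m where "m = 1 / sqrt (ip z z)"
    have m: "m * m * ip z z = 1" using z0 by (simp add: m_def)
    show ?thesis
    proof (rule that)
      show "frame d (comb k x 0 x) (comb m z 0 z)"
        using k m d1 xz by (simp add: frame_def ip_comb)
      show "\<exists>\<alpha>' \<beta>'. comb \<alpha> (comb k x 0 x) \<beta> (comb m z 0 z) = comb \<alpha>' x \<beta>' y" for \<alpha> \<beta>
        by (rule exI[of _ "\<alpha> * k + \<beta> * m * c"], rule exI[of _ "\<beta> * m"]) (auto simp: comb_def z_def algebra_simps)
    qed
  qed
qed

lemma form_bound: "\<exists>C. \<forall>x. \<bar>form b x x\<bar> \<le> C * ip x x"
proof -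
  define C where "C = (\<Sum>p\<in>E. \<bar>b 0 p\<bar> + 2 * \<bar>b 1 p\<bar> + \<bar>b 2 p\<bar>)"
  have "\<bar>form b x x\<bar> \<le> C * ip x x" for x
  proof -
    have "\<bar>form b x x\<bar> \<le> (\<Sum>p\<in>E. (\<bar>b 0 p\<bar> + 2 * \<bar>b 1 p\<bar> + \<bar>b 2 p\<bar>) * ip x x)"
      unfolding form_def
    proof (rule order_trans[OF sum_abs sum_mono])
      fix p assume p: "p \<in> E"
      have le: "\<bar>x v\<bar> * \<bar>x v\<bar> \<le> ip x x" if "v \<in> N" for v
        unfolding ip_def abs_mult_self using that finite_N by (intro member_le_sum) auto
      have le2: "\<bar>x v\<bar> * \<bar>x w\<bar> \<le> ip x x" if "v \<in> N" "w \<in> N" for v w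
      proof -
        have "0 \<le> (\<bar>x v\<bar> - \<bar>x w\<bar>)\<^sup>2" by simp
        then have "2 * (\<bar>x v\<bar> * \<bar>x w\<bar>) \<le> \<bar>x v\<bar> * \<bar>x v\<bar> + \<bar>x w\<bar> * \<bar>x w\<bar>"
          by (simp only: power2_eq_square) (simp add: algebra_simps del: abs_mult_self_eq abs_mult_self)
        then show ?thesis using le[OF that(1)] le[OF that(2)] by linarith
      qed
      note l = le2[OF ends(1) ends(1), OF p p] le2[OF ends(2) ends(1), OF p p] le2[OF ends(1) ends(2), OF p p] le2[OF ends(2) ends(2), OF p p]
      have tri: "\<bar>A + B * (C + D) + F\<bar> \<le> \<bar>A\<bar> + \<bar>B\<bar> * \<bar>C\<bar> + \<bar>B\<bar> * \<bar>D\<bar> + \<bar>F\<bar>" for A B C D F :: real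
        unfolding abs_mult[symmetric] distrib_left by linarith
      have "\<bar>b 0 p * (x (s p) * x (s p)) + b 1 p * (x (t p) * x (s p) + x (s p) * x (t p)) + b 2 p * (x (t p) * x (t p))\<bar>
        \<le> \<bar>b 0 p\<bar> * (\<bar>x (s p)\<bar> * \<bar>x (s p)\<bar>) + \<bar>b 1 p\<bar> * (\<bar>x (t p)\<bar> * \<bar>x (s p)\<bar>) + \<bar>b 1 p\<bar> * (\<bar>x (s p)\<bar> * \<bar>x (t p)\<bar>)
         + \<bar>b 2 p\<bar> * (\<bar>x (t p)\<bar> * \<bar>x (t p)\<bar>)"
        using tri[of "b 0 p * (x (s p) * x (s p))" "b 1 p" "x (t p) * x (s p)" "x (s p) * x (t p)" "b 2 p * (x (t p) * x (t p))"]
        unfolding abs_mult .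
      also have "\<dots> \<le> \<bar>b 0 p\<bar> * ip x x + \<bar>b 1 p\<bar> * ip x x + \<bar>b 1 p\<bar> * ip x x + \<bar>b 2 p\<bar> * ip x x"
        by (intro add_mono mult_left_mono l abs_ge_zero)
      finally show "\<bar>b 0 p * (x (s p) * x (s p)) + b 1 p * (x (t p) * x (s p) + x (s p) * x (t p)) + b 2 p * (x (t p) * x (t p))\<bar>
        \<le> (\<bar>b 0 p\<bar> + 2 * \<bar>b 1 p\<bar> + \<bar>b 2 p\<bar>) * ip x x" by (simp add: algebra_simps)
    qed
    then show ?thesis by (simp add: C_def sum_distrib_right)
  qed
  then show ?thesis by blast
qed

text \<open>If the form is nondegenerate, a step of gradient descent makes a nonpositive subspace negative.\<close>

lemma nonpos_imp_negative:
  assumes d: "d \<in> {0, 1}" and neg: "nonpos d b"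
    and nondeg: "\<And>x. \<forall>v\<in>N. flux b x v = 0 \<Longrightarrow> \<forall>v\<in>N. x v = 0"
  shows "negative d b"
proof -
  obtain x y where xy: "frame d x y" "\<And>\<alpha> \<beta>. form b (comb \<alpha> x \<beta> y) (comb \<alpha> x \<beta> y) \<le> 0"
    using neg unfolding nonpos_def by blast
  obtain C where C: "\<And>x. \<bar>form b x x\<bar> \<le> C * ip x x" using form_bound by blast
  \<comment> \<open>The step size satisfies e C < 2. With g the flux of z, the form at z - e g is at
    most -2 e |g|^2 + e^2 C |g|^2 when it is nonpositive at z, so the linear gain dominates.\<close>
  define e where "e = 1 / (\<bar>C\<bar> + 1)"
  have e: "e > 0" "e * C < 2"
    unfolding e_def by (auto simp: field_simps abs_if)
  define P where "P z = comb 1 z (- e) (flux b z)" for z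
  have P: "form b (P z) (P z) < 0" if z: "form b z z \<le> 0" "\<exists>v\<in>N. z v \<noteq> 0" for z
  proof -
    let ?g = "flux b z"
    have "ip ?g ?g \<noteq> 0" unfolding ip_zero using nondeg z by blast
    then have g: "ip ?g ?g > 0" using ip_nonneg[of ?g] by linarith
    have "form b (P z) (P z) = form b z z - 2 * e * form b z ?g + e * e * form b ?g ?g"
      unfolding P_def form_comb by (simp add: form_sym[of b ?g z] algebra_simps)
    also have "form b z ?g = ip ?g ?g" by (rule form_flux)
    also have "e * e * form b ?g ?g \<le> e * (e * (C * ip ?g ?g))"
      using C[of ?g] e by (simp add: mult.assoc)
    also have "e * (C * ip ?g ?g) < 2 * ip ?g ?g" using e g by (simp add: mult.assoc[symmetric])
    finally show ?thesis using z(1) e by (simp add: mult_ac)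
  qed
  have Pl: "P (comb \<alpha> x \<beta> y) = comb \<alpha> (P x) \<beta> (P y)" for \<alpha> \<beta>
  proof
    fix v
    have "flux b (comb \<alpha> x \<beta> y) v = \<alpha> * flux b x v + \<beta> * flux b y v"
      unfolding flux_def comb_def sum_distrib_left sum.distrib[symmetric] by (auto intro!: sum.cong simp: algebra_simps)
    then show "P (comb \<alpha> x \<beta> y) v = comb \<alpha> (P x) \<beta> (P y) v" unfolding P_def comb_def by (simp add: algebra_simps)
  qed
  have form0: "form b z z = 0" if "\<forall>v\<in>N. z v = 0" for z
  proof -
    have "form b z z = form b (\<lambda>_. 0) (\<lambda>_. 0)" by (rule form_cong) (use that in auto)
    then show ?thesis by (simp add: form_def)
  qed
  \<comment> \<open>For z in the nonpositive subspace and nonzero on N the form is negative at P z,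
    so P z is nonzero on N as well: the step preserves the dimension.\<close>
  have inj: "\<forall>v\<in>N. comb \<alpha> x \<beta> y v = 0" if "\<forall>v\<in>N. comb \<alpha> (P x) \<beta> (P y) v = 0" for \<alpha> \<beta>
    using P[OF xy(2)[of \<alpha> \<beta>]] form0[OF that] unfolding Pl by auto
  obtain x' y' where f: "frame d x' y'" "\<And>\<alpha> \<beta>. \<exists>\<alpha>' \<beta>'. comb \<alpha> x' \<beta> y' = comb \<alpha>' (P x) \<beta>' (P y)"
  proof (rule frame_span[OF d, of "P x" "P y"])
    fix \<alpha> \<beta> assume "\<forall>v\<in>N. comb \<alpha> (P x) \<beta> (P y) v = 0"
    then have "ip (comb \<alpha> x \<beta> y) (comb \<alpha> x \<beta> y) = 0" using inj unfolding ip_zero by blast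
    then have "\<alpha>\<^sup>2 + d * \<beta>\<^sup>2 = 0" unfolding frame_comb[OF xy(1)] .
    then show "\<alpha> = 0 \<and> d * \<beta> = 0" using d by (auto simp: sum_power2_eq_zero_iff)
  qed blast
  have "form b (comb \<alpha> x' \<beta> y') (comb \<alpha> x' \<beta> y') < 0" if nz: "\<exists>v\<in>N. comb \<alpha> x' \<beta> y' v \<noteq> 0" for \<alpha> \<beta>
  proof -
    obtain \<alpha>' \<beta>' where eq: "comb \<alpha> x' \<beta> y' = P (comb \<alpha>' x \<beta>' y)" using f(2) Pl by metis
    have "\<exists>v\<in>N. comb \<alpha>' x \<beta>' y v \<noteq> 0"
    proof (rule ccontr)
      assume a: "\<not> ?thesis"
      then have "flux b (comb \<alpha>' x \<beta>' y) = flux b (\<lambda>_. 0)" by (intro flux_cong) auto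
      then have "P (comb \<alpha>' x \<beta>' y) v = 0" if "v \<in> N" for v using a that by (simp add: P_def comb_def flux_def cong: if_cong)
      then show False using nz eq by auto
    qed
    then show ?thesis unfolding eq by (rule P[OF xy(2)])
  qed
  then show ?thesis using f(1) unfolding negative_def by blast
qed

lemma form_zero: "\<forall>v\<in>N. x v = 0 \<Longrightarrow> form b x x = 0"
  using form_cong[of x "\<lambda>_. 0" x "\<lambda>_. 0" b] by (simp add: form_def)

section \<open>Kernels of the assembled form\<close>

definition kernel1 :: "(nat \<Rightarrow> 'p \<Rightarrow> real) \<Rightarrow> bool" where
  "kernel1 b \<longleftrightarrow> (\<exists>x. (\<exists>v\<in>N. x v \<noteq> 0) \<and> (\<forall>v\<in>N. flux b x v = 0))"

definition kernel2 :: "(nat \<Rightarrow> 'p \<Rightarrow> real) \<Rightarrow> bool" where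
  "kernel2 b \<longleftrightarrow> (\<exists>x y. (\<forall>\<alpha> \<beta>. (\<forall>v\<in>N. comb \<alpha> x \<beta> y v = 0) \<longrightarrow> \<alpha> = 0 \<and> \<beta> = 0) \<and>
     (\<forall>v\<in>N. flux b x v = 0) \<and> (\<forall>v\<in>N. flux b y v = 0))"

lemma flux_zero_form: "\<forall>v\<in>N. flux b x v = 0 \<Longrightarrow> form b x y = 0" "\<forall>v\<in>N. flux b x v = 0 \<Longrightarrow> form b y x = 0"
   apply (simp add: form_flux ip_def)
  apply (subst form_sym)
  apply (simp add: form_flux ip_def)
  done

lemma frame_nonzero:
  assumes "frame d x y"
  shows "\<exists>v\<in>N. x v \<noteq> 0"
  using assms ip_zero[of x] unfolding frame_def by auto

lemma nonpos_mono_dim: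
  assumes "nonpos 1 b"
  shows "nonpos 0 b"
proof -
  obtain x y where "frame 1 x y" and *: "\<And>\<alpha> \<beta>. form b (comb \<alpha> x \<beta> y) (comb \<alpha> x \<beta> y) \<le> 0"
    using assms unfolding nonpos_def by blast
  then have "frame 0 x (\<lambda>_. 0)" unfolding frame_def ip_def by simp
  moreover have "comb \<alpha> x \<beta> (\<lambda>_. 0) = comb \<alpha> x 0 y" for \<alpha> \<beta> by (simp add: comb_def)
  ultimately show ?thesis using * unfolding nonpos_def by metis
qed

lemma span_nonpos:
  assumes indep: "\<And>\<alpha> \<beta>. \<forall>v\<in>N. comb \<alpha> x \<beta> y v = 0 \<Longrightarrow> \<alpha> = 0 \<and> \<beta> = 0"
    and neg: "\<And>\<alpha> \<beta>. form b (comb \<alpha> x \<beta> y) (comb \<alpha> x \<beta> y) \<le> 0"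
  shows "nonpos 1 b"
proof -
  obtain x' y' where f: "frame 1 x' y'" "\<And>\<alpha> \<beta>. \<exists>\<alpha>' \<beta>'. comb \<alpha> x' \<beta> y' = comb \<alpha>' x \<beta>' y"
  proof (rule frame_span[of 1 x y])
    show "\<alpha> = 0 \<and> 1 * \<beta> = 0" if "\<forall>v\<in>N. comb \<alpha> x \<beta> y v = 0" for \<alpha> \<beta> using indep[OF that] by simp
  qed simp_all
  then show ?thesis using neg unfolding nonpos_def by metis
qed

end

text \<open>A strictly decreasing continuous family of forms; \<open>kernel1\<close> and \<open>kernel2\<close> hold at the parameters at
  which an eigenvalue of the form, or two of them, cross \<open>0\<close>.\<close>

locale pencil = network E s t N
  for E :: "'p set" and s t :: "'p \<Rightarrow> 'n" and N :: "'n set" +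
  fixes B :: "real \<Rightarrow> nat \<Rightarrow> 'p \<Rightarrow> real" and \<Lambda> :: real
  assumes continuous: "\<And>ls l i p. (\<And>n. ls n \<in> {-1..\<Lambda>}) \<Longrightarrow> l \<in> {-1..\<Lambda>} \<Longrightarrow> ls \<longlonglongrightarrow> l \<Longrightarrow> p \<in> E \<Longrightarrow> (\<lambda>n. B (ls n) i p) \<longlonglongrightarrow> B l i p"
    and decreasing: "\<And>l m x. -1 \<le> l \<Longrightarrow> l < m \<Longrightarrow> m \<le> \<Lambda> \<Longrightarrow> \<exists>v\<in>N. x v \<noteq> 0 \<Longrightarrow> form (B m) x x < form (B l) x x"
    and positive: "\<And>l x. -1 \<le> l \<Longrightarrow> l < 0 \<Longrightarrow> \<exists>v\<in>N. x v \<noteq> 0 \<Longrightarrow> 0 < form (B l) x x"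
    and top: "nonpos 1 (B \<Lambda>)" "0 \<le> \<Lambda>"
begin

text \<open>The search starts at -1, although the form is positive below 0, in order that parameters
  slightly to the left of the threshold stay admissible even when the threshold is 0.\<close>

definition threshold :: "real \<Rightarrow> real" where
  "threshold d = Inf {l \<in> {-1..\<Lambda>}. nonpos d (B l)}"

lemma nonpos_ge_0:
  assumes "-1 \<le> l" "nonpos d (B l)"
  shows "0 \<le> l"
proof (rule ccontr)
  assume "\<not> 0 \<le> l"
  obtain x y where xy: "frame d x y" "form (B l) (comb 1 x 0 y) (comb 1 x 0 y) \<le> 0"
    using assms unfolding nonpos_def by blast
  have "0 < form (B l) x x" using positive[of l x] frame_nonzero[OF xy(1)] assms \<open>\<not> 0 \<le> l\<close> by simp
  then show False using xy(2) form_scale[of "B l" 1 x y] by simp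
qed

text \<open>The matrices depend continuously on the parameter and \<open>nonpos\<close> survives
  limits, so a sequence of admissible parameters approaching the infimum shows that the infimum is
  attained.\<close>

lemma threshold:
  assumes d: "d \<in> {0, 1}"
  shows threshold_nonpos: "nonpos d (B (threshold d))"
    and threshold_range: "threshold d \<in> {0..\<Lambda>}"
    and threshold_least: "\<And>l. l \<in> {-1..\<Lambda>} \<Longrightarrow> nonpos d (B l) \<Longrightarrow> threshold d \<le> l"
proof -
  let ?S = "{l \<in> {-1..\<Lambda>}. nonpos d (B l)}"
  have "nonpos d (B \<Lambda>)" using d top nonpos_mono_dim by auto
  then have ne: "\<Lambda> \<in> ?S" using top by auto
  have bd: "bdd_below ?S" by (rule bdd_belowI[of _ "-1"]) auto
  show least: "\<And>l. l \<in> {-1..\<Lambda>} \<Longrightarrow> nonpos d (B l) \<Longrightarrow> threshold d \<le> l"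
    unfolding threshold_def by (rule cInf_lower[OF _ bd]) auto
  have "threshold d \<in> closure ?S"
    unfolding threshold_def by (rule closure_contains_Inf) (use ne bd in auto)
  then obtain ls where ls: "\<And>n. ls n \<in> ?S" "ls \<longlonglongrightarrow> threshold d" unfolding closure_sequential by blast
  have "threshold d \<in> {0..\<Lambda>}"
  proof -
    have "0 \<le> threshold d" by (rule LIMSEQ_le_const[OF ls(2)]) (use ls(1) nonpos_ge_0 in force)
    then show ?thesis using least[of \<Lambda>] ne by auto
  qed
  then show "threshold d \<in> {0..\<Lambda>}" .
  show "nonpos d (B (threshold d))"
  proof (rule nonpos_closed[where b = "\<lambda>n. B (ls n)", rotated])
    show "(\<lambda>n. B (ls n) i p) \<longlonglongrightarrow> B (threshold d) i p" if "p \<in> E" for i p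
      by (rule continuous[OF _ _ ls(2) that]) (use ls(1) \<open>threshold d \<in> {0..\<Lambda>}\<close> in auto)
  qed (use d ls(1) in auto)
qed

text \<open>If the form were nondegenerate at the threshold, gradient descent would make it negative
  on a subspace of the same dimension, and by continuity it would be nonpositive already slightly to
  the left.\<close>

lemma threshold_kernel:
  assumes d: "d \<in> {0, 1}"
  shows "kernel1 (B (threshold d))"
proof (rule ccontr)
  assume "\<not> kernel1 (B (threshold d))"
  then have "negative d (B (threshold d))"
    using nonpos_imp_negative[OF d threshold_nonpos[OF d]] unfolding kernel1_def by blast
  moreover have "(\<lambda>n. threshold d - inverse (real (Suc n))) \<longlonglongrightarrow> threshold d - 0"
    by (intro tendsto_diff tendsto_const LIMSEQ_inverse_real_of_nat)
  moreover have rng: "threshold d - inverse (real (Suc n)) \<in> {-1..\<Lambda>}" for n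
  proof -
    have "0 < inverse (real (Suc n))" "inverse (real (Suc n)) \<le> 1" by (auto simp: field_simps)
    then show ?thesis using threshold_range[OF d, unfolded atLeastAtMost_iff] unfolding atLeastAtMost_iff by linarith
  qed
  ultimately have "\<exists>n. nonpos d (B (threshold d - inverse (real (Suc n))))"
    using threshold_range[OF d] by (intro negative_open[OF d _ \<open>negative d (B (threshold d))\<close>] continuous) (auto simp del: of_nat_Suc)
  then obtain n where "nonpos d (B (threshold d - inverse (real (Suc n))))" by blast
  then have "threshold d \<le> threshold d - inverse (real (Suc n))" by (rule threshold_least[OF d rng])
  then show False by (simp del: of_nat_Suc)
qed

lemma kernel1_threshold:
  assumes "l \<in> {-1..\<Lambda>}" "kernel1 (B l)"
  shows "threshold 0 \<le> l"
proof -
  obtain x where x: "\<exists>v\<in>N. x v \<noteq> 0" "\<forall>v\<in>N. flux (B l) x v = 0" using assms unfolding kernel1_def by blast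
  obtain x' y' where f: "frame 0 x' y'" "\<And>\<alpha> \<beta>. \<exists>\<alpha>' \<beta>'. comb \<alpha> x' \<beta> y' = comb \<alpha>' x \<beta>' x"
  proof (rule frame_span[of 0 x "\<lambda>_. 0"])
    fix \<alpha> \<beta> :: real assume "\<forall>v\<in>N. comb \<alpha> x \<beta> (\<lambda>_. 0) v = 0"
    then show "\<alpha> = 0 \<and> 0 * \<beta> = 0" using x by (auto simp: comb_def)
  next
    fix x' y' assume *: "frame 0 x' y'" "\<And>\<alpha> \<beta>. \<exists>\<alpha>' \<beta>'. comb \<alpha> x' \<beta> y' = comb \<alpha>' x \<beta>' (\<lambda>_. 0)"
    have "comb \<alpha> x \<beta> (\<lambda>_. 0) = comb \<alpha> x 0 x" for \<alpha> \<beta> by (simp add: comb_def)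
    then show thesis using * that by metis
  qed simp
  have "form (B l) (comb \<alpha> x' \<beta> y') (comb \<alpha> x' \<beta> y') \<le> 0" for \<alpha> \<beta>
  proof -
    obtain \<alpha>' \<beta>' where "comb \<alpha> x' \<beta> y' = comb \<alpha>' x \<beta>' x" using f(2) by blast
    then show ?thesis using flux_zero_form(1)[OF x(2)] by (simp add: form_comb)
  qed
  then have "nonpos 0 (B l)" using f(1) unfolding nonpos_def by blast
  then show ?thesis by (intro threshold_least assms) auto
qed

lemma kernel2_threshold:
  assumes "l \<in> {-1..\<Lambda>}" "kernel2 (B l)"
  shows "threshold 1 \<le> l"
proof -
  obtain x y where x: "\<And>\<alpha> \<beta>. \<forall>v\<in>N. comb \<alpha> x \<beta> y v = 0 \<Longrightarrow> \<alpha> = 0 \<and> \<beta> = 0"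
    "\<forall>v\<in>N. flux (B l) x v = 0" "\<forall>v\<in>N. flux (B l) y v = 0" using assms unfolding kernel2_def by blast
  have "form (B l) (comb \<alpha> x \<beta> y) (comb \<alpha> x \<beta> y) \<le> 0" for \<alpha> \<beta>
    using flux_zero_form(1)[OF x(2)] flux_zero_form(1)[OF x(3)] by (simp add: form_comb)
  then have "nonpos 1 (B l)" using x(1) by (rule span_nonpos[rotated])
  then show ?thesis by (intro threshold_least assms) auto
qed

text \<open>A kernel vector x for the smaller parameter l becomes strictly negative at m, while a
  kernel vector y at m is orthogonal to everything with respect to the form at m. On their span the
  form is thus \<alpha>^2 times a negative number, which also shows that x and y are
  independent.\<close>

lemma kernel1_kernel1_threshold:
  assumes l: "-1 \<le> l" "l < m" "m \<le> \<Lambda>" "kernel1 (B l)" "kernel1 (B m)"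
  shows "threshold 1 \<le> m"
proof -
  obtain x where x: "\<exists>v\<in>N. x v \<noteq> 0" "\<forall>v\<in>N. flux (B l) x v = 0" using l unfolding kernel1_def by blast
  obtain y where y: "\<exists>v\<in>N. y v \<noteq> 0" "\<forall>v\<in>N. flux (B m) y v = 0" using l unfolding kernel1_def by blast
  have neg: "form (B m) x x < 0" using decreasing[OF l(1-3) x(1)] flux_zero_form(1)[OF x(2)] by simp
  have eq: "form (B m) (comb \<alpha> x \<beta> y) (comb \<alpha> x \<beta> y) = \<alpha>\<^sup>2 * form (B m) x x" for \<alpha> \<beta>
    using flux_zero_form[OF y(2)] by (simp add: form_comb power2_eq_square)
  have "nonpos 1 (B m)"
  proof (rule span_nonpos)
    fix \<alpha> \<beta> assume z: "\<forall>v\<in>N. comb \<alpha> x \<beta> y v = 0"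
    have "\<alpha>\<^sup>2 * form (B m) x x = 0" using form_zero[OF z] eq by metis
    then have "\<alpha> = 0" using neg by simp
    then show "\<alpha> = 0 \<and> \<beta> = 0" using z y(1) by (auto simp: comb_def)
  next
    show "form (B m) (comb \<alpha> x \<beta> y) (comb \<alpha> x \<beta> y) \<le> 0" for \<alpha> \<beta>
      unfolding eq using neg by (simp add: mult_nonneg_nonpos)
  qed
  then show ?thesis using l by (intro threshold_least) auto
qed

text \<open>If the two thresholds coincide, the form at this parameter is nonnegative: the line
  through a negative vector would stay nonpositive slightly to the left and push the first threshold
  down. A plane on which a nonnegative form is nonpositive consists of null vectors, and these lie
  in the kernel.\<close>

lemma threshold_1_cases: "kernel2 (B (threshold 1)) \<or> (threshold 0 < threshold 1 \<and> kernel1 (B (threshold 0)) \<and> kernel1 (B (threshold 1)))"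
proof -
  have d: "(0::real) \<in> {0, 1}" "(1::real) \<in> {0, 1}" by simp_all
  have r: "0 \<le> threshold 1" "threshold 1 \<le> \<Lambda>" using threshold_range[OF d(2)] by simp_all
  have le: "threshold 0 \<le> threshold 1"
    by (rule threshold_least[OF d(1) _ nonpos_mono_dim[OF threshold_nonpos[OF d(2)]]]) (use r in simp)
  show ?thesis
  proof (cases "threshold 0 < threshold 1")
    case True
    then show ?thesis using threshold_kernel[OF d(1)] threshold_kernel[OF d(2)] by blast
  next
    case False
    define l where "l = threshold 1"
    have l: "l = threshold 0" "0 \<le> l" "l \<le> \<Lambda>" using False le r by (simp_all add: l_def)
    have pos: "0 \<le> form (B l) x x" for x
    proof (rule ccontr)
      assume neg: "\<not> ?thesis"
      then have "\<exists>v\<in>N. x v \<noteq> 0" using form_zero[of x "B l"] by auto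
      then have "ip x x \<noteq> 0" using ip_zero by blast
      then have ipx: "0 < ip x x" using ip_nonneg[of x] by linarith
      define k where "k = 1 / sqrt (ip x x)"
      have k: "0 < k" "k * k * ip x x = 1" using ipx by (simp_all add: k_def)
      have "negative 0 (B l)"
        unfolding negative_def
      proof (intro exI conjI allI impI)
        show "frame 0 (comb k x 0 x) (\<lambda>_. 0)" using k by (simp add: frame_def ip_comb) (simp add: ip_def)
        fix \<alpha> \<beta> assume nz: "\<exists>v\<in>N. comb \<alpha> (comb k x 0 x) \<beta> (\<lambda>_. 0) v \<noteq> 0"
        have c: "comb \<alpha> (comb k x 0 x) \<beta> (\<lambda>_. 0) = comb (\<alpha> * k) x 0 x" by (simp add: comb_def mult_ac)
        have "\<alpha> * k \<noteq> 0" using nz by (auto simp: comb_def)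
        then have "0 < (\<alpha> * k)\<^sup>2" by (simp only: zero_less_power2) simp
        then show "form (B l) (comb \<alpha> (comb k x 0 x) \<beta> (\<lambda>_. 0)) (comb \<alpha> (comb k x 0 x) \<beta> (\<lambda>_. 0)) < 0"
          unfolding c form_scale using neg by (simp add: mult_pos_neg)
      qed
      moreover have "(\<lambda>n. l - inverse (real (Suc n))) \<longlonglongrightarrow> l - 0"
        by (intro tendsto_diff tendsto_const LIMSEQ_inverse_real_of_nat)
      moreover have rng: "l - inverse (real (Suc n)) \<in> {-1..\<Lambda>}" for n
      proof -
        have "0 < inverse (real (Suc n))" "inverse (real (Suc n)) \<le> 1" by (auto simp: field_simps)
        then show ?thesis using l unfolding atLeastAtMost_iff by linarith
      qed
      ultimately have "\<exists>n. nonpos 0 (B (l - inverse (real (Suc n))))"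
        using l(2,3) by (intro negative_open[OF _ _ \<open>negative 0 (B l)\<close>] continuous) (auto simp del: of_nat_Suc)
      then obtain n where "nonpos 0 (B (l - inverse (real (Suc n))))" by blast
      then have "l \<le> l - inverse (real (Suc n))" using threshold_least[of 0, OF _ rng] l(1) by simp
      then show False by (simp del: of_nat_Suc)
    qed
    obtain x y where xy: "frame 1 x y" "\<And>\<alpha> \<beta>. form (B l) (comb \<alpha> x \<beta> y) (comb \<alpha> x \<beta> y) \<le> 0"
      using threshold_nonpos[OF d(2)] unfolding nonpos_def l_def by blast
    \<comment> \<open>A null vector of a nonnegative form is in the kernel, since otherwise a small
      step against its flux would make the form negative.\<close>
    have ker: "\<forall>v\<in>N. flux (B l) z v = 0" if z: "form (B l) z z \<le> 0" for z
    proof -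
      let ?g = "flux (B l) z"
      obtain C where C: "\<And>x. \<bar>form (B l) x x\<bar> \<le> C * ip x x" using form_bound by blast
      have "ip ?g ?g \<le> 0"
      proof (rule ccontr)
        assume g: "\<not> ?thesis"
        define e where "e = 1 / (\<bar>C\<bar> + 1)"
        have e: "e > 0" "e * C < 2" unfolding e_def by (auto simp: field_simps abs_if)
        have "0 \<le> form (B l) (comb 1 z (- e) ?g) (comb 1 z (- e) ?g)" by (rule pos)
        also have "\<dots> = form (B l) z z - 2 * e * form (B l) z ?g + e * e * form (B l) ?g ?g"
          unfolding form_comb by (simp add: form_sym[of "B l" ?g z] algebra_simps)
        also have "form (B l) z ?g = ip ?g ?g" by (rule form_flux)
        also have "e * e * form (B l) ?g ?g \<le> e * (e * (C * ip ?g ?g))"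
          using C[of ?g] e by (simp add: mult.assoc)
        also have "e * (C * ip ?g ?g) < 2 * ip ?g ?g" using e g by (simp add: mult.assoc[symmetric])
        finally show False using z e by (simp add: mult_ac)
      qed
      then have "ip ?g ?g = 0" using ip_nonneg[of ?g] by linarith
      then show ?thesis unfolding ip_zero .
    qed
    have "kernel2 (B l)"
      unfolding kernel2_def
    proof (intro exI conjI allI impI)
      show "\<forall>v\<in>N. flux (B l) x v = 0" "\<forall>v\<in>N. flux (B l) y v = 0"
        using ker xy(2)[of 1 0] xy(2)[of 0 1] by (simp_all add: comb_def)
      fix \<alpha> \<beta> assume "\<forall>v\<in>N. comb \<alpha> x \<beta> y v = 0"
      then have "\<alpha>\<^sup>2 + \<beta>\<^sup>2 = 0" using frame_comb[OF xy(1), of \<alpha> \<beta>] unfolding ip_zero[symmetric] by simp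
      then show "\<alpha> = 0" "\<beta> = 0" by (simp_all add: sum_power2_eq_zero_iff)
    qed
    then show ?thesis by (simp add: l_def)
  qed
qed

end

section \<open>Subdividing the graph\<close>

lemma solution_cong:
  assumes "\<And>x. x \<in> {0..L} \<Longrightarrow> u x = u' x" "\<And>x. x \<in> {0..L} \<Longrightarrow> w x = w' x" "\<And>x. x \<in> {0..L} \<Longrightarrow> V x = V' x"
  shows "solution V L u w \<longleftrightarrow> solution V' L u' w'"
proof -
  have "(w has_integral (u x - u 0)) {0..x} \<longleftrightarrow> (w' has_integral (u' x - u' 0)) {0..x}"
    "((\<lambda>t. V t * u t) has_integral (w x - w 0)) {0..x} \<longleftrightarrow> ((\<lambda>t. V' t * u' t) has_integral (w' x - w' 0)) {0..x}"
    if "x \<in> {0..L}" for x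
  proof -
    have "(w has_integral (u x - u 0)) {0..x} \<longleftrightarrow> (w' has_integral (u x - u 0)) {0..x}"
      by (rule has_integral_cong) (use that assms in auto)
    moreover have "((\<lambda>t. V t * u t) has_integral (w x - w 0)) {0..x} \<longleftrightarrow> ((\<lambda>t. V' t * u' t) has_integral (w x - w 0)) {0..x}"
      by (rule has_integral_cong) (use that assms in auto)
    moreover have "0 \<in> {0..L}" using that by simp
    ultimately show "(w has_integral (u x - u 0)) {0..x} \<longleftrightarrow> (w' has_integral (u' x - u' 0)) {0..x}"
      "((\<lambda>t. V t * u t) has_integral (w x - w 0)) {0..x} \<longleftrightarrow> ((\<lambda>t. V' t * u' t) has_integral (w' x - w' 0)) {0..x}"
      using assms(1,2) that by metis+
  qed
  then show ?thesis unfolding solution_def primitive_def by blast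
qed

lemma primitive_shift:
  assumes "primitive L f g" "0 \<le> a" "a + b \<le> L"
  shows "primitive b (\<lambda>y. f (a + y)) (\<lambda>y. g (a + y))"
  unfolding primitive_def
proof
  fix x assume x: "x \<in> {0..b}"
  have "(g has_integral (f (a + x) - f a)) {a..a + x}"
    using assms x by (intro primitive_diff[OF assms(1)]) auto
  then have "((\<lambda>y. g (y + a)) has_integral (f (a + x) - f a)) {a - a..a + x - a}"
    by (rule has_integral_shift_real_ivl)
  then show "((\<lambda>y. g (a + y)) has_integral (f (a + x) - f (a + 0))) {0..x}" by (simp add: add.commute)
qed

lemma solution_shift:
  assumes "solution V L u w" "0 \<le> a" "a + b \<le> L"
  shows "solution (\<lambda>y. V (a + y)) b (\<lambda>y. u (a + y)) (\<lambda>y. w (a + y))"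
  using assms primitive_shift[of L u w a b] primitive_shift[of L w "\<lambda>t. V t * u t" a b] by (auto simp: solution_def)

text \<open>At the junction the density k is prescribed by the first piece only; the value at one
  point does not affect the integral over the second piece.\<close>

lemma primitive_glue:
  assumes f: "primitive a f g" and f': "primitive b f' g'" and "f' 0 = f a" "0 \<le> a"
    and k: "\<And>x. x \<in> {0..a} \<Longrightarrow> k x = g x" "\<And>x. x \<in> {0<..b} \<Longrightarrow> k (a + x) = g' x"
  shows "primitive (a + b) (\<lambda>x. if x \<le> a then f x else f' (x - a)) k"
  unfolding primitive_def
proof
  fix x assume x: "x \<in> {0..a + b}"
  have k1: "(k has_integral (f y - f 0)) {0..y}" if "y \<in> {0..a}" for y
  proof -
    have "(g has_integral (f y - f 0)) {0..y}" using f that by (auto simp: primitive_def)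
    then show ?thesis by (rule has_integral_eq[rotated]) (use k(1) that in auto)
  qed
  show "(k has_integral ((if x \<le> a then f x else f' (x - a)) - (if 0 \<le> a then f 0 else f' (0 - a)))) {0..x}"
  proof (cases "x \<le> a")
    case True
    then show ?thesis using k1[of x] x assms(4) by simp
  next
    case False
    have "(g' has_integral (f' (x - a) - f' 0)) {0..x - a}" using f' x False by (auto simp: primitive_def)
    then have "((\<lambda>y. g' (y + - a)) has_integral (f' (x - a) - f' 0)) {0 - - a..x - a - - a}"
      by (rule has_integral_shift_real_ivl)
    then have "((\<lambda>y. g' (y - a)) has_integral (f' (x - a) - f' 0)) {a..x}" by simp
    then have "(k has_integral (f' (x - a) - f' 0)) {a..x}"
    proof (rule has_integral_spike[of "{a}", rotated 2])
      fix y assume "y \<in> {a..x} - {a}"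
      then show "k y = g' (y - a)" using k(2)[of "y - a"] x by auto
    qed simp
    then have "(k has_integral ((f a - f 0) + (f' (x - a) - f' 0))) {0..x}"
      by (intro has_integral_combine[OF _ _ k1[of a]]) (use False assms(4) in auto)
    then show ?thesis using False assms(3,4) by simp
  qed
qed

lemma solution_glue:
  assumes u: "solution V a u w" and u': "solution (\<lambda>y. V (a + y)) b u' w'"
    and "u' 0 = u a" "w' 0 = w a" "0 \<le> a"
  shows "solution V (a + b) (\<lambda>x. if x \<le> a then u x else u' (x - a)) (\<lambda>x. if x \<le> a then w x else w' (x - a))"
  unfolding solution_def
proof
  show "primitive (a + b) (\<lambda>x. if x \<le> a then u x else u' (x - a)) (\<lambda>x. if x \<le> a then w x else w' (x - a))"
    by (rule primitive_glue[of a u w b u' w']) (use assms in \<open>auto simp: solution_def\<close>)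
  show "primitive (a + b) (\<lambda>x. if x \<le> a then w x else w' (x - a)) (\<lambda>t. V t * (if t \<le> a then u t else u' (t - a)))"
    by (rule primitive_glue[of a w "\<lambda>t. V t * u t" b w' "\<lambda>y. V (a + y) * u' y"]) (use assms in \<open>auto simp: solution_def\<close>)
qed

text \<open>U lives on the glued space, which contains the continuity at the vertices; W collects
  the derivatives on the edges. The equation is in integrated form, so it holds at every point and
  is insensitive to changes of q on null sets.\<close>

definition real_eigenfunction ::
  "('v, 'e) metric_graph \<Rightarrow> (('v, 'e) point \<Rightarrow> real) \<Rightarrow> real \<Rightarrow> (('v, 'e) point \<Rightarrow> real) \<Rightarrow> ('e \<Rightarrow> real \<Rightarrow> real) \<Rightarrow> bool" where
  "real_eigenfunction G q \<mu> U W \<longleftrightarrow>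
     (\<forall>e\<in>edges G. solution (\<lambda>x. q (place G e x) - \<mu>) (len G e) (\<lambda>x. U (place G e x)) (W e)) \<and>
     (\<forall>v\<in>vertices G. (\<Sum>e | e \<in> edges G \<and> tgt G e = v. W e (len G e)) + (\<Sum>e | e \<in> edges G \<and> src G e = v. - W e 0) = 0)"

lemma real_eigenfunction_linear:
  assumes U: "real_eigenfunction G q \<mu> U W" and U': "real_eigenfunction G q \<mu> U' W'"
  shows "real_eigenfunction G q \<mu> (\<lambda>p. a * U p + b * U' p) (\<lambda>e x. a * W e x + b * W' e x)"
  unfolding real_eigenfunction_def
proof (intro conjI ballI)
  show "solution (\<lambda>x. q (place G e x) - \<mu>) (len G e) (\<lambda>x. a * U (place G e x) + b * U' (place G e x)) (\<lambda>x. a * W e x + b * W' e x)"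
    if "e \<in> edges G" for e
    using that assms by (intro solution_linear) (auto simp: real_eigenfunction_def)
  fix v assume v: "v \<in> vertices G"
  have "(\<Sum>e | e \<in> edges G \<and> tgt G e = v. a * W e (len G e) + b * W' e (len G e)) + (\<Sum>e | e \<in> edges G \<and> src G e = v. - (a * W e 0 + b * W' e 0))
    = a * ((\<Sum>e | e \<in> edges G \<and> tgt G e = v. W e (len G e)) + (\<Sum>e | e \<in> edges G \<and> src G e = v. - W e 0))
     + b * ((\<Sum>e | e \<in> edges G \<and> tgt G e = v. W' e (len G e)) + (\<Sum>e | e \<in> edges G \<and> src G e = v. - W' e 0))"
    by (simp add: sum.distrib sum_distrib_left[symmetric] sum_negf sum_subtractf algebra_simps)
  then show "(\<Sum>e | e \<in> edges G \<and> tgt G e = v. a * W e (len G e) + b * W' e (len G e)) + (\<Sum>e | e \<in> edges G \<and> src G e = v. - (a * W e 0 + b * W' e 0)) = 0"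
    using assms v by (simp add: real_eigenfunction_def)
qed

section \<open>Nodes and pieces of the subdivided graph\<close>

locale subdivided_graph =
  fixes G :: "('v, 'e) metric_graph" and n :: nat
  assumes G: "compact_metric_graph G" and n: "0 < n"
begin

definition mesh :: "'e \<Rightarrow> real" where "mesh e = len G e / n"

text \<open>Nodes are points of the glued space: ends of edges at the same vertex are one node, so
  that the assembled form contains the gluing.\<close>

definition node :: "'e \<Rightarrow> nat \<Rightarrow> ('v, 'e) point" where "node e i = place G e (i * mesh e)"

definition pieces :: "('e \<times> nat) set" where "pieces = edges G \<times> {..<n}"

definition left_node :: "'e \<times> nat \<Rightarrow> ('v, 'e) point" where "left_node p = node (fst p) (snd p)"

definition right_node :: "'e \<times> nat \<Rightarrow> ('v, 'e) point" where "right_node p = node (fst p) (Suc (snd p))"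

definition nodes :: "('v, 'e) point set" where "nodes = left_node ` pieces \<union> right_node ` pieces"

lemma finite_edges: "finite (edges G)" and len_pos: "e \<in> edges G \<Longrightarrow> 0 < len G e" and edges_nonempty: "edges G \<noteq> {}"
  using G by (auto simp: compact_metric_graph_def)

lemma mesh_pos: "e \<in> edges G \<Longrightarrow> 0 < mesh e" and n_mesh: "real n * mesh e = len G e"
  using n len_pos by (auto simp: mesh_def)

lemma mesh_mono: "e \<in> edges G \<Longrightarrow> i \<le> n \<Longrightarrow> 0 \<le> real i * mesh e \<and> real i * mesh e \<le> len G e"
  using mesh_pos[of e] n_mesh[of e] mult_right_mono[of "real i" "real n" "mesh e"] by auto

lemma mesh_strict: "e \<in> edges G \<Longrightarrow> i < n \<Longrightarrow> real i * mesh e < len G e"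
  using mesh_pos[of e] n_mesh[of e] mult_strict_right_mono[of "real i" "real n" "mesh e"] by auto

sublocale network pieces left_node right_node nodes
  using finite_edges by unfold_locales (auto simp: pieces_def nodes_def)

lemma node_0: "node e 0 = Vertex (src G e)" and node_n: "e \<in> edges G \<Longrightarrow> node e n = Vertex (tgt G e)"
  using n_mesh[of e] len_pos[of e] by (auto simp: node_def place_def)

lemma node_interior: "e \<in> edges G \<Longrightarrow> 0 < i \<Longrightarrow> i < n \<Longrightarrow> node e i = Interior e (i * mesh e)"
  using mesh_pos[of e] mesh_strict[of e i] by (auto simp: node_def place_def)

lemma node_eq_interior:
  assumes "e \<in> edges G" "e' \<in> edges G" "0 < i" "i < n" "j \<le> n"
  shows "node e' j = node e i \<longleftrightarrow> e' = e \<and> j = i"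
proof (cases "j = 0 \<or> j = n")
  case True
  then show ?thesis using assms node_interior[of e i] node_0[of e'] node_n[of e'] by auto
next
  case False
  then show ?thesis using assms node_interior[of e i] node_interior[of e' j] mesh_pos[of e] by auto
qed

lemma place_in_points: "e \<in> edges G \<Longrightarrow> x \<in> {0..len G e} \<Longrightarrow> place G e x \<in> points G"
  unfolding points_def by blast

lemma nodes_points: "nodes \<subseteq> points G"
proof -
  have "node e i \<in> points G" if "e \<in> edges G" "i \<le> n" for e i
    using that mesh_mono[of e i] by (auto simp: node_def intro: place_in_points)
  then show ?thesis by (auto simp: nodes_def left_node_def right_node_def pieces_def)
qed

lemma node_in_nodes:
  assumes "e \<in> edges G" "i \<le> n"
  shows "node e i \<in> nodes"
proof (cases "i < n")
  case True
  then have "node e i = left_node (e, i)" "(e, i) \<in> pieces" using assms by (auto simp: left_node_def pieces_def)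
  then show ?thesis unfolding nodes_def by blast
next
  case False
  then have "node e i = right_node (e, n - 1)" "(e, n - 1) \<in> pieces" using assms n by (auto simp: right_node_def pieces_def)
  then show ?thesis unfolding nodes_def by blast
qed

lemma nodes_cases:
  assumes "v \<in> nodes"
  obtains v' where "v = Vertex v'" "v' \<in> vertices G"
  | e i where "e \<in> edges G" "0 < i" "i < n" "v = node e i"
proof -
  have "\<exists>e i. e \<in> edges G \<and> i \<le> n \<and> v = node e i"
  proof -
    obtain e i where "e \<in> edges G" "i < n" "v = node e i \<or> v = node e (Suc i)"
      using assms unfolding nodes_def left_node_def right_node_def pieces_def by fastforce
    then show ?thesis by (metis Suc_leI less_imp_le)
  qed
  then obtain e i where ei: "e \<in> edges G" "i \<le> n" "v = node e i" by blast
  then show thesis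
    using that node_0[of e] node_n[of e] by (cases "i = 0"; cases "i = n") (auto simp: vertices_def)
qed

definition piece_potential :: "(('v, 'e) point \<Rightarrow> real) \<Rightarrow> real \<Rightarrow> 'e \<times> nat \<Rightarrow> real \<Rightarrow> real" where
  "piece_potential q \<mu> p = (\<lambda>y. q (place G (fst p) (real (snd p) * mesh (fst p) + y)) - \<mu>)"

definition matrices :: "(('v, 'e) point \<Rightarrow> real) \<Rightarrow> real \<Rightarrow> nat \<Rightarrow> 'e \<times> nat \<Rightarrow> real" where
  "matrices q \<mu> i p = stiffness (piece_potential q \<mu> p) (mesh (fst p)) i"

text \<open>The vertex condition rewritten through the first and last node of each edge, in the
  shape in which the telescoped flux appears. A loop contributes with both ends.\<close>

lemma Kirchhoff_sum:
  fixes W :: "'e \<Rightarrow> real \<Rightarrow> real"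
  shows "(\<Sum>e | e \<in> edges G \<and> tgt G e = v. W e (len G e)) + (\<Sum>e | e \<in> edges G \<and> src G e = v. - W e 0)
    = (\<Sum>e\<in>edges G. (if node e n = Vertex v then W e (real n * mesh e) else 0) - (if node e 0 = Vertex v then W e (real 0 * mesh e) else 0))"
proof -
  have "(\<Sum>e | e \<in> edges G \<and> tgt G e = v. W e (len G e)) = (\<Sum>e\<in>edges G. if node e n = Vertex v then W e (real n * mesh e) else 0)"
    unfolding n_mesh using finite_edges node_n by (subst sum.inter_filter[symmetric]) (auto intro!: sum.cong)
  moreover have "(\<Sum>e | e \<in> edges G \<and> src G e = v. - W e 0) = - (\<Sum>e\<in>edges G. if node e 0 = Vertex v then W e (real 0 * mesh e) else 0)"
    unfolding node_0 sum_negf[symmetric] sum.inter_filter[OF finite_edges] by (rule sum.cong) auto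
  ultimately show ?thesis by (simp add: sum_subtractf)
qed

text \<open>When the derivatives at the ends of all pieces of an edge are values of one function W,
  the contribution of the right end of a piece cancels that of the left end of the next piece. Only
  the ends of the edges survive.\<close>

lemma flux_telescope:
  assumes W: "\<And>e i. e \<in> edges G \<Longrightarrow> i < n \<Longrightarrow> b 0 (e, i) * x (node e i) + b 1 (e, i) * x (node e (Suc i)) = - W e (real i * mesh e)"
    "\<And>e i. e \<in> edges G \<Longrightarrow> i < n \<Longrightarrow> b 1 (e, i) * x (node e i) + b 2 (e, i) * x (node e (Suc i)) = W e (real (Suc i) * mesh e)"
  shows "flux b x v = (\<Sum>e\<in>edges G. (if node e n = v then W e (real n * mesh e) else 0) - (if node e 0 = v then W e (real 0 * mesh e) else 0))"
proof -
  let ?g = "\<lambda>e i. if node e i = v then W e (real i * mesh e) else 0"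
  have "flux b x v = (\<Sum>(e, i)\<in>edges G \<times> {..<n}. ?g e (Suc i) - ?g e i)"
    unfolding flux_def
  proof (rule sum.cong)
    fix p assume "p \<in> edges G \<times> {..<n}"
    then obtain e i where p: "p = (e, i)" "e \<in> edges G" "i < n" by auto
    show "(if left_node p = v then b 0 p * x (left_node p) + b 1 p * x (right_node p) else 0) +
      (if right_node p = v then b 1 p * x (left_node p) + b 2 p * x (right_node p) else 0) =
      (case p of (e, i) \<Rightarrow> ?g e (Suc i) - ?g e i)"
      unfolding p left_node_def right_node_def fst_conv snd_conv W(1)[OF p(2,3)] W(2)[OF p(2,3)] by simp
  qed (simp add: pieces_def)
  also have "\<dots> = (\<Sum>e\<in>edges G. \<Sum>i<n. ?g e (Suc i) - ?g e i)" by (rule sum.cartesian_product[symmetric])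
  also have "\<dots> = (\<Sum>e\<in>edges G. ?g e n - ?g e 0)"
    using sum_lessThan_telescope[of "?g e" n for e] by (intro sum.cong refl) auto
  finally show ?thesis .
qed

text \<open>An interior node is the left end of exactly one piece and the right end of exactly the
  preceding one, so its flux compares the derivatives from the two sides.\<close>

lemma flux_interior:
  assumes e: "e \<in> edges G" "0 < i" "i < n"
  shows "flux b x (node e i) = b 1 (e, i - 1) * x (node e (i - 1)) + b 2 (e, i - 1) * x (node e i)
     + (b 0 (e, i) * x (node e i) + b 1 (e, i) * x (node e (Suc i)))"
proof -
  have 1: "left_node p = node e i \<longleftrightarrow> p = (e, i)" "right_node p = node e i \<longleftrightarrow> p = (e, i - 1)" if "p \<in> pieces" for p
    using node_eq_interior[of e "fst p" i "snd p"] node_eq_interior[of e "fst p" i "Suc (snd p)"] that e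
    by (auto simp: left_node_def right_node_def pieces_def prod_eq_iff)
  have "flux b x (node e i) = (\<Sum>p\<in>pieces. (if p = (e, i) then b 0 p * x (left_node p) + b 1 p * x (right_node p) else 0) +
     (if p = (e, i - 1) then b 1 p * x (left_node p) + b 2 p * x (right_node p) else 0))"
    unfolding flux_def by (rule sum.cong) (use 1 in auto)
  also have "\<dots> = (b 0 (e, i) * x (left_node (e, i)) + b 1 (e, i) * x (right_node (e, i))) +
     (b 1 (e, i - 1) * x (left_node (e, i - 1)) + b 2 (e, i - 1) * x (right_node (e, i - 1)))"
    unfolding sum.distrib sum.delta[OF finite_E] using e by (auto simp: pieces_def)
  finally show ?thesis using e by (simp add: left_node_def right_node_def)
qed

end

section \<open>Eigenfunctions and kernel vectors at the nodes\<close>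

locale fine_graph = subdivided_graph +
  fixes M K :: real
  assumes mesh_small: "e \<in> edges G \<Longrightarrow> K * (mesh e)\<^sup>2 \<le> 1 / 100" and M: "0 \<le> M"
begin

lemma edge_potential:
  assumes q: "q \<in> bounded_potentials G M" and \<mu>: "\<bar>\<mu>\<bar> + M \<le> K" and e: "e \<in> edges G"
  shows "potential (len G e) K (\<lambda>x. q (place G e x) - \<mu>)"
  unfolding potential_def
proof (intro conjI ballI)
  show "(\<lambda>x. q (place G e x) - \<mu>) \<in> borel_measurable (lebesgue_on {0..len G e})"
    using q e by (auto simp: bounded_potentials_def)
  show "\<bar>q (place G e x) - \<mu>\<bar> \<le> K" if "x \<in> {0..len G e}" for x
  proof -
    have "place G e x \<in> points G" using that e by (rule place_in_points[rotated])
    then have "0 \<le> q (place G e x)" "q (place G e x) \<le> M" using q by (auto simp: bounded_potentials_def)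
    then show ?thesis using \<mu> by linarith
  qed
qed

lemma piece_short:
  assumes q: "q \<in> bounded_potentials G M" and \<mu>: "\<bar>\<mu>\<bar> + M \<le> K" and p: "p \<in> pieces"
  shows "short (mesh (fst p)) K (piece_potential q \<mu> p)"
proof -
  obtain e i where ei: "p = (e, i)" "e \<in> edges G" "i < n" using p by (auto simp: pieces_def)
  let ?V = "\<lambda>x. q (place G e x) - \<mu>" and ?a = "real i * mesh e"
  have pot: "potential (len G e) K ?V" by (rule edge_potential[OF q \<mu> ei(2)])
  have h: "0 < mesh e" "0 \<le> ?a" "?a + mesh e \<le> len G e"
    using mesh_pos[OF ei(2)] mesh_mono[OF ei(2), of i] mesh_mono[OF ei(2), of "Suc i"] ei(3) by (auto simp: algebra_simps)
  have "?V integrable_on {?a..?a + mesh e}" by (rule potential_integrable[OF pot]) (use h in auto)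
  then have "(\<lambda>y. ?V (y + ?a)) integrable_on {?a - ?a..?a + mesh e - ?a}" by (rule integrable_shift_real_ivl)
  then have "piece_potential q \<mu> p integrable_on {0..mesh e}"
    by (simp add: piece_potential_def ei add.commute)
  then have "piece_potential q \<mu> p \<in> borel_measurable (lebesgue_on {0..mesh e})" by (rule integrable_imp_measurable)
  moreover have "\<bar>piece_potential q \<mu> p y\<bar> \<le> K" if "y \<in> {0..mesh e}" for y
    using pot that h by (auto simp: potential_def piece_potential_def ei)
  ultimately show ?thesis using mesh_small[OF ei(2)] h ei by (simp add: short_def potential_def)
qed

lemma piece_solution:
  assumes "solution (\<lambda>x. q (place G e x) - \<mu>) (len G e) u w" "e \<in> edges G" "i < n"
  shows "solution (piece_potential q \<mu> (e, i)) (mesh e) (\<lambda>y. u (real i * mesh e + y)) (\<lambda>y. w (real i * mesh e + y))"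
proof -
  have "0 \<le> real i * mesh e" "real i * mesh e + mesh e \<le> len G e"
    using mesh_mono[of e i] mesh_mono[of e "Suc i"] assms by (auto simp: algebra_simps)
  from solution_shift[OF assms(1) this] show ?thesis by (simp add: piece_potential_def)
qed

text \<open>The flux of the nodal values telescopes to the ends of the edges. At a vertex this is
  the Kirchhoff sum; at an interior node nothing is left, since no edge ends there.\<close>

lemma eigenfunction_kernel:
  assumes q: "q \<in> bounded_potentials G M" and \<mu>: "\<bar>\<mu>\<bar> + M \<le> K" and U: "real_eigenfunction G q \<mu> U W"
    and v: "v \<in> nodes"
  shows "flux (matrices q \<mu>) U v = 0"
proof -
  have sol: "solution (piece_potential q \<mu> (e, i)) (mesh e) (\<lambda>y. U (place G e (real i * mesh e + y))) (\<lambda>y. W e (real i * mesh e + y))"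
    if "e \<in> edges G" "i < n" for e i
    using U that by (intro piece_solution) (auto simp: real_eigenfunction_def)
  have end': "U (place G e (real i * mesh e + mesh e)) = U (node e (Suc i))" "W e (real i * mesh e + mesh e) = W e (real (Suc i) * mesh e)" for e i
    by (simp_all add: node_def algebra_simps)
  have tel: "flux (matrices q \<mu>) U v = (\<Sum>e\<in>edges G. (if node e n = v then W e (real n * mesh e) else 0) - (if node e 0 = v then W e (real 0 * mesh e) else 0))"
  proof (rule flux_telescope)
    fix e i assume ei: "e \<in> edges G" "i < n"
    then have p: "(e, i) \<in> pieces" by (simp add: pieces_def)
    show "matrices q \<mu> 0 (e, i) * U (node e i) + matrices q \<mu> 1 (e, i) * U (node e (Suc i)) = - W e (real i * mesh e)"
      "matrices q \<mu> 1 (e, i) * U (node e i) + matrices q \<mu> 2 (e, i) * U (node e (Suc i)) = W e (real (Suc i) * mesh e)"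
      using stiffness_flux[OF piece_short[OF q \<mu> p, unfolded fst_conv] sol[OF ei]]
      by (simp_all only: matrices_def fst_conv end') (simp_all add: node_def)
  qed
  show ?thesis using v
  proof (cases rule: nodes_cases)
    case (1 v')
    then show ?thesis using U Kirchhoff_sum[where W=W and v=v'] unfolding tel real_eigenfunction_def by simp
  next
    case (2 e i)
    then show ?thesis unfolding tel by (intro sum.neutral) (use node_interior node_0 node_n in auto)
  qed
qed

lemma piece_cover:
  assumes e: "e \<in> edges G" and y: "y \<in> {0..len G e}"
  obtains i where "i < n" "y - real i * mesh e \<in> {0..mesh e}"
proof -
  \<comment> \<open>The minimum with n - 1 assigns the right end of the edge, where the floor is n,
    to the last piece.\<close>
  define i where "i = min (nat \<lfloor>y / mesh e\<rfloor>) (n - 1)"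
  have h: "0 < mesh e" using mesh_pos e by auto
  have y0: "0 \<le> y / mesh e" using y h by auto
  have lo: "real (nat \<lfloor>y / mesh e\<rfloor>) \<le> y / mesh e" using y0 by linarith
  have hi: "y / mesh e < real (nat \<lfloor>y / mesh e\<rfloor>) + 1" using y0 by linarith
  have yn: "y / mesh e \<le> real n" using y h n_mesh[of e] by (simp add: field_simps)
  have "i < n" using n by (auto simp: i_def)
  moreover have "real i \<le> y / mesh e" using lo by (auto simp: i_def)
  moreover have "y / mesh e \<le> real i + 1"
    using hi yn n by (auto simp: i_def min_def of_nat_diff)
  ultimately show thesis using that[of i] h by (simp add: field_simps)
qed

text \<open>On each piece the boundary values are 0, and a short interval admits only the zero
  solution. Hence an eigenfunction is determined by its values at the finitely many nodes.\<close>

lemma eigenfunction_zero: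
  assumes q: "q \<in> bounded_potentials G M" and \<mu>: "\<bar>\<mu>\<bar> + M \<le> K" and U: "real_eigenfunction G q \<mu> U W"
    and zero: "\<And>v. v \<in> nodes \<Longrightarrow> U v = 0" and p: "p \<in> points G"
  shows "U p = 0"
proof -
  obtain e y where e: "e \<in> edges G" "y \<in> {0..len G e}" "p = place G e y" using p by (auto simp: points_def)
  obtain i where i: "i < n" "y - real i * mesh e \<in> {0..mesh e}" using piece_cover[OF e(1,2)] .
  have pc: "(e, i) \<in> pieces" using e i by (simp add: pieces_def)
  note sh = piece_short[OF q \<mu> pc, unfolded fst_conv]
  have sol: "solution (piece_potential q \<mu> (e, i)) (mesh e) (\<lambda>y. U (place G e (real i * mesh e + y))) (\<lambda>y. W e (real i * mesh e + y))"
    using U e i by (intro piece_solution) (auto simp: real_eigenfunction_def)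
  have z: "U (place G e (real i * mesh e + 0)) = 0" "U (place G e (real i * mesh e + mesh e)) = 0"
    using zero[OF node_in_nodes[of e i]] zero[OF node_in_nodes[of e "Suc i"]] e i by (auto simp: node_def algebra_simps)
  have "\<bar>U (place G e (real i * mesh e + (y - real i * mesh e)))\<bar> \<le> 2 * 0"
    by (rule solution_near_linear(3)[OF sh sol i(2)]) (use z in auto)
  then show ?thesis using e by simp
qed

text \<open>The solutions on the pieces of an edge are glued from left to right. Their values match
  by construction, and the vanishing flux at an interior node is exactly the equality of the two
  one-sided derivatives.\<close>

lemma kernel_edge_solution:
  assumes q: "q \<in> bounded_potentials G M" and \<mu>: "\<bar>\<mu>\<bar> + M \<le> K" and e: "e \<in> edges G"
    and ker: "\<And>v. v \<in> nodes \<Longrightarrow> flux (matrices q \<mu>) x v = 0" and k: "k < n"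
  shows "\<exists>u w. solution (\<lambda>x. q (place G e x) - \<mu>) (real (Suc k) * mesh e) u w \<and>
    (\<forall>j\<le>Suc k. u (real j * mesh e) = x (node e j)) \<and>
    (\<forall>j\<le>k. matrices q \<mu> 0 (e, j) * x (node e j) + matrices q \<mu> 1 (e, j) * x (node e (Suc j)) = - w (real j * mesh e) \<and>
       matrices q \<mu> 1 (e, j) * x (node e j) + matrices q \<mu> 2 (e, j) * x (node e (Suc j)) = w (real (Suc j) * mesh e))"
  using k
proof (induction k)
  case 0
  then have p: "(e, 0) \<in> pieces" using e by (simp add: pieces_def)
  note sh = piece_short[OF q \<mu> p, unfolded fst_conv]
  obtain u w where u: "solution (piece_potential q \<mu> (e, 0)) (mesh e) u w" "u 0 = x (node e 0)" "u (mesh e) = x (node e (Suc 0))"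
    using dirichlet_exists[OF sh] by blast
  have "piece_potential q \<mu> (e, 0) = (\<lambda>x. q (place G e x) - \<mu>)" by (simp add: piece_potential_def)
  then show ?case using u stiffness_flux[OF sh u(1)] by (intro exI[of _ u] exI[of _ w]) (auto simp: matrices_def le_Suc_eq)
next
  case (Suc k)
  let ?a = "real (Suc k) * mesh e"
  obtain u w where u: "solution (\<lambda>x. q (place G e x) - \<mu>) ?a u w" "\<And>j. j \<le> Suc k \<Longrightarrow> u (real j * mesh e) = x (node e j)" "u ?a = x (node e (Suc k))"
    "\<And>j. j \<le> k \<Longrightarrow> matrices q \<mu> 0 (e, j) * x (node e j) + matrices q \<mu> 1 (e, j) * x (node e (Suc j)) = - w (real j * mesh e)"
    "\<And>j. j \<le> k \<Longrightarrow> matrices q \<mu> 1 (e, j) * x (node e j) + matrices q \<mu> 2 (e, j) * x (node e (Suc j)) = w (real (Suc j) * mesh e)"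
  proof -
    from Suc.IH[OF Suc_lessD[OF Suc.prems]] obtain u w where "solution (\<lambda>x. q (place G e x) - \<mu>) ?a u w"
      "\<forall>j\<le>Suc k. u (real j * mesh e) = x (node e j)"
      "\<forall>j\<le>k. matrices q \<mu> 0 (e, j) * x (node e j) + matrices q \<mu> 1 (e, j) * x (node e (Suc j)) = - w (real j * mesh e) \<and>
        matrices q \<mu> 1 (e, j) * x (node e j) + matrices q \<mu> 2 (e, j) * x (node e (Suc j)) = w (real (Suc j) * mesh e)"
      by blast
    then show thesis using that[of u w] by blast
  qed
  have p: "(e, Suc k) \<in> pieces" using e Suc by (simp add: pieces_def)
  note sh = piece_short[OF q \<mu> p, unfolded fst_conv]
  obtain u' w' where u': "solution (piece_potential q \<mu> (e, Suc k)) (mesh e) u' w'" "u' 0 = x (node e (Suc k))" "u' (mesh e) = x (node e (Suc (Suc k)))"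
    using dirichlet_exists[OF sh] by blast
  have a: "0 \<le> ?a" "0 < mesh e" using mesh_pos[OF e] by auto
  have fl: "- w' 0 = matrices q \<mu> 0 (e, Suc k) * x (node e (Suc k)) + matrices q \<mu> 1 (e, Suc k) * x (node e (Suc (Suc k)))"
    "w' (mesh e) = matrices q \<mu> 1 (e, Suc k) * x (node e (Suc k)) + matrices q \<mu> 2 (e, Suc k) * x (node e (Suc (Suc k)))"
    using stiffness_flux[OF sh u'(1)] u' by (simp_all add: matrices_def)
  have "flux (matrices q \<mu>) x (node e (Suc k)) = 0" using ker node_in_nodes e Suc by auto
  then have w': "w' 0 = w ?a"
    using flux_interior[of e "Suc k" "matrices q \<mu>" x] e Suc.prems u(5)[of k] fl(1) by simp
  define u2 where "u2 = (\<lambda>x. if x \<le> ?a then u x else u' (x - ?a))"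
  define w2 where "w2 = (\<lambda>x. if x \<le> ?a then w x else w' (x - ?a))"
  have eq: "?a + mesh e = real (Suc (Suc k)) * mesh e" by (simp add: algebra_simps)
  have "solution (\<lambda>x. q (place G e x) - \<mu>) (?a + mesh e) u2 w2"
    unfolding u2_def w2_def by (rule solution_glue[OF u(1)]) (use u' u w' a in \<open>auto simp: piece_potential_def\<close>)
  then have 1: "solution (\<lambda>x. q (place G e x) - \<mu>) (real (Suc (Suc k)) * mesh e) u2 w2" unfolding eq .
  have le: "real j * mesh e \<le> ?a" if "j \<le> Suc k" for j using that a by (intro mult_right_mono) auto
  have low: "w2 y = w y" "u2 y = u y" if "y \<le> ?a" for y using that by (simp_all add: u2_def w2_def)
  have w1: "w2 (real (Suc (Suc k)) * mesh e) = w' (mesh e)" "u2 (real (Suc (Suc k)) * mesh e) = u' (mesh e)"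
    unfolding eq[symmetric] using a by (auto simp: u2_def w2_def)
  have 2: "matrices q \<mu> 0 (e, j) * x (node e j) + matrices q \<mu> 1 (e, j) * x (node e (Suc j)) = - w2 (real j * mesh e) \<and>
       matrices q \<mu> 1 (e, j) * x (node e j) + matrices q \<mu> 2 (e, j) * x (node e (Suc j)) = w2 (real (Suc j) * mesh e)" if "j \<le> Suc k" for j
  proof (cases "j = Suc k")
    case True
    then show ?thesis using w1 fl w' low(1)[of ?a] by (simp del: of_nat_Suc)
  next
    case False
    then have j: "j \<le> k" using that by simp
    have "w2 (real j * mesh e) = w (real j * mesh e)" "w2 (real (Suc j) * mesh e) = w (real (Suc j) * mesh e)"
      using low(1)[OF le[of j]] low(1)[OF le[of "Suc j"]] j by simp_all
    then show ?thesis using u(4,5)[OF j] by simp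
  qed
  have 3: "u2 (real j * mesh e) = x (node e j)" if "j \<le> Suc (Suc k)" for j
  proof (cases "j = Suc (Suc k)")
    case True
    then show ?thesis using w1 u'(3) by simp
  next
    case False
    then show ?thesis using low(2)[OF le[of j]] u(2)[of j] that by simp
  qed
  show ?case using 1 2 3 by blast
qed

lemma kernel_eigenfunction:
  assumes q: "q \<in> bounded_potentials G M" and \<mu>: "\<bar>\<mu>\<bar> + M \<le> K"
    and ker: "\<And>v. v \<in> nodes \<Longrightarrow> flux (matrices q \<mu>) x v = 0"
  obtains U W where "real_eigenfunction G q \<mu> U W" "\<And>v. v \<in> nodes \<Longrightarrow> U v = x v"
proof -
  define P where "P e u w \<longleftrightarrow> solution (\<lambda>x. q (place G e x) - \<mu>) (len G e) u w \<and>
    (\<forall>j\<le>n. u (real j * mesh e) = x (node e j)) \<and>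
    (\<forall>j<n. matrices q \<mu> 0 (e, j) * x (node e j) + matrices q \<mu> 1 (e, j) * x (node e (Suc j)) = - w (real j * mesh e) \<and>
       matrices q \<mu> 1 (e, j) * x (node e j) + matrices q \<mu> 2 (e, j) * x (node e (Suc j)) = w (real (Suc j) * mesh e))" for e u w
  have "\<exists>u w. P e u w" if e: "e \<in> edges G" for e
  proof -
    have "Suc (n - 1) = n" "j \<le> n - 1 \<longleftrightarrow> j < n" for j using n by auto
    then show ?thesis using kernel_edge_solution[OF q \<mu> e ker, of "n - 1"] n unfolding P_def n_mesh[of e, symmetric] by simp
  qed
  then obtain u w where P: "\<And>e. e \<in> edges G \<Longrightarrow> P e (u e) (w e)" by metis
  have u: "\<And>e. e \<in> edges G \<Longrightarrow> solution (\<lambda>x. q (place G e x) - \<mu>) (len G e) (u e) (w e)"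
    "\<And>e j. e \<in> edges G \<Longrightarrow> j \<le> n \<Longrightarrow> u e (real j * mesh e) = x (node e j)"
    "\<And>e j. e \<in> edges G \<Longrightarrow> j < n \<Longrightarrow> matrices q \<mu> 0 (e, j) * x (node e j) + matrices q \<mu> 1 (e, j) * x (node e (Suc j)) = - w e (real j * mesh e)"
    "\<And>e j. e \<in> edges G \<Longrightarrow> j < n \<Longrightarrow> matrices q \<mu> 1 (e, j) * x (node e j) + matrices q \<mu> 2 (e, j) * x (node e (Suc j)) = w e (real (Suc j) * mesh e)"
    using P unfolding P_def by blast+
  \<comment> \<open>At a vertex U takes the nodal value. It agrees with the values of the edge
    solutions at their ends, so U is consistent on the glued space.\<close>
  define U where "U p = (case p of Vertex v \<Rightarrow> x (Vertex v) | Interior e y \<Rightarrow> u e y)" for p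
  have Upl: "U (place G e y) = u e y" if "e \<in> edges G" "y \<in> {0..len G e}" for e y
    using that u(2)[OF that(1), of 0] u(2)[OF that(1), of n] n_mesh[of e] node_0[of e] node_n[OF that(1)]
    by (auto simp: U_def place_def)
  have "real_eigenfunction G q \<mu> U w"
    unfolding real_eigenfunction_def
  proof (intro conjI ballI)
    show "solution (\<lambda>x. q (place G e x) - \<mu>) (len G e) (\<lambda>x. U (place G e x)) (w e)" if "e \<in> edges G" for e
      using u(1)[OF that] solution_cong[of "len G e" "\<lambda>x. U (place G e x)" "u e"] Upl[OF that] by blast
    fix v assume v: "v \<in> vertices G"
    then obtain e where "e \<in> edges G" "Vertex v = node e 0 \<or> Vertex v = node e n"
      using node_0 node_n by (auto simp: vertices_def)
    then have "Vertex v \<in> nodes" using node_in_nodes by auto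
    then have "flux (matrices q \<mu>) x (Vertex v) = 0" by (rule ker)
    moreover have "flux (matrices q \<mu>) x (Vertex v) = (\<Sum>e\<in>edges G. (if node e n = Vertex v then w e (real n * mesh e) else 0) - (if node e 0 = Vertex v then w e (real 0 * mesh e) else 0))"
      by (rule flux_telescope) (use u in auto)
    ultimately show "(\<Sum>e | e \<in> edges G \<and> tgt G e = v. w e (len G e)) + (\<Sum>e | e \<in> edges G \<and> src G e = v. - w e 0) = 0"
      unfolding Kirchhoff_sum by simp
  qed
  moreover have "U v = x v" if "v \<in> nodes" for v using that
  proof (cases rule: nodes_cases)
    case (2 e i)
    then have "U (place G e (real i * mesh e)) = x v"
      using Upl[of e "real i * mesh e"] mesh_mono[of e i] u(2)[of e i] by simp
    then show ?thesis using 2 by (simp add: node_def)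
  qed (simp add: U_def)
  ultimately show thesis using that by blast
qed

end

section \<open>Eigenspaces and kernels\<close>

lemma integrable_lebesgue_on_subinterval:
  fixes g :: "real \<Rightarrow> complex"
  assumes "integrable (lebesgue_on {0..L}) g" "x \<in> {0..L}"
  shows "integrable (lebesgue_on {0..x}) g"
proof -
  have "set_integrable lebesgue {0..L} g"
    using assms(1) by (simp add: set_integrable_def integrable_restrict_space)
  then have "set_integrable lebesgue {0..x} g"
    by (rule set_integrable_subset) (use assms in auto)
  then show ?thesis by (simp add: set_integrable_def integrable_restrict_space)
qed

text \<open>On a bounded interval |g| \<le> 1 + |g|^2 makes a square integrable g integrable, which
  allows the passage from the Lebesgue to the gauge integral.\<close>

lemma sobolev_has_integral:
  assumes "sobolev L f g" "x \<in> {0..L}"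
  shows "(g has_integral (f x - f 0)) {0..x}"
proof -
  have m: "g \<in> borel_measurable (lebesgue_on {0..L})" and i: "integrable (lebesgue_on {0..L}) (\<lambda>x. (cmod (g x))\<^sup>2)"
    and f: "f x = f 0 + (LINT t|lebesgue_on {0..x}. g t)" using assms unfolding sobolev_def by blast+
  have "finite_measure (lebesgue_on {0..L})" by (rule finite_measure_lebesgue_on) simp
  then have "integrable (lebesgue_on {0..L}) (\<lambda>x. 1 + (cmod (g x))\<^sup>2)"
    using i by (intro Bochner_Integration.integrable_add finite_measure.integrable_const)
  then have "integrable (lebesgue_on {0..L}) g"
  proof (rule Bochner_Integration.integrable_bound[OF _ m])
    have "cmod z \<le> 1 + (cmod z)\<^sup>2" for z
    proof -
      have "0 \<le> (1 - cmod z)\<^sup>2" by simp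
      then have "2 * cmod z \<le> 1 + (cmod z)\<^sup>2" by (simp add: power2_eq_square algebra_simps)
      then show ?thesis using norm_ge_zero[of z] by linarith
    qed
    then show "AE x in lebesgue_on {0..L}. norm (g x) \<le> norm (1 + (cmod (g x))\<^sup>2)"
      by (intro AE_I2) (simp add: order_trans[OF _ abs_ge_self])
  qed
  then have "integrable (lebesgue_on {0..x}) g" by (rule integrable_lebesgue_on_subinterval) (use assms in auto)
  then have "(g has_integral (LINT t|lebesgue_on {0..x}. g t)) {0..x}"
    by (rule has_integral_integral_lebesgue_on) simp
  then show ?thesis using f by simp
qed

lemma has_integral_complexI:
  assumes "((\<lambda>x. Re (g x)) has_integral a) S" "((\<lambda>x. Im (g x)) has_integral b) S"
  shows "(g has_integral Complex a b) S"
proof -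
  have "((of_real \<circ> (\<lambda>x. Re (g x))) has_integral complex_of_real a) S"
    by (rule has_integral_linear[OF assms(1) bounded_linear_of_real])
  moreover have "bounded_linear (\<lambda>x. \<i> * complex_of_real x)"
    by (intro bounded_linear_mult_right[THEN bounded_linear_compose] bounded_linear_of_real)
  then have "(((\<lambda>x. \<i> * complex_of_real x) \<circ> (\<lambda>x. Im (g x))) has_integral \<i> * complex_of_real b) S"
    by (rule has_integral_linear[OF assms(2)])
  ultimately have "((\<lambda>x. complex_of_real (Re (g x)) + \<i> * complex_of_real (Im (g x))) has_integral complex_of_real a + \<i> * complex_of_real b) S"
    unfolding o_def by (rule has_integral_add)
  then show ?thesis by (simp add: complex_eq[symmetric] Complex_eq)
qed

text \<open>A bounded measurable derivative is square integrable, so the solutions of the integrated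
  equation meet the requirements of the Sobolev space.\<close>

lemma sobolev_primitive:
  assumes re: "primitive L (\<lambda>x. Re (f x)) (\<lambda>x. Re (g x))" and im: "primitive L (\<lambda>x. Im (f x)) (\<lambda>x. Im (g x))"
    and C: "\<And>x. x \<in> {0..L} \<Longrightarrow> \<bar>Re (g x)\<bar> \<le> C" "\<And>x. x \<in> {0..L} \<Longrightarrow> \<bar>Im (g x)\<bar> \<le> C" and L: "0 \<le> L"
  shows "sobolev L f g"
proof -
  have mr: "(\<lambda>x. Re (g x)) \<in> borel_measurable (lebesgue_on {0..L})" and mi: "(\<lambda>x. Im (g x)) \<in> borel_measurable (lebesgue_on {0..L})"
    by (intro integrable_imp_measurable primitive_integrable[OF re] primitive_integrable[OF im]; simp)+
  then have m: "g \<in> borel_measurable (lebesgue_on {0..L})" by (subst borel_measurable_complex_iff) auto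
  have C0: "cmod (g x) \<le> 2 * C" if "x \<in> {0..L}" for x
    using cmod_le[of "g x"] C[OF that] by linarith
  have fin: "finite_measure (lebesgue_on {0..L})" by (rule finite_measure_lebesgue_on) simp
  have bnd: "integrable (lebesgue_on {0..L}) (k :: real \<Rightarrow> 'a :: euclidean_space)"
    if "k \<in> borel_measurable (lebesgue_on {0..L})" "\<And>x. x \<in> {0..L} \<Longrightarrow> norm (k x) \<le> D" for k D
    by (rule measurable_bounded_by_integrable_imp_lebesgue_integrable[OF that(1) finite_measure.integrable_const[OF fin] that(2)]) auto
  have "integrable (lebesgue_on {0..L}) (\<lambda>x. (cmod (g x))\<^sup>2)"
  proof (rule bnd)
    show "norm ((cmod (g x))\<^sup>2) \<le> (2 * C)\<^sup>2" if "x \<in> {0..L}" for x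
      using power_mono[OF C0[OF that], of 2] by simp
  qed (use m in measurable)
  moreover have gi: "integrable (lebesgue_on {0..L}) g" by (rule bnd[OF m C0])
  moreover have "f x = f 0 + (LINT t|lebesgue_on {0..x}. g t)" if x: "x \<in> {0..L}" for x
  proof -
    have "(g has_integral Complex (Re (f x) - Re (f 0)) (Im (f x) - Im (f 0))) {0..x}"
      using re im x by (intro has_integral_complexI) (auto simp: primitive_def)
    moreover have "Complex (Re (f x) - Re (f 0)) (Im (f x) - Im (f 0)) = f x - f 0" by (simp add: complex_eq_iff)
    ultimately have "integral {0..x} g = f x - f 0" by (simp add: integral_unique)
    moreover have "(LINT t|lebesgue_on {0..x}. g t) = integral {0..x} g"
      by (rule lebesgue_integral_eq_integral[OF integrable_lebesgue_on_subinterval[OF gi x]]) simp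
    ultimately show ?thesis by simp
  qed
  ultimately show ?thesis using m unfolding sobolev_def by blast
qed

lemma Re_sobolev:
  assumes "sobolev L f g"
  shows "primitive L (\<lambda>x. Re (f x)) (\<lambda>x. Re (g x))"
  unfolding primitive_def
proof
  fix x assume "x \<in> {0..L}"
  from has_integral_Re[OF sobolev_has_integral[OF assms this]]
  show "((\<lambda>x. Re (g x)) has_integral Re (f x) - Re (f 0)) {0..x}" by simp
qed

lemma Im_sobolev:
  assumes "sobolev L f g"
  shows "primitive L (\<lambda>x. Im (f x)) (\<lambda>x. Im (g x))"
  unfolding primitive_def
proof
  fix x assume "x \<in> {0..L}"
  from has_integral_Im[OF sobolev_has_integral[OF assms this]]
  show "((\<lambda>x. Im (g x)) has_integral Im (f x) - Im (f 0)) {0..x}" by simp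
qed

text \<open>The operator equation is an identity almost everywhere; integration absorbs the
  exceptional set and leads to the integrated form.\<close>

lemma primitive_AE_cong:
  assumes "primitive L f g" "AE x in lebesgue_on {0..L}. g x = g' x"
  shows "primitive L f g'"
  unfolding primitive_def
proof
  fix x assume x: "x \<in> {0..L}"
  have "AE x in lebesgue. x \<in> {0..L} \<longrightarrow> g x = g' x"
    using assms(2) by (subst (asm) AE_restrict_space_iff) auto
  then have neg: "negligible {x. \<not> (x \<in> {0..L} \<longrightarrow> g x = g' x)}"
    by (simp add: completion.AE_iff_null_sets negligible_iff_null_sets)
  have "(g has_integral f x - f 0) {0..x}" using assms(1) x by (auto simp: primitive_def)
  then show "(g' has_integral f x - f 0) {0..x}"
    by (rule has_integral_spike[OF neg, rotated]) (use x in auto)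
qed

section \<open>Multiplicities of complex eigenspaces\<close>

context fine_graph
begin

text \<open>Since q and \<mu> are real, the equation and the vertex conditions separate into real
  and imaginary parts. Conversely, (q - \<mu>) u serves as the second derivative.\<close>

lemma eigenspace_real:
  assumes q: "q \<in> bounded_potentials G M" and \<mu>: "\<bar>\<mu>\<bar> + M \<le> K"
  shows "u \<in> eigenspace G q \<mu> \<longleftrightarrow> (\<forall>p. p \<notin> points G \<longrightarrow> u p = 0) \<and>
    (\<exists>W. real_eigenfunction G q \<mu> (\<lambda>p. Re (u p)) W) \<and> (\<exists>W. real_eigenfunction G q \<mu> (\<lambda>p. Im (u p)) W)"
proof (intro iffI conjI)
  assume "u \<in> eigenspace G q \<mu>"
  then have off: "\<forall>p. p \<notin> points G \<longrightarrow> u p = 0" and "schroedinger G q u (fun_scale (of_real \<mu>) u)"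
    by (auto simp: eigenspace_def)
  then obtain u1 u2 where u1: "\<And>e. e \<in> edges G \<Longrightarrow> sobolev (len G e) (\<lambda>x. u (place G e x)) (u1 e)"
    "\<And>e. e \<in> edges G \<Longrightarrow> sobolev (len G e) (u1 e) (u2 e)"
    and kir: "\<And>v. v \<in> vertices G \<Longrightarrow> (\<Sum>e | e \<in> edges G \<and> tgt G e = v. u1 e (len G e)) + (\<Sum>e | e \<in> edges G \<and> src G e = v. - u1 e 0) = 0"
    and ae: "\<And>e. e \<in> edges G \<Longrightarrow> AE x in lebesgue_on {0..len G e}. fun_scale (of_real \<mu>) u (place G e x) = - u2 e x + of_real (q (place G e x)) * u (place G e x)"
    unfolding schroedinger_def by blast
  show "\<forall>p. p \<notin> points G \<longrightarrow> u p = 0" by (rule off)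
  have ae': "AE x in lebesgue_on {0..len G e}. u2 e x = of_real (q (place G e x) - \<mu>) * u (place G e x)" if "e \<in> edges G" for e
    using ae[OF that] by eventually_elim (simp add: fun_scale_def algebra_simps)
  have "real_eigenfunction G q \<mu> (\<lambda>p. Re (u p)) (\<lambda>e x. Re (u1 e x))"
    unfolding real_eigenfunction_def solution_def
  proof (intro conjI ballI)
    fix e assume e: "e \<in> edges G"
    show "primitive (len G e) (\<lambda>x. Re (u (place G e x))) (\<lambda>x. Re (u1 e x))" by (rule Re_sobolev[OF u1(1)[OF e]])
    show "primitive (len G e) (\<lambda>x. Re (u1 e x)) (\<lambda>t. (q (place G e t) - \<mu>) * Re (u (place G e t)))"
    proof (rule primitive_AE_cong[OF Re_sobolev[OF u1(2)[OF e]]])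
      show "AE x in lebesgue_on {0..len G e}. Re (u2 e x) = (q (place G e x) - \<mu>) * Re (u (place G e x))"
        using ae'[OF e] by eventually_elim simp
    qed
  next
    fix v assume "v \<in> vertices G"
    from arg_cong[OF kir[OF this], of Re]
    show "(\<Sum>e | e \<in> edges G \<and> tgt G e = v. Re (u1 e (len G e))) + (\<Sum>e | e \<in> edges G \<and> src G e = v. - Re (u1 e 0)) = 0"
      by simp
  qed
  then show "\<exists>W. real_eigenfunction G q \<mu> (\<lambda>p. Re (u p)) W" by blast
  have "real_eigenfunction G q \<mu> (\<lambda>p. Im (u p)) (\<lambda>e x. Im (u1 e x))"
    unfolding real_eigenfunction_def solution_def
  proof (intro conjI ballI)
    fix e assume e: "e \<in> edges G"
    show "primitive (len G e) (\<lambda>x. Im (u (place G e x))) (\<lambda>x. Im (u1 e x))" by (rule Im_sobolev[OF u1(1)[OF e]])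
    show "primitive (len G e) (\<lambda>x. Im (u1 e x)) (\<lambda>t. (q (place G e t) - \<mu>) * Im (u (place G e t)))"
    proof (rule primitive_AE_cong[OF Im_sobolev[OF u1(2)[OF e]]])
      show "AE x in lebesgue_on {0..len G e}. Im (u2 e x) = (q (place G e x) - \<mu>) * Im (u (place G e x))"
        using ae'[OF e] by eventually_elim simp
    qed
  next
    fix v assume "v \<in> vertices G"
    from arg_cong[OF kir[OF this], of Im]
    show "(\<Sum>e | e \<in> edges G \<and> tgt G e = v. Im (u1 e (len G e))) + (\<Sum>e | e \<in> edges G \<and> src G e = v. - Im (u1 e 0)) = 0"
      by simp
  qed
  then show "\<exists>W. real_eigenfunction G q \<mu> (\<lambda>p. Im (u p)) W" by blast
next
  assume "(\<forall>p. p \<notin> points G \<longrightarrow> u p = 0) \<and>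
    (\<exists>W. real_eigenfunction G q \<mu> (\<lambda>p. Re (u p)) W) \<and> (\<exists>W. real_eigenfunction G q \<mu> (\<lambda>p. Im (u p)) W)"
  then obtain W1 W2 where off: "\<forall>p. p \<notin> points G \<longrightarrow> u p = 0"
    and W1: "real_eigenfunction G q \<mu> (\<lambda>p. Re (u p)) W1" and W2: "real_eigenfunction G q \<mu> (\<lambda>p. Im (u p)) W2" by blast
  have "schroedinger G q u (fun_scale (of_real \<mu>) u)"
    unfolding schroedinger_def
  proof (intro exI conjI ballI)
    fix e assume e: "e \<in> edges G"
    let ?V = "\<lambda>x. q (place G e x) - \<mu>"
    have s1: "solution ?V (len G e) (\<lambda>x. Re (u (place G e x))) (W1 e)" and s2: "solution ?V (len G e) (\<lambda>x. Im (u (place G e x))) (W2 e)"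
      using W1 W2 e by (auto simp: real_eigenfunction_def)
    have pot: "potential (len G e) K ?V" by (rule edge_potential[OF q \<mu> e])
    obtain C1 where C1: "\<And>t. t \<in> {0..len G e} \<Longrightarrow> \<bar>Re (u (place G e t))\<bar> \<le> C1" "\<And>t. t \<in> {0..len G e} \<Longrightarrow> \<bar>W1 e t\<bar> \<le> C1"
      "\<And>t. t \<in> {0..len G e} \<Longrightarrow> \<bar>?V t * Re (u (place G e t))\<bar> \<le> C1" using solution_bounds[OF s1 pot] by blast
    obtain C2 where C2: "\<And>t. t \<in> {0..len G e} \<Longrightarrow> \<bar>Im (u (place G e t))\<bar> \<le> C2" "\<And>t. t \<in> {0..len G e} \<Longrightarrow> \<bar>W2 e t\<bar> \<le> C2"
      "\<And>t. t \<in> {0..len G e} \<Longrightarrow> \<bar>?V t * Im (u (place G e t))\<bar> \<le> C2" using solution_bounds[OF s2 pot] by blast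
    show "sobolev (len G e) (\<lambda>x. u (place G e x)) ((\<lambda>e x. Complex (W1 e x) (W2 e x)) e)"
      by (rule sobolev_primitive[where C = "max C1 C2"])
        (use s1 s2 C1 C2 len_pos[OF e] in \<open>auto simp: solution_def le_max_iff_disj\<close>)
    show "sobolev (len G e) ((\<lambda>e x. Complex (W1 e x) (W2 e x)) e) ((\<lambda>e x. of_real (q (place G e x) - \<mu>) * u (place G e x)) e)"
      by (rule sobolev_primitive[where C = "max C1 C2"])
        (use s1 s2 C1 C2 len_pos[OF e] in \<open>auto simp: solution_def le_max_iff_disj\<close>)
    show "AE x in lebesgue_on {0..len G e}. fun_scale (of_real \<mu>) u (place G e x) =
       - (\<lambda>e x. of_real (q (place G e x) - \<mu>) * u (place G e x)) e x + of_real (q (place G e x)) * u (place G e x)"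
      by (intro AE_I2) (simp add: fun_scale_def algebra_simps)
  next
    fix v assume "v \<in> vertices G"
    then show "(\<Sum>e | e \<in> edges G \<and> tgt G e = v. (\<lambda>e x. Complex (W1 e x) (W2 e x)) e (len G e)) +
      (\<Sum>e | e \<in> edges G \<and> src G e = v. - (\<lambda>e x. Complex (W1 e x) (W2 e x)) e 0) = 0"
      using W1 W2 unfolding complex_eq_iff by (simp add: real_eigenfunction_def)
  qed
  then show "u \<in> eigenspace G q \<mu>" using off by (simp add: eigenspace_def)
qed

lemma eigenspace_subspace:
  assumes q: "q \<in> bounded_potentials G M" and \<mu>: "\<bar>\<mu>\<bar> + M \<le> K"
  shows "cfun.subspace (eigenspace G q \<mu>)"
proof -
  have lin: "(\<exists>W. real_eigenfunction G q \<mu> (\<lambda>p. a * U p + b * U' p) W)"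
    if "\<exists>W. real_eigenfunction G q \<mu> U W" "\<exists>W. real_eigenfunction G q \<mu> U' W" for a b U U'
    using that real_eigenfunction_linear by blast
  have zero: "\<exists>W. real_eigenfunction G q \<mu> (\<lambda>p. 0) W"
    by (rule exI[of _ "\<lambda>e x. 0"]) (simp add: real_eigenfunction_def solution_def primitive_def)
  show ?thesis
    unfolding cfun.subspace_def
  proof (intro conjI ballI allI)
    show "0 \<in> eigenspace G q \<mu>" unfolding eigenspace_real[OF q \<mu>] using zero by simp
    fix x y c assume x: "x \<in> eigenspace G q \<mu>" and y: "y \<in> eigenspace G q \<mu>"
    show "x + y \<in> eigenspace G q \<mu>"
      using x y lin[of "\<lambda>p. Re (x p)" "\<lambda>p. Re (y p)" 1 1] lin[of "\<lambda>p. Im (x p)" "\<lambda>p. Im (y p)" 1 1]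
      unfolding eigenspace_real[OF q \<mu>] by simp
  next
    fix x c assume x: "x \<in> eigenspace G q \<mu>"
    show "fun_scale c x \<in> eigenspace G q \<mu>"
      using x lin[of "\<lambda>p. Re (x p)" "\<lambda>p. Im (x p)" "Re c" "- Im c"] lin[of "\<lambda>p. Im (x p)" "\<lambda>p. Re (x p)" "Re c" "Im c"]
      unfolding eigenspace_real[OF q \<mu>] by (simp add: fun_scale_def add.commute)
  qed
qed

lemma eigenspace_zero:
  assumes q: "q \<in> bounded_potentials G M" and \<mu>: "\<bar>\<mu>\<bar> + M \<le> K" and u: "u \<in> eigenspace G q \<mu>"
    and z: "\<And>v. v \<in> nodes \<Longrightarrow> u v = 0"
  shows "u = 0"
proof
  fix p
  show "u p = 0 p"
  proof (cases "p \<in> points G")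
    case True
    obtain W1 W2 where W: "real_eigenfunction G q \<mu> (\<lambda>p. Re (u p)) W1" "real_eigenfunction G q \<mu> (\<lambda>p. Im (u p)) W2"
      using u unfolding eigenspace_real[OF q \<mu>] by blast
    have "Re (u p) = 0" "Im (u p) = 0"
      using eigenfunction_zero[OF q \<mu> W(1) _ True] eigenfunction_zero[OF q \<mu> W(2) _ True] z by simp_all
    then show ?thesis by (simp add: complex_eq_iff)
  qed (use u in \<open>simp add: eigenspace_def\<close>)
qed

text \<open>\<open>cfun.dim\<close> is the cardinality of a basis and would be 0 for an infinite
  one, so finiteness has to be established. Restriction to the nodes is linear and injective on the
  eigenspace, and its image lies in the span of finitely many point masses.\<close>

lemma eigenspace_basis:
  assumes q: "q \<in> bounded_potentials G M" and \<mu>: "\<bar>\<mu>\<bar> + M \<le> K"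
  obtains B where "B \<subseteq> eigenspace G q \<mu>" "cfun.independent B" "eigenspace G q \<mu> \<subseteq> cfun.span B" "finite B"
    "card B = multiplicity G q \<mu>"
proof -
  obtain B where B: "B \<subseteq> eigenspace G q \<mu>" "cfun.independent B" "eigenspace G q \<mu> \<subseteq> cfun.span B" "card B = cfun.dim (eigenspace G q \<mu>)"
    by (rule cfun.basis_exists)
  have span: "cfun.span B \<subseteq> eigenspace G q \<mu>"
    by (rule cfun.span_minimal[OF B(1) eigenspace_subspace[OF q \<mu>]])
  interpret vector_space_pair "fun_scale :: complex \<Rightarrow> (('a, 'b) point \<Rightarrow> complex) \<Rightarrow> ('a, 'b) point \<Rightarrow> complex"
    "fun_scale :: complex \<Rightarrow> (('a, 'b) point \<Rightarrow> complex) \<Rightarrow> ('a, 'b) point \<Rightarrow> complex" ..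
  define R :: "(('a, 'b) point \<Rightarrow> complex) \<Rightarrow> ('a, 'b) point \<Rightarrow> complex" where "R u = (\<lambda>p. if p \<in> nodes then u p else 0)" for u
  have R: "Vector_Spaces.linear fun_scale fun_scale R"
    by unfold_locales (auto simp: R_def fun_scale_def fun_eq_iff)
  have inj: "inj_on R (cfun.span B)"
  proof (rule inj_onI)
    fix x y assume xy: "x \<in> cfun.span B" "y \<in> cfun.span B" "R x = R y"
    have "x - y \<in> eigenspace G q \<mu>" using cfun.span_diff[OF xy(1,2)] span by blast
    moreover have "(x - y) v = 0" if "v \<in> nodes" for v using fun_cong[OF xy(3), of v] that by (simp add: R_def)
    ultimately have "x - y = 0" by (rule eigenspace_zero[OF q \<mu>])
    then show "x = y" by simp
  qed
  have ind: "cfun.independent (R ` B)" by (rule linear_independent_injective_image[OF R B(2) inj])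
  define \<delta> :: "('a, 'b) point \<Rightarrow> ('a, 'b) point \<Rightarrow> complex" where "\<delta> v = (\<lambda>p. if p = v then 1 else 0)" for v
  have sum_fun: "(\<Sum>v\<in>S. F v) p = (\<Sum>v\<in>S. F v p)" for S p and F :: "('a, 'b) point \<Rightarrow> ('a, 'b) point \<Rightarrow> complex"
    by (induction S rule: infinite_finite_induct) auto
  have "R u \<in> cfun.span (\<delta> ` nodes)" for u
  proof -
    have "R u = (\<Sum>v\<in>nodes. fun_scale (u v) (\<delta> v))"
    proof
      fix p
      have "(\<Sum>v\<in>nodes. fun_scale (u v) (\<delta> v)) p = (\<Sum>v\<in>nodes. if v = p then u v else 0)"
        by (simp add: sum_fun fun_scale_def \<delta>_def if_distrib eq_commute cong: if_cong)
      also have "\<dots> = R u p" using finite_N by (simp add: R_def)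
      finally show "R u p = (\<Sum>v\<in>nodes. fun_scale (u v) (\<delta> v)) p" by simp
    qed
    then show ?thesis by (simp add: cfun.span_sum cfun.span_scale cfun.span_base)
  qed
  then have "R ` B \<subseteq> cfun.span (\<delta> ` nodes)" by blast
  then have "finite (R ` B)" using cfun.independent_span_bound[OF finite_imageI[OF finite_N] ind] by blast
  then have "finite B" using inj_on_subset[OF inj cfun.span_superset] by (simp add: finite_image_iff)
  then show thesis using that B by (simp add: multiplicity_def)
qed

lemma of_real_eigenfunction:
  assumes q: "q \<in> bounded_potentials G M" and \<mu>: "\<bar>\<mu>\<bar> + M \<le> K"
    and ker: "\<And>v. v \<in> nodes \<Longrightarrow> flux (matrices q \<mu>) x v = 0"
  obtains u where "u \<in> eigenspace G q \<mu>" "\<And>v. v \<in> nodes \<Longrightarrow> u v = of_real (x v)"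
proof -
  obtain U W where U: "real_eigenfunction G q \<mu> U W" "\<And>v. v \<in> nodes \<Longrightarrow> U v = x v"
    using kernel_eigenfunction[OF q \<mu> ker] by blast
  define u where "u p = (if p \<in> points G then complex_of_real (U p) else 0)" for p
  have eq: "U (place G e y) = Re (u (place G e y))" "0 = Im (u (place G e y))" if "e \<in> edges G" "y \<in> {0..len G e}" for e y
    using place_in_points[OF that] by (simp_all add: u_def)
  have "real_eigenfunction G q \<mu> (\<lambda>p. Re (u p)) W"
    using U(1) solution_cong[of "len G e" "\<lambda>x. U (place G e x)" "\<lambda>x. Re (u (place G e x))" for e] eq(1)
    unfolding real_eigenfunction_def by blast
  moreover have "solution (\<lambda>x. q (place G e x) - \<mu>) (len G e) (\<lambda>x. Im (u (place G e x))) (\<lambda>x. 0)" if "e \<in> edges G" for e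
  proof -
    have "solution (\<lambda>x. q (place G e x) - \<mu>) (len G e) (\<lambda>x. 0) (\<lambda>x. 0)" by (simp add: solution_def primitive_def)
    then show ?thesis using solution_cong[of "len G e" "\<lambda>x. 0" "\<lambda>x. Im (u (place G e x))"] eq(2)[OF that] by blast
  qed
  then have "real_eigenfunction G q \<mu> (\<lambda>p. Im (u p)) (\<lambda>e x. 0)" by (simp add: real_eigenfunction_def)
  ultimately have "u \<in> eigenspace G q \<mu>" unfolding eigenspace_real[OF q \<mu>] by (auto simp: u_def)
  moreover have "u v = of_real (x v)" if "v \<in> nodes" for v using that nodes_points U(2) by (auto simp: u_def)
  ultimately show thesis using that by blast
qed

text \<open>A nonzero eigenfunction is nonzero at some node, so its real or its imaginary part gives
  a real kernel vector. Conversely, a kernel vector extends to an eigenfunction.\<close>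

lemma multiplicity_ge_1:
  assumes q: "q \<in> bounded_potentials G M" and \<mu>: "\<bar>\<mu>\<bar> + M \<le> K"
  shows "1 \<le> multiplicity G q \<mu> \<longleftrightarrow> kernel1 (matrices q \<mu>)"
proof
  obtain B where B: "B \<subseteq> eigenspace G q \<mu>" "cfun.independent B" "eigenspace G q \<mu> \<subseteq> cfun.span B" "finite B"
    "card B = multiplicity G q \<mu>" using eigenspace_basis[OF q \<mu>] .
  assume "1 \<le> multiplicity G q \<mu>"
  then obtain b where b: "b \<in> B" using B(5) by fastforce
  then have "b \<noteq> 0" using B(2) cfun.dependent_zero by blast
  then obtain v where v: "v \<in> nodes" "b v \<noteq> 0" using eigenspace_zero[OF q \<mu>] b B(1) by blast
  obtain W1 W2 where W: "real_eigenfunction G q \<mu> (\<lambda>p. Re (b p)) W1" "real_eigenfunction G q \<mu> (\<lambda>p. Im (b p)) W2"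
    using b B(1) eigenspace_real[OF q \<mu>] by blast
  show "kernel1 (matrices q \<mu>)"
  proof (cases "Re (b v) = 0")
    case True
    then have "Im (b v) \<noteq> 0" using v by (simp add: complex_eq_iff)
    then show ?thesis unfolding kernel1_def using v eigenfunction_kernel[OF q \<mu> W(2)] by (intro exI[of _ "\<lambda>p. Im (b p)"]) blast
  next
    case False
    then show ?thesis unfolding kernel1_def using v eigenfunction_kernel[OF q \<mu> W(1)] by (intro exI[of _ "\<lambda>p. Re (b p)"]) blast
  qed
next
  obtain B where B: "B \<subseteq> eigenspace G q \<mu>" "cfun.independent B" "eigenspace G q \<mu> \<subseteq> cfun.span B" "finite B"
    "card B = multiplicity G q \<mu>" using eigenspace_basis[OF q \<mu>] .
  assume "kernel1 (matrices q \<mu>)"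
  then obtain x v where x: "v \<in> nodes" "x v \<noteq> 0" "\<And>v. v \<in> nodes \<Longrightarrow> flux (matrices q \<mu>) x v = 0"
    unfolding kernel1_def by blast
  obtain u where u: "u \<in> eigenspace G q \<mu>" "\<And>v. v \<in> nodes \<Longrightarrow> u v = of_real (x v)" using of_real_eigenfunction[OF q \<mu> x(3)] by blast
  have "B \<noteq> {}"
  proof
    assume "B = {}"
    then have "u = 0" using u(1) B(3) by auto
    then show False using u(2)[OF x(1)] x(2) by simp
  qed
  then show "1 \<le> multiplicity G q \<mu>" using B(4,5) by (metis One_nat_def Suc_leI card_gt_0_iff)
qed

text \<open>A comparison of complex and real dimension. If all real kernel vectors were multiples of
  one vector r, then all eigenfunctions would be complex multiples of r at the nodes. Conversely,
  vectors that are independent over the reals stay independent over the complex numbers.\<close>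

lemma multiplicity_ge_2:
  assumes q: "q \<in> bounded_potentials G M" and \<mu>: "\<bar>\<mu>\<bar> + M \<le> K"
  shows "2 \<le> multiplicity G q \<mu> \<longleftrightarrow> kernel2 (matrices q \<mu>)"
proof
  obtain B where B: "B \<subseteq> eigenspace G q \<mu>" "cfun.independent B" "eigenspace G q \<mu> \<subseteq> cfun.span B" "finite B"
    "card B = multiplicity G q \<mu>" using eigenspace_basis[OF q \<mu>] .
  assume "2 \<le> multiplicity G q \<mu>"
  then have "2 \<le> card B" using B(5) by simp
  then obtain z1 z2 where z: "z1 \<in> B" "z2 \<in> B" "z1 \<noteq> z2" by (meson card_2_iff' card_le_Suc_iff ex_card insert_subset numeral_2_eq_2 subset_iff)
  show "kernel2 (matrices q \<mu>)"
  proof (rule ccontr)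
    assume no: "\<not> kernel2 (matrices q \<mu>)"
    have par: "\<exists>c. \<forall>v\<in>nodes. y v = c * x v"
      if nz: "\<exists>v\<in>nodes. x v \<noteq> 0" and ker: "\<forall>v\<in>nodes. flux (matrices q \<mu>) x v = 0" "\<forall>v\<in>nodes. flux (matrices q \<mu>) y v = 0" for x y
    proof -
      obtain \<alpha> \<beta> where ab: "\<forall>v\<in>nodes. comb \<alpha> x \<beta> y v = 0" "\<not> (\<alpha> = 0 \<and> \<beta> = 0)"
      proof -
        have "\<not> (\<forall>\<alpha> \<beta>. (\<forall>v\<in>nodes. comb \<alpha> x \<beta> y v = 0) \<longrightarrow> \<alpha> = 0 \<and> \<beta> = 0)"
        proof
          assume all: "\<forall>\<alpha> \<beta>. (\<forall>v\<in>nodes. comb \<alpha> x \<beta> y v = 0) \<longrightarrow> \<alpha> = 0 \<and> \<beta> = 0"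
          have "kernel2 (matrices q \<mu>)"
            unfolding kernel2_def by (rule exI[of _ x], rule exI[of _ y], intro conjI all ker)
          then show False using no by simp
        qed
        then show thesis using that by blast
      qed
      have "\<beta> \<noteq> 0"
      proof
        assume "\<beta> = 0"
        then have "\<forall>v\<in>nodes. \<alpha> * x v = 0" using ab(1) by (simp add: comb_def)
        then show False using ab(2) \<open>\<beta> = 0\<close> nz by auto
      qed
      have "y v = (- \<alpha> / \<beta>) * x v" if "v \<in> nodes" for v
      proof -
        have "\<alpha> * x v + \<beta> * y v = 0" using ab(1) that by (simp add: comb_def)
        then show ?thesis using \<open>\<beta> \<noteq> 0\<close> by (simp add: field_simps eq_neg_iff_add_eq_0)
      qed
      then show ?thesis by blast
    qed
    have fl: "\<forall>v\<in>nodes. flux (matrices q \<mu>) (\<lambda>p. Re (z p)) v = 0" "\<forall>v\<in>nodes. flux (matrices q \<mu>) (\<lambda>p. Im (z p)) v = 0"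
      if zB: "z \<in> B" for z
    proof -
      obtain W1 W2 where W: "real_eigenfunction G q \<mu> (\<lambda>p. Re (z p)) W1" "real_eigenfunction G q \<mu> (\<lambda>p. Im (z p)) W2"
        using zB B(1) eigenspace_real[OF q \<mu>] by blast
      show "\<forall>v\<in>nodes. flux (matrices q \<mu>) (\<lambda>p. Re (z p)) v = 0" "\<forall>v\<in>nodes. flux (matrices q \<mu>) (\<lambda>p. Im (z p)) v = 0"
        using eigenfunction_kernel[OF q \<mu> W(1)] eigenfunction_kernel[OF q \<mu> W(2)] by blast+
    qed
    have "z1 \<noteq> 0" using z(1) B(2) cfun.dependent_zero by blast
    then obtain v where v: "v \<in> nodes" "z1 v \<noteq> 0" using eigenspace_zero[OF q \<mu>] z(1) B(1) by blast
    obtain r where r: "\<exists>v\<in>nodes. r v \<noteq> 0" "\<forall>v\<in>nodes. flux (matrices q \<mu>) r v = 0"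
    proof (cases "Re (z1 v) = 0")
      case True
      then have "Im (z1 v) \<noteq> 0" using v by (simp add: complex_eq_iff)
      then show ?thesis using that[of "\<lambda>p. Im (z1 p)"] fl(2)[OF z(1)] v by blast
    next
      case False
      then show ?thesis using that[of "\<lambda>p. Re (z1 p)"] fl(1)[OF z(1)] v by blast
    qed
    have mult: "\<exists>c. \<forall>v\<in>nodes. z v = c * of_real (r v)" if zB: "z \<in> B" for z
    proof -
      obtain c d where "\<forall>v\<in>nodes. Re (z v) = c * r v" "\<forall>v\<in>nodes. Im (z v) = d * r v"
        using par[OF r fl(1)[OF zB]] par[OF r fl(2)[OF zB]] by blast
      then have "\<forall>v\<in>nodes. z v = Complex c d * of_real (r v)" by (simp add: complex_eq_iff)
      then show ?thesis by blast
    qed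
    obtain c1 where c1: "\<forall>v\<in>nodes. z1 v = c1 * of_real (r v)" using mult[OF z(1)] by blast
    obtain c2 where c2: "\<forall>v\<in>nodes. z2 v = c2 * of_real (r v)" using mult[OF z(2)] by blast
    have c10: "c1 \<noteq> 0" using c1 v by auto
    have "fun_scale (c2 / c1) z1 - z2 = 0"
    proof (rule eigenspace_zero[OF q \<mu>])
      show "fun_scale (c2 / c1) z1 - z2 \<in> eigenspace G q \<mu>"
        using z B(1) by (intro cfun.subspace_diff cfun.subspace_scale eigenspace_subspace[OF q \<mu>]) auto
      show "(fun_scale (c2 / c1) z1 - z2) v = 0" if "v \<in> nodes" for v
        using c1 c2 c10 that by (simp add: fun_scale_def)
    qed
    then have "z2 = fun_scale (c2 / c1) z1" by simp
    then have "z2 \<in> cfun.span (B - {z2})" using z by (simp add: cfun.span_scale cfun.span_base)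
    then show False using B(2) z(2) cfun.dependent_def by blast
  qed
next
  obtain B where B: "B \<subseteq> eigenspace G q \<mu>" "cfun.independent B" "eigenspace G q \<mu> \<subseteq> cfun.span B" "finite B"
    "card B = multiplicity G q \<mu>" using eigenspace_basis[OF q \<mu>] .
  assume "kernel2 (matrices q \<mu>)"
  then obtain x y where xy: "\<And>\<alpha> \<beta>. \<forall>v\<in>nodes. comb \<alpha> x \<beta> y v = 0 \<Longrightarrow> \<alpha> = 0 \<and> \<beta> = 0"
    "\<And>v. v \<in> nodes \<Longrightarrow> flux (matrices q \<mu>) x v = 0" "\<And>v. v \<in> nodes \<Longrightarrow> flux (matrices q \<mu>) y v = 0"
    unfolding kernel2_def by blast
  obtain u where u: "u \<in> eigenspace G q \<mu>" "\<And>v. v \<in> nodes \<Longrightarrow> u v = of_real (x v)" using of_real_eigenfunction[OF q \<mu> xy(2)] by blast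
  obtain w where w: "w \<in> eigenspace G q \<mu>" "\<And>v. v \<in> nodes \<Longrightarrow> w v = of_real (y v)" using of_real_eigenfunction[OF q \<mu> xy(3)] by blast
  have indep: "a = 0 \<and> b = 0" if "\<forall>v\<in>nodes. a * u v + b * w v = 0" for a b :: complex
  proof -
    have "comb (Re a) x (Re b) y v = 0" "comb (Im a) x (Im b) y v = 0" if v: "v \<in> nodes" for v
    proof -
      have "a * of_real (x v) + b * of_real (y v) = 0" using \<open>\<forall>v\<in>nodes. a * u v + b * w v = 0\<close> u(2)[OF v] w(2)[OF v] v by force
      then show "comb (Re a) x (Re b) y v = 0" "comb (Im a) x (Im b) y v = 0" by (simp_all add: comb_def complex_eq_iff)
    qed
    then show ?thesis using xy(1)[of "Re a" "Re b"] xy(1)[of "Im a" "Im b"] by (simp add: complex_eq_iff)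
  qed
  have ne: "u \<noteq> w" using indep[of 1 "-1"] by force
  have u0: "u \<noteq> 0" using indep[of 1 0] by auto
  have "w \<notin> cfun.span {u}"
  proof
    assume "w \<in> cfun.span {u}"
    then obtain k where "w = fun_scale k u" unfolding cfun.span_singleton by blast
    then have "\<forall>v\<in>nodes. k * u v + (-1) * w v = 0" by (simp add: fun_scale_def)
    from indep[OF this] show False by simp
  qed
  then have "cfun.independent {w, u}"
    using u0 by (intro cfun.independent_insertI) (simp_all add: cfun.dependent_single cfun.independent_empty)
  moreover have "{w, u} \<subseteq> cfun.span B" using u(1) w(1) B(3) by blast
  ultimately have "card {w, u} \<le> card B" using cfun.independent_span_bound[OF B(4)] by blast
  then show "2 \<le> multiplicity G q \<mu>" using ne B(5) by (simp add: eq_commute)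
qed

end

section \<open>Weak compactness\<close>

text \<open>Weak convergence tested against the indicator functions of the intervals [0,x]. For
  uniformly bounded potentials this yields convergence against Lipschitz functions, even when these
  vary with n, and thereby the continuity of the matrices.\<close>

definition weakly_converges ::
  "('v, 'e) metric_graph \<Rightarrow> (nat \<Rightarrow> ('v, 'e) point \<Rightarrow> real) \<Rightarrow> (('v, 'e) point \<Rightarrow> real) \<Rightarrow> bool" where
  "weakly_converges G qs q \<longleftrightarrow> (\<forall>e\<in>edges G. \<forall>x\<in>{0..len G e}.
     (\<lambda>n. integral {0..x} (\<lambda>t. qs n (place G e t))) \<longlonglongrightarrow> integral {0..x} (\<lambda>t. q (place G e t)))"

text \<open>The diagonal sequence is a subsequence of each successive selection only from some index
  on. Hence the property must be inherited by subsequences and must not depend on finitely many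
  initial terms.\<close>

lemma diagonal_selection:
  fixes P :: "'i \<Rightarrow> (nat \<Rightarrow> nat) \<Rightarrow> bool"
  assumes A: "countable A"
    and ex: "\<And>a s. a \<in> A \<Longrightarrow> strict_mono (s :: nat \<Rightarrow> nat) \<Longrightarrow> \<exists>r. strict_mono r \<and> P a (s \<circ> r)"
    and sub: "\<And>a (s :: nat \<Rightarrow> nat) r. P a s \<Longrightarrow> strict_mono r \<Longrightarrow> P a (s \<circ> r)"
    and tail: "\<And>a (s :: nat \<Rightarrow> nat) m. P a (s \<circ> (+) m) \<Longrightarrow> P a s"
  obtains r where "strict_mono r" "\<And>a. a \<in> A \<Longrightarrow> P a r"
proof (cases "A = {}")
  case True
  then show ?thesis using that[of id] by (simp add: strict_mono_id)
next
  case False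
  interpret S: subseqs "\<lambda>k. P (from_nat_into A k)"
    by unfold_locales (rule ex[OF from_nat_into[OF False]])
  have "P a S.diagseq" if a: "a \<in> A" for a
  proof -
    obtain k where k: "from_nat_into A k = a" using from_nat_into_surj[OF A a] by blast
    have "P (from_nat_into A k) (S.diagseq \<circ> (+) (Suc k))" by (rule S.diagseq_holds) (rule sub)
    then show ?thesis unfolding k by (rule tail)
  qed
  then show ?thesis using that[OF S.subseq_diagseq] by blast
qed

text \<open>The sequence is Cauchy because it is uniformly close to Cauchy sequences. Combined with
  equicontinuity, this extends convergence from a countable dense set of arguments to all of
  them.\<close>

lemma convergent_approximation:
  fixes X :: "nat \<Rightarrow> real"
  assumes "\<And>\<epsilon>. \<epsilon> > 0 \<Longrightarrow> \<exists>Y. convergent Y \<and> (\<forall>n. \<bar>X n - Y n\<bar> \<le> \<epsilon>)"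
  shows "convergent X"
proof -
  have "Cauchy X"
  proof (rule CauchyI)
    fix e :: real assume e: "e > 0"
    obtain Y where Y: "convergent Y" "\<And>n. \<bar>X n - Y n\<bar> \<le> e / 4" using assms[of "e / 4"] e by auto
    have "Cauchy Y" using Y(1) by (simp add: Cauchy_convergent_iff)
    then obtain N where N: "\<And>m n. m \<ge> N \<Longrightarrow> n \<ge> N \<Longrightarrow> norm (Y m - Y n) < e / 4"
      using CauchyD[of Y "e / 4"] e by auto
    have "norm (X m - X n) < e" if "m \<ge> N" "n \<ge> N" for m n
      using N[OF that] Y(2)[of m] Y(2)[of n] e unfolding real_norm_def by linarith
    then show "\<exists>M. \<forall>m\<ge>M. \<forall>n\<ge>M. norm (X m - X n) < e" by blast
  qed
  then show ?thesis by (simp add: Cauchy_convergent_iff)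
qed

lemma convergent_comp: "convergent X \<Longrightarrow> strict_mono r \<Longrightarrow> convergent (\<lambda>n. X (r n))"
  using convergent_subseq_convergent[of X r] by (simp add: o_def)

lemma convergent_tail: "convergent (\<lambda>n. X (m + n)) \<Longrightarrow> convergent (X :: nat \<Rightarrow> real)"
proof -
  assume "convergent (\<lambda>n. X (m + n))"
  then obtain l where "(\<lambda>n. X (n + m)) \<longlonglongrightarrow> l" by (auto simp: convergent_def add.commute)
  then show ?thesis using LIMSEQ_offset by (auto simp: convergent_def)
qed

lemma bounded_convergent_selection:
  fixes X :: "'i \<Rightarrow> nat \<Rightarrow> real"
  assumes "countable A" "\<And>a n. a \<in> A \<Longrightarrow> \<bar>X a n\<bar> \<le> B a"
  obtains r where "strict_mono r" "\<And>a. a \<in> A \<Longrightarrow> convergent (\<lambda>n. X a (r n))"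
proof (rule diagonal_selection[OF assms(1), where P = "\<lambda>a s. convergent (\<lambda>n. X a (s n))"])
  fix a and s :: "nat \<Rightarrow> nat" assume a: "a \<in> A"
  have "bounded (range (\<lambda>n. X a (s n)))" using assms(2)[OF a] by (auto simp: bounded_iff)
  then show "\<exists>r. strict_mono r \<and> convergent (\<lambda>n. X a ((s \<circ> r) n))"
    using bounded_imp_convergent_subsequence[of "\<lambda>n. X a (s n)"] by (force simp: convergent_def o_def)
next
  show "convergent (\<lambda>n. X a ((s \<circ> r) n))" if "convergent (\<lambda>n. X a (s n))" "strict_mono r" for a and s r :: "nat \<Rightarrow> nat"
    using convergent_comp[OF that] by (simp add: o_def)
  show "convergent (\<lambda>n. X a (s n))" if "convergent (\<lambda>n. X a ((s \<circ> (+) m) n))" for a m and s :: "nat \<Rightarrow> nat"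
    using that by (intro convergent_tail[of "\<lambda>n. X a (s n)" m]) (simp add: o_def)
qed (rule that)

section \<open>Weak compactness on a single edge\<close>

locale bounded_sequence =
  fixes f :: "nat \<Rightarrow> real \<Rightarrow> real" and L M :: real
  assumes meas: "f n \<in> borel_measurable (lebesgue_on {0..L})"
    and bounds: "x \<in> {0..L} \<Longrightarrow> 0 \<le> f n x" "x \<in> {0..L} \<Longrightarrow> f n x \<le> M" and M: "0 \<le> M"
begin

abbreviation leb :: "real measure" where "leb \<equiv> lebesgue_on {0..L}"

definition J :: "nat \<Rightarrow> real set \<Rightarrow> real" where "J n A = set_lebesgue_integral leb A (f n)"

sublocale F: finite_measure leb
  by (rule finite_measure_lebesgue_on) simp

lemma bounded_integrable:
  fixes g :: "real \<Rightarrow> real"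
  assumes "g \<in> borel_measurable leb" "\<And>x. x \<in> {0..L} \<Longrightarrow> \<bar>g x\<bar> \<le> C"
  shows "integrable leb g"
  by (rule F.integrable_const_bound[of g C]) (use assms in \<open>auto intro!: AE_I2\<close>)

lemma set_int: "A \<in> sets leb \<Longrightarrow> set_integrable leb A (f n)"
  unfolding set_integrable_def
  by (rule integrable_mult_indicator) (auto intro!: bounded_integrable[where C=M] meas simp: bounds)

lemma J_bounds:
  assumes A: "A \<in> sets leb"
  shows "0 \<le> J n A" "J n A \<le> M * measure leb A"
proof -
  show "0 \<le> J n A" unfolding J_def set_lebesgue_integral_def
    by (intro integral_nonneg_AE AE_I2) (auto simp: bounds indicator_def)
  have "J n A \<le> (LINT x|leb. indicat_real A x * M)"
    unfolding J_def set_lebesgue_integral_def real_scaleR_def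
  proof (rule integral_mono)
    show "integrable leb (\<lambda>x. indicat_real A x * f n x)" using set_int[OF A, of n] by (simp add: set_integrable_def)
    show "integrable leb (\<lambda>x. indicat_real A x * M)" by (rule bounded_integrable[where C=M]) (use A M in \<open>auto simp: indicator_def\<close>)
  qed (auto simp: bounds indicator_def)
  also have "\<dots> = M * measure leb A"
    using A sets.sets_into_space[OF A] by (simp add: mult.commute Int_absorb2)
  finally show "J n A \<le> M * measure leb A" .
qed

lemma J_Un:
  assumes "A \<in> sets leb" "B \<in> sets leb" "A \<inter> B = {}"
  shows "J n (A \<union> B) = J n A + J n B"
  unfolding J_def using assms by (intro set_integral_Un set_int) auto

lemma J_diff:
  assumes "A \<in> sets leb" "B \<in> sets leb" "A \<subseteq> B"
  shows "J n (B - A) = J n B - J n A"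
proof -
  have "J n (A \<union> (B - A)) = J n A + J n (B - A)" using assms by (intro J_Un) auto
  moreover have "A \<union> (B - A) = B" using assms by blast
  ultimately show ?thesis by simp
qed

lemma J_sums:
  assumes "\<And>i. A i \<in> sets leb" "disjoint_family A"
  shows "J n (\<Union>i. A i) = (\<Sum>i. J n (A i))"
  unfolding J_def using assms
  by (intro lebesgue_integral_countable_add set_int) (auto simp: disjoint_family_on_def)

text \<open>Tannery's theorem exchanges the limit with the countable sum: the terms are dominated by
  M times the measures of the disjoint sets, which are summable. Here the uniform bound yields
  countable additivity of the limit.\<close>

lemma J_limit_union:
  assumes A: "\<And>i. A i \<in> sets leb" "disjoint_family A" and conv: "\<And>i. (\<lambda>n. J (r n) (A i)) \<longlonglongrightarrow> l i"
  shows "(\<lambda>n. J (r n) (\<Union>i. A i)) \<longlonglongrightarrow> suminf l" "summable l"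
proof -
  have sm: "summable (\<lambda>i. M * measure leb (A i))"
    using F.finite_measure_UNION[OF _ A(2)] A(1) by (intro summable_mult) (auto simp: sums_iff)
  have "\<forall>\<^sub>F (k, n) in at_top \<times>\<^sub>F sequentially. norm (J (r n) (A k)) \<le> M * measure leb (A k)"
    by (rule always_eventually) (use J_bounds[OF A(1)] in auto)
  from tannerys_theorem[OF conv this sm]
  have "summable (\<lambda>i. norm (l i))" "(\<lambda>n. \<Sum>i. J (r n) (A i)) \<longlonglongrightarrow> suminf l" by auto
  then show "(\<lambda>n. J (r n) (\<Union>i. A i)) \<longlonglongrightarrow> suminf l" "summable l"
    using J_sums[OF A] by (auto intro: summable_norm_cancel)
qed

text \<open>A subsequence is selected for rational half-lines. Since J changes by at most M times
  the measure of the difference, it converges for all half-lines. The sets with convergence are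
  closed under complements and countable disjoint unions, so a Dynkin argument gives all Borel sets,
  and null sets change nothing.\<close>

lemma J_convergent_selection:
  obtains r where "strict_mono r" "\<And>A. A \<in> sets leb \<Longrightarrow> convergent (\<lambda>n. J (r n) A)"
proof -
  have sets_S: "A \<inter> {0..L} \<in> sets leb" if "A \<in> sets lebesgue" for A
    using that by (auto simp: sets_restrict_space)
  have c_bound: "\<bar>J n ({..x} \<inter> {0..L})\<bar> \<le> M * measure leb {0..L}" for n x
  proof -
    have s: "{..x} \<inter> {0..L} \<in> sets leb" by (rule sets_S) auto
    have "measure leb ({..x} \<inter> {0..L}) \<le> measure leb {0..L}" using s by (intro F.finite_measure_mono) (auto simp: sets_restrict_space)
    then show ?thesis using J_bounds[OF s, of n] M mult_left_mono by fastforce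
  qed
  obtain r where r: "strict_mono r" "\<And>x. x \<in> \<rat> \<Longrightarrow> convergent (\<lambda>n. J (r n) ({..x} \<inter> {0..L}))"
    using bounded_convergent_selection[OF countable_rat, of "\<lambda>x n. J n ({..x} \<inter> {0..L})" "\<lambda>_. M * measure leb {0..L}"] c_bound by blast
  have half: "convergent (\<lambda>n. J (r n) ({..x} \<inter> {0..L}))" for x
  proof (rule convergent_approximation)
    fix \<epsilon> :: real assume \<epsilon>: "\<epsilon> > 0"
    then have "x < x + \<epsilon> / (M + 1)" using M by simp
    then obtain y where y: "y \<in> \<rat>" "x < y" "y < x + \<epsilon> / (M + 1)" using Rats_dense_in_real by blast
    have "\<bar>J (r n) ({..x} \<inter> {0..L}) - J (r n) ({..y} \<inter> {0..L})\<bar> \<le> \<epsilon>" for n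
    proof -
      let ?A = "{..x} \<inter> {0..L}" and ?B = "{..y} \<inter> {0..L}"
      have s: "?A \<in> sets leb" "?B \<in> sets leb" by (rule sets_S; simp)+
      have "?A \<subseteq> ?B" using y by auto
      then have "J (r n) ?B - J (r n) ?A = J (r n) (?B - ?A)" using J_diff[OF s] by simp
      moreover have "0 \<le> J (r n) (?B - ?A)" "J (r n) (?B - ?A) \<le> M * measure leb (?B - ?A)" using J_bounds[of "?B - ?A" "r n"] s by auto
      moreover have "measure leb (?B - ?A) \<le> y - x"
      proof -
        have "measure leb (?B - ?A) = measure lebesgue (?B - ?A)" by (rule measure_restrict_space) auto
        also have "\<dots> \<le> measure lebesgue {x..y}" by (intro measure_mono_fmeasurable) auto
        also have "\<dots> = y - x" using y by simp
        finally show ?thesis .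
      qed
      then have "M * measure leb (?B - ?A) \<le> M * (\<epsilon> / (M + 1))" using y M by (intro mult_left_mono) auto
      moreover have "M * (\<epsilon> / (M + 1)) \<le> \<epsilon>" using M \<epsilon> by (simp add: field_simps)
      ultimately show ?thesis by linarith
    qed
    then show "\<exists>Y. convergent Y \<and> (\<forall>n. \<bar>J (r n) ({..x} \<inter> {0..L}) - Y n\<bar> \<le> \<epsilon>)" using r(2)[OF y(1)] by blast
  qed
  have borel: "convergent (\<lambda>n. J (r n) (A \<inter> {0..L}))" if "A \<in> sets borel" for A
  proof -
    have gen: "sets borel = sigma_sets UNIV (range (\<lambda>a::real. {..a}))" by (subst borel_eq_atMost) simp
    have bl: "B \<inter> {0..L} \<in> sets leb" if "B \<in> sigma_sets UNIV (range (\<lambda>a::real. {..a}))" for B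
      using that unfolding gen[symmetric] by (intro sets_S) auto
    have S: "convergent (\<lambda>n. J (r n) {0..L})"
    proof -
      have "{..L} \<inter> {0..L} = {0..L}" by auto
      then show ?thesis using half[of L] by simp
    qed
    have range_Pow: "range (\<lambda>a::real. {..a}) \<subseteq> Pow UNIV" by simp
    have "Int_stable (range (\<lambda>a::real. {..a}))" by (auto simp: Int_stable_def)
    then show ?thesis using range_Pow that[unfolded gen]
    proof (induction rule: sigma_sets_induct_disjoint)
      case (basic A)
      then show ?case using half by auto
    next
      case empty
      then show ?case by (simp add: J_def set_lebesgue_integral_def convergent_const)
    next
      case (compl A)
      have "J (r n) ((UNIV - A) \<inter> {0..L}) = J (r n) {0..L} - J (r n) (A \<inter> {0..L})" for n
      proof -
        have "(UNIV - A) \<inter> {0..L} = {0..L} - A \<inter> {0..L}" by auto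
        moreover have "{0..L} \<in> sets leb" using sets.top[of leb] by simp
        ultimately show ?thesis using J_diff[OF bl[OF compl(1)], of "{0..L}"] by simp
      qed
      then show ?case using convergent_diff[OF S compl(2)] by simp
    next
      case (union A)
      have "(\<lambda>n. J (r n) (\<Union>i. A i \<inter> {0..L})) \<longlonglongrightarrow> (\<Sum>i. lim (\<lambda>n. J (r n) (A i \<inter> {0..L})))"
      proof (rule J_limit_union)
        show "A i \<inter> {0..L} \<in> sets leb" for i using union(2) by (intro bl) auto
        show "disjoint_family (\<lambda>i. A i \<inter> {0..L})" using union(1) by (auto simp: disjoint_family_on_def)
        show "(\<lambda>n. J (r n) (A i \<inter> {0..L})) \<longlonglongrightarrow> lim (\<lambda>n. J (r n) (A i \<inter> {0..L}))" for i
          using union(3) by (simp add: convergent_LIMSEQ_iff)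
      qed
      then show ?case by (auto simp: convergent_def)
    qed
  qed
  show thesis
  proof (rule that[OF r(1)])
    fix A assume A: "A \<in> sets leb"
    then have "A \<in> sets lebesgue \<and> A \<subseteq> {0..L}" by (subst (asm) sets_restrict_space_iff) auto
    then have AS: "A \<subseteq> {0..L}" and "A \<in> sets lebesgue" by auto
    from this(2) obtain B N N' where B: "A = B \<union> N" "N \<subseteq> N'" "N' \<in> null_sets lborel" "B \<in> sets lborel" by (rule sets_completionE)
    have N': "negligible N'" using null_sets_completionI[OF B(3)] by (simp add: negligible_iff_null_sets)
    have BS: "B \<inter> {0..L} \<in> sets leb" using B(4) by (intro sets_S) auto
    have "J n A = J n (B \<inter> {0..L})" for n
    proof -
      have D: "A - B \<inter> {0..L} \<in> sets leb" using A BS by auto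
      have "negligible (A - B \<inter> {0..L})" by (rule negligible_subset[OF N']) (use B AS in auto)
      then have "measure lebesgue (A - B \<inter> {0..L}) = 0" by (rule negligible_imp_measure0)
      then have "measure leb (A - B \<inter> {0..L}) = 0"
        using measure_restrict_space[of "{0..L}" lebesgue "A - B \<inter> {0..L}"] AS by fastforce
      then have "J n (A - B \<inter> {0..L}) = 0" using J_bounds[OF D, of n] by simp
      then show ?thesis using J_diff[OF BS A, of n] B AS by auto
    qed
    then show "convergent (\<lambda>n. J (r n) A)" using borel[of B] B(4) by simp
  qed
qed

text \<open>The limits of the integrals over measurable sets form a measure bounded by M times
  Lebesgue measure; its Radon-Nikodym density is the weak limit.\<close>

lemma weak_compactness:
  obtains r g where "strict_mono r" "g \<in> borel_measurable leb" "\<And>x. 0 \<le> g x \<and> g x \<le> M"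
    "\<And>A. A \<in> sets leb \<Longrightarrow> (\<lambda>n. J (r n) A) \<longlonglongrightarrow> set_lebesgue_integral leb A g"
proof -
  obtain r where r: "strict_mono r" "\<And>A. A \<in> sets leb \<Longrightarrow> convergent (\<lambda>n. J (r n) A)"
    using J_convergent_selection by blast
  define \<nu> where "\<nu> A = lim (\<lambda>n. J (r n) A)" for A
  have lim: "(\<lambda>n. J (r n) A) \<longlonglongrightarrow> \<nu> A" if "A \<in> sets leb" for A
    unfolding \<nu>_def using r(2)[OF that] by (simp add: convergent_LIMSEQ_iff)
  have \<nu>0: "0 \<le> \<nu> A" if "A \<in> sets leb" for A
    by (rule LIMSEQ_le_const[OF lim[OF that]]) (use J_bounds[OF that] in blast)
  have \<nu>M: "\<nu> A \<le> M * measure leb A" if "A \<in> sets leb" for A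
    by (rule LIMSEQ_le_const2[OF lim[OF that]]) (use J_bounds[OF that] in blast)
  define N where "N = measure_of (space leb) (sets leb) (\<lambda>A. ennreal (\<nu> A))"
  have sN: "sets N = sets leb" "space N = space leb" unfolding N_def by (rule sets.sets_measure_of_eq, rule sets.space_measure_of_eq)
  have eN: "emeasure N A = ennreal (\<nu> A)" if A: "A \<in> sets leb" for A
    unfolding N_def
  proof (rule emeasure_measure_of_sigma[OF sets.sigma_algebra_axioms _ _ A])
    have "\<nu> {} = 0" using \<nu>0[of "{}"] \<nu>M[of "{}"] by simp
    then show "positive (sets leb) (\<lambda>A. ennreal (\<nu> A))" by (simp add: positive_def)
    show "countably_additive (sets leb) (\<lambda>A. ennreal (\<nu> A))"
    proof (rule countably_additiveI)
      fix A :: "nat \<Rightarrow> real set"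
      assume A: "range A \<subseteq> sets leb" "disjoint_family A" "(\<Union>i. A i) \<in> sets leb"
      have Ai: "A i \<in> sets leb" for i using A(1) by auto
      have u: "(\<lambda>n. J (r n) (\<Union>i. A i)) \<longlonglongrightarrow> (\<Sum>i. \<nu> (A i))" "summable (\<lambda>i. \<nu> (A i))"
        using J_limit_union[OF Ai A(2) lim[OF Ai]] by auto
      then have "\<nu> (\<Union>i. A i) = (\<Sum>i. \<nu> (A i))" using LIMSEQ_unique[OF lim[OF A(3)]] by simp
      then show "(\<Sum>i. ennreal (\<nu> (A i))) = ennreal (\<nu> (\<Union>i. A i))"
        using suminf_ennreal2[OF \<nu>0[OF Ai] u(2)] by simp
    qed
  qed
  have "absolutely_continuous leb N"
    unfolding absolutely_continuous_def
  proof
    fix A assume A: "A \<in> null_sets leb"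
    then have "\<nu> A \<le> 0" using \<nu>M[of A] by (auto simp: measure_def null_sets_def)
    then show "A \<in> null_sets N" using A eN[of A] by (auto simp: null_sets_def sN ennreal_neg)
  qed
  then obtain h where h: "h \<in> borel_measurable leb" "density leb h = N"
    using F.Radon_Nikodym sN(1) by blast
  have nn: "(\<integral>\<^sup>+x. h x * indicator A x \<partial>leb) = ennreal (\<nu> A)" if "A \<in> sets leb" for A
    using emeasure_density[OF h(1) that] eN[OF that] h(2) by simp
  have "(\<integral>\<^sup>+x. h x \<partial>leb) = (\<integral>\<^sup>+x. h x * indicator (space leb) x \<partial>leb)" by (intro nn_integral_cong) auto
  then have hfin: "(\<integral>\<^sup>+x. h x \<partial>leb) < \<infinity>" using nn[of "space leb"] by simp
  then have AEh: "AE x in leb. h x = ennreal (enn2real (h x))"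
    using nn_integral_PInf_AE[OF h(1)] by (auto simp: less_top)
  define h' where "h' x = enn2real (h x)" for x
  have h'm: "h' \<in> borel_measurable leb" unfolding h'_def using h(1) by measurable
  have "(\<integral>\<^sup>+x. ennreal (h' x) \<partial>leb) = (\<integral>\<^sup>+x. h x \<partial>leb)"
    using AEh by (intro nn_integral_cong_AE) (auto simp: h'_def)
  then have h'i: "integrable leb h'"
    using hfin h'm by (intro integrableI_nonneg) (auto simp: h'_def)
  have h'A: "set_lebesgue_integral leb A h' = \<nu> A" if A: "A \<in> sets leb" for A
  proof -
    have "ennreal (set_lebesgue_integral leb A h') = (\<integral>\<^sup>+x. ennreal (indicator A x * h' x) \<partial>leb)"
      unfolding set_lebesgue_integral_def real_scaleR_def
      using integrable_mult_indicator[OF A h'i] by (intro nn_integral_eq_integral[symmetric]) (auto simp: h'_def indicator_def)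
    also have "\<dots> = (\<integral>\<^sup>+x. h x * indicator A x \<partial>leb)"
      using AEh by (intro nn_integral_cong_AE) (auto simp: h'_def indicator_def)
    finally have "ennreal (set_lebesgue_integral leb A h') = ennreal (\<nu> A)" using nn[OF A] by simp
    moreover have "0 \<le> set_lebesgue_integral leb A h'"
      unfolding set_lebesgue_integral_def by (intro integral_nonneg_AE AE_I2) (auto simp: h'_def indicator_def)
    ultimately show ?thesis using \<nu>0[OF A] by simp
  qed
  have "AE x in leb. 0 \<le> M - h' x"
  proof (rule F.density_nonneg)
    show "integrable leb (\<lambda>x. M - h' x)" using h'i by simp
    fix A assume A: "A \<in> sets leb"
    have "set_lebesgue_integral leb A (\<lambda>x. M - h' x) = set_lebesgue_integral leb A (\<lambda>x. M) - set_lebesgue_integral leb A h'"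
      by (rule set_integral_diff; unfold set_integrable_def; rule integrable_mult_indicator[OF A])
        (simp_all add: h'i)
    also have "set_lebesgue_integral leb A (\<lambda>x. M) = M * measure leb A"
      using A sets.sets_into_space[OF A] by (simp add: set_lebesgue_integral_def mult.commute Int_absorb2)
    finally show "0 \<le> set_lebesgue_integral leb A (\<lambda>x. M - h' x)" using h'A[OF A] \<nu>M[OF A] by simp
  qed
  \<comment> \<open>The density is at most M almost everywhere; the minimum with M enforces the
    bound at every point.\<close>
  then have AEM: "AE x in leb. min M (h' x) = h' x" by eventually_elim simp
  show thesis
  proof (rule that[OF r(1)])
    show "(\<lambda>x. min M (h' x)) \<in> borel_measurable leb" using h'm by measurable
    show "0 \<le> min M (h' x) \<and> min M (h' x) \<le> M" for x using M by (simp add: h'_def)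
    fix A assume A: "A \<in> sets leb"
    have "set_lebesgue_integral leb A (\<lambda>x. min M (h' x)) = set_lebesgue_integral leb A h'"
      unfolding set_lebesgue_integral_def using AEM A h'm by (intro integral_cong_AE) auto
    then show "(\<lambda>n. J (r n) A) \<longlonglongrightarrow> set_lebesgue_integral leb A (\<lambda>x. min M (h' x))"
      using lim[OF A] h'A[OF A] by simp
  qed
qed

lemma integral_eq_set_integral:
  fixes g :: "real \<Rightarrow> real"
  assumes g: "g \<in> borel_measurable leb" "\<And>x. x \<in> {0..L} \<Longrightarrow> \<bar>g x\<bar> \<le> C" and x: "x \<in> {0..L}"
  shows "integral {0..x} g = set_lebesgue_integral leb {0..x} g"
proof -
  have "{0..x} \<in> sets leb" using x by (subst sets_restrict_space_iff) auto
  then have i: "integrable leb (\<lambda>t. indicat_real {0..x} t *\<^sub>R g t)"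
    by (rule integrable_mult_indicator[OF _ bounded_integrable[OF g(1)]]) (rule g(2))
  have "set_lebesgue_integral leb {0..x} g = integral {0..L} (\<lambda>t. indicat_real {0..x} t *\<^sub>R g t)"
    unfolding set_lebesgue_integral_def by (rule lebesgue_integral_eq_integral[OF i]) simp
  also have "\<dots> = integral {0..L} (\<lambda>t. if t \<in> {0..x} then g t else 0)"
    by (rule arg_cong[where f = "integral {0..L}"]) (auto simp: indicator_def)
  also have "\<dots> = integral {0..x} g"
    using x by (subst integral_restrict_Int) (simp add: Int_absorb2)
  finally show ?thesis by simp
qed

text \<open>On the set C of pointwise convergence the integrals converge by dominated convergence,
  so there the pointwise limit may replace g. On the complement g stays. The weak limit is therefore
  applied to the set \<open>{0..x} - C\<close>, which is why it is assumed for all measurable sets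
  and not for intervals alone.\<close>

lemma pointwise_weak_limit:
  assumes g: "g \<in> borel_measurable leb" "\<And>x. 0 \<le> g x \<and> g x \<le> M"
    and lim: "\<And>A. A \<in> sets leb \<Longrightarrow> (\<lambda>n. J n A) \<longlonglongrightarrow> set_lebesgue_integral leb A g"
  defines "h \<equiv> \<lambda>x. if convergent (\<lambda>n. f n x) then lim (\<lambda>n. f n x) else g x"
  shows "h \<in> borel_measurable leb" "\<And>x. x \<in> {0..L} \<Longrightarrow> 0 \<le> h x \<and> h x \<le> M"
    "\<And>x. x \<in> {0..L} \<Longrightarrow> (\<lambda>n. integral {0..x} (f n)) \<longlonglongrightarrow> integral {0..x} h"
proof -
  define C where "C = {x \<in> {0..L}. convergent (\<lambda>n. f n x)}"
  have C: "C \<in> sets leb"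
    using sets_Collect_Cauchy[of f leb] meas by (simp add: C_def Cauchy_convergent_iff[symmetric])
  have h: "h x = (if x \<in> C then lim (\<lambda>n. f n x) else g x)" if "x \<in> {0..L}" for x
    using that by (simp add: h_def C_def)
  have limC: "(\<lambda>n. f n x) \<longlonglongrightarrow> h x" if "x \<in> C" for x
    using that by (simp add: h_def C_def convergent_LIMSEQ_iff)
  show hb: "0 \<le> h x \<and> h x \<le> M" if x: "x \<in> {0..L}" for x
  proof (cases "x \<in> C")
    case True
    then show ?thesis using LIMSEQ_le_const[OF limC[OF True], of 0] LIMSEQ_le_const2[OF limC[OF True], of M] bounds x by blast
  qed (use h x g in auto)
  have m1: "(\<lambda>x. indicat_real C x * f n x) \<in> borel_measurable leb" for n
    using meas[of n] C by (intro borel_measurable_times borel_measurable_indicator)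
  have m2: "(\<lambda>n. indicat_real C x * f n x) \<longlonglongrightarrow> indicat_real C x * h x" for x
    using limC[of x] by (cases "x \<in> C") auto
  have "(\<lambda>x. indicat_real C x * h x) \<in> borel_measurable leb"
    by (rule borel_measurable_LIMSEQ_metric[OF m1]) (rule m2)
  then have "(\<lambda>x. indicat_real C x * h x + indicat_real ({0..L} - C) x * g x) \<in> borel_measurable leb"
    using g(1) C sets.compl_sets[OF C] by (intro borel_measurable_add borel_measurable_times[of "indicat_real ({0..L} - C)"] borel_measurable_indicator) auto
  then show hm: "h \<in> borel_measurable leb"
    by (rule measurable_cong[THEN iffD1, rotated]) (use h in \<open>auto simp: indicator_def C_def\<close>)
  fix x assume x: "x \<in> {0..L}"
  let ?A = "{0..x} \<inter> C" and ?B = "{0..x} - C"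
  have sx: "{0..x} \<in> sets leb" using x by (subst sets_restrict_space_iff) auto
  have sA: "?A \<in> sets leb" "?B \<in> sets leb" using sx C by auto
  have "(\<lambda>n. LINT t|leb. indicat_real ?A t * f n t) \<longlonglongrightarrow> (LINT t|leb. indicat_real ?A t * h t)"
  proof (rule integral_dominated_convergence[where w = "\<lambda>_. M"])
    show "(\<lambda>t. indicat_real ?A t * h t) \<in> borel_measurable leb" using hm sA by (intro borel_measurable_times borel_measurable_indicator)
    show "(\<lambda>t. indicat_real ?A t * f n t) \<in> borel_measurable leb" for n using meas sA by (intro borel_measurable_times borel_measurable_indicator)
    show "integrable leb (\<lambda>_. M)" by simp
    show "AE t in leb. (\<lambda>n. indicat_real ?A t * f n t) \<longlonglongrightarrow> indicat_real ?A t * h t"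
      using limC by (intro AE_I2) (auto simp: indicator_def)
    show "AE t in leb. norm (indicat_real ?A t * f n t) \<le> M" for n
      using bounds M by (intro AE_I2) (auto simp: indicator_def)
  qed
  then have l1: "(\<lambda>n. J n ?A) \<longlonglongrightarrow> set_lebesgue_integral leb ?A h" by (simp add: J_def set_lebesgue_integral_def)
  have "set_lebesgue_integral leb ?B g = set_lebesgue_integral leb ?B h"
    unfolding set_lebesgue_integral_def by (rule Bochner_Integration.integral_cong) (use h x in \<open>auto simp: indicator_def\<close>)
  then have l2: "(\<lambda>n. J n ?B) \<longlonglongrightarrow> set_lebesgue_integral leb ?B h" using lim[OF sA(2)] by simp
  have un: "?A \<union> ?B = {0..x}" "?A \<inter> ?B = {}" by auto
  have J: "J n ?A + J n ?B = integral {0..x} (f n)" for n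
    using J_Un[OF sA un(2), of n] integral_eq_set_integral[OF meas _ x, where C = M] bounds unfolding un(1) J_def by auto
  have si: "set_integrable leb A h" if "A \<in> sets leb" for A
    unfolding set_integrable_def using that hb by (intro integrable_mult_indicator bounded_integrable[OF hm, of M]) auto
  have "set_lebesgue_integral leb ({0..x} \<inter> C \<union> ({0..x} - C)) h = set_lebesgue_integral leb ?A h + set_lebesgue_integral leb ?B h"
    by (rule set_integral_Un) (use si sA un in auto)
  then have "set_lebesgue_integral leb ?A h + set_lebesgue_integral leb ?B h = integral {0..x} h"
    using integral_eq_set_integral[OF hm _ x, of M] hb unfolding un(1) by auto
  then show "(\<lambda>n. integral {0..x} (f n)) \<longlonglongrightarrow> integral {0..x} h"
    using tendsto_add[OF l1 l2] unfolding J by simp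
qed

end

section \<open>From single edges to the graph\<close>

definition weak_limit_on_edge ::
  "('v, 'e) metric_graph \<Rightarrow> real \<Rightarrow> (nat \<Rightarrow> ('v, 'e) point \<Rightarrow> real) \<Rightarrow> 'e \<Rightarrow> (real \<Rightarrow> real) \<Rightarrow> bool" where
  "weak_limit_on_edge G M qs e g \<longleftrightarrow> g \<in> borel_measurable (lebesgue_on {0..len G e}) \<and> (\<forall>x. 0 \<le> g x \<and> g x \<le> M) \<and>
     (\<forall>A\<in>sets (lebesgue_on {0..len G e}).
       (\<lambda>n. set_lebesgue_integral (lebesgue_on {0..len G e}) A (\<lambda>x. qs n (place G e x)))
        \<longlonglongrightarrow> set_lebesgue_integral (lebesgue_on {0..len G e}) A g)"

lemma edge_bounded_sequence:
  assumes qs: "\<And>n. qs n \<in> bounded_potentials G M" and e: "e \<in> edges G" and M: "0 \<le> M"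
  shows "bounded_sequence (\<lambda>n x. qs n (place G e x)) (len G e) M"
proof
  show "(\<lambda>x. qs n (place G e x)) \<in> borel_measurable (lebesgue_on {0..len G e})" for n
    using qs[of n] e by (auto simp: bounded_potentials_def)
  have "place G e x \<in> points G" if "x \<in> {0..len G e}" for x using that e unfolding points_def by blast
  then show "0 \<le> qs n (place G e x)" "qs n (place G e x) \<le> M" if "x \<in> {0..len G e}" for x n
    using qs[of n] that by (auto simp: bounded_potentials_def)
qed (rule M)

lemma weak_limit_selection:
  fixes qs :: "nat \<Rightarrow> ('v, 'e) point \<Rightarrow> real"
  assumes G: "finite (edges G)" and qs: "\<And>n. qs n \<in> bounded_potentials G M" and M: "0 \<le> M"
  obtains r where "strict_mono r" "\<And>e. e \<in> edges G \<Longrightarrow> \<exists>g. weak_limit_on_edge G M (\<lambda>n. qs (r n)) e g"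
proof (rule diagonal_selection[OF countable_finite[OF G], where P = "\<lambda>e s. \<exists>g. weak_limit_on_edge G M (\<lambda>n. qs (s n)) e g"])
  fix e and s :: "nat \<Rightarrow> nat" assume e: "e \<in> edges G"
  interpret bounded_sequence "\<lambda>n x. qs (s n) (place G e x)" "len G e" M
    by (rule edge_bounded_sequence[OF qs e M])
  obtain r g where "strict_mono r" "g \<in> borel_measurable leb" "\<And>x. 0 \<le> g x \<and> g x \<le> M"
    "\<And>A. A \<in> sets leb \<Longrightarrow> (\<lambda>n. J (r n) A) \<longlonglongrightarrow> set_lebesgue_integral leb A g"
    using weak_compactness by blast
  then have "strict_mono r \<and> (\<exists>g. weak_limit_on_edge G M (\<lambda>n. qs ((s \<circ> r) n)) e g)"
    unfolding weak_limit_on_edge_def J_def by auto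
  then show "\<exists>r. strict_mono r \<and> (\<exists>g. weak_limit_on_edge G M (\<lambda>n. qs ((s \<circ> r) n)) e g)" by blast
next
  fix e and s r :: "nat \<Rightarrow> nat" assume "\<exists>g. weak_limit_on_edge G M (\<lambda>n. qs (s n)) e g" "strict_mono r"
  then show "\<exists>g. weak_limit_on_edge G M (\<lambda>n. qs ((s \<circ> r) n)) e g"
    using LIMSEQ_subseq_LIMSEQ[OF _ \<open>strict_mono r\<close>] unfolding weak_limit_on_edge_def o_def by blast
next
  fix e m and s :: "nat \<Rightarrow> nat" assume "\<exists>g. weak_limit_on_edge G M (\<lambda>n. qs ((s \<circ> (+) m) n)) e g"
  then obtain g where g: "weak_limit_on_edge G M (\<lambda>n. qs (s (n + m))) e g" by (auto simp: o_def add.commute)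
  let ?X = "\<lambda>A n. set_lebesgue_integral (lebesgue_on {0..len G e}) A (\<lambda>x. qs (s n) (place G e x))"
  have "?X A \<longlonglongrightarrow> set_lebesgue_integral (lebesgue_on {0..len G e}) A g" if "A \<in> sets (lebesgue_on {0..len G e})" for A
    by (rule LIMSEQ_offset[where k = m]) (use g that in \<open>auto simp: weak_limit_on_edge_def\<close>)
  then show "\<exists>g. weak_limit_on_edge G M (\<lambda>n. qs (s n)) e g"
    using g unfolding weak_limit_on_edge_def by (intro exI[of _ g]) blast
qed (rule that)

lemma weak_limit_potential:
  assumes qs: "\<And>n. qs n \<in> bounded_potentials G M" and M: "0 \<le> M"
    and g: "\<And>e. e \<in> edges G \<Longrightarrow> \<exists>g. weak_limit_on_edge G M qs e g"
  obtains q where "q \<in> bounded_potentials G M" "weakly_converges G qs q"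
    "\<And>p. convergent (\<lambda>n. qs n p) \<Longrightarrow> q p = lim (\<lambda>n. qs n p)"
proof -
  obtain g where g: "\<And>e. e \<in> edges G \<Longrightarrow> weak_limit_on_edge G M qs e (g e)" using g by metis
  \<comment> \<open>Weak limits on different edges need not agree at a common vertex. Their end
    values are set to 0, in accordance with the default value of q at the vertices.\<close>
  define g' where "g' e x = (if x = 0 \<or> x = len G e then 0 else g e x)" for e x
  define q where "q p = (if convergent (\<lambda>n. qs n p) then lim (\<lambda>n. qs n p) else
    (case p of Interior e x \<Rightarrow> g' e x | Vertex v \<Rightarrow> 0))" for p
  have main: "(\<lambda>x. q (place G e x)) \<in> borel_measurable (lebesgue_on {0..len G e}) \<and>
    (\<forall>x\<in>{0..len G e}. 0 \<le> q (place G e x) \<and> q (place G e x) \<le> M \<and>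
      (\<lambda>n. integral {0..x} (\<lambda>t. qs n (place G e t))) \<longlonglongrightarrow> integral {0..x} (\<lambda>t. q (place G e t)))"
    if e: "e \<in> edges G" for e
  proof -
    interpret bounded_sequence "\<lambda>n x. qs n (place G e x)" "len G e" M
      by (rule edge_bounded_sequence[OF qs e M])
    have ge: "g e \<in> borel_measurable leb" "\<And>x. 0 \<le> g e x \<and> g e x \<le> M"
      "\<And>A. A \<in> sets leb \<Longrightarrow> (\<lambda>n. J n A) \<longlonglongrightarrow> set_lebesgue_integral leb A (g e)"
      using g[OF e] unfolding weak_limit_on_edge_def J_def by auto
    have ae: "AE x in leb. g' e x = g e x"
    proof -
      have "AE x in lebesgue. x \<notin> {0, len G e}" by (rule AE_not_in) (simp add: negligible_iff_null_sets[symmetric])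
      then have "AE x in leb. x \<notin> {0, len G e}" by (subst AE_restrict_space_iff) auto
      then show ?thesis by eventually_elim (simp add: g'_def)
    qed
    have g'm: "g' e \<in> borel_measurable leb"
    proof -
      have "{0, len G e} \<inter> space leb \<in> sets leb" by (subst sets_restrict_space_iff) auto
      then have "(\<lambda>x. if x \<in> {0, len G e} then 0 else g e x) \<in> borel_measurable leb"
        by (intro measurable_If_set ge(1)) auto
      then show ?thesis by (simp add: g'_def[abs_def])
    qed
    have "set_lebesgue_integral leb A (g' e) = set_lebesgue_integral leb A (g e)" if "A \<in> sets leb" for A
      unfolding set_lebesgue_integral_def using ae that g'm ge(1) by (intro integral_cong_AE) auto
    then have lim': "(\<lambda>n. J n A) \<longlonglongrightarrow> set_lebesgue_integral leb A (g' e)" if "A \<in> sets leb" for A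
      using ge(3)[OF that] that by simp
    have g'b: "0 \<le> g' e x \<and> g' e x \<le> M" for x using ge(2) M by (simp add: g'_def)
    note pw = pointwise_weak_limit[OF g'm g'b lim']
    let ?h = "\<lambda>x. if convergent (\<lambda>n. qs n (place G e x)) then lim (\<lambda>n. qs n (place G e x)) else g' e x"
    have eq: "q (place G e x) = ?h x" for x by (auto simp: q_def place_def g'_def)
    show ?thesis unfolding eq using pw by blast
  qed
  show thesis
  proof (rule that)
    show "q \<in> bounded_potentials G M"
      unfolding bounded_potentials_def points_def using main by auto
    show "weakly_converges G qs q" unfolding weakly_converges_def using main by blast
    show "q p = lim (\<lambda>n. qs n p)" if "convergent (\<lambda>n. qs n p)" for p using that by (simp add: q_def)
  qed
qed

lemma place_finite_fibre: "finite {x. place G e x = a}"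
proof -
  have "{x. place G e x = a} \<subseteq> {0, len G e, (case a of Interior e' y \<Rightarrow> y | Vertex v \<Rightarrow> 0)}"
    by (auto simp: place_def split: if_splits)
  then show ?thesis by (rule finite_subset) simp
qed

lemma bounded_potentials_update:
  assumes q: "q \<in> bounded_potentials G M" and c: "0 \<le> c" "c \<le> M"
  shows "q(a := c) \<in> bounded_potentials G M"
  unfolding bounded_potentials_def
proof (intro CollectI conjI ballI)
  show "0 \<le> (q(a := c)) p" "(q(a := c)) p \<le> M" if "p \<in> points G" for p
    using q c that by (auto simp: bounded_potentials_def)
  fix e assume e: "e \<in> edges G"
  let ?F = "{x. place G e x = a}"
  have "?F \<inter> space (lebesgue_on {0..len G e}) \<in> sets (lebesgue_on {0..len G e})"
    by (subst sets_restrict_space_iff) (auto intro!: negligible_imp_sets negligible_finite finite_Int place_finite_fibre)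
  then have "(\<lambda>x. if x \<in> ?F then c else q (place G e x)) \<in> borel_measurable (lebesgue_on {0..len G e})"
    using q e by (intro measurable_If_set) (auto simp: bounded_potentials_def)
  then show "(\<lambda>x. (q(a := c)) (place G e x)) \<in> borel_measurable (lebesgue_on {0..len G e})"
    by (simp add: fun_upd_def)
qed

lemma weakly_converges_update:
  assumes "weakly_converges G qs q"
  shows "weakly_converges G qs (q(a := c))"
proof -
  have "integral {0..x} (\<lambda>t. (q(a := c)) (place G e t)) = integral {0..x} (\<lambda>t. q (place G e t))" for e x
    by (rule integral_spike[OF negligible_finite[OF place_finite_fibre[of G e a]]]) auto
  then show ?thesis using assms by (simp add: weakly_converges_def)
qed

section \<open>Eigenvalues as thresholds\<close>

context fine_graph
begin

lemma form_stiffness: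
  "form (matrices q \<mu>) x x = (\<Sum>p\<in>pieces. stiffness_quad (piece_potential q \<mu> p) (mesh (fst p)) (x (left_node p)) (x (right_node p)))"
  by (simp add: form_def matrices_def stiffness_form_def)

lemma nonzero_piece:
  assumes "\<exists>v\<in>nodes. x v \<noteq> (0::real)"
  obtains p where "p \<in> pieces" "x (left_node p) \<noteq> 0 \<or> x (right_node p) \<noteq> 0"
  using assms unfolding nodes_def by blast

lemma piece_point:
  assumes "p \<in> pieces" "y \<in> {0..mesh (fst p)}"
  shows "place G (fst p) (real (snd p) * mesh (fst p) + y) \<in> points G"
proof -
  have p: "fst p \<in> edges G" "snd p < n" using assms by (auto simp: pieces_def)
  have "real (snd p) * mesh (fst p) + mesh (fst p) \<le> len G (fst p)" "0 \<le> real (snd p) * mesh (fst p)"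
    using mesh_mono[of "fst p" "snd p"] mesh_mono[of "fst p" "Suc (snd p)"] p by (auto simp: algebra_simps)
  then show ?thesis using assms(2) by (intro place_in_points p) auto
qed

lemma form_positive:
  assumes q: "q \<in> bounded_potentials G M" and \<mu>: "\<bar>\<mu>\<bar> + M \<le> K" "\<mu> < 0" and x: "\<exists>v\<in>nodes. x v \<noteq> 0"
  shows "0 < form (matrices q \<mu>) x x"
proof -
  have pos: "0 < stiffness_quad (piece_potential q \<mu> p) (mesh (fst p)) a b" if p: "p \<in> pieces" and ab: "a \<noteq> 0 \<or> b \<noteq> 0" for p a b
  proof (rule stiffness_pos[OF piece_short[OF q \<mu>(1) p] _ _ ab])
    show "0 < - \<mu>" using \<mu> by simp
    show "- \<mu> \<le> piece_potential q \<mu> p t" if "t \<in> {0..mesh (fst p)}" for t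
      using piece_point[OF p that] q by (simp add: piece_potential_def bounded_potentials_def)
  qed
  have nn: "0 \<le> stiffness_quad (piece_potential q \<mu> p) (mesh (fst p)) a b" if p: "p \<in> pieces" for p a b
    using pos[OF p, of a b] by (cases "a \<noteq> 0 \<or> b \<noteq> 0") (auto simp: stiffness_form_def)
  obtain p where p: "p \<in> pieces" "x (left_node p) \<noteq> 0 \<or> x (right_node p) \<noteq> 0" using nonzero_piece[OF x] .
  show ?thesis unfolding form_stiffness by (rule sum_pos2[OF finite_E p(1)]) (use pos[OF p] nn in auto)
qed

lemma form_decreasing:
  assumes q: "q \<in> bounded_potentials G M" and \<mu>: "\<bar>\<mu>\<bar> + M \<le> K" "\<bar>\<nu>\<bar> + M \<le> K" "\<mu> < \<nu>" and x: "\<exists>v\<in>nodes. x v \<noteq> 0"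
  shows "form (matrices q \<nu>) x x < form (matrices q \<mu>) x x"
proof -
  have lt: "stiffness_quad (piece_potential q \<nu> p) (mesh (fst p)) a b < stiffness_quad (piece_potential q \<mu> p) (mesh (fst p)) a b"
    if p: "p \<in> pieces" and ab: "a \<noteq> 0 \<or> b \<noteq> 0" for p a b
  proof -
    have eq: "piece_potential q \<nu> p = (\<lambda>t. piece_potential q \<mu> p t - (\<nu> - \<mu>))" by (auto simp: piece_potential_def)
    show ?thesis
      using stiffness_strict_mono[OF piece_short[OF q \<mu>(1) p] piece_short[OF q \<mu>(2) p, unfolded eq] _ ab] \<mu>(3) eq by simp
  qed
  have le: "stiffness_quad (piece_potential q \<nu> p) (mesh (fst p)) a b \<le> stiffness_quad (piece_potential q \<mu> p) (mesh (fst p)) a b"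
    if p: "p \<in> pieces" for p a b
    using lt[OF p, of a b] by (cases "a \<noteq> 0 \<or> b \<noteq> 0") (auto simp: stiffness_form_def)
  obtain p where p: "p \<in> pieces" "x (left_node p) \<noteq> 0 \<or> x (right_node p) \<noteq> 0" using nonzero_piece[OF x] .
  show ?thesis unfolding form_stiffness
    by (rule sum_strict_mono_ex1[OF finite_E]) (use le lt p in blast)+
qed

text \<open>The integral over the initial part of a piece is a difference of two integrals that
  start at the end 0 of the edge, and these converge by assumption; the parameter enters
  linearly.\<close>

lemma matrices_tendsto:
  assumes qs: "\<And>k. qs k \<in> bounded_potentials G M" and q: "q \<in> bounded_potentials G M"
    and ls: "\<And>k. \<bar>ls k\<bar> + M \<le> K" and l: "\<bar>l\<bar> + M \<le> K"
    and weak: "weakly_converges G qs q" and lim: "ls \<longlonglongrightarrow> l" and p: "p \<in> pieces"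
  shows "(\<lambda>k. matrices (qs k) (ls k) i p) \<longlonglongrightarrow> matrices q l i p"
  unfolding matrices_def
proof (rule stiffness_continuous[OF piece_short[OF qs ls p] piece_short[OF q l p]])
  let ?e = "fst p" and ?a = "real (snd p) * mesh (fst p)"
  have e: "?e \<in> edges G" "snd p < n" using p by (auto simp: pieces_def)
  have a: "0 \<le> ?a" "?a + mesh ?e \<le> len G ?e"
    using mesh_mono[of ?e "snd p"] mesh_mono[of ?e "Suc (snd p)"] e by (auto simp: algebra_simps)
  fix x assume x: "x \<in> {0..mesh ?e}"
  have M0: "\<bar>0\<bar> + M \<le> K" using l by linarith
  have int: "integral {0..x} (piece_potential q \<mu> p) = integral {0..?a + x} (\<lambda>t. q (place G ?e t)) - integral {0..?a} (\<lambda>t. q (place G ?e t)) - \<mu> * x"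
    if q: "q \<in> bounded_potentials G M" for q \<mu>
  proof -
    let ?f = "\<lambda>t. q (place G ?e t)"
    have int: "?f integrable_on {u..v}" if "0 \<le> u" "v \<le> len G ?e" for u v
      using potential_integrable[OF edge_potential[OF q M0 e(1)] that] by simp
    have "(?f has_integral integral {?a..?a + x} ?f) {?a..?a + x}"
      by (intro integrable_integral int) (use a x in auto)
    then have "((\<lambda>y. ?f (y + ?a)) has_integral integral {?a..?a + x} ?f) {?a - ?a..?a + x - ?a}"
      by (rule has_integral_shift_real_ivl)
    then have "((\<lambda>y. ?f (?a + y)) has_integral integral {?a..?a + x} ?f) {0..x}" by (simp add: add.commute)
    then have "((\<lambda>y. ?f (?a + y) - \<mu>) has_integral integral {?a..?a + x} ?f - x * \<mu>) {0..x}"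
      using has_integral_const_real[of \<mu> 0 x] x by (intro has_integral_diff) auto
    then have "integral {0..x} (piece_potential q \<mu> p) = integral {?a..?a + x} ?f - x * \<mu>"
      unfolding piece_potential_def by (rule integral_unique)
    moreover have "integral {0..?a} ?f + integral {?a..?a + x} ?f = integral {0..?a + x} ?f"
      by (rule Henstock_Kurzweil_Integration.integral_combine) (use a x int in auto)
    ultimately show ?thesis by (simp add: mult.commute)
  qed
  show "(\<lambda>k. integral {0..x} (piece_potential (qs k) (ls k) p)) \<longlonglongrightarrow> integral {0..x} (piece_potential q l p)"
    unfolding int[OF q] int[OF qs]
    using weak e a x unfolding weakly_converges_def by (intro tendsto_intros lim) auto
qed

end

text \<open>The number of pieces is a multiple of 8, so that odd multiples of one eighth of an edge
  are nodes. Between these points the tents of the upper bound are at least half of their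
  height.\<close>

lemma fine_mesh_exists:
  assumes "compact_metric_graph G"
  obtains m where "m > 0" "\<And>e. e \<in> edges G \<Longrightarrow> K * (len G e / real (8 * m))\<^sup>2 \<le> 1 / 100"
proof -
  have fin: "finite (edges G)" using assms by (simp add: compact_metric_graph_def)
  define C where "C = (\<Sum>e\<in>edges G. \<bar>K\<bar> * (len G e)\<^sup>2)"
  have C: "\<bar>K\<bar> * (len G e)\<^sup>2 \<le> C" if "e \<in> edges G" for e
    unfolding C_def using fin that by (intro member_le_sum) auto
  obtain m :: nat where m: "max 1 (100 * C) < m" using reals_Archimedean2 by blast
  then have m1: "1 \<le> real m" "100 * C \<le> real m" by auto
  have "K * (len G e / real (8 * m))\<^sup>2 \<le> 1 / 100" if e: "e \<in> edges G" for e
  proof -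
    have "K * (len G e)\<^sup>2 \<le> \<bar>K\<bar> * (len G e)\<^sup>2" by (intro mult_right_mono) auto
    then have "100 * (K * (len G e)\<^sup>2) \<le> real m" using C[OF e] m1 by linarith
    also have "\<dots> \<le> real (8 * m) * real (8 * m)"
      using m1 mult_mono[of 1 "8 * real m" "real m" "8 * real m"] by simp
    finally show ?thesis using m1 by (simp add: power_divide field_simps power2_eq_square)
  qed
  then show thesis using that[of m] m by simp
qed

text \<open>The definition of the eigenvalues ranges over arbitrarily negative \<mu>, so the
  subdivision is adapted to the given \<mu>. The form is positive definite there and has no
  kernel.\<close>

lemma multiplicity_negative:
  assumes G: "compact_metric_graph G" and M: "0 \<le> M" and q: "q \<in> bounded_potentials G M" and \<mu>: "\<mu> < 0"
  shows "multiplicity G q \<mu> = 0"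
proof -
  obtain m where m: "m > 0" "\<And>e. e \<in> edges G \<Longrightarrow> (\<bar>\<mu>\<bar> + M) * (len G e / real (8 * m))\<^sup>2 \<le> 1 / 100"
    using fine_mesh_exists[OF G, where K = "\<bar>\<mu>\<bar> + M"] by blast
  interpret S: subdivided_graph G "8 * m" by unfold_locales (use G m in auto)
  interpret F: fine_graph G "8 * m" M "\<bar>\<mu>\<bar> + M" by unfold_locales (use m M in \<open>auto simp: S.mesh_def\<close>)
  have "\<not> S.kernel1 (S.matrices q \<mu>)"
  proof
    assume "S.kernel1 (S.matrices q \<mu>)"
    then obtain x where x: "\<exists>v\<in>S.nodes. x v \<noteq> 0" "\<forall>v\<in>S.nodes. S.flux (S.matrices q \<mu>) x v = 0"
      unfolding S.kernel1_def by blast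
    then show False using F.form_positive[OF q _ \<mu> x(1)] S.flux_zero_form(1)[OF x(2), of x] by simp
  qed
  then show ?thesis using F.multiplicity_ge_1[OF q, of \<mu>] by simp
qed

section \<open>Two tent functions that bound the second threshold\<close>

definition tent :: "real \<Rightarrow> real \<Rightarrow> real \<Rightarrow> real" where
  "tent L a y = max 0 (min (y - a) (a + L / 2 - y))"

lemma tent_Lipschitz: "\<bar>tent L a y - tent L a z\<bar> \<le> \<bar>y - z\<bar>"
  unfolding tent_def by (auto simp: max_def min_def)

text \<open>The three conditions on \<Lambda> have separate purposes: q - \<Lambda> is at most
  -\<Lambda>/2; the mesh is admissible for all parameters in [-1,\<Lambda>]; and the form is
  nonpositive on the span of two tents, where 10240 = 2 * 5120 comes from
  \<open>nonpos_top\<close>.\<close>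

locale tent_graph = fine_graph +
  fixes \<Lambda> :: real and e0 :: 'b and m :: nat
  assumes n8: "n = 8 * m" and e0: "e0 \<in> edges G" and \<Lambda>: "2 * M \<le> \<Lambda>" "\<Lambda> + M + 1 \<le> K" "10240 \<le> \<Lambda> * (len G e0)\<^sup>2"
begin

definition bump :: "real \<Rightarrow> ('a, 'b) point \<Rightarrow> real" where
  "bump a p = (case p of Vertex v \<Rightarrow> 0 | Interior e y \<Rightarrow> if e = e0 then tent (len G e0) a y else 0)"

lemma bump_node:
  assumes "a = 0 \<or> a = len G e0 / 2" "e \<in> edges G" "i \<le> n"
  shows "bump a (node e i) = (if e = e0 then tent (len G e0) a (real i * mesh e0) else 0)"
proof -
  consider "i = 0" | "i = n" | "0 < i" "i < n" using assms(3) by linarith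
  then show ?thesis
  proof cases
    case 1
    then show ?thesis using assms(1) len_pos[OF e0] by (auto simp: node_0 bump_def tent_def)
  next
    case 2
    then show ?thesis using assms(1,2) len_pos[OF e0] by (auto simp: node_n bump_def tent_def n_mesh)
  next
    case 3
    then show ?thesis using assms(2) by (simp add: node_interior bump_def)
  qed
qed

lemma m_mesh: "real m * mesh e0 = len G e0 / 8"
  using n_mesh[of e0] by (simp add: n8)

text \<open>The tents over the two halves of \<open>e0\<close> have slopes at most 1 and are at
  least L/8 on the middle half of their supports. With S = \<alpha>^2 + \<beta>^2 the difference
  quotients contribute at most 2 S L to the form, while the potential subtracts at least \<Lambda> S
  L^3 / 5120.\<close>

lemma nonpos_top:
  assumes q: "q \<in> bounded_potentials G M"
  shows "nonpos 1 (matrices q \<Lambda>)"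
proof (rule span_nonpos)
  let ?L = "len G e0" and ?h = "mesh e0"
  have L: "0 < ?L" using len_pos e0 by simp
  have h: "0 < ?h" using mesh_pos e0 by simp
  have mn: "i * m \<le> n" if "i \<le> 8" for i using that n8 by simp
  have at: "real (i * m) * ?h = real i * (?L / 8)" for i using m_mesh by simp
  fix \<alpha> \<beta> :: real
  let ?x = "comb \<alpha> (bump 0) \<beta> (bump (?L / 2))"
  define X where "X i = \<alpha> * tent ?L 0 (real i * ?h) + \<beta> * tent ?L (?L / 2) (real i * ?h)" for i
  have x: "?x (node e i) = (if e = e0 then X i else 0)" if "e \<in> edges G" "i \<le> n" for e i
    using that bump_node by (simp add: comb_def X_def)
  have X0: "X i = \<alpha> * tent ?L 0 (real i * ?h)" "?L / 8 \<le> tent ?L 0 (real i * ?h)" if "i \<in> {m..3 * m}" for i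
  proof -
    have "real m * ?h \<le> real i * ?h" "real i * ?h \<le> real (3 * m) * ?h" using that h by (auto intro!: mult_right_mono)
    then show "X i = \<alpha> * tent ?L 0 (real i * ?h)" "?L / 8 \<le> tent ?L 0 (real i * ?h)"
      using at[of 1] at[of 3] L by (auto simp: X_def tent_def max_def min_def)
  qed
  have X1: "X i = \<beta> * tent ?L (?L / 2) (real i * ?h)" "?L / 8 \<le> tent ?L (?L / 2) (real i * ?h)" if "i \<in> {5 * m..7 * m}" for i
  proof -
    have "real (5 * m) * ?h \<le> real i * ?h" "real i * ?h \<le> real (7 * m) * ?h" using that h by (auto intro!: mult_right_mono)
    then show "X i = \<beta> * tent ?L (?L / 2) (real i * ?h)" "?L / 8 \<le> tent ?L (?L / 2) (real i * ?h)"
      using at[of 5] at[of 7] L by (auto simp: X_def tent_def max_def min_def)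
  qed
  show "\<alpha> = 0 \<and> \<beta> = 0" if z: "\<forall>v\<in>nodes. ?x v = 0"
  proof -
    have "X i = 0" if "i \<le> n" for i using z node_in_nodes[OF e0 that] x[OF e0 that] by simp
    then have "X (2 * m) = 0" "X (6 * m) = 0" using mn by auto
    then show ?thesis using X0[of "2 * m"] X1[of "6 * m"] L by (auto simp: mult_eq_0_iff)
  qed
  have sh: "short (mesh (fst p)) \<Lambda> (piece_potential q \<Lambda> p)" if p: "p \<in> pieces" for p
  proof -
    have "\<bar>\<Lambda>\<bar> + M \<le> K" using \<Lambda> M by linarith
    then have s: "short (mesh (fst p)) K (piece_potential q \<Lambda> p)" by (intro piece_short[OF q _ p])
    have "\<Lambda> * (mesh (fst p))\<^sup>2 \<le> K * (mesh (fst p))\<^sup>2" using \<Lambda> M by (intro mult_right_mono) auto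
    also have "\<dots> \<le> 1 / 100" using s by (simp add: short_def)
    finally have "\<Lambda> * (mesh (fst p))\<^sup>2 \<le> 1 / 100" .
    moreover have "\<bar>piece_potential q \<Lambda> p t\<bar> \<le> \<Lambda>" if "t \<in> {0..mesh (fst p)}" for t
    proof -
      have "0 \<le> q (place G (fst p) (real (snd p) * mesh (fst p) + t))" "q (place G (fst p) (real (snd p) * mesh (fst p) + t)) \<le> M"
        using piece_point[OF p that] q by (auto simp: bounded_potentials_def)
      then show ?thesis using \<Lambda> M by (simp add: piece_potential_def)
    qed
    ultimately show ?thesis using s by (auto simp: short_def potential_def)
  qed
  have up: "stiffness_quad (piece_potential q \<Lambda> p) (mesh (fst p)) a b \<le> (b - a)\<^sup>2 / mesh (fst p) - \<Lambda> * mesh (fst p) * (a\<^sup>2 + b\<^sup>2) / 20"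
    if p: "p \<in> pieces" for p a b
  proof (rule stiffness_upper[OF sh[OF p]])
    show "piece_potential q \<Lambda> p t \<le> - \<Lambda> / 2" if "t \<in> {0..mesh (fst p)}" for t
    proof -
      have "q (place G (fst p) (real (snd p) * mesh (fst p) + t)) \<le> M"
        using piece_point[OF p that] q by (auto simp: bounded_potentials_def)
      then show ?thesis using \<Lambda> M by (simp add: piece_potential_def)
    qed
  qed
  let ?S = "\<alpha>\<^sup>2 + \<beta>\<^sup>2"
  have \<Lambda>0: "0 \<le> \<Lambda>" using \<Lambda> M by linarith
  have "form (matrices q \<Lambda>) ?x ?x = (\<Sum>(e, i)\<in>edges G \<times> {..<n}. stiffness_quad (piece_potential q \<Lambda> (e, i)) (mesh e) (?x (node e i)) (?x (node e (Suc i))))"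
    unfolding form_stiffness by (rule sum.cong) (auto simp: pieces_def left_node_def right_node_def)
  also have "\<dots> = (\<Sum>e\<in>edges G. \<Sum>i<n. stiffness_quad (piece_potential q \<Lambda> (e, i)) (mesh e) (?x (node e i)) (?x (node e (Suc i))))"
    by (rule sum.cartesian_product[symmetric])
  also have "\<dots> = (\<Sum>e\<in>edges G. if e = e0 then \<Sum>i<n. stiffness_quad (piece_potential q \<Lambda> (e0, i)) (mesh e0) (X i) (X (Suc i)) else 0)"
    by (intro sum.cong refl) (auto simp: x stiffness_form_def intro!: sum.neutral sum.cong)
  also have "\<dots> = (\<Sum>i<n. stiffness_quad (piece_potential q \<Lambda> (e0, i)) ?h (X i) (X (Suc i)))"
    using finite_edges e0 by simp
  also have "\<dots> \<le> (\<Sum>i<n. 2 * ?S * ?h - \<Lambda> * ?h / 20 * (X i)\<^sup>2)"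
  proof (rule sum_mono)
    fix i assume "i \<in> {..<n}"
    then have p: "(e0, i) \<in> pieces" using e0 by (simp add: pieces_def)
    have d: "\<bar>real (Suc i) * ?h - real i * ?h\<bar> = ?h" using h by (simp add: algebra_simps)
    have t: "(tent ?L a (real (Suc i) * ?h) - tent ?L a (real i * ?h))\<^sup>2 \<le> ?h\<^sup>2" for a
      using tent_Lipschitz[of ?L a "real (Suc i) * ?h" "real i * ?h"] unfolding d by (metis abs_ge_zero power2_abs power_mono)
    have sq: "(a * x + b * y)\<^sup>2 \<le> 2 * ((a\<^sup>2 + b\<^sup>2) * k)" if "x\<^sup>2 \<le> k" "y\<^sup>2 \<le> k" for a b x y k :: real
    proof -
      have "0 \<le> (a * x - b * y)\<^sup>2" by simp
      then have "(a * x + b * y)\<^sup>2 \<le> 2 * (a\<^sup>2 * x\<^sup>2) + 2 * (b\<^sup>2 * y\<^sup>2)" by (simp add: power2_eq_square algebra_simps)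
      also have "\<dots> \<le> 2 * (a\<^sup>2 * k) + 2 * (b\<^sup>2 * k)" using that by (intro add_mono mult_left_mono) auto
      finally show ?thesis by (simp add: algebra_simps)
    qed
    have "X (Suc i) - X i = \<alpha> * (tent ?L 0 (real (Suc i) * ?h) - tent ?L 0 (real i * ?h)) + \<beta> * (tent ?L (?L / 2) (real (Suc i) * ?h) - tent ?L (?L / 2) (real i * ?h))"
      by (simp add: X_def algebra_simps)
    then have "(X (Suc i) - X i)\<^sup>2 \<le> 2 * (?S * ?h\<^sup>2)" using sq[OF t t] by simp
    then have "(X (Suc i) - X i)\<^sup>2 / ?h \<le> 2 * ?S * ?h" using h by (simp add: pos_divide_le_eq power2_eq_square algebra_simps)
    moreover have "\<Lambda> * ?h / 20 * (X i)\<^sup>2 \<le> \<Lambda> * ?h * ((X i)\<^sup>2 + (X (Suc i))\<^sup>2) / 20"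
      using \<Lambda>0 h by (simp add: distrib_left)
    ultimately show "stiffness_quad (piece_potential q \<Lambda> (e0, i)) ?h (X i) (X (Suc i)) \<le> 2 * ?S * ?h - \<Lambda> * ?h / 20 * (X i)\<^sup>2"
      using up[OF p, of "X i" "X (Suc i)"] unfolding fst_conv by linarith
  qed
  also have "\<dots> = 2 * ?S * ?L - \<Lambda> * ?h / 20 * (\<Sum>i<n. (X i)\<^sup>2)"
  proof -
    have "(\<Sum>i<n. C - c * (X i)\<^sup>2) = real n * C - c * (\<Sum>i<n. (X i)\<^sup>2)" for C c by (simp add: sum_subtractf sum_distrib_left)
    moreover have "real n * (2 * ?S * ?h) = 2 * ?S * ?L" unfolding n_mesh[of e0, symmetric] by simp
    ultimately show ?thesis by (simp only:)
  qed
  also have "\<dots> \<le> 2 * ?S * ?L - \<Lambda> * ?h / 20 * (2 * real m * (?S * (?L / 8)\<^sup>2))"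
  proof -
    have scaled: "a\<^sup>2 * (?L / 8)\<^sup>2 \<le> (a * t)\<^sup>2" if "?L / 8 \<le> t" for a t
      unfolding power_mult_distrib using that L by (intro mult_left_mono power_mono) auto
    \<comment> \<open>Of the sum over all nodes only 2 m nodes under the upper half of each tent are
      kept. Together with m h = L/8 this produces the factor 5120 = 10 * 8 * 64.\<close>
    have "2 * real m * (?S * (?L / 8)\<^sup>2) = (\<Sum>i\<in>{m..<3 * m}. \<alpha>\<^sup>2 * (?L / 8)\<^sup>2) + (\<Sum>i\<in>{5 * m..<7 * m}. \<beta>\<^sup>2 * (?L / 8)\<^sup>2)"
      by (simp add: algebra_simps)
    also have "\<dots> \<le> (\<Sum>i\<in>{m..<3 * m}. (X i)\<^sup>2) + (\<Sum>i\<in>{5 * m..<7 * m}. (X i)\<^sup>2)"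
    proof (intro add_mono sum_mono)
      show "\<alpha>\<^sup>2 * (?L / 8)\<^sup>2 \<le> (X i)\<^sup>2" if "i \<in> {m..<3 * m}" for i
        using X0[of i] scaled[of "tent ?L 0 (real i * ?h)" \<alpha>] that by auto
      show "\<beta>\<^sup>2 * (?L / 8)\<^sup>2 \<le> (X i)\<^sup>2" if "i \<in> {5 * m..<7 * m}" for i
        using X1[of i] scaled[of "tent ?L (?L / 2) (real i * ?h)" \<beta>] that by auto
    qed
    also have "\<dots> = (\<Sum>i\<in>{m..<3 * m} \<union> {5 * m..<7 * m}. (X i)\<^sup>2)"
      by (rule sum.union_disjoint[symmetric]) auto
    also have "\<dots> \<le> (\<Sum>i<n. (X i)\<^sup>2)" by (rule sum_mono2) (auto simp: n8)
    finally have "2 * real m * (?S * (?L / 8)\<^sup>2) \<le> (\<Sum>i<n. (X i)\<^sup>2)" .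
    then show ?thesis using \<Lambda>0 h by (intro diff_left_mono mult_left_mono) auto
  qed
  also have "\<dots> = ?S * ?L * (2 - \<Lambda> * ?L\<^sup>2 / 5120)"
  proof -
    have "\<Lambda> * ?h / 20 * (2 * real m * (?S * (?L / 8)\<^sup>2)) = \<Lambda> / 10 * (real m * ?h) * (?S * (?L / 8)\<^sup>2)" by simp
    also have "\<dots> = ?S * ?L * (\<Lambda> * ?L\<^sup>2 / 5120)" unfolding m_mesh by (simp add: power2_eq_square)
    finally show ?thesis by (simp add: algebra_simps)
  qed
  also have "\<dots> \<le> 0" using \<Lambda> L by (intro mult_nonneg_nonpos) auto
  finally show "form (matrices q \<Lambda>) ?x ?x \<le> 0" .
qed

lemma range_bound: "l \<in> {-1..\<Lambda>} \<Longrightarrow> \<bar>l\<bar> + M \<le> K"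
  using \<Lambda> M by auto

lemma weakly_converges_const: "weakly_converges G (\<lambda>_. q) q"
  by (simp add: weakly_converges_def)

lemma pencil_matrices:
  assumes q: "q \<in> bounded_potentials G M"
  shows "pencil pieces left_node right_node nodes (matrices q) \<Lambda>"
proof unfold_locales
  show "(\<lambda>n. matrices q (ls n) i p) \<longlonglongrightarrow> matrices q l i p"
    if "\<And>n. ls n \<in> {-1..\<Lambda>}" "l \<in> {-1..\<Lambda>}" "ls \<longlonglongrightarrow> l" "p \<in> pieces" for ls l i p
    using that by (intro matrices_tendsto[where qs = "\<lambda>_. q"] q range_bound weakly_converges_const)
  show "form (matrices q m) x x < form (matrices q l) x x" if "-1 \<le> l" "l < m" "m \<le> \<Lambda>" "\<exists>v\<in>nodes. x v \<noteq> 0" for l m x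
    using that by (intro form_decreasing q range_bound) auto
  show "0 < form (matrices q l) x x" if "-1 \<le> l" "l < 0" "\<exists>v\<in>nodes. x v \<noteq> 0" for l x
    using that \<Lambda> M by (intro form_positive q range_bound) auto
qed (use nonpos_top[OF q] \<Lambda> M in auto)

section \<open>Eigenvalues as thresholds and their continuity\<close>

definition thr :: "real \<Rightarrow> (('a, 'b) point \<Rightarrow> real) \<Rightarrow> real" where
  "thr d q = Inf {l \<in> {-1..\<Lambda>}. nonpos d (matrices q l)}"

text \<open>The total multiplicity up to l reaches 1 when some parameter up to l has a kernel, and
  it reaches 2 when there is a double kernel or two different parameters have one. The lemmas on
  thresholds match both cases; an l above \<Lambda> is no competitor, since the thresholds do not
  exceed \<Lambda>.\<close>

lemma eigenvalue_thr:
  assumes q: "q \<in> bounded_potentials G M"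
  shows "eigenvalue G q 1 = thr 0 q" "eigenvalue G q 2 = thr 1 q"
proof -
  interpret P: pencil pieces left_node right_node nodes "matrices q" \<Lambda> by (rule pencil_matrices[OF q])
  have thr: "P.threshold d = thr d q" for d by (simp add: P.threshold_def thr_def)
  note [simp] = thr[symmetric]
  have r: "P.threshold 0 \<in> {0..\<Lambda>}" "P.threshold 1 \<in> {0..\<Lambda>}" using P.threshold_range[of 0] P.threshold_range[of 1] by auto
  have ge1: "1 \<le> multiplicity G q \<mu> \<longleftrightarrow> kernel1 (matrices q \<mu>)" if "\<mu> \<in> {-1..\<Lambda>}" for \<mu>
    by (rule multiplicity_ge_1[OF q range_bound[OF that]])
  have ge2: "2 \<le> multiplicity G q \<mu> \<longleftrightarrow> kernel2 (matrices q \<mu>)" if "\<mu> \<in> {-1..\<Lambda>}" for \<mu>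
    by (rule multiplicity_ge_2[OF q range_bound[OF that]])
  have nonneg: "0 \<le> \<mu>" if "1 \<le> multiplicity G q \<mu>" for \<mu>
    using multiplicity_negative[OF G M q, of \<mu>] that by (cases "\<mu> < 0") auto
  have m0: "1 \<le> multiplicity G q (P.threshold 0)" "1 \<le> multiplicity G q (P.threshold 1)"
    using ge1[of "P.threshold 0"] ge1[of "P.threshold 1"] r P.threshold_kernel[of 0] P.threshold_kernel[of 1] by auto
  have "eigenvalue G q 1 = P.threshold 0"
    unfolding eigenvalue_def
  proof (rule cInf_eq_minimum)
    show "P.threshold 0 \<in> {l. \<exists>S. finite S \<and> S \<subseteq> {..l} \<and> 1 \<le> (\<Sum>\<mu>\<in>S. multiplicity G q \<mu>)}"
      by (simp only: mem_Collect_eq, rule exI[of _ "{P.threshold 0}"]) (use m0 in simp)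
    fix l assume "l \<in> {l. \<exists>S. finite S \<and> S \<subseteq> {..l} \<and> 1 \<le> (\<Sum>\<mu>\<in>S. multiplicity G q \<mu>)}"
    then obtain S where S: "finite S" "S \<subseteq> {..l}" "1 \<le> (\<Sum>\<mu>\<in>S. multiplicity G q \<mu>)" by auto
    then have "(\<Sum>\<mu>\<in>S. multiplicity G q \<mu>) \<noteq> 0" by linarith
    then obtain \<mu> where \<mu>: "\<mu> \<in> S" "multiplicity G q \<mu> \<noteq> 0" by (meson sum.not_neutral_contains_not_neutral)
    then have \<mu>1: "1 \<le> multiplicity G q \<mu>" by simp
    show "P.threshold 0 \<le> l"
    proof (cases "\<mu> \<le> \<Lambda>")
      case True
      then have "\<mu> \<in> {-1..\<Lambda>}" using nonneg[OF \<mu>1] by simp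
      then have "P.threshold 0 \<le> \<mu>" using ge1 \<mu>1 by (intro P.kernel1_threshold) auto
      then show ?thesis using \<mu>(1) S(2) by auto
    qed (use \<mu>(1) S(2) r in auto)
  qed
  then show "eigenvalue G q 1 = thr 0 q" by simp
  have "eigenvalue G q 2 = P.threshold 1"
    unfolding eigenvalue_def
  proof (rule cInf_eq_minimum)
    show "P.threshold 1 \<in> {l. \<exists>S. finite S \<and> S \<subseteq> {..l} \<and> 2 \<le> (\<Sum>\<mu>\<in>S. multiplicity G q \<mu>)}"
      using P.threshold_1_cases
    proof
      assume "kernel2 (matrices q (P.threshold 1))"
      then have "2 \<le> multiplicity G q (P.threshold 1)" using ge2[of "P.threshold 1"] r by auto
      then show ?thesis by (simp only: mem_Collect_eq, intro exI[of _ "{P.threshold 1}"]) simp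
    next
      assume "P.threshold 0 < P.threshold 1 \<and> kernel1 (matrices q (P.threshold 0)) \<and> kernel1 (matrices q (P.threshold 1))"
      then have "(\<Sum>\<mu>\<in>{P.threshold 0, P.threshold 1}. multiplicity G q \<mu>) \<ge> 2" using m0 by simp
      then show ?thesis
        using \<open>P.threshold 0 < P.threshold 1 \<and> _\<close> by (simp only: mem_Collect_eq, intro exI[of _ "{P.threshold 0, P.threshold 1}"]) simp
    qed
    fix l assume "l \<in> {l. \<exists>S. finite S \<and> S \<subseteq> {..l} \<and> 2 \<le> (\<Sum>\<mu>\<in>S. multiplicity G q \<mu>)}"
    then obtain S where S: "finite S" "S \<subseteq> {..l}" "2 \<le> (\<Sum>\<mu>\<in>S. multiplicity G q \<mu>)" by auto
    then have "(\<Sum>\<mu>\<in>S. multiplicity G q \<mu>) \<noteq> 0" by linarith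
    then obtain \<mu> where \<mu>: "\<mu> \<in> S" "multiplicity G q \<mu> \<noteq> 0" by (meson sum.not_neutral_contains_not_neutral)
    then have \<mu>1: "1 \<le> multiplicity G q \<mu>" by simp
    show "P.threshold 1 \<le> l"
    proof (cases "l \<le> \<Lambda>")
      case True
      have in_range: "\<nu> \<in> {-1..\<Lambda>}" if "\<nu> \<in> S" "1 \<le> multiplicity G q \<nu>" for \<nu>
        using nonneg[OF that(2)] that(1) S(2) True by auto
      show ?thesis
      proof (cases "2 \<le> multiplicity G q \<mu>")
        case True
        then have "P.threshold 1 \<le> \<mu>" using ge2 in_range[OF \<mu>(1) \<mu>1] by (intro P.kernel2_threshold) auto
        then show ?thesis using \<mu>(1) S(2) by auto
      next
        case False
        \<comment> \<open>A multiplicity below 2 at \<mu> forces a second parameter in S with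
          positive multiplicity.\<close>
        have "(\<Sum>\<mu>\<in>S. multiplicity G q \<mu>) = multiplicity G q \<mu> + (\<Sum>\<mu>\<in>S - {\<mu>}. multiplicity G q \<mu>)"
          by (rule sum.remove[OF S(1) \<mu>(1)])
        then have "(\<Sum>\<mu>\<in>S - {\<mu>}. multiplicity G q \<mu>) \<noteq> 0" using False S(3) by simp
        then obtain \<nu> where \<nu>: "\<nu> \<in> S - {\<mu>}" "multiplicity G q \<nu> \<noteq> 0" by (meson sum.not_neutral_contains_not_neutral)
        then have \<nu>1: "1 \<le> multiplicity G q \<nu>" by simp
        have rng: "\<mu> \<in> {-1..\<Lambda>}" "\<nu> \<in> {-1..\<Lambda>}" using in_range \<mu>(1) \<mu>1 \<nu>(1) \<nu>1 by auto
        have "kernel1 (matrices q \<mu>)" "kernel1 (matrices q \<nu>)" using ge1 rng \<mu>1 \<nu>1 by auto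
        then have "P.threshold 1 \<le> max \<mu> \<nu>"
          using P.kernel1_kernel1_threshold[of \<mu> \<nu>] P.kernel1_kernel1_threshold[of \<nu> \<mu>] rng \<nu>(1) by (auto simp: max_def)
        moreover have "\<mu> \<le> l" "\<nu> \<le> l" using \<mu>(1) \<nu>(1) S(2) by auto
        ultimately show ?thesis by linarith
      qed
    qed (use r in auto)
  qed
  then show "eigenvalue G q 2 = thr 1 q" by simp
qed

text \<open>From above: by strict decrease the form at the threshold plus \<epsilon> is negative on
  the extremal subspace, and negativity is stable under perturbation of the potential. From below:
  at an accumulation point of the thresholds the limit form is nonpositive, since nonpositivity is
  closed.\<close>

lemma thr_tendsto:
  assumes qs: "\<And>k. qs k \<in> bounded_potentials G M" and q: "q \<in> bounded_potentials G M"
    and weak: "weakly_converges G qs q" and d: "d \<in> {0, 1}"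
  shows "(\<lambda>k. thr d (qs k)) \<longlonglongrightarrow> thr d q"
proof -
  have P: "nonpos d (matrices q (thr d q))" "thr d q \<in> {0..\<Lambda>}" "\<And>l. l \<in> {-1..\<Lambda>} \<Longrightarrow> nonpos d (matrices q l) \<Longrightarrow> thr d q \<le> l"
    if q: "q \<in> bounded_potentials G M" for q
  proof -
    interpret P: pencil pieces left_node right_node nodes "matrices q" \<Lambda> by (rule pencil_matrices[OF q])
    have thr: "P.threshold d = thr d q" by (simp add: P.threshold_def thr_def)
    show "nonpos d (matrices q (thr d q))" "thr d q \<in> {0..\<Lambda>}" "\<And>l. l \<in> {-1..\<Lambda>} \<Longrightarrow> nonpos d (matrices q l) \<Longrightarrow> thr d q \<le> l"
      using P.threshold[OF d] unfolding thr by auto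
  qed
  have sub: "weakly_converges G (qs \<circ> r) q" if "strict_mono r" for r :: "nat \<Rightarrow> nat"
    using weak LIMSEQ_subseq_LIMSEQ[OF _ that] unfolding weakly_converges_def by (fastforce simp: o_def)
  have upper: "\<forall>\<^sub>F k in sequentially. thr d (qs k) \<le> thr d q + \<epsilon>" if \<epsilon>: "\<epsilon> > 0" for \<epsilon>
  proof (rule ccontr)
    assume "\<not> ?thesis"
    then obtain r :: "nat \<Rightarrow> nat" where r: "strict_mono r" "\<And>k. \<not> thr d (qs (r k)) \<le> thr d q + \<epsilon>"
      by (metis (mono_tags, lifting) not_eventually_sequentiallyD)
    \<comment> \<open>This parameter is at most \<Lambda>, because thresholds of the sequence exceed
      it.\<close>
    define l where "l = thr d q + \<epsilon>"
    have l: "l \<in> {-1..\<Lambda>}" "thr d q < l" "-1 \<le> thr d q"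
      using P(2)[OF q] P(2)[OF qs, of "r 0"] r(2)[of 0] \<epsilon> by (auto simp: l_def)
    obtain x y where xy: "frame d x y" "\<And>\<alpha> \<beta>. form (matrices q (thr d q)) (comb \<alpha> x \<beta> y) (comb \<alpha> x \<beta> y) \<le> 0"
      using P(1)[OF q] unfolding nonpos_def by blast
    have "form (matrices q l) (comb \<alpha> x \<beta> y) (comb \<alpha> x \<beta> y) < 0" if "\<exists>v\<in>nodes. comb \<alpha> x \<beta> y v \<noteq> 0" for \<alpha> \<beta>
    proof -
      have "form (matrices q l) (comb \<alpha> x \<beta> y) (comb \<alpha> x \<beta> y) < form (matrices q (thr d q)) (comb \<alpha> x \<beta> y) (comb \<alpha> x \<beta> y)"
        using l P(2)[OF q] that by (intro form_decreasing q range_bound) auto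
      then show ?thesis using xy(2)[of \<alpha> \<beta>] by linarith
    qed
    then have neg: "negative d (matrices q l)" using xy(1) unfolding negative_def by blast
    have "\<exists>k. nonpos d (matrices ((qs \<circ> r) k) l)"
    proof (rule negative_open[OF d _ neg])
      show "(\<lambda>k. matrices ((qs \<circ> r) k) l i p) \<longlonglongrightarrow> matrices q l i p" if "p \<in> pieces" for i p
        by (rule matrices_tendsto[OF _ q range_bound[OF l(1)] range_bound[OF l(1)] sub[OF r(1)] tendsto_const that]) (simp add: qs)
    qed
    then obtain k where "nonpos d (matrices (qs (r k)) l)" by auto
    then have "thr d (qs (r k)) \<le> l" by (rule P(3)[OF qs l(1)])
    then show False using r(2)[of k] by (simp add: l_def)
  qed
  have lower: "\<forall>\<^sub>F k in sequentially. thr d q - \<epsilon> < thr d (qs k)" if \<epsilon>: "\<epsilon> > 0" for \<epsilon>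
  proof (rule ccontr)
    assume "\<not> ?thesis"
    then obtain r :: "nat \<Rightarrow> nat" where r: "strict_mono r" "\<And>k. \<not> thr d q - \<epsilon> < thr d (qs (r k))"
      by (metis (mono_tags, lifting) not_eventually_sequentiallyD)
    have "bounded (range (\<lambda>k. thr d (qs (r k))))"
      using P(2)[OF qs] by (intro boundedI[of _ \<Lambda>]) auto
    then obtain l s where s: "strict_mono (s :: nat \<Rightarrow> nat)" "((\<lambda>k. thr d (qs (r k))) \<circ> s) \<longlonglongrightarrow> l"
      using bounded_imp_convergent_subsequence by blast
    define rs where "rs = r \<circ> s"
    have rs: "strict_mono rs" unfolding rs_def by (rule strict_mono_o[OF r(1) s(1)])
    have lim: "(\<lambda>k. thr d (qs (rs k))) \<longlonglongrightarrow> l" using s(2) by (simp add: rs_def o_def)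
    have l: "l \<in> {-1..\<Lambda>}"
    proof -
      have b: "-1 \<le> thr d (qs k)" "thr d (qs k) \<le> \<Lambda>" for k using P(2)[OF qs, of k] by auto
      have "-1 \<le> l" by (rule LIMSEQ_le_const[OF lim]) (use b in blast)
      moreover have "l \<le> \<Lambda>" by (rule LIMSEQ_le_const2[OF lim]) (use b in blast)
      ultimately show ?thesis by simp
    qed
    have le: "l \<le> thr d q - \<epsilon>"
    proof (rule LIMSEQ_le_const2[OF lim])
      show "\<exists>N. \<forall>k\<ge>N. thr d (qs (rs k)) \<le> thr d q - \<epsilon>" using r(2) by (auto simp: rs_def not_less)
    qed
    have "nonpos d (matrices q l)"
    proof (rule nonpos_closed)
      show "d \<le> 1" using d by auto
      show "(\<lambda>k. matrices ((qs \<circ> rs) k) (thr d (qs (rs k))) i p) \<longlonglongrightarrow> matrices q l i p" if "p \<in> pieces" for i p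
      proof (rule matrices_tendsto[OF _ q _ range_bound[OF l] sub[OF rs] lim that])
        show "\<bar>thr d (qs (rs k))\<bar> + M \<le> K" for k using P(2)[OF qs, of "rs k"] by (intro range_bound) auto
      qed (simp add: qs)
      show "nonpos d (matrices ((qs \<circ> rs) k) (thr d (qs (rs k))))" for k using P(1)[OF qs] by simp
    qed
    then have "thr d q \<le> l" by (rule P(3)[OF q l])
    then show False using le \<epsilon> by simp
  qed
  show ?thesis
  proof (rule tendstoI)
    fix \<epsilon> :: real assume \<epsilon>: "\<epsilon> > 0"
    then have "\<epsilon> / 2 > 0" by simp
    from upper[OF this] lower[OF \<epsilon>] show "\<forall>\<^sub>F k in sequentially. dist (thr d (qs k)) (thr d q) < \<epsilon>"
      by eventually_elim (use \<epsilon> in \<open>auto simp: dist_real_def\<close>)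
  qed
qed

end

theorem fundamental_gap_continuous:
  assumes G: "compact_metric_graph G" and M: "0 \<le> M"
    and qs: "\<And>k. qs k \<in> bounded_potentials G M" and q: "q \<in> bounded_potentials G M"
    and weak: "weakly_converges G qs q"
  shows "(\<lambda>k. fundamental_gap G (qs k)) \<longlonglongrightarrow> fundamental_gap G q"
proof -
  obtain e0 where e0: "e0 \<in> edges G" using G by (auto simp: compact_metric_graph_def)
  have L: "0 < len G e0" using G e0 by (auto simp: compact_metric_graph_def)
  \<comment> \<open>\<Lambda> depends only on M and on the length of one edge, so a single
    subdivision serves the whole sequence and its limit.\<close>
  define \<Lambda> where "\<Lambda> = max (2 * M) (10240 / (len G e0)\<^sup>2)"
  obtain m where m: "m > 0" "\<And>e. e \<in> edges G \<Longrightarrow> (\<Lambda> + M + 1) * (len G e / real (8 * m))\<^sup>2 \<le> 1 / 100"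
    using fine_mesh_exists[OF G, where K = "\<Lambda> + M + 1"] by blast
  interpret S: subdivided_graph G "8 * m" by unfold_locales (use G m in auto)
  interpret T: tent_graph G "8 * m" M "\<Lambda> + M + 1" \<Lambda> e0 m
  proof unfold_locales
    have "10240 / (len G e0)\<^sup>2 \<le> \<Lambda>" by (simp add: \<Lambda>_def)
    then show "10240 \<le> \<Lambda> * (len G e0)\<^sup>2" using L by (simp add: pos_divide_le_eq)
  qed (use m M e0 in \<open>auto simp: S.mesh_def \<Lambda>_def\<close>)
  show ?thesis
    unfolding fundamental_gap_def T.eigenvalue_thr[OF qs] T.eigenvalue_thr[OF q]
    by (intro tendsto_diff T.thr_tendsto qs q weak) auto
qed

section \<open>Topology of the graph\<close>

lemma topspace_graph_topology [simp]: "topspace (graph_topology G) = points G"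
proof -
  have "openin (graph_topology G) (points G)"
    unfolding openin_graph_topology
  proof (intro conjI ballI)
    fix e assume "e \<in> edges G"
    then have "{x \<in> {0..len G e}. place G e x \<in> points G} = {0..len G e}" unfolding points_def by blast
    then show "openin (top_of_set {0..len G e}) {x \<in> {0..len G e}. place G e x \<in> points G}" by simp
  qed simp
  moreover have "U \<subseteq> points G" if "openin (graph_topology G) U" for U using that by (simp add: openin_graph_topology)
  ultimately show ?thesis unfolding topspace_def by blast
qed

lemma continuous_map_place:
  assumes "e \<in> edges G"
  shows "continuous_map (top_of_set {0..len G e}) (graph_topology G) (place G e)"
  unfolding continuous_map
proof (intro conjI allI impI)
  show "place G e ` topspace (top_of_set {0..len G e}) \<subseteq> topspace (graph_topology G)"
    using assms unfolding topspace_graph_topology points_def by auto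
  show "openin (top_of_set {0..len G e}) {x \<in> topspace (top_of_set {0..len G e}). place G e x \<in> U}"
    if "openin (graph_topology G) U" for U
    using that assms unfolding openin_graph_topology by simp
qed

lemma continuous_map_graph:
  fixes f :: "('v, 'e) point \<Rightarrow> real"
  assumes "\<And>e. e \<in> edges G \<Longrightarrow> continuous_on {0..len G e} (\<lambda>x. f (place G e x))"
  shows "continuous_map (graph_topology G) euclideanreal f"
  unfolding continuous_map
proof (intro conjI allI impI)
  fix U :: "real set" assume U: "openin euclideanreal U"
  show "openin (graph_topology G) {p \<in> topspace (graph_topology G). f p \<in> U}"
    unfolding openin_graph_topology
  proof (intro conjI ballI)
    fix e assume e: "e \<in> edges G"
    have "{x \<in> {0..len G e}. place G e x \<in> {p \<in> topspace (graph_topology G). f p \<in> U}} = {0..len G e} \<inter> (\<lambda>x. f (place G e x)) -` U"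
      using e unfolding topspace_graph_topology points_def by auto
    then show "openin (top_of_set {0..len G e}) {x \<in> {0..len G e}. place G e x \<in> {p \<in> topspace (graph_topology G). f p \<in> U}}"
      using continuous_openin_preimage_gen[OF assms[OF e]] U by simp
  qed auto
qed simp

text \<open>For fixed a in the graph, a continuous nonnegative function that vanishes only at a. It
  stands in for the distance to a, both to separate points and to keep compact parts of a path away
  from a. At a vertex it is a product over the two ends of an edge, which covers loops.\<close>

definition separator :: "('v, 'e) metric_graph \<Rightarrow> ('v, 'e) point \<Rightarrow> ('v, 'e) point \<Rightarrow> real" where
  "separator G a p = (case a of
     Vertex v \<Rightarrow> (case p of Vertex w \<Rightarrow> if w = v then 0 else 1
       | Interior e x \<Rightarrow> (if src G e = v then x / len G e else 1) * (if tgt G e = v then (len G e - x) / len G e else 1))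
   | Interior e' y \<Rightarrow> (case p of Vertex w \<Rightarrow> 1
       | Interior e x \<Rightarrow> if e = e' then min 1 (\<bar>x - y\<bar> / min y (len G e - y)) else 1))"

context
  fixes G :: "('v, 'e) metric_graph"
  assumes G: "compact_metric_graph G"
begin

lemma edge_len: "e \<in> edges G \<Longrightarrow> 0 < len G e"
  using G by (simp add: compact_metric_graph_def)

lemma interior_point:
  assumes "Interior e x \<in> points G"
  shows "e \<in> edges G" "0 < x" "x < len G e"
proof -
  obtain e' y where "e' \<in> edges G" "y \<in> {0..len G e'}" "Interior e x = place G e' y"
    using assms unfolding points_def by blast
  then show "e \<in> edges G" "0 < x" "x < len G e" by (auto simp: place_def split: if_splits)
qed

lemma separator_vertex_place:
  assumes "e \<in> edges G"
  shows "separator G (Vertex v) (place G e x) = (if src G e = v then x / len G e else 1) * (if tgt G e = v then (len G e - x) / len G e else 1)"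
  using edge_len[OF assms] by (auto simp: separator_def place_def)

lemma separator_interior_place:
  assumes "e \<in> edges G" "Interior e' y \<in> points G"
  shows "separator G (Interior e' y) (place G e x) = (if e = e' then min 1 (\<bar>x - y\<bar> / min y (len G e - y)) else 1)"
  using edge_len[OF assms(1)] interior_point[OF assms(2)] by (auto simp: separator_def place_def min_def abs_if)

lemma separator_continuous:
  assumes "a \<in> points G"
  shows "continuous_map (graph_topology G) euclideanreal (separator G a)"
proof (rule continuous_map_graph)
  fix e assume e: "e \<in> edges G"
  show "continuous_on {0..len G e} (\<lambda>x. separator G a (place G e x))"
  proof (cases a)
    case (Vertex v)
    show ?thesis unfolding Vertex separator_vertex_place[OF e] using edge_len[OF e]
      by (cases "src G e = v"; cases "tgt G e = v") (auto intro!: continuous_intros)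
  next
    case (Interior e' y)
    show ?thesis unfolding Interior separator_interior_place[OF e assms[unfolded Interior]]
      using interior_point[OF assms[unfolded Interior]]
      by (cases "e = e'") (auto intro!: continuous_intros)
  qed
qed

lemma separator_nonneg:
  assumes "a \<in> points G" "p \<in> points G"
  shows "0 \<le> separator G a p" "separator G a p = 0 \<longleftrightarrow> p = a"
proof -
  have "0 \<le> separator G a p \<and> (separator G a p = 0 \<longleftrightarrow> p = a)"
  proof (cases a; cases p)
    fix e x e' y assume "a = Interior e' y" "p = Interior e x"
    then show ?thesis using interior_point[of e x] interior_point[of e' y] assms
      by (auto simp: separator_def min_def divide_simps)
  next
    fix v e x assume "a = Vertex v" "p = Interior e x"
    then show ?thesis using interior_point[of e x] assms by (auto simp: separator_def)
  qed (auto simp: separator_def)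
  then show "0 \<le> separator G a p" "separator G a p = 0 \<longleftrightarrow> p = a" by auto
qed

text \<open>The continuous function \<open>separator G a\<close> takes different values at the two
  points. The property makes images of paths closed, hence their traces on the edges measurable, and
  it gives first hitting times.\<close>

lemma Hausdorff_graph: "Hausdorff_space (graph_topology G)"
  unfolding Hausdorff_space_def
proof (intro allI impI)
  fix a p assume ap: "a \<in> topspace (graph_topology G) \<and> p \<in> topspace (graph_topology G) \<and> a \<noteq> p"
  let ?d = "separator G a"
  have pos: "0 < ?d p" using ap separator_nonneg[of a p] by auto
  have z: "?d a = 0" using ap separator_nonneg[of a a] by auto
  have cont: "continuous_map (graph_topology G) euclideanreal ?d" using ap by (intro separator_continuous) auto
  let ?U = "{x \<in> topspace (graph_topology G). ?d x \<in> {..<?d p / 2}}" and ?V = "{x \<in> topspace (graph_topology G). ?d x \<in> {?d p / 2<..}}"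
  have "openin (graph_topology G) ?U" "openin (graph_topology G) ?V"
    by (rule openin_continuous_map_preimage[OF cont]; simp)+
  moreover have "a \<in> ?U" "p \<in> ?V" using ap pos z by auto
  moreover have "disjnt ?U ?V" by (auto simp: disjnt_def)
  ultimately show "\<exists>U V. openin (graph_topology G) U \<and> openin (graph_topology G) V \<and> a \<in> U \<and> p \<in> V \<and> disjnt U V" by blast
qed

section \<open>Images of paths and arc length\<close>

lemma compact_preimage_closed:
  assumes e: "e \<in> edges G" and K: "compactin (graph_topology G) K"
  shows "closed {x \<in> {0..len G e}. place G e x \<in> K}"
proof -
  have "closedin (graph_topology G) K" by (rule compactin_imp_closedin[OF Hausdorff_graph K])
  then have "closedin (top_of_set {0..len G e}) {x \<in> topspace (top_of_set {0..len G e}). place G e x \<in> K}"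
    by (rule closedin_continuous_map_preimage[OF continuous_map_place[OF e]])
  then show ?thesis by (auto intro: closedin_closed_trans)
qed

lemma path_image_compactin:
  assumes "pathin (graph_topology G) \<gamma>" "0 \<le> a" "b \<le> 1"
  shows "compactin (graph_topology G) (\<gamma> ` {a..b})"
proof (rule image_compactin)
  show "continuous_map (top_of_set {0..1}) (graph_topology G) \<gamma>" using assms(1) by (simp add: pathin_def)
  show "compactin (top_of_set {0..1}) {a..b}" using assms by (auto simp: compactin_subtopology)
qed

lemma arc_length_mono:
  assumes "pathin (graph_topology G) \<gamma>" "s \<le> t" "t \<le> 1"
  shows "arc_length G \<gamma> s \<le> arc_length G \<gamma> t"
  unfolding arc_length_def
proof (rule sum_mono, rule measure_mono_fmeasurable)
  fix e assume e: "e \<in> edges G"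
  show "{x \<in> {0..len G e}. place G e x \<in> \<gamma> ` {0..s}} \<subseteq> {x \<in> {0..len G e}. place G e x \<in> \<gamma> ` {0..t}}"
    using assms(2) by auto
  have c: "closed {x \<in> {0..len G e}. place G e x \<in> \<gamma> ` {0..t}}" if "t \<le> 1" for t
    using that by (intro compact_preimage_closed[OF e] path_image_compactin assms(1)) auto
  show "{x \<in> {0..len G e}. place G e x \<in> \<gamma> ` {0..s}} \<in> sets lebesgue"
    using c[of s] assms(2,3) by auto
  have "compact {x \<in> {0..len G e}. place G e x \<in> \<gamma> ` {0..t}}"
    using c[OF assms(3)] by (auto simp: compact_eq_bounded_closed intro: bounded_subset[of "{0..len G e}"])
  then show "{x \<in> {0..len G e}. place G e x \<in> \<gamma> ` {0..t}} \<in> lmeasurable" by (rule lmeasurable_compact)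
qed

lemma arc_length_0: "arc_length G \<gamma> 0 = 0"
  unfolding arc_length_def
proof (rule sum.neutral, rule ballI)
  fix e
  have "finite {x \<in> {0..len G e}. place G e x \<in> \<gamma> ` {0..0}}"
    by (rule finite_subset[OF _ place_finite_fibre[of G e "\<gamma> 0"]]) auto
  then show "measure lebesgue {x \<in> {0..len G e}. place G e x \<in> \<gamma> ` {0..0}} = 0"
    by (intro negligible_imp_measure0 negligible_finite)
qed

lemma arc_length_range:
  assumes "pathin (graph_topology G) \<gamma>" "t \<in> {0..1}"
  shows "arc_length G \<gamma> t \<in> {0..arc_length G \<gamma> 1}"
  using arc_length_mono[OF assms(1), of 0 t] arc_length_mono[OF assms(1), of t 1] assms(2) by (auto simp: arc_length_0)

end

section \<open>Limits of potentials that are convex on paths\<close>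

text \<open>If y lies on one side of y1, then y1 is between y and the end on the other side.
  Convexity with the value at y1 nonnegative and the end value at most M prevents f y from being
  very negative.\<close>

lemma convex_lower_bound:
  fixes f :: "real \<Rightarrow> real"
  assumes f: "convex_on {0..L} f" and y1: "0 < y1" "y1 < L" and M: "0 \<le> f y1" "f 0 \<le> M" "f L \<le> M" "0 \<le> M"
    and y: "y \<in> {0..L}"
  shows "- (M * L / y1 + M * L / (L - y1)) \<le> f y" "f y \<le> M"
proof -
  have L: "0 < L" using y1 by linarith
  have nn: "0 \<le> M * L / y1" "0 \<le> M * L / (L - y1)" using y1 M L by auto
  show "f y \<le> M"
  proof -
    have "f ((1 - y / L) *\<^sub>R 0 + (y / L) *\<^sub>R L) \<le> (1 - y / L) * f 0 + (y / L) * f L"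
      using y L by (intro convex_onD[OF f]) auto
    also have "\<dots> \<le> (1 - y / L) * M + (y / L) * M"
      using y L M by (intro add_mono mult_left_mono) auto
    also have "\<dots> = M" by (simp add: algebra_simps)
    finally show ?thesis using L by simp
  qed
  show "- (M * L / y1 + M * L / (L - y1)) \<le> f y"
  proof (cases "y1 \<le> y")
    case True
    then have y0: "0 < y" using y1 by linarith
    have "f ((1 - y1 / y) *\<^sub>R 0 + (y1 / y) *\<^sub>R y) \<le> (1 - y1 / y) * f 0 + (y1 / y) * f y"
      using y y1 y0 True L by (intro convex_onD[OF f]) auto
    then have "0 \<le> (1 - y1 / y) * f 0 + (y1 / y) * f y" using y0 M by simp
    also have "(1 - y1 / y) * f 0 \<le> 1 * M" using True y0 y1 M
      by (intro order_trans[OF mult_left_mono[of "f 0" M] mult_right_mono]) auto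
    finally have "- (M * y / y1) \<le> f y" using y0 y1 by (simp add: field_simps)
    moreover have "M * y / y1 \<le> M * L / y1" using y y1 M by (intro divide_right_mono mult_left_mono) auto
    ultimately show ?thesis using nn by linarith
  next
    case False
    then have yL: "0 < L - y" using y1 by linarith
    let ?l = "(L - y1) / (L - y)"
    have l: "0 < ?l" "?l \<le> 1" using False y1 yL by auto
    have eq: "(1 - ?l) *\<^sub>R L + ?l *\<^sub>R y = y1"
    proof -
      have k: "(1 - k) * L + k * y = L - k * (L - y)" for k by (simp add: algebra_simps)
      have h: "?l * (L - y) = L - y1" using yL by simp
      show ?thesis unfolding real_scaleR_def k h by simp
    qed
    have "f ((1 - ?l) *\<^sub>R L + ?l *\<^sub>R y) \<le> (1 - ?l) * f L + ?l * f y"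
      using y l L by (intro convex_onD[OF f]) auto
    then have "0 \<le> (1 - ?l) * f L + ?l * f y" using M unfolding eq by linarith
    also have "(1 - ?l) * f L \<le> 1 * M" using l M
      by (intro order_trans[OF mult_left_mono[of "f L" M] mult_right_mono]) auto
    finally have "- M \<le> f y * ?l" by (simp add: mult.commute)
    then have "- M / ?l \<le> f y" using l(1) by (simp only: pos_divide_le_eq)
    moreover have "M / ?l = M * (L - y) / (L - y1)" by simp
    moreover have "M * (L - y) / (L - y1) \<le> M * L / (L - y1)" using y y1 M by (intro divide_right_mono mult_left_mono) auto
    ultimately show ?thesis using nn by simp
  qed
qed

text \<open>The convex function f is tied to q only at the values of
  \<open>arc_length G \<gamma>\<close>. One such value strictly between 0 and the total length
  bounds f from below by convexity; if there is none, f is replaced by the linear interpolation of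
  its end values. The constant depends on the path and on M but not on q, as the selection of
  subsequences demands.\<close>

lemma convex_on_path_bounded:
  assumes G: "compact_metric_graph G" and path: "graph_path G \<gamma>" and M: "0 \<le> M"
  obtains C where "\<And>q. q \<in> bounded_potentials G M \<Longrightarrow> convex_on_path G \<gamma> q \<Longrightarrow>
    \<exists>f. convex_on {0..arc_length G \<gamma> 1} f \<and> (\<forall>t\<in>{0..1}. q (\<gamma> t) = f (arc_length G \<gamma> t)) \<and>
      (\<forall>y\<in>{0..arc_length G \<gamma> 1}. \<bar>f y\<bar> \<le> C)"
proof -
  let ?a = "arc_length G \<gamma>" and ?L = "arc_length G \<gamma> 1"
  have pathin: "pathin (graph_topology G) \<gamma>" using path by (simp add: graph_path_def)
  have rng: "?a t \<in> {0..?L}" if "t \<in> {0..1}" for t by (rule arc_length_range[OF G pathin that])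
  have \<gamma>: "\<gamma> t \<in> points G" if "t \<in> {0..1}" for t
    using pathin that continuous_map_image_subset_topspace[of "top_of_set {0..1}" "graph_topology G" \<gamma>] by (auto simp: pathin_def)
  have qb: "0 \<le> q (\<gamma> t)" "q (\<gamma> t) \<le> M" if "q \<in> bounded_potentials G M" "t \<in> {0..1}" for q t
    using that \<gamma> by (auto simp: bounded_potentials_def)
  show thesis
  proof (cases "\<exists>t\<in>{0..1}. 0 < ?a t \<and> ?a t < ?L")
    case True
    then obtain t1 where t1: "t1 \<in> {0..1}" "0 < ?a t1" "?a t1 < ?L" by blast
    show thesis
    proof (rule that)
      fix q assume q: "q \<in> bounded_potentials G M" and "convex_on_path G \<gamma> q"
      then obtain f where f: "convex_on {0..?L} f" "\<And>t. t \<in> {0..1} \<Longrightarrow> q (\<gamma> t) = f (?a t)" by (auto simp: convex_on_path_def)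
      have v: "0 \<le> f (?a t1)" "f 0 \<le> M" "f ?L \<le> M"
        using f(2)[of t1] f(2)[of 0] f(2)[of 1] qb[OF q, of t1] qb[OF q, of 0] qb[OF q, of 1] t1(1) arc_length_0[OF G, of \<gamma>] by auto
      have "\<bar>f y\<bar> \<le> M + (M * ?L / ?a t1 + M * ?L / (?L - ?a t1))" if "y \<in> {0..?L}" for y
      proof -
        have "0 \<le> M * ?L / ?a t1" "0 \<le> M * ?L / (?L - ?a t1)" using t1 M by auto
        then show ?thesis using convex_lower_bound[OF f(1) t1(2,3) v M that] M by linarith
      qed
      then show "\<exists>f. convex_on {0..?L} f \<and> (\<forall>t\<in>{0..1}. q (\<gamma> t) = f (?a t)) \<and>
        (\<forall>y\<in>{0..?L}. \<bar>f y\<bar> \<le> M + (M * ?L / ?a t1 + M * ?L / (?L - ?a t1)))" using f by blast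
    qed
  next
    case False
    then have ends: "?a t = 0 \<or> ?a t = ?L" if "t \<in> {0..1}" for t using rng[OF that] that by force
    show thesis
    proof (rule that)
      fix q assume q: "q \<in> bounded_potentials G M" and "convex_on_path G \<gamma> q"
      then obtain f where f: "convex_on {0..?L} f" "\<And>t. t \<in> {0..1} \<Longrightarrow> q (\<gamma> t) = f (?a t)" by (auto simp: convex_on_path_def)
      have v: "0 \<le> f 0" "f 0 \<le> M" "0 \<le> f ?L" "f ?L \<le> M"
        using f(2)[of 0] f(2)[of 1] qb[OF q, of 0] qb[OF q, of 1] arc_length_0[OF G, of \<gamma>] by auto
      define g where "g y = f 0 + (f ?L - f 0) * (y / ?L)" for y
      have "convex_on {0..?L} g"
        by (rule convex_onI) (auto simp: g_def algebra_simps add_divide_distrib diff_divide_distrib)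
      moreover have "q (\<gamma> t) = g (?a t)" if "t \<in> {0..1}" for t
        using ends[OF that] f(2)[OF that] by (cases "?L = 0") (auto simp: g_def)
      moreover have "\<bar>g y\<bar> \<le> M" if y: "y \<in> {0..?L}" for y
      proof (cases "?L = 0")
        case False
        then have L: "0 < ?L" using y by auto
        have s: "0 \<le> y / ?L" "y / ?L \<le> 1" using y L by auto
        have "g y = (1 - y / ?L) * f 0 + (y / ?L) * f ?L" by (simp add: g_def algebra_simps)
        moreover have "0 \<le> (1 - y / ?L) * f 0 + (y / ?L) * f ?L" using s v by (intro add_nonneg_nonneg mult_nonneg_nonneg) auto
        moreover have "(1 - y / ?L) * f 0 + (y / ?L) * f ?L \<le> (1 - y / ?L) * M + (y / ?L) * M"
          using s v by (intro add_mono mult_left_mono) auto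
        moreover have "(1 - y / ?L) * M + (y / ?L) * M = M" by (simp add: algebra_simps)
        ultimately show ?thesis by linarith
      qed (use v in \<open>simp add: g_def\<close>)
      ultimately show "\<exists>f. convex_on {0..?L} f \<and> (\<forall>t\<in>{0..1}. q (\<gamma> t) = f (?a t)) \<and> (\<forall>y\<in>{0..?L}. \<bar>f y\<bar> \<le> M)" by blast
    qed
  qed
qed

text \<open>The point b is a convex combination of a and a point c at distance \<delta> beyond b. So
  the slope from a to b is at most the slope from a to c, which is controlled by C and
  \<delta>.\<close>

lemma convex_Lipschitz:
  fixes f :: "real \<Rightarrow> real"
  assumes f: "convex_on {0..L} f" and C: "\<And>y. y \<in> {0..L} \<Longrightarrow> \<bar>f y\<bar> \<le> C"
    and d: "0 < \<delta>" "\<delta> \<le> y" "y \<le> z" "z \<le> L - \<delta>"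
  shows "\<bar>f z - f y\<bar> \<le> 2 * C / \<delta> * (z - y)"
proof -
  have C0: "0 \<le> C" using C[of y] d by fastforce
  have *: "f b - f a \<le> 2 * C / \<delta> * \<bar>b - a\<bar>"
    if that: "a \<in> {0..L}" "c \<in> {0..L}" and dist: "\<bar>c - b\<bar> = \<delta>" "\<bar>c - a\<bar> = \<bar>c - b\<bar> + \<bar>b - a\<bar>" for a b c
  proof -
    let ?l = "\<bar>b - a\<bar> / (\<bar>b - a\<bar> + \<delta>)"
    have l: "0 \<le> ?l" "?l \<le> 1" using d(1) by (auto simp: divide_simps)
    have l3: "?l \<le> \<bar>b - a\<bar> / \<delta>" using d(1) by (intro divide_left_mono) (auto intro: mult_pos_pos add_nonneg_pos)
    have "?l * (c - a) = b - a"
    proof -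
      consider "a = b" | "a < b" "c - a = \<bar>b - a\<bar> + \<delta>" | "b < a" "c - a = - (\<bar>b - a\<bar> + \<delta>)"
        using dist d(1) by linarith
      then show ?thesis
      proof cases
        case 2
        have "?l * (\<bar>b - a\<bar> + \<delta>) = \<bar>b - a\<bar>" using d(1) by simp
        then have "?l * (c - a) = \<bar>b - a\<bar>" unfolding 2(2) .
        also have "\<dots> = b - a" using 2(1) by simp
        finally show ?thesis .
      next
        case 3
        have "?l * (\<bar>b - a\<bar> + \<delta>) = \<bar>b - a\<bar>" using d(1) by simp
        then have "?l * (c - a) = - \<bar>b - a\<bar>" unfolding 3(2) mult_minus_right by (rule arg_cong)
        also have "\<dots> = b - a" using 3(1) by simp
        finally show ?thesis .
      qed simp
    qed
    then have h: "?l * (c - a) = b - a" .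
    have k: "(1 - k) * a + k * c = a + k * (c - a)" for k by (simp add: algebra_simps)
    have eq: "(1 - ?l) *\<^sub>R a + ?l *\<^sub>R c = b" unfolding real_scaleR_def k h by simp
    have "f b \<le> (1 - ?l) * f a + ?l * f c"
      using convex_onD[OF f l(1,2) that(1,2)] unfolding eq .
    moreover have "v - p \<le> k * (r - p)" if "v \<le> (1 - k) * p + k * r" for v p k r :: real
      using that by (simp add: algebra_simps)
    ultimately have "f b - f a \<le> ?l * (f c - f a)" by blast
    also have "\<dots> \<le> ?l * (2 * C)" using l C[OF that(1)] C[OF that(2)] by (intro mult_left_mono) auto
    also have "\<dots> \<le> \<bar>b - a\<bar> / \<delta> * (2 * C)" using l3 C0 by (intro mult_right_mono) auto
    finally show ?thesis by (simp add: mult.commute)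
  qed
  have "f z - f y \<le> 2 * C / \<delta> * \<bar>z - y\<bar>" by (rule *[of y "z + \<delta>"]) (use d in auto)
  moreover have "f y - f z \<le> 2 * C / \<delta> * \<bar>y - z\<bar>" by (rule *[of z "y - \<delta>"]) (use d in auto)
  ultimately show ?thesis using d by (simp add: abs_le_iff)
qed

text \<open>Away from the ends the functions are equi-Lipschitz, so convergence at rational points
  suffices. The Lipschitz constants degenerate at the ends, and these are added to the countable
  set.\<close>

lemma convex_selection:
  fixes f :: "nat \<Rightarrow> real \<Rightarrow> real"
  assumes f: "\<And>n. convex_on {0..L} (f n)" and C: "\<And>n y. y \<in> {0..L} \<Longrightarrow> \<bar>f n y\<bar> \<le> C"
  obtains r where "strict_mono r" "\<And>y. y \<in> {0..L} \<Longrightarrow> convergent (\<lambda>n. f (r n) y)"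
proof -
  have "countable ((\<rat> \<union> {0, L}) \<inter> {0..L})" by (intro countable_Int1 countable_Un countable_rat) simp
  then obtain r where r: "strict_mono r" "\<And>y. y \<in> (\<rat> \<union> {0, L}) \<inter> {0..L} \<Longrightarrow> convergent (\<lambda>n. f (r n) y)"
    using bounded_convergent_selection[of "(\<rat> \<union> {0, L}) \<inter> {0..L}" "\<lambda>y n. f n y" "\<lambda>_. C"] C by blast
  have "convergent (\<lambda>n. f (r n) y)" if y: "y \<in> {0..L}" for y
  proof (cases "y = 0 \<or> y = L")
    case True
    then show ?thesis using r(2)[of y] y by auto
  next
    case False
    define \<delta> where "\<delta> = min y (L - y) / 2"
    have \<delta>: "0 < \<delta>" "\<delta> \<le> y" "y < L - \<delta>" using False y by (auto simp: \<delta>_def min_def field_simps)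
    have C0: "0 \<le> C" using C[OF y, of 0] by linarith
    show ?thesis
    proof (rule convergent_approximation)
      fix \<epsilon> :: real assume \<epsilon>: "\<epsilon> > 0"
      \<comment> \<open>The summand 1 keeps the constant positive when C = 0.\<close>
      let ?K = "2 * C / \<delta> + 1"
      have K: "0 < ?K" using C0 \<delta>(1) by (simp add: add_nonneg_pos)
      have "y < min (L - \<delta>) (y + \<epsilon> / ?K)" using \<delta> \<epsilon> K by simp
      then obtain z where z: "z \<in> \<rat>" "y < z" "z < min (L - \<delta>) (y + \<epsilon> / ?K)" using Rats_dense_in_real by blast
      have "\<bar>f (r n) y - f (r n) z\<bar> \<le> \<epsilon>" for n
      proof -
        have "\<bar>f (r n) z - f (r n) y\<bar> \<le> 2 * C / \<delta> * (z - y)"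
          by (rule convex_Lipschitz[OF f C]) (use \<delta> z in auto)
        also have "\<dots> \<le> ?K * (\<epsilon> / ?K)" using z K C0 \<delta> by (intro mult_mono) auto
        also have "\<dots> = \<epsilon>" using K by simp
        finally show ?thesis by (simp add: abs_minus_commute)
      qed
      moreover have "convergent (\<lambda>n. f (r n) z)" using r(2)[of z] z \<delta> y by auto
      ultimately show "\<exists>Y. convergent Y \<and> (\<forall>n. \<bar>f (r n) y - Y n\<bar> \<le> \<epsilon>)" by blast
    qed
  qed
  then show thesis using that r(1) by blast
qed

lemma convex_limit:
  fixes f :: "nat \<Rightarrow> real \<Rightarrow> real"
  assumes f: "\<And>n. convex_on S (f n)" and lim: "\<And>y. y \<in> S \<Longrightarrow> (\<lambda>n. f n y) \<longlonglongrightarrow> F y"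
  shows "convex_on S F"
proof -
  have S: "convex S" using f[of 0] by (rule convex_on_imp_convex)
  show ?thesis
  proof (rule convex_onI)
    fix t x y :: real assume t: "0 < t" "t < 1" and xy: "x \<in> S" "y \<in> S"
    have m: "(1 - t) *\<^sub>R x + t *\<^sub>R y \<in> S" using S t xy by (simp add: convex_alt)
    show "F ((1 - t) *\<^sub>R x + t *\<^sub>R y) \<le> (1 - t) * F x + t * F y"
    proof (rule LIMSEQ_le[OF lim[OF m]])
      show "(\<lambda>n. (1 - t) * f n x + t * f n y) \<longlonglongrightarrow> (1 - t) * F x + t * F y" by (intro tendsto_intros lim xy)
      show "\<exists>N. \<forall>n\<ge>N. f n ((1 - t) *\<^sub>R x + t *\<^sub>R y) \<le> (1 - t) * f n x + t * f n y"
        using convex_onD[OF f] t xy by auto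
    qed
  qed (rule S)
qed

theorem convex_potentials_compact:
  fixes qs :: "nat \<Rightarrow> ('v, 'e) point \<Rightarrow> real"
  assumes G: "compact_metric_graph G" and P: "finite \<P>" "\<And>\<gamma>. \<gamma> \<in> \<P> \<Longrightarrow> graph_path G \<gamma>" and M: "0 \<le> M"
    and qs: "\<And>n. qs n \<in> convex_potentials G \<P> M"
  obtains r q where "strict_mono r" "q \<in> convex_potentials G \<P> M" "weakly_converges G (\<lambda>n. qs (r n)) q"
proof -
  have fin: "finite (edges G)" using G by (simp add: compact_metric_graph_def)
  have qb: "qs n \<in> bounded_potentials G M" and qc: "\<gamma> \<in> \<P> \<Longrightarrow> convex_on_path G \<gamma> (qs n)" for n \<gamma>
    using qs by (auto simp: convex_potentials_def)
  have "\<exists>C. \<forall>n. \<exists>f. convex_on {0..arc_length G \<gamma> 1} f \<and> (\<forall>t\<in>{0..1}. qs n (\<gamma> t) = f (arc_length G \<gamma> t)) \<and>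
      (\<forall>y\<in>{0..arc_length G \<gamma> 1}. \<bar>f y\<bar> \<le> C)" if \<gamma>: "\<gamma> \<in> \<P>" for \<gamma>
  proof -
    obtain C where "\<And>q. q \<in> bounded_potentials G M \<Longrightarrow> convex_on_path G \<gamma> q \<Longrightarrow>
      \<exists>f. convex_on {0..arc_length G \<gamma> 1} f \<and> (\<forall>t\<in>{0..1}. q (\<gamma> t) = f (arc_length G \<gamma> t)) \<and>
      (\<forall>y\<in>{0..arc_length G \<gamma> 1}. \<bar>f y\<bar> \<le> C)"
      using convex_on_path_bounded[OF G P(2)[OF \<gamma>] M] by blast
    then show ?thesis using qb qc[OF \<gamma>] by (intro exI[of _ C]) blast
  qed
  then obtain C where "\<forall>\<gamma>\<in>\<P>. \<forall>n. \<exists>f. convex_on {0..arc_length G \<gamma> 1} f \<and> (\<forall>t\<in>{0..1}. qs n (\<gamma> t) = f (arc_length G \<gamma> t)) \<and>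
      (\<forall>y\<in>{0..arc_length G \<gamma> 1}. \<bar>f y\<bar> \<le> C \<gamma>)" by metis
  then obtain f where f: "\<And>\<gamma> n. \<gamma> \<in> \<P> \<Longrightarrow> convex_on {0..arc_length G \<gamma> 1} (f \<gamma> n) \<and>
      (\<forall>t\<in>{0..1}. qs n (\<gamma> t) = f \<gamma> n (arc_length G \<gamma> t)) \<and> (\<forall>y\<in>{0..arc_length G \<gamma> 1}. \<bar>f \<gamma> n y\<bar> \<le> C \<gamma>)" by metis
  obtain r1 where r1: "strict_mono r1" "\<And>\<gamma>. \<gamma> \<in> \<P> \<Longrightarrow> \<forall>y\<in>{0..arc_length G \<gamma> 1}. convergent (\<lambda>n. f \<gamma> (r1 n) y)"
  proof (rule diagonal_selection[OF countable_finite[OF P(1)], where P = "\<lambda>\<gamma> s. \<forall>y\<in>{0..arc_length G \<gamma> 1}. convergent (\<lambda>n. f \<gamma> (s n) y)"])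
    fix \<gamma> and s :: "nat \<Rightarrow> nat" assume \<gamma>: "\<gamma> \<in> \<P>"
    obtain r where "strict_mono r" "\<And>y. y \<in> {0..arc_length G \<gamma> 1} \<Longrightarrow> convergent (\<lambda>n. f \<gamma> (s (r n)) y)"
      by (rule convex_selection[of "arc_length G \<gamma> 1" "\<lambda>n. f \<gamma> (s n)" "C \<gamma>"]) (use f[OF \<gamma>] in auto)
    then show "\<exists>r. strict_mono r \<and> (\<forall>y\<in>{0..arc_length G \<gamma> 1}. convergent (\<lambda>n. f \<gamma> ((s \<circ> r) n) y))" by auto
  next
    show "\<forall>y\<in>{0..arc_length G \<gamma> 1}. convergent (\<lambda>n. f \<gamma> ((s \<circ> r) n) y)"
      if "\<forall>y\<in>{0..arc_length G \<gamma> 1}. convergent (\<lambda>n. f \<gamma> (s n) y)" "strict_mono r" for \<gamma> and s r :: "nat \<Rightarrow> nat"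
      using that convergent_comp[OF _ that(2)] by (auto simp: o_def)
    show "\<forall>y\<in>{0..arc_length G \<gamma> 1}. convergent (\<lambda>n. f \<gamma> (s n) y)"
      if "\<forall>y\<in>{0..arc_length G \<gamma> 1}. convergent (\<lambda>n. f \<gamma> ((s \<circ> (+) m) n) y)" for \<gamma> m and s :: "nat \<Rightarrow> nat"
      using that convergent_tail[of "\<lambda>n. f \<gamma> (s n) y" m for y] by (auto simp: o_def)
  qed blast
  obtain r2 where r2: "strict_mono r2" "\<And>e. e \<in> edges G \<Longrightarrow> \<exists>g. weak_limit_on_edge G M (\<lambda>n. qs (r1 (r2 n))) e g"
    using weak_limit_selection[OF fin qb M, of r1] by blast
  define r where "r n = r1 (r2 n)" for n
  have r: "strict_mono r" using strict_mono_o[OF r1(1) r2(1)] by (simp add: r_def[abs_def] o_def)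
  have conv: "convergent (\<lambda>n. f \<gamma> (r n) y)" if "\<gamma> \<in> \<P>" "y \<in> {0..arc_length G \<gamma> 1}" for \<gamma> y
    unfolding r_def using r1(2)[OF that(1)] that(2) convergent_comp[OF _ r2(1)] by blast
  obtain q where q: "q \<in> bounded_potentials G M" "weakly_converges G (\<lambda>n. qs (r n)) q"
    "\<And>p. convergent (\<lambda>n. qs (r n) p) \<Longrightarrow> q p = lim (\<lambda>n. qs (r n) p)"
    by (rule weak_limit_potential[of "\<lambda>n. qs (r n)" G M]) (use qb M r2(2) in \<open>auto simp: r_def\<close>)
  have "convex_on_path G \<gamma> q" if \<gamma>: "\<gamma> \<in> \<P>" for \<gamma>
    unfolding convex_on_path_def
  proof (intro exI conjI ballI)
    show "convex_on {0..arc_length G \<gamma> 1} (\<lambda>y. lim (\<lambda>n. f \<gamma> (r n) y))"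
      by (rule convex_limit[of _ "\<lambda>n. f \<gamma> (r n)"]) (use f[OF \<gamma>] conv[OF \<gamma>] in \<open>auto simp: convergent_LIMSEQ_iff\<close>)
    fix t :: real assume t: "t \<in> {0..1}"
    have "arc_length G \<gamma> t \<in> {0..arc_length G \<gamma> 1}"
      using P(2)[OF \<gamma>] t by (intro arc_length_range[OF G]) (auto simp: graph_path_def)
    moreover have eq: "(\<lambda>n. qs (r n) (\<gamma> t)) = (\<lambda>n. f \<gamma> (r n) (arc_length G \<gamma> t))" using f[OF \<gamma>] t by auto
    ultimately have "convergent (\<lambda>n. qs (r n) (\<gamma> t))" using conv[OF \<gamma>] by simp
    \<comment> \<open>At each point of the path the potentials converge, so q is the pointwise limit
      there and not merely a weak limit.\<close>
    then show "q (\<gamma> t) = lim (\<lambda>n. f \<gamma> (r n) (arc_length G \<gamma> t))" using q(3) eq by simp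
  qed
  then have "q \<in> convex_potentials G \<P> M" using q(1) by (simp add: convex_potentials_def)
  then show thesis using that r q(2) by blast
qed

section \<open>Limits of single-well potentials\<close>

text \<open>The limits at rational points define a monotone function F, and the sequence converges
  to F wherever F is continuous. At most countably many points remain; a second selection takes care
  of them and of the ends, so that convergence holds at every point.\<close>

lemma helly_selection_mono:
  fixes f :: "nat \<Rightarrow> real \<Rightarrow> real"
  assumes mono: "\<And>n. mono_on {a..b} (f n)" and bound: "\<And>n x. x \<in> {a..b} \<Longrightarrow> \<bar>f n x\<bar> \<le> C"
  obtains r where "strict_mono r" "\<And>x. x \<in> {a..b} \<Longrightarrow> convergent (\<lambda>n. f (r n) x)"
proof -
  have "countable ({a..b} \<inter> \<rat>)" by (rule countable_subset[OF _ countable_rat]) auto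
  then obtain r where r: "strict_mono r" "\<And>x. x \<in> {a..b} \<inter> \<rat> \<Longrightarrow> convergent (\<lambda>n. f (r n) x)"
    using bounded_convergent_selection[of "{a..b} \<inter> \<rat>" "\<lambda>x n. f n x" "\<lambda>_. C"] bound by (metis IntD1)
  define F where "F x = (SUP z\<in>{z \<in> {a..b} \<inter> \<rat>. z \<le> x}. lim (\<lambda>n. f (r n) z))" for x
  define D where "D = {x \<in> {a<..<b}. \<not> convergent (\<lambda>n. f (r n) x)}"
  have lim: "(\<lambda>n. f (r n) z) \<longlonglongrightarrow> lim (\<lambda>n. f (r n) z)" if "z \<in> {a..b} \<inter> \<rat>" for z
    using r(2)[OF that] by (simp add: convergent_LIMSEQ_iff)
  have lim_bound: "lim (\<lambda>n. f (r n) z) \<le> C" if "z \<in> {a..b} \<inter> \<rat>" for z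
    using LIMSEQ_le_const2[OF lim[OF that], of C] bound[of z] that by (auto simp: abs_le_iff)
  have lim_mono: "lim (\<lambda>n. f (r n) z) \<le> lim (\<lambda>n. f (r n) z')" if "z \<in> {a..b} \<inter> \<rat>" "z' \<in> {a..b} \<inter> \<rat>" "z \<le> z'" for z z'
    by (rule LIMSEQ_le[OF lim[OF that(1)] lim[OF that(2)]]) (use mono_onD[OF mono] that in auto)
  have ne: "{z \<in> {a..b} \<inter> \<rat>. z \<le> x} \<noteq> {}" if "x \<in> {a<..<b}" for x
  proof -
    have ax: "a < x" using that by simp
    obtain z where "z \<in> \<rat>" "a < z" "z < x" using Rats_dense_in_real[OF ax] by blast
    then show ?thesis using that by auto
  qed
  have Flow: "lim (\<lambda>n. f (r n) z) \<le> F x" if "z \<in> {a..b} \<inter> \<rat>" "z \<le> x" for z x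
    unfolding F_def by (rule cSUP_upper) (use that lim_bound in \<open>auto intro!: bdd_aboveI2[where M = C]\<close>)
  have Fup: "F x \<le> lim (\<lambda>n. f (r n) z)" if "z \<in> {a..b} \<inter> \<rat>" "x \<le> z" "x \<in> {a<..<b}" for z x
    unfolding F_def by (rule cSUP_least[OF ne[OF that(3)]]) (use that in \<open>auto intro!: lim_mono\<close>)
  have Fmono: "mono_on {a<..<b} F"
  proof (rule mono_onI)
    fix x y assume "x \<in> {a<..<b}" "y \<in> {a<..<b}" "x \<le> y"
    then show "F x \<le> F y" unfolding F_def
      by (intro cSUP_subset_mono ne) (use lim_bound in \<open>auto intro!: bdd_aboveI2[where M = C]\<close>)
  qed
  have "convergent (\<lambda>n. f (r n) x)" if x: "x \<in> {a<..<b}" "continuous (at x within {a<..<b}) F" for x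
  proof -
    have "isCont F x" using x by (simp add: at_within_open[of x "{a<..<b}"])
    have "(\<lambda>n. f (r n) x) \<longlonglongrightarrow> F x"
    proof (rule order_tendstoI)
      fix c assume c: "c < F x"
      have "\<forall>\<^sub>F y in at x. c < F y" using \<open>isCont F x\<close> c by (simp add: isCont_def order_tendstoD)
      then obtain d where d: "d > 0" "\<And>y. y \<noteq> x \<Longrightarrow> dist y x < d \<Longrightarrow> c < F y" by (auto simp: eventually_at)
      have "max a (x - d) < x" using x d by auto
      then obtain y where y: "max a (x - d) < y" "y < x" using dense by blast
      obtain z where z: "z \<in> \<rat>" "y < z" "z < x" using Rats_dense_in_real[OF y(2)] by blast
      have zI: "z \<in> {a..b} \<inter> \<rat>" using x y z by auto
      have "c < F y" using d(2)[of y] y by (auto simp: dist_real_def)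
      also have "\<dots> \<le> lim (\<lambda>n. f (r n) z)" using Fup[OF zI, of y] x y z by auto
      finally have "\<forall>\<^sub>F n in sequentially. c < f (r n) z" using order_tendstoD(1)[OF lim[OF zI]] by blast
      then show "\<forall>\<^sub>F n in sequentially. c < f (r n) x"
      proof eventually_elim
        case (elim n)
        also have "f (r n) z \<le> f (r n) x" using mono_onD[OF mono] zI x z by auto
        finally show ?case .
      qed
    next
      fix c assume c: "F x < c"
      have "\<forall>\<^sub>F y in at x. F y < c" using \<open>isCont F x\<close> c by (simp add: isCont_def order_tendstoD)
      then obtain d where d: "d > 0" "\<And>y. y \<noteq> x \<Longrightarrow> dist y x < d \<Longrightarrow> F y < c" by (auto simp: eventually_at)
      have "x < min b (x + d)" using x d by auto
      then obtain y where y: "x < y" "y < min b (x + d)" using dense by blast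
      obtain z where z: "z \<in> \<rat>" "x < z" "z < y" using Rats_dense_in_real[OF y(1)] by blast
      have zI: "z \<in> {a..b} \<inter> \<rat>" using x y z by auto
      have "lim (\<lambda>n. f (r n) z) \<le> F y" using Flow[OF zI, of y] z by auto
      also have "\<dots> < c" using d(2)[of y] y by (auto simp: dist_real_def)
      finally have "\<forall>\<^sub>F n in sequentially. f (r n) z < c" using order_tendstoD(2)[OF lim[OF zI]] by blast
      then show "\<forall>\<^sub>F n in sequentially. f (r n) x < c"
      proof eventually_elim
        case (elim n)
        have "f (r n) x \<le> f (r n) z" using mono_onD[OF mono] zI x z by auto
        also note elim
        finally show ?case .
      qed
    qed
    then show ?thesis by (auto simp: convergent_def)
  qed
  then have "D \<subseteq> {x \<in> {a<..<b}. \<not> continuous (at x within {a<..<b}) F}" by (auto simp: D_def)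
  then have "countable D" by (rule countable_subset[OF _ mono_on_ctble_discont[OF Fmono]])
  then have "countable ((D \<union> {a, b}) \<inter> {a..b})" by auto
  then obtain r' where r': "strict_mono r'" "\<And>x. x \<in> (D \<union> {a, b}) \<inter> {a..b} \<Longrightarrow> convergent (\<lambda>n. f (r (r' n)) x)"
    using bounded_convergent_selection[of "(D \<union> {a, b}) \<inter> {a..b}" "\<lambda>x n. f (r n) x" "\<lambda>_. C"] bound by (metis IntD2)
  show thesis
  proof (rule that)
    show "strict_mono (r \<circ> r')" using r(1) r'(1) by (simp add: strict_mono_o)
    show "convergent (\<lambda>n. f ((r \<circ> r') n) x)" if x: "x \<in> {a..b}" for x
    proof (cases "x \<in> D \<union> {a, b}")
      case True then show ?thesis using r'(2) x by simp
    next
      case False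
      then have "convergent (\<lambda>n. f (r n) x)" using x by (auto simp: D_def)
      from convergent_comp[OF this r'(1)] show ?thesis by simp
    qed
  qed
qed

text \<open>A point strictly inside a segment of T has at least the two directions along the
  segment, so its degree is not 1. Finiteness permits a subsequence that converges at all boundary
  points.\<close>

lemma finite_boundary:
  assumes G: "compact_metric_graph G" and T: "subgraph G T"
  shows "finite (boundary_of G T)"
proof -
  obtain S where S1: "finite S" and S2: "\<forall>(e, a, b)\<in>S. e \<in> edges G \<and> 0 \<le> a \<and> a \<le> b \<and> b \<le> len G e"
    and T_eq: "T = (\<Union>(e, a, b)\<in>S. place G e ` {a..b})"
    using T unfolding subgraph_def by (elim exE conjE) (rule that)
  have "boundary_of G T \<subseteq> (\<Union>(e, a, b)\<in>S. {place G e a, place G e b, Vertex (src G e), Vertex (tgt G e)})"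
  proof
    fix p assume p: "p \<in> boundary_of G T"
    then obtain e a b x where x: "(e, a, b) \<in> S" "x \<in> {a..b}" "p = place G e x" unfolding boundary_of_def T_eq by auto
    have s: "e \<in> edges G" "0 \<le> a" "b \<le> len G e" using bspec[OF S2 x(1)] by auto
    have "x = a \<or> x = b"
    proof (rule ccontr)
      assume "\<not> (x = a \<or> x = b)"
      then have ab: "a < x" "x < b" using x by auto
      define A where "A = {(e, x, \<sigma>). e \<in> edges G \<and> x \<in> {0..len G e} \<and> place G e x = p \<and> \<sigma> \<in> {-1, 1} \<and>
        (\<exists>\<epsilon>>0. \<forall>t\<in>{0<..<\<epsilon>}. x + \<sigma> * t \<in> {0..len G e} \<and> place G e (x + \<sigma> * t) \<in> T)}"
      have "(e, x, \<sigma>) \<in> A" if "\<sigma> \<in> {-1, 1 :: real}" for \<sigma>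
      proof -
        have "\<forall>t\<in>{0<..<min (x - a) (b - x)}. x + \<sigma> * t \<in> {0..len G e} \<and> place G e (x + \<sigma> * t) \<in> T"
        proof
          fix t assume t: "t \<in> {0<..<min (x - a) (b - x)}"
          then have "x + \<sigma> * t \<in> {a..b}" using that by auto
          then show "x + \<sigma> * t \<in> {0..len G e} \<and> place G e (x + \<sigma> * t) \<in> T" using s x(1) unfolding T_eq by fastforce
        qed
        moreover have "0 < min (x - a) (b - x)" using ab by auto
        ultimately have "\<exists>\<epsilon>>0. \<forall>t\<in>{0<..<\<epsilon>}. x + \<sigma> * t \<in> {0..len G e} \<and> place G e (x + \<sigma> * t) \<in> T" by blast
        moreover have "x \<in> {0..len G e}" using s x(2) by auto
        ultimately show ?thesis unfolding A_def using that s(1) x(3) by blast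
      qed
      then have "(e, x, -1) \<in> A" "(e, x, 1) \<in> A" by auto
      moreover have "card A = 1" using p by (simp add: boundary_of_def degree_in_def A_def)
      ultimately show False by (auto simp: card_1_singleton_iff)
    qed
    then show "p \<in> (\<Union>(e, a, b)\<in>S. {place G e a, place G e b, Vertex (src G e), Vertex (tgt G e)})"
      using x by (auto intro!: bexI[of _ "(e, a, b)"])
  qed
  then show ?thesis by (rule finite_subset) (use S1 in auto)
qed

section \<open>Rerouting a path to a nearby end point\<close>

lemma pathin_join:
  assumes \<gamma>: "pathin X \<gamma>" and \<sigma>: "pathin X \<sigma>" and c: "0 \<le> c" "c \<le> 1" and eq: "\<gamma> c = \<sigma> 0"
  shows "pathin X (\<lambda>r. if r \<le> 1 / 2 then \<gamma> (2 * c * r) else \<sigma> (2 * r - 1))"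
  unfolding pathin_def
proof (rule continuous_map_cases_le)
  show "continuous_map (subtopology (top_of_set {0..1}) {x \<in> topspace (top_of_set {0..1}). x \<le> 1 / 2}) X (\<lambda>r. \<gamma> (2 * c * r))"
  proof (rule continuous_map_compose[OF _ \<gamma>[unfolded pathin_def], unfolded o_def])
    have "2 * c * r \<le> 1" if "r \<le> 1 / 2" "0 \<le> r" for r using mult_mono[of c 1 r "1/2"] that c by simp
    then show "continuous_map (subtopology (top_of_set {0..1}) {x \<in> topspace (top_of_set {0..1}). x \<le> 1 / 2}) (top_of_set {0..1}) (\<lambda>r. 2 * c * r)"
      using c by (auto simp: subtopology_subtopology intro!: continuous_intros)
  qed
  show "continuous_map (subtopology (top_of_set {0..1}) {x \<in> topspace (top_of_set {0..1}). 1 / 2 \<le> x}) X (\<lambda>r. \<sigma> (2 * r - 1))"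
    by (rule continuous_map_compose[OF _ \<sigma>[unfolded pathin_def], unfolded o_def])
       (auto simp: subtopology_subtopology intro!: continuous_intros)
  show "\<gamma> (2 * c * r) = \<sigma> (2 * r - 1)" if "r = 1 / 2" for r unfolding that using eq by simp
qed auto

text \<open>The only points of an edge that \<open>place\<close> can identify are the two ends of a
  loop, which are \<open>len G e\<close> apart.\<close>

lemma place_inj_near:
  assumes "place G e u = place G e v" "u \<in> {0..len G e}" "v \<in> {0..len G e}" "\<bar>u - v\<bar> < len G e"
  shows "u = v"
  using assms by (auto simp: place_def split: if_splits)


text \<open>The path is followed up to the first time c at which it meets the segment, and from
  there the segment is followed to y. Before c the path avoids the segment, which gives injectivity;
  the part up to s precedes c and is only reparametrized, by the factor k.\<close>

lemma graph_path_extension: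
  assumes G: "compact_metric_graph G" and \<gamma>: "graph_path G \<gamma>" "\<gamma> 0 \<noteq> \<gamma> 1"
    and e: "e \<in> edges G" and xy: "x \<in> {0..len G e}" "y \<in> {0..len G e}" "\<bar>x - y\<bar> < len G e" "\<gamma> 1 = place G e x"
    and s: "0 \<le> s" "\<And>t. t \<in> {0..s} \<Longrightarrow> \<gamma> t \<notin> place G e ` closed_segment x y"
  obtains \<eta> k where "graph_path G \<eta>" "\<eta> ` {0..1} \<subseteq> \<gamma> ` {0..1} \<union> place G e ` closed_segment x y" "\<eta> 1 = place G e y"
    "0 < k" "k * s \<le> 1" "\<And>t. t \<in> {0..s} \<Longrightarrow> \<eta> (k * t) = \<gamma> t"
proof -
  define B where "B = place G e ` closed_segment x y"
  define K where "K = {t \<in> topspace (top_of_set {0..1}). \<gamma> t \<in> B}"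
  have pathin: "pathin (graph_topology G) \<gamma>" using \<gamma> by (simp add: graph_path_def)
  have inj: "t = t'" if "\<gamma> t = \<gamma> t'" "t \<in> {0..1}" "t' \<in> {0..1}" for t t'
  proof -
    have "t = t' \<or> {t, t'} = {0, 1}" using \<gamma>(1) that unfolding graph_path_def by blast
    then show ?thesis using \<gamma>(2) that(1) by (auto simp: doubleton_eq_iff)
  qed
  have seg: "closed_segment x y \<subseteq> {0..len G e}" using xy by (auto simp: closed_segment_eq_real_ivl split: if_splits)
  have inj_seg: "u = v" if "place G e u = place G e v" "u \<in> closed_segment x y" "v \<in> closed_segment x y" for u v
  proof (rule place_inj_near[OF that(1)])
    have "\<bar>u - v\<bar> \<le> \<bar>x - y\<bar>" using that by (auto simp: closed_segment_eq_real_ivl split: if_splits)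
    then show "\<bar>u - v\<bar> < len G e" using xy by linarith
  qed (use that seg in auto)
  have compB: "compactin (graph_topology G) B" unfolding B_def
    by (rule image_compactin[OF _ continuous_map_place[OF e]]) (use seg in \<open>auto simp: compactin_subtopology\<close>)
  have "closedin (top_of_set {0..1}) K" unfolding K_def
    by (rule closedin_continuous_map_preimage[OF pathin[unfolded pathin_def] compactin_imp_closedin[OF Hausdorff_graph[OF G] compB]])
  then have "closed K" by (rule closedin_closed_trans) simp
  have K1: "1 \<in> K" using xy by (auto simp: K_def B_def)
  have bdd: "bdd_below K" by (auto simp: K_def intro!: bdd_belowI[of _ 0])
  define c where "c = Inf K"
  have cK: "c \<in> K" unfolding c_def using closed_contains_Inf[OF _ bdd \<open>closed K\<close>] K1 by blast
  then have c: "0 \<le> c" "c \<le> 1" by (auto simp: K_def)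
  have below: "\<gamma> t \<notin> B" if "0 \<le> t" "t < c" for t
    using cInf_lower[OF _ bdd, of t] that c by (auto simp: K_def c_def)
  have sc: "s < c" using s(2)[of c] cK c by (cases "c \<le> s") (auto simp: K_def B_def)
  obtain w where w: "w \<in> closed_segment x y" "\<gamma> c = place G e w" using cK by (auto simp: K_def B_def)
  show thesis
  proof (cases "w = y")
    \<comment> \<open>If the path first meets the segment at y itself, a second part would be
      constant and not injective, so the path is merely cut at c.\<close>
    case True
    define \<eta> where "\<eta> r = \<gamma> (c * r)" for r
    have cr: "c * r \<in> {0..1}" if "r \<in> {0..1}" for r using mult_mono[of c 1 r 1] c that by auto
    show thesis
    proof (rule that)
      have "pathin (graph_topology G) \<eta>" unfolding pathin_def \<eta>_def
        by (rule continuous_map_compose[OF _ pathin[unfolded pathin_def], unfolded o_def])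
           (use cr in \<open>auto intro!: continuous_intros\<close>)
      moreover have "r = r'" if "r \<in> {0..1}" "r' \<in> {0..1}" "\<eta> r = \<eta> r'" for r r'
        using inj[OF that(3)[unfolded \<eta>_def] cr cr] that(1,2) sc s by auto
      ultimately show "graph_path G \<eta>" by (auto simp: graph_path_def)
      show "\<eta> ` {0..1} \<subseteq> \<gamma> ` {0..1} \<union> place G e ` closed_segment x y" using cr by (auto simp: \<eta>_def)
      show "\<eta> 1 = place G e y" using w True by (simp add: \<eta>_def)
      show "0 < 1 / c" "1 / c * s \<le> 1" "\<And>t. t \<in> {0..s} \<Longrightarrow> \<eta> (1 / c * t) = \<gamma> t" using sc s by (auto simp: \<eta>_def)
    qed
  next
    case False
    define \<sigma> where "\<sigma> r = place G e (w + (y - w) * r)" for r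
    have wr: "w + (y - w) * r \<in> closed_segment x y" if "r \<in> {0..1}" for r
    proof -
      have "closed_segment w y \<subseteq> closed_segment x y" using w by (simp add: subset_closed_segment)
      moreover have "w + (y - w) * r \<in> closed_segment w y"
        unfolding closed_segment_def using that by (auto simp: algebra_simps intro!: exI[of _ r])
      ultimately show ?thesis by blast
    qed
    have path\<sigma>: "pathin (graph_topology G) \<sigma>" unfolding pathin_def \<sigma>_def
    proof (rule continuous_map_compose[OF _ continuous_map_place[OF e], unfolded o_def])
      show "continuous_map (top_of_set {0..1}) (top_of_set {0..len G e}) (\<lambda>r. w + (y - w) * r)"
        using wr seg by (force intro!: continuous_intros)
    qed
    define \<eta> where "\<eta> r = (if r \<le> 1 / 2 then \<gamma> (2 * c * r) else \<sigma> (2 * r - 1))" for r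
    have cr: "2 * c * r \<in> {0..1}" if "0 \<le> r" "r \<le> 1 / 2" for r using mult_mono[of c 1 "2 * r" 1] c that by (auto simp: ac_simps)
    show thesis
    proof (rule that)
      have "pathin (graph_topology G) \<eta>" unfolding \<eta>_def using w(2) by (intro pathin_join pathin path\<sigma> c) (simp add: \<sigma>_def)
      moreover have mixed: "\<eta> r \<noteq> \<eta> r'" if "r \<in> {0..1}" "r' \<in> {0..1}" "r \<le> 1 / 2" "1 / 2 < r'" for r r'
      proof
        assume eq: "\<eta> r = \<eta> r'"
        have r': "\<eta> r' = place G e (w + (y - w) * (2 * r' - 1))" using that by (simp add: \<eta>_def \<sigma>_def)
        have seg': "w + (y - w) * (2 * r' - 1) \<in> closed_segment x y" by (rule wr) (use that in auto)
        have "\<gamma> (2 * c * r) \<in> B" using eq r' seg' that by (auto simp: B_def \<eta>_def)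
        then have "c \<le> 2 * c * r" using below[of "2 * c * r"] cr[of r] that by force
        then have "c * 1 \<le> c * (2 * r)" by (simp add: ac_simps)
        then have "1 \<le> 2 * r" using sc s by (auto simp: mult_le_cancel_left)
        then have r: "r = 1 / 2" using that by simp
        have "\<eta> r = \<gamma> c" unfolding \<eta>_def r by simp
        then have "place G e w = place G e (w + (y - w) * (2 * r' - 1))" using eq r' w(2) by simp
        from inj_seg[OF this w(1) seg'] show False using False that by simp
      qed
      moreover have "r = r'" if "r \<in> {0..1}" "r' \<in> {0..1}" "\<eta> r = \<eta> r'" for r r'
      proof (cases "r \<le> 1 / 2"; cases "r' \<le> 1 / 2")
        assume "r \<le> 1 / 2" "r' \<le> 1 / 2"
        then show ?thesis using inj[of "2 * c * r" "2 * c * r'"] cr that sc s by (auto simp: \<eta>_def)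
      next
        assume h: "\<not> r \<le> 1 / 2" "\<not> r' \<le> 1 / 2"
        then have "place G e (w + (y - w) * (2 * r - 1)) = place G e (w + (y - w) * (2 * r' - 1))"
          using that(3) by (simp add: \<eta>_def \<sigma>_def)
        then have "w + (y - w) * (2 * r - 1) = w + (y - w) * (2 * r' - 1)"
          by (rule inj_seg) (use h that in \<open>auto intro!: wr\<close>)
        then show ?thesis using False by simp
      qed (use mixed[of r r'] mixed[of r' r] that in auto)
      ultimately show "graph_path G \<eta>" by (auto simp: graph_path_def)
      have "\<eta> r \<in> \<gamma> ` {0..1} \<union> place G e ` closed_segment x y" if "r \<in> {0..1}" for r
        using cr[of r] wr[of "2 * r - 1"] that by (auto simp: \<eta>_def \<sigma>_def)
      then show "\<eta> ` {0..1} \<subseteq> \<gamma> ` {0..1} \<union> place G e ` closed_segment x y" by blast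
      show "\<eta> 1 = place G e y" by (simp add: \<eta>_def \<sigma>_def)
      show "0 < 1 / (2 * c)" "1 / (2 * c) * s \<le> 1" "\<And>t. t \<in> {0..s} \<Longrightarrow> \<eta> (1 / (2 * c) * t) = \<gamma> t"
        using sc s by (auto simp: \<eta>_def field_simps)
    qed
  qed
qed


lemma path_range_points:
  assumes "pathin (graph_topology G) \<gamma>" "t \<in> {0..1}"
  shows "\<gamma> t \<in> points G"
  using assms continuous_map_image_subset_topspace[of "top_of_set {0..1}" "graph_topology G" \<gamma>] by (auto simp: pathin_def)

lemma path_continuous_on:
  fixes f :: "('v, 'e) point \<Rightarrow> real"
  assumes "pathin (graph_topology G) \<gamma>" "continuous_map (graph_topology G) euclideanreal f"
  shows "continuous_on {0..1} (\<lambda>t. f (\<gamma> t))"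
  using continuous_map_compose[OF assms(1)[unfolded pathin_def] assms(2)] by (simp add: o_def)

lemma tree_path_ends:
  assumes "tree_subgraph G T" "graph_path G \<gamma>" "\<gamma> ` {0..1} \<subseteq> T"
  shows "\<gamma> 0 \<noteq> \<gamma> 1"
  using assms by (auto simp: tree_subgraph_def)

lemma tree_path_inj:
  assumes T: "tree_subgraph G T" "graph_path G \<gamma>" "\<gamma> ` {0..1} \<subseteq> T"
  shows "inj_on \<gamma> {0..1}"
proof (rule inj_onI)
  fix t t' assume h: "t \<in> {0..1}" "t' \<in> {0..1}" "\<gamma> t = \<gamma> t'"
  then have "t = t' \<or> {t, t'} = {0, 1}" using T(2) unfolding graph_path_def by blast
  then show "t = t'" using tree_path_ends[OF T] h(3) by (auto simp: doubleton_eq_iff)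
qed

text \<open>Up to time s < 1 the path stays away from the limit centre, as measured by
  \<open>separator\<close>. For large n it therefore avoids the segment between the limit centre and
  the n-th centre and can be rerouted to the latter within T. The single-well property holds along
  the rerouted path, which agrees with the given one up to s after reparametrization.\<close>

lemma eventually_antimono_before_limit_centre:
  fixes qs :: "nat \<Rightarrow> ('v, 'e) point \<Rightarrow> real"
  assumes G: "compact_metric_graph G" and T: "tree_subgraph G T"
    and e: "e \<in> edges G" "{\<alpha>..\<beta>} \<subseteq> {0..len G e}" "place G e ` {\<alpha>..\<beta>} \<subseteq> T"
    and xs: "\<And>n. xs n \<in> {\<alpha>..\<beta>}" "xs \<longlonglongrightarrow> x"
    and well: "\<And>n \<gamma>. graph_path G \<gamma> \<Longrightarrow> \<gamma> ` {0..1} \<subseteq> T \<Longrightarrow> \<gamma> 0 \<in> boundary_of G T \<Longrightarrow> \<gamma> 1 = place G e (xs n) \<Longrightarrow>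
      antimono_on {0..1} (\<lambda>t. qs n (\<gamma> t))"
    and \<gamma>: "graph_path G \<gamma>" "\<gamma> ` {0..1} \<subseteq> T" "\<gamma> 0 \<in> boundary_of G T" "\<gamma> 1 = place G e x" and s: "0 \<le> s" "s < 1"
  shows "\<forall>\<^sub>F n in sequentially. antimono_on {0..s} (\<lambda>t. qs n (\<gamma> t))"
proof -
  let ?d = "separator G (place G e x)"
  have pathin: "pathin (graph_topology G) \<gamma>" using \<gamma> by (simp add: graph_path_def)
  have ends: "\<gamma> 0 \<noteq> \<gamma> 1" by (rule tree_path_ends[OF T \<gamma>(1,2)])
  have x: "x \<in> {\<alpha>..\<beta>}" using xs closed_sequentially[of "{\<alpha>..\<beta>}" xs x] by blast
  then have xI: "x \<in> {0..len G e}" using e by blast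
  then have a: "place G e x \<in> points G" using e unfolding points_def by blast
  have dcont: "continuous_map (graph_topology G) euclideanreal ?d" by (rule separator_continuous[OF G a])
  have "continuous_on {0..1} (\<lambda>t. ?d (\<gamma> t))" by (rule path_continuous_on[OF pathin dcont])
  then have "continuous_on {0..s} (\<lambda>t. ?d (\<gamma> t))" by (rule continuous_on_subset) (use s in auto)
  moreover have "compact {0..s}" "{0..s} \<noteq> {}" using s by auto
  ultimately obtain t0 where t0: "t0 \<in> {0..s}" "\<And>t. t \<in> {0..s} \<Longrightarrow> ?d (\<gamma> t0) \<le> ?d (\<gamma> t)"
    using continuous_attains_inf[of "{0..s}" "\<lambda>t. ?d (\<gamma> t)"] by blast
  have "\<gamma> t0 \<noteq> place G e x" using inj_onD[OF tree_path_inj[OF T \<gamma>(1,2)], of t0 1] \<gamma>(4) t0 s by auto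
  then have pos: "0 < ?d (\<gamma> t0)"
    using separator_nonneg[OF G a, of "\<gamma> t0"] path_range_points[OF pathin, of t0] t0 s by fastforce
  have "continuous_on {0..len G e} (\<lambda>y. ?d (place G e y))"
    using continuous_map_compose[OF continuous_map_place[OF e(1)] dcont] by (simp add: o_def)
  then obtain \<delta> where \<delta>: "0 < \<delta>" "\<And>y. y \<in> {0..len G e} \<Longrightarrow> dist y x < \<delta> \<Longrightarrow> dist (?d (place G e y)) (?d (place G e x)) < ?d (\<gamma> t0)"
    using xI pos unfolding continuous_on_iff by blast
  have d0: "?d (place G e x) = 0" using separator_nonneg[OF G a a] by simp
  \<comment> \<open>The bound by the length of the edge excludes a segment that covers a whole
    loop.\<close>
  have "\<forall>\<^sub>F n in sequentially. dist (xs n) x < min \<delta> (len G e)"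
    using tendstoD[OF xs(2), of "min \<delta> (len G e)"] \<delta>(1) edge_len[OF G e(1)] by auto
  then show ?thesis
  proof eventually_elim
    case (elim n)
    have y: "xs n \<in> {0..len G e}" using xs(1) e by blast
    have seg: "closed_segment x (xs n) \<subseteq> {\<alpha>..\<beta>}" using x xs(1)[of n] by (auto simp: closed_segment_eq_real_ivl split: if_splits)
    have avoid: "\<gamma> t \<notin> place G e ` closed_segment x (xs n)" if t: "t \<in> {0..s}" for t
    proof
      assume "\<gamma> t \<in> place G e ` closed_segment x (xs n)"
      then obtain y where y: "y \<in> closed_segment x (xs n)" "\<gamma> t = place G e y" by blast
      have "dist y x < \<delta>" using elim y(1) by (auto simp: closed_segment_eq_real_ivl dist_real_def split: if_splits)
      moreover have "y \<in> {0..len G e}" using y(1) seg e(2) by blast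
      ultimately have "dist (?d (place G e y)) (?d (place G e x)) < ?d (\<gamma> t0)" using \<delta>(2) by blast
      then show False using t0(2)[OF t] unfolding y(2) d0 by (simp add: dist_real_def)
    qed
    have "\<bar>x - xs n\<bar> < len G e" using elim unfolding dist_real_def by linarith
    from graph_path_extension[OF G \<gamma>(1) ends e(1) xI y this \<gamma>(4) s(1) avoid]
    obtain \<eta> k where \<eta>: "graph_path G \<eta>" "\<eta> ` {0..1} \<subseteq> \<gamma> ` {0..1} \<union> place G e ` closed_segment x (xs n)"
      "\<eta> 1 = place G e (xs n)" and k: "0 < k" "k * s \<le> 1" and eq: "\<And>t. t \<in> {0..s} \<Longrightarrow> \<eta> (k * t) = \<gamma> t" by blast
    have "\<eta> ` {0..1} \<subseteq> T" using \<eta>(2) \<gamma>(2) seg e(3) by blast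
    moreover have "\<eta> 0 \<in> boundary_of G T" using eq[of 0] s \<gamma>(3) by simp
    ultimately have anti: "antimono_on {0..1} (\<lambda>t. qs n (\<eta> t))" using well \<eta>(1,3) by blast
    show "antimono_on {0..s} (\<lambda>t. qs n (\<gamma> t))"
    proof (rule monotone_onI)
      fix t t' assume t: "t \<in> {0..s}" "t' \<in> {0..s}" "t \<le> t'"
      have "k * t' \<le> k * s" using t k by (intro mult_left_mono) auto
      moreover have "k * t \<le> k * t'" using t k by (intro mult_left_mono) auto
      moreover have "0 \<le> k * t" using t k by auto
      ultimately show "qs n (\<gamma> t') \<le> qs n (\<gamma> t)"
        using monotone_onD[OF anti, of "k * t" "k * t'"] k(2) eq[OF t(1)] eq[OF t(2)] by auto
    qed
  qed
qed

text \<open>The coordinate function below is a clamped version of \<open>z - x\<close> which vanishes at the ends of the edge.\<close>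

lemma monotone_coordinate_on_path:
  fixes G :: "('v, 'e) metric_graph"
  assumes G: "compact_metric_graph G" and \<gamma>: "pathin (graph_topology G) \<gamma>" "inj_on \<gamma> {0..1}"
    and t: "0 < t" "t < 1" "\<gamma> t = Interior e x"
  obtains k \<rho> where "0 < \<rho>" "{t - \<rho>..t + \<rho>} \<subseteq> {0<..<1}" "k t = x"
    "continuous_on {t - \<rho>..t + \<rho>} k" "\<And>u. u \<in> {t - \<rho>..t + \<rho>} \<Longrightarrow> \<gamma> u = place G e (k u)"
    "strict_mono_on {t - \<rho>..t + \<rho>} k \<or> strict_antimono_on {t - \<rho>..t + \<rho>} k"
proof -
  define w where "w z = min z (len G e - z)" for z
  define \<kappa> where "\<kappa> p = (case p of Vertex v \<Rightarrow> 0 | Interior e' z \<Rightarrow> if e' = e then max (- w z) (min (w z) (z - x)) else 0)" for p :: "('v, 'e) point"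
  have p: "Interior e x \<in> points G" using path_range_points[OF \<gamma>(1), of t] t by auto
  note x = interior_point[OF G p]
  have \<kappa>_place: "\<kappa> (place G e' z) = (if e' = e then max (- w z) (min (w z) (z - x)) else 0)" if "e' \<in> edges G" "z \<in> {0..len G e'}" for e' z
    using x that by (auto simp: \<kappa>_def place_def w_def min_def max_def)
  have \<kappa>: "continuous_map (graph_topology G) euclideanreal \<kappa>"
  proof (rule continuous_map_graph)
    fix e' assume e': "e' \<in> edges G"
    have "continuous_on {0..len G e'} (\<lambda>z. if e' = e then max (- w z) (min (w z) (z - x)) else 0)"
      unfolding w_def by (cases "e' = e") (auto intro!: continuous_intros)
    then show "continuous_on {0..len G e'} (\<lambda>z. \<kappa> (place G e' z))"
      by (subst continuous_on_cong[OF refl \<kappa>_place[OF e']]) auto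
  qed
  define k where "k u = x + \<kappa> (\<gamma> u)" for u
  let ?d = "separator G (Interior e x)"
  have kcont: "continuous_on {0..1} k" unfolding k_def by (intro continuous_intros path_continuous_on[OF \<gamma>(1) \<kappa>])
  have "continuous_on {0..1} (\<lambda>u. ?d (\<gamma> u))" by (rule path_continuous_on[OF \<gamma>(1) separator_continuous[OF G p]])
  moreover have "?d (\<gamma> t) = 0" using separator_nonneg[OF G p p] t by simp
  ultimately obtain \<delta> where \<delta>: "0 < \<delta>" "\<And>u. u \<in> {0..1} \<Longrightarrow> dist u t < \<delta> \<Longrightarrow> dist (?d (\<gamma> u)) 0 < 1 / 2"
    using t unfolding continuous_on_iff by (metis atLeastAtMost_iff less_eq_real_def half_gt_zero zero_less_one)
  define \<rho> where "\<rho> = min (\<delta> / 2) (min (t / 2) ((1 - t) / 2))"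
  have \<rho>: "0 < \<rho>" "\<rho> < \<delta>" "\<rho> < t" "\<rho> < 1 - t" using \<delta> t by (auto simp: \<rho>_def min_def)
  have sub: "{t - \<rho>..t + \<rho>} \<subseteq> {0<..<1}" using \<rho> by auto
  have \<gamma>k: "\<gamma> u = place G e (k u)" if u: "u \<in> {t - \<rho>..t + \<rho>}" for u
  proof -
    have uI: "u \<in> {0..1}" using u sub by force
    have "dist u t < \<delta>" using u \<rho> by (auto simp: dist_real_def)
    then have d: "?d (\<gamma> u) < 1 / 2" using \<delta>(2)[OF uI] by (simp add: dist_real_def)
    obtain e' z where z: "e' \<in> edges G" "z \<in> {0..len G e'}" "\<gamma> u = place G e' z"
      using path_range_points[OF \<gamma>(1) uI] unfolding points_def by blast
    have e': "e' = e" and "\<bar>z - x\<bar> / min x (len G e - x) < 1 / 2"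
      using d unfolding z(3) separator_interior_place[OF G z(1) p] by (auto split: if_splits)
    \<comment> \<open>Closer to x than half of its distance to the ends of the edge, the clamp is
      inactive and k is the coordinate itself.\<close>
    then have "\<bar>z - x\<bar> < min x (len G e - x) / 2" using x by (simp add: field_simps)
    then have "\<bar>z - x\<bar> < x / 2" "\<bar>z - x\<bar> < (len G e - x) / 2" by (auto simp: min_def split: if_splits)
    then have "\<bar>z - x\<bar> \<le> z" "\<bar>z - x\<bar> \<le> len G e - z" unfolding abs_if by (auto split: if_splits)
    then have "\<bar>z - x\<bar> \<le> w z" by (simp add: w_def)
    then have "\<kappa> (\<gamma> u) = z - x" unfolding z(3) \<kappa>_place[OF z(1,2)] using e' by auto
    then show ?thesis using z e' by (simp add: k_def)
  qed
  have kc: "continuous_on {t - \<rho>..t + \<rho>} k" by (rule continuous_on_subset[OF kcont]) (use sub in force)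
  have kinj: "inj_on k {t - \<rho>..t + \<rho>}"
  proof (rule inj_onI)
    fix u v assume h: "u \<in> {t - \<rho>..t + \<rho>}" "v \<in> {t - \<rho>..t + \<rho>}" "k u = k v"
    then have "\<gamma> u = \<gamma> v" using \<gamma>k by simp
    then show "u = v" using inj_onD[OF \<gamma>(2)] h sub by force
  qed
  have kt: "k t = x" using \<kappa>_place[OF x(1), of x] x t by (simp add: k_def place_def w_def)
  have int: "is_interval {t - \<rho>..t + \<rho>}" by simp
  show thesis
    by (rule that[OF \<rho>(1) sub kt kc \<gamma>k]) (use injective_eq_monotone_map[OF int kc] kinj in auto)
qed


text \<open>Near t the path runs along the edge in one direction and, by the intermediate value
  theorem, covers a neighbourhood of x. There a function that is nonincreasing along the path is
  monotone in the coordinate, in a direction that depends on the path. The rational ends reduce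
  uncountably many paths to countably many intervals.\<close>

lemma monotone_interval_on_path:
  fixes G :: "('v, 'e) metric_graph"
  assumes G: "compact_metric_graph G" and \<gamma>: "pathin (graph_topology G) \<gamma>" "inj_on \<gamma> {0..1}"
    and t: "0 < t" "t < 1" "\<gamma> t = Interior e x"
  obtains r1 r2 s where "r1 \<in> \<rat>" "r2 \<in> \<rat>" "0 \<le> r1" "r1 < x" "x < r2" "r2 \<le> len G e" "0 \<le> s" "s < 1"
    "\<And>f :: ('v, 'e) point \<Rightarrow> real. antimono_on {0..s} (\<lambda>u. f (\<gamma> u)) \<Longrightarrow>
      mono_on {r1..r2} (\<lambda>z. f (place G e z)) \<or> antimono_on {r1..r2} (\<lambda>z. f (place G e z))"
proof -
  obtain k \<rho> where \<rho>: "0 < \<rho>" "{t - \<rho>..t + \<rho>} \<subseteq> {0<..<1}" and kt: "k t = x"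
    and kc: "continuous_on {t - \<rho>..t + \<rho>} k" and \<gamma>k: "\<And>u. u \<in> {t - \<rho>..t + \<rho>} \<Longrightarrow> \<gamma> u = place G e (k u)"
    and mono: "strict_mono_on {t - \<rho>..t + \<rho>} k \<or> strict_antimono_on {t - \<rho>..t + \<rho>} k"
    using monotone_coordinate_on_path[OF G \<gamma> t] by blast
  have "Interior e x \<in> points G" using path_range_points[OF \<gamma>(1), of t] t by auto
  note x = interior_point[OF G this]
  have "t - \<rho> \<in> {t - \<rho>..t + \<rho>}" "t + \<rho> \<in> {t - \<rho>..t + \<rho>}" using \<rho>(1) by auto
  then have "t - \<rho> \<in> {0<..<1}" "t + \<rho> \<in> {0<..<1}" using \<rho>(2) by blast+
  then have \<rho>I: "0 < t - \<rho>" "t + \<rho> < 1" by auto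
  let ?l = "min (k (t - \<rho>)) (k (t + \<rho>))" and ?u = "max (k (t - \<rho>)) (k (t + \<rho>))"
  have tI: "t \<in> {t - \<rho>..t + \<rho>}" "t - \<rho> < t" "t < t + \<rho>" "t - \<rho> \<in> {t - \<rho>..t + \<rho>}" "t + \<rho> \<in> {t - \<rho>..t + \<rho>}" using \<rho>(1) by auto
  have "k (t - \<rho>) < x \<and> x < k (t + \<rho>) \<or> k (t + \<rho>) < x \<and> x < k (t - \<rho>)"
    using mono monotone_onD[of "{t - \<rho>..t + \<rho>}" "(<)" "(<)" k, OF _ tI(4,1,2)] monotone_onD[of "{t - \<rho>..t + \<rho>}" "(<)" "(<)" k, OF _ tI(1,5,3)]
      monotone_onD[of "{t - \<rho>..t + \<rho>}" "(<)" "(>)" k, OF _ tI(4,1,2)] monotone_onD[of "{t - \<rho>..t + \<rho>}" "(<)" "(>)" k, OF _ tI(1,5,3)]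
    unfolding kt by blast
  then have lu: "?l < x" "x < ?u" by auto
  have "max 0 ?l < x" "x < min (len G e) ?u" using lu x by auto
  then obtain r1 r2 where r: "r1 \<in> \<rat>" "max 0 ?l < r1" "r1 < x" "r2 \<in> \<rat>" "x < r2" "r2 < min (len G e) ?u"
    using Rats_dense_in_real by meson
  have preimage: "\<exists>v\<in>{t - \<rho>..t + \<rho>}. k v = z" if z: "z \<in> {r1..r2}" for z
  proof (cases "k (t - \<rho>) \<le> k (t + \<rho>)")
    case True
    then have "k (t - \<rho>) \<le> z" "z \<le> k (t + \<rho>)" using z r(2,6) by auto
    then show ?thesis using IVT'[OF _ _ _ kc, of z] \<rho>(1) by auto
  next
    case False
    then have "k (t + \<rho>) \<le> z" "z \<le> k (t - \<rho>)" using z r(2,6) by auto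
    then show ?thesis using IVT2'[OF _ _ _ kc, of z] \<rho>(1) by auto
  qed
  show thesis
  proof (rule that[OF r(1,4)])
    fix f :: "('v, 'e) point \<Rightarrow> real"
    assume anti: "antimono_on {0..t + \<rho>} (\<lambda>u. f (\<gamma> u))"
    have le: "f (place G e (k v')) \<le> f (place G e (k v))" if "v \<in> {t - \<rho>..t + \<rho>}" "v' \<in> {t - \<rho>..t + \<rho>}" "v \<le> v'" for v v'
      using monotone_onD[OF anti, of v v'] \<gamma>k[OF that(1)] \<gamma>k[OF that(2)] that \<rho>I by auto
    show "mono_on {r1..r2} (\<lambda>z. f (place G e z)) \<or> antimono_on {r1..r2} (\<lambda>z. f (place G e z))"
      using mono
    proof
      assume m: "strict_mono_on {t - \<rho>..t + \<rho>} k"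
      have "antimono_on {r1..r2} (\<lambda>z. f (place G e z))"
      proof (rule monotone_onI)
        fix z z' assume z: "z \<in> {r1..r2}" "z' \<in> {r1..r2}" "z \<le> z'"
        obtain v v' where v: "v \<in> {t - \<rho>..t + \<rho>}" "v' \<in> {t - \<rho>..t + \<rho>}" "k v = z" "k v' = z'" using preimage z by blast
        have "v \<le> v'" using monotone_onD[OF m v(2,1)] v z by force
        then show "f (place G e z') \<le> f (place G e z)" using le[OF v(1,2)] v by simp
      qed
      then show ?thesis ..
    next
      assume m: "strict_antimono_on {t - \<rho>..t + \<rho>} k"
      have "mono_on {r1..r2} (\<lambda>z. f (place G e z))"
      proof (rule mono_onI)
        fix z z' assume z: "z \<in> {r1..r2}" "z' \<in> {r1..r2}" "z \<le> z'"
        obtain v v' where v: "v \<in> {t - \<rho>..t + \<rho>}" "v' \<in> {t - \<rho>..t + \<rho>}" "k v = z" "k v' = z'" using preimage z by blast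
        have "v' \<le> v" using monotone_onD[OF m v(1,2)] v z by force
        then show "f (place G e z) \<le> f (place G e z')" using le[OF v(2,1)] v by simp
      qed
      then show ?thesis ..
    qed
  qed (use r x \<rho>I \<rho>(1) t in auto)
qed

text \<open>All rational intervals are treated at once, whether or not a path makes the potentials
  monotone on them. The alternative of convergence or eventual failure of monotonicity is inherited
  by subsequences and ignores initial terms, as the diagonal argument demands. When one kind of
  monotonicity occurs infinitely often, Helly selection gives convergence.\<close>

lemma monotone_intervals_selection:
  fixes qs :: "nat \<Rightarrow> ('v, 'e) point \<Rightarrow> real"
  assumes fin: "finite (edges G)" and qs: "\<And>n. qs n \<in> bounded_potentials G M"
  obtains r where "strict_mono r"
    "\<And>e r1 r2. e \<in> edges G \<Longrightarrow> r1 \<in> \<rat> \<Longrightarrow> r2 \<in> \<rat> \<Longrightarrow> 0 \<le> r1 \<Longrightarrow> r2 \<le> len G e \<Longrightarrow>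
      (\<forall>z\<in>{r1..r2}. convergent (\<lambda>n. qs (r n) (place G e z))) \<or>
      (\<forall>\<^sub>F n in sequentially. \<not> (mono_on {r1..r2} (\<lambda>z. qs (r n) (place G e z)) \<or> antimono_on {r1..r2} (\<lambda>z. qs (r n) (place G e z))))"
proof -
  define up where "up e r1 r2 n \<longleftrightarrow> mono_on {r1..r2} (\<lambda>z. qs n (place G e z))" for e r1 r2 n
  define dn where "dn e r1 r2 n \<longleftrightarrow> antimono_on {r1..r2} (\<lambda>z. qs n (place G e z))" for e r1 r2 n
  define P :: "'e \<times> real \<times> real \<Rightarrow> (nat \<Rightarrow> nat) \<Rightarrow> bool" where "P = (\<lambda>(e, r1, r2) s. (\<forall>z\<in>{r1..r2}. convergent (\<lambda>n. qs (s n) (place G e z))) \<or>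
      (\<forall>\<^sub>F n in sequentially. \<not> (up e r1 r2 (s n) \<or> dn e r1 r2 (s n))))"
  define A :: "('e \<times> real \<times> real) set" where "A = {(e, r1, r2). e \<in> edges G \<and> r1 \<in> \<rat> \<and> r2 \<in> \<rat> \<and> 0 \<le> r1 \<and> r2 \<le> len G e}"
  have "A \<subseteq> edges G \<times> \<rat> \<times> \<rat>" by (auto simp: A_def)
  then have A: "countable A" by (rule countable_subset) (intro countable_SIGMA countable_rat countable_finite fin)
  have bound: "\<bar>qs n (place G e z)\<bar> \<le> M" if "e \<in> edges G" "z \<in> {0..len G e}" for n e z
    using qs[of n] that unfolding bounded_potentials_def points_def by fastforce
  obtain r where r: "strict_mono r" "\<And>i. i \<in> A \<Longrightarrow> P i r"
  proof (rule diagonal_selection[OF A, where P = P])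
    fix i :: "'e \<times> real \<times> real" and s :: "nat \<Rightarrow> nat" assume i: "i \<in> A"
    obtain e r1 r2 where i_eq: "i = (e, r1, r2)" by (metis prod_cases3)
    have e: "e \<in> edges G" "{r1..r2} \<subseteq> {0..len G e}" using i by (auto simp: A_def i_eq)
    have b: "\<bar>qs n (place G e z)\<bar> \<le> M" if "z \<in> {r1..r2}" for n z using bound e that by blast
    consider (never) "\<forall>\<^sub>F n in sequentially. \<not> (up e r1 r2 (s n) \<or> dn e r1 r2 (s n))"
      | (up) "infinite {n. up e r1 r2 (s n)}" | (dn) "infinite {n. dn e r1 r2 (s n)}"
    proof -
      assume *: "\<forall>\<^sub>F n in sequentially. \<not> (up e r1 r2 (s n) \<or> dn e r1 r2 (s n)) \<Longrightarrow> thesis"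
        "infinite {n. up e r1 r2 (s n)} \<Longrightarrow> thesis" "infinite {n. dn e r1 r2 (s n)} \<Longrightarrow> thesis"
      show thesis
      proof (cases "finite {n. up e r1 r2 (s n) \<or> dn e r1 r2 (s n)}")
        case True
        then show ?thesis by (intro *(1)) (simp add: cofinite_eq_sequentially[symmetric] eventually_cofinite)
      next
        case False
        then show ?thesis using *(2,3) by (auto simp: Collect_disj_eq)
      qed
    qed
    then show "\<exists>r. strict_mono r \<and> P i (s \<circ> r)"
    proof cases
      case never
      then show ?thesis by (intro exI[of _ id]) (simp add: P_def i_eq strict_mono_id)
    next
      case up
      obtain r where r: "strict_mono (r :: nat \<Rightarrow> nat)" "\<And>n. up e r1 r2 (s (r n))" using infinite_enumerate[OF up] by auto
      obtain r' where r': "strict_mono r'" "\<And>z. z \<in> {r1..r2} \<Longrightarrow> convergent (\<lambda>n. qs (s (r (r' n))) (place G e z))"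
        using helly_selection_mono[of r1 r2 "\<lambda>n z. qs (s (r n)) (place G e z)" M, OF r(2)[unfolded up_def] b] that by metis
      then show ?thesis using r(1) by (intro exI[of _ "r \<circ> r'"]) (simp add: P_def i_eq strict_mono_o)
    next
      case dn
      obtain r where r: "strict_mono (r :: nat \<Rightarrow> nat)" "\<And>n. dn e r1 r2 (s (r n))" using infinite_enumerate[OF dn] by auto
      have m: "mono_on {r1..r2} (\<lambda>z. - qs (s (r n)) (place G e z))" for n
        using r(2)[of n] by (auto simp: dn_def monotone_on_def)
      have nb: "\<bar>- qs (s (r n)) (place G e z)\<bar> \<le> M" if "z \<in> {r1..r2}" for n z using b[OF that] by simp
      obtain r' where r': "strict_mono r'" "\<And>z. z \<in> {r1..r2} \<Longrightarrow> convergent (\<lambda>n. - qs (s (r (r' n))) (place G e z))"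
        using helly_selection_mono[of r1 r2 "\<lambda>n z. - qs (s (r n)) (place G e z)" M, OF m nb] that by metis
      then show ?thesis using r(1)
        by (intro exI[of _ "r \<circ> r'"]) (simp add: P_def i_eq strict_mono_o convergent_minus_iff[symmetric])
    qed
  next
    fix i :: "'e \<times> real \<times> real" and s r :: "nat \<Rightarrow> nat" assume "P i s" "strict_mono r"
    then show "P i (s \<circ> r)"
      unfolding P_def using convergent_comp[of _ r] eventually_subseq[of r] by (auto split: prod.splits)
  next
    fix i :: "'e \<times> real \<times> real" and s :: "nat \<Rightarrow> nat" and m assume "P i (s \<circ> (+) m)"
    moreover have "eventually Q sequentially" if "\<forall>\<^sub>F n in sequentially. Q (m + n)" for Q
      using that eventually_sequentially_seg[of Q m] by (simp add: add.commute)
    ultimately show "P i s"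
      unfolding P_def using convergent_tail[where m = m] by (auto split: prod.splits)
  next
    fix r :: "nat \<Rightarrow> nat" assume "strict_mono r" "\<And>i. i \<in> A \<Longrightarrow> P i r"
    then show thesis by (rule that)
  qed
  show thesis by (rule that[OF r(1)]) (use r(2) in \<open>auto simp: P_def A_def up_def dn_def\<close>)
qed


text \<open>Some segment of T contains infinitely many of the points, and their coordinates on it
  have a convergent subsequence. Staying on one segment makes the short connection from the limit to
  the later centres a part of T.\<close>

lemma centre_selection:
  fixes a :: "nat \<Rightarrow> ('v, 'e) point"
  assumes T: "subgraph G T" and a: "\<And>n. a n \<in> T"
  obtains e \<alpha> \<beta> r xs x where "e \<in> edges G" "{\<alpha>..\<beta>} \<subseteq> {0..len G e}" "place G e ` {\<alpha>..\<beta>} \<subseteq> T"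
    "strict_mono (r :: nat \<Rightarrow> nat)" "\<And>n. a (r n) = place G e (xs n)" "\<And>n. xs n \<in> {\<alpha>..\<beta>}" "xs \<longlonglongrightarrow> x" "x \<in> {\<alpha>..\<beta>}"
proof -
  obtain S where S1: "finite S" and S2: "\<forall>(e, a, b)\<in>S. e \<in> edges G \<and> 0 \<le> a \<and> a \<le> b \<and> b \<le> len G e"
    and T_eq: "T = (\<Union>(e, a, b)\<in>S. place G e ` {a..b})"
    using T unfolding subgraph_def by (elim exE conjE) (rule that)
  have "\<exists>c\<in>S. a n \<in> (case c of (e, \<alpha>, \<beta>) \<Rightarrow> place G e ` {\<alpha>..\<beta>})" for n using a[of n] unfolding T_eq by blast
  then obtain c where c: "\<And>n. c n \<in> S" "\<And>n. a n \<in> (case c n of (e, \<alpha>, \<beta>) \<Rightarrow> place G e ` {\<alpha>..\<beta>})" by metis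
  have "finite (c ` UNIV)" by (rule finite_subset[OF _ S1]) (use c(1) in blast)
  then obtain d where d: "d \<in> c ` UNIV" "infinite (c -` {d})" using inf_img_fin_domE[OF _ infinite_UNIV_nat] by blast
  obtain e \<alpha> \<beta> where d_eq: "d = (e, \<alpha>, \<beta>)" by (metis prod_cases3)
  have dS: "(e, \<alpha>, \<beta>) \<in> S" using d(1) c(1) d_eq by auto
  obtain r where r: "strict_mono (r :: nat \<Rightarrow> nat)" "\<And>n. c (r n) = d" using infinite_enumerate[OF d(2)] by auto
  have "\<exists>x\<in>{\<alpha>..\<beta>}. a (r n) = place G e x" for n using c(2)[of "r n"] unfolding r(2) d_eq by auto
  then obtain xs where xs: "\<And>n. xs n \<in> {\<alpha>..\<beta>}" "\<And>n. a (r n) = place G e (xs n)" by metis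
  obtain x r' where x: "x \<in> {\<alpha>..\<beta>}" "strict_mono (r' :: nat \<Rightarrow> nat)" "(xs \<circ> r') \<longlonglongrightarrow> x"
    using seq_compactE[of "{\<alpha>..\<beta>}" xs] compact_imp_seq_compact[OF compact_Icc] xs(1) by blast
  show thesis
  proof (rule that[of e \<alpha> \<beta> "r \<circ> r'" "xs \<circ> r'" x])
    show "place G e ` {\<alpha>..\<beta>} \<subseteq> T" using dS unfolding T_eq by fast
    show "e \<in> edges G" "{\<alpha>..\<beta>} \<subseteq> {0..len G e}" using bspec[OF S2 dS] by auto
    show "strict_mono (r \<circ> r')" by (rule strict_mono_o[OF r(1) x(2)])
  qed (use xs x in auto)
qed

theorem single_well_potentials_compact:
  fixes qs :: "nat \<Rightarrow> ('v, 'e) point \<Rightarrow> real"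
  assumes G: "compact_metric_graph G" and T: "tree_subgraph G T" and M: "0 \<le> M"
    and qs: "\<And>n. qs n \<in> single_well_potentials G T M"
  obtains r q where "strict_mono r" "q \<in> single_well_potentials G T M" "weakly_converges G (\<lambda>n. qs (r n)) q"
proof -
  have fin: "finite (edges G)" using G by (simp add: compact_metric_graph_def)
  have sub: "subgraph G T" using T by (simp add: tree_subgraph_def)
  have qb: "qs n \<in> bounded_potentials G M" for n using qs by (auto simp: single_well_potentials_def)
  have "\<exists>a\<in>T. \<forall>\<gamma>. graph_path G \<gamma> \<and> \<gamma> ` {0..1} \<subseteq> T \<and> \<gamma> 0 \<in> boundary_of G T \<and> \<gamma> 1 = a \<longrightarrow>
      antimono_on {0..1} (\<lambda>t. qs n (\<gamma> t))" for n
    using qs[of n] by (simp add: single_well_potentials_def single_well_def)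
  then obtain a where a: "\<And>n. a n \<in> T" and well: "\<And>n \<gamma>. graph_path G \<gamma> \<Longrightarrow> \<gamma> ` {0..1} \<subseteq> T \<Longrightarrow>
      \<gamma> 0 \<in> boundary_of G T \<Longrightarrow> \<gamma> 1 = a n \<Longrightarrow> antimono_on {0..1} (\<lambda>t. qs n (\<gamma> t))" by metis
  obtain e \<alpha> \<beta> s1 xs x where e: "e \<in> edges G" "{\<alpha>..\<beta>} \<subseteq> {0..len G e}" "place G e ` {\<alpha>..\<beta>} \<subseteq> T"
    and s1: "strict_mono (s1 :: nat \<Rightarrow> nat)" and xs: "\<And>n. a (s1 n) = place G e (xs n)" "\<And>n. xs n \<in> {\<alpha>..\<beta>}" "xs \<longlonglongrightarrow> x" "x \<in> {\<alpha>..\<beta>}"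
    using centre_selection[where a = a, OF sub a] by metis
  \<comment> \<open>Vertices and boundary points are finitely many and get a selection of their own;
    the rational intervals only reach interior points of edges at positive times.\<close>
  define Z where "Z = {p \<in> points G. p \<in> Vertex ` vertices G \<union> boundary_of G T}"
  have "finite Z" unfolding Z_def vertices_def using fin finite_boundary[OF G sub] by auto
  have Zb: "\<bar>qs n p\<bar> \<le> M" if "p \<in> Z" for n p using qb[of n] that by (auto simp: Z_def bounded_potentials_def)
  obtain s2 where s2: "strict_mono s2" "\<And>p. p \<in> Z \<Longrightarrow> convergent (\<lambda>n. qs (s1 (s2 n)) p)"
    using bounded_convergent_selection[OF countable_finite[OF \<open>finite Z\<close>], of "\<lambda>p n. qs (s1 n) p" "\<lambda>_. M"] Zb by blast
  obtain s3 where s3: "strict_mono s3" and mon: "\<And>e r1 r2. e \<in> edges G \<Longrightarrow> r1 \<in> \<rat> \<Longrightarrow> r2 \<in> \<rat> \<Longrightarrow> 0 \<le> r1 \<Longrightarrow> r2 \<le> len G e \<Longrightarrow>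
      (\<forall>z\<in>{r1..r2}. convergent (\<lambda>n. qs (s1 (s2 (s3 n))) (place G e z))) \<or>
      (\<forall>\<^sub>F n in sequentially. \<not> (mono_on {r1..r2} (\<lambda>z. qs (s1 (s2 (s3 n))) (place G e z)) \<or>
        antimono_on {r1..r2} (\<lambda>z. qs (s1 (s2 (s3 n))) (place G e z))))"
    using monotone_intervals_selection[OF fin, of "\<lambda>n. qs (s1 (s2 n))" M] qb by blast
  obtain s4 where s4: "strict_mono s4"
      "\<And>e. e \<in> edges G \<Longrightarrow> \<exists>g. weak_limit_on_edge G M (\<lambda>n. qs (s1 (s2 (s3 (s4 n))))) e g"
    using weak_limit_selection[OF fin, of "\<lambda>n. qs (s1 (s2 (s3 n)))" M] qb M by blast
  define Q where "Q n = qs (s1 (s2 (s3 (s4 n))))" for n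
  have Q_eq: "Q = (\<lambda>n. qs (s1 (s2 (s3 (s4 n)))))" by (rule ext) (rule Q_def)
  have Qb: "Q n \<in> bounded_potentials G M" for n using qb by (simp add: Q_def)
  obtain q where q: "q \<in> bounded_potentials G M" "weakly_converges G Q q"
    and qlim: "\<And>p. convergent (\<lambda>n. Q n p) \<Longrightarrow> q p = lim (\<lambda>n. Q n p)"
    using weak_limit_potential[OF Qb M s4(2)[folded Q_def]] by blast
  let ?a = "place G e x"
  have aT: "?a \<in> T" using e xs(4) by blast
  have smono: "strict_mono (\<lambda>n. s2 (s3 (s4 n)))" using s2(1) s3 s4(1) by (simp add: strict_mono_def)
  have anti: "\<forall>\<^sub>F n in sequentially. antimono_on {0..s} (\<lambda>t. Q n (\<gamma> t))"
    if \<gamma>: "graph_path G \<gamma>" "\<gamma> ` {0..1} \<subseteq> T" "\<gamma> 0 \<in> boundary_of G T" "\<gamma> 1 = ?a" and s: "0 \<le> s" "s < 1" for \<gamma> s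
  proof (rule eventually_antimono_before_limit_centre[OF G T e _ _ _ \<gamma> s])
    show "xs (s2 (s3 (s4 n))) \<in> {\<alpha>..\<beta>}" for n by (rule xs(2))
    show "(\<lambda>n. xs (s2 (s3 (s4 n)))) \<longlonglongrightarrow> x" using LIMSEQ_subseq_LIMSEQ[OF xs(3) smono] by (simp add: o_def)
    show "antimono_on {0..1} (\<lambda>t. Q n (\<gamma> t))"
      if "graph_path G \<gamma>" "\<gamma> ` {0..1} \<subseteq> T" "\<gamma> 0 \<in> boundary_of G T" "\<gamma> 1 = place G e (xs (s2 (s3 (s4 n))))" for n \<gamma>
      unfolding Q_def by (rule well[OF that(1-3)]) (simp add: that(4) xs(1))
  qed
  have conv: "convergent (\<lambda>n. Q n (\<gamma> t))"
    if \<gamma>: "graph_path G \<gamma>" "\<gamma> ` {0..1} \<subseteq> T" "\<gamma> 0 \<in> boundary_of G T" "\<gamma> 1 = ?a" and t: "0 \<le> t" "t < 1" for \<gamma> t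
  proof -
    have pathin: "pathin (graph_topology G) \<gamma>" using \<gamma>(1) by (simp add: graph_path_def)
    have p: "\<gamma> t \<in> points G" using path_range_points[OF pathin, of t] t by auto
    have Z: ?thesis if "\<gamma> t \<in> Z"
      using convergent_comp[OF s2(2)[OF that], of "\<lambda>n. s3 (s4 n)"] s3 s4(1) by (simp add: Q_def strict_mono_def)
    show ?thesis
    proof (cases "t = 0")
      case True
      then show ?thesis using Z \<gamma>(3) p by (simp add: Z_def)
    next
      case False
      show ?thesis
      proof (cases "\<gamma> t")
        case (Vertex v)
        then have "\<gamma> t \<in> Z" using p by (auto simp: Z_def points_def place_def vertices_def split: if_splits)
        then show ?thesis by (rule Z)
      next
        case (Interior e' y)
        have t0: "0 < t" using t False by simp
        obtain r1 r2 s where r: "r1 \<in> \<rat>" "r2 \<in> \<rat>" "0 \<le> r1" "r1 < y" "y < r2" "r2 \<le> len G e'" "0 \<le> s" "s < 1"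
          and m: "\<And>f :: ('v, 'e) point \<Rightarrow> real. antimono_on {0..s} (\<lambda>u. f (\<gamma> u)) \<Longrightarrow>
            mono_on {r1..r2} (\<lambda>z. f (place G e' z)) \<or> antimono_on {r1..r2} (\<lambda>z. f (place G e' z))"
          using monotone_interval_on_path[OF G pathin tree_path_inj[OF T \<gamma>(1,2)] t0 t(2) Interior] by metis
        have e': "e' \<in> edges G" "0 < y" "y < len G e'" using interior_point[OF G, of e' y] p Interior by auto
        have ev: "\<forall>\<^sub>F n in sequentially. mono_on {r1..r2} (\<lambda>z. Q n (place G e' z)) \<or> antimono_on {r1..r2} (\<lambda>z. Q n (place G e' z))"
          using anti[OF \<gamma> r(7,8)] by eventually_elim (rule m)
        \<comment> \<open>The potentials are eventually monotone on this interval along the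
          subsequence \<open>s4\<close>, which rules out the second alternative of the
          selection.\<close>
        have "\<not> (\<forall>\<^sub>F n in sequentially. \<not> (mono_on {r1..r2} (\<lambda>z. qs (s1 (s2 (s3 n))) (place G e' z)) \<or>
            antimono_on {r1..r2} (\<lambda>z. qs (s1 (s2 (s3 n))) (place G e' z))))"
        proof
          assume *: "\<forall>\<^sub>F n in sequentially. \<not> (mono_on {r1..r2} (\<lambda>z. qs (s1 (s2 (s3 n))) (place G e' z)) \<or>
            antimono_on {r1..r2} (\<lambda>z. qs (s1 (s2 (s3 n))) (place G e' z)))"
          have "\<forall>\<^sub>F n in sequentially. False"
            using ev eventually_subseq[OF s4(1) *] unfolding Q_def by eventually_elim blast
          then show False by simp
        qed
        then have "convergent (\<lambda>n. qs (s1 (s2 (s3 n))) (place G e' y))"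
          using mon[OF e'(1) r(1,2,3,6)] r by auto
        from convergent_comp[OF this s4(1)] show ?thesis using Interior e' by (simp add: Q_def place_def)
      qed
    qed
  qed
  txt \<open>The potentials need not converge at the limit centre; \<open>0\<close> is the least admissible value there.\<close>
  have single: "single_well G T (q(?a := 0))"
    unfolding single_well_def
  proof (rule bexI[OF _ aT], intro allI impI)
    fix \<gamma> assume "graph_path G \<gamma> \<and> \<gamma> ` {0..1} \<subseteq> T \<and> \<gamma> 0 \<in> boundary_of G T \<and> \<gamma> 1 = ?a"
    then have \<gamma>: "graph_path G \<gamma>" "\<gamma> ` {0..1} \<subseteq> T" "\<gamma> 0 \<in> boundary_of G T" "\<gamma> 1 = ?a" by auto
    have pathin: "pathin (graph_topology G) \<gamma>" using \<gamma>(1) by (simp add: graph_path_def)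
    have ne: "\<gamma> t \<noteq> ?a" if "0 \<le> t" "t < 1" for t
      using inj_onD[OF tree_path_inj[OF T \<gamma>(1,2)], of t 1] \<gamma>(4) that by auto
    have lim: "(\<lambda>n. Q n (\<gamma> t)) \<longlonglongrightarrow> q (\<gamma> t)" if "0 \<le> t" "t < 1" for t
      using conv[OF \<gamma> that] qlim by (simp add: convergent_LIMSEQ_iff)
    show "antimono_on {0..1} (\<lambda>t. (q(?a := 0)) (\<gamma> t))"
    proof (rule monotone_onI)
      fix t t' :: real assume t: "t \<in> {0..1}" "t' \<in> {0..1}" "t \<le> t'"
      show "(q(?a := 0)) (\<gamma> t') \<le> (q(?a := 0)) (\<gamma> t)"
      proof (cases "t' = 1")
        case True
        then show ?thesis using \<gamma>(4) q(1) path_range_points[OF pathin t(1)] by (auto simp: bounded_potentials_def)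
      next
        case False
        then have t': "0 \<le> t'" "t' < 1" "0 \<le> t" "t < 1" using t by auto
        have "\<forall>\<^sub>F n in sequentially. Q n (\<gamma> t') \<le> Q n (\<gamma> t)"
          using anti[OF \<gamma> t'(1,2)] by eventually_elim (use monotone_onD t t' in force)
        then have "q (\<gamma> t') \<le> q (\<gamma> t)" by (rule tendsto_le[OF sequentially_bot lim[OF t'(3,4)] lim[OF t'(1,2)]])
        then show ?thesis using ne t' by simp
      qed
    qed
  qed
  show thesis
  proof (rule that)
    show "strict_mono (\<lambda>n. s1 (s2 (s3 (s4 n))))" using s1 s2(1) s3 s4(1) by (simp add: strict_mono_def)
    show "q(?a := 0) \<in> single_well_potentials G T M"
      unfolding single_well_potentials_def using single bounded_potentials_update[OF q(1), of 0 ?a] M by auto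
    show "weakly_converges G (\<lambda>n. qs (s1 (s2 (s3 (s4 n))))) (q(?a := 0))"
      using weakly_converges_update[OF q(2), of ?a 0] by (simp only: Q_eq)
  qed
qed

lemma gap_extrema_attained:
  fixes \<Lambda> :: "(('v, 'e) point \<Rightarrow> real) set"
  assumes G: "compact_metric_graph G" and M: "0 \<le> M" and \<Lambda>: "\<Lambda> \<noteq> {}" "\<Lambda> \<subseteq> bounded_potentials G M"
    and selection: "\<And>qs. (\<And>n. qs n \<in> \<Lambda>) \<Longrightarrow>
      \<exists>r q. strict_mono r \<and> q \<in> \<Lambda> \<and> weakly_converges G (\<lambda>n. qs (r n :: nat)) q"
  shows "\<exists>q_min\<in>\<Lambda>. \<exists>q_max\<in>\<Lambda>.
    (\<forall>q\<in>\<Lambda>. fundamental_gap G q_min \<le> fundamental_gap G q) \<and>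
    (\<forall>q\<in>\<Lambda>. fundamental_gap G q \<le> fundamental_gap G q_max)"
proof -
  let ?S = "fundamental_gap G ` \<Lambda>"
  have "seq_compact ?S"
    unfolding seq_compact_def
  proof (intro allI impI)
    fix X :: "nat \<Rightarrow> real" assume "\<forall>n. X n \<in> ?S"
    then have "\<forall>n. \<exists>q\<in>\<Lambda>. X n = fundamental_gap G q" by blast
    then obtain qs where qs: "\<And>n. qs n \<in> \<Lambda>" "\<And>n. X n = fundamental_gap G (qs n)" by metis
    obtain r q where r: "strict_mono r" "q \<in> \<Lambda>" "weakly_converges G (\<lambda>n. qs (r n)) q" using selection[of qs, OF qs(1)] by (elim exE conjE) (rule that)
    have "(\<lambda>n. fundamental_gap G (qs (r n))) \<longlonglongrightarrow> fundamental_gap G q"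
      by (rule fundamental_gap_continuous[OF G M _ _ r(3)]) (use \<Lambda>(2) qs(1) r(2) in blast)+
    then show "\<exists>l\<in>?S. \<exists>r. strict_mono r \<and> (X \<circ> r) \<longlonglongrightarrow> l"
      using r(1,2) qs(2) by (auto simp: o_def)
  qed
  then have S: "compact ?S" "?S \<noteq> {}" using \<Lambda>(1) by (auto simp: compact_eq_seq_compact_metric)
  show ?thesis using compact_attains_inf[OF S] compact_attains_sup[OF S] by auto
qed

text \<open>This makes both classes nonempty; for single wells any point of T serves as the
  centre.\<close>

lemma zero_potential:
  assumes "0 \<le> M"
  shows "(\<lambda>_. 0) \<in> convex_potentials G \<P> M" "T \<noteq> {} \<Longrightarrow> (\<lambda>_. 0) \<in> single_well_potentials G T M"
proof -
  have b: "(\<lambda>_. 0) \<in> bounded_potentials G M" using assms by (simp add: bounded_potentials_def)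
  have "convex_on_path G \<gamma> (\<lambda>_. 0)" for \<gamma>
    unfolding convex_on_path_def by (rule exI[of _ "\<lambda>_. 0"]) (simp add: convex_on_const)
  then show "(\<lambda>_. 0) \<in> convex_potentials G \<P> M" using b by (simp add: convex_potentials_def)
  show "(\<lambda>_. 0) \<in> single_well_potentials G T M" if "T \<noteq> {}"
    using b that by (auto simp: single_well_potentials_def single_well_def intro: monotone_onI)
qed

theorem theorem3p5:
  fixes G :: "('v, 'e) metric_graph"
    and \<P> :: "(real \<Rightarrow> ('v, 'e) point) set"
    and T :: "('v, 'e) point set"
    and M :: real
    and \<Lambda> :: "(('v, 'e) point \<Rightarrow> real) set"
  assumes "compact_metric_graph G"
    and "finite \<P>" and "\<forall>\<gamma>\<in>\<P>. graph_path G \<gamma>"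
    and "tree_subgraph G T"
    and "M > 0"
    and "\<Lambda> = convex_potentials G \<P> M \<or> \<Lambda> = single_well_potentials G T M"
  shows "\<exists>q_min\<in>\<Lambda>. \<exists>q_max\<in>\<Lambda>.
    (\<forall>q\<in>\<Lambda>. fundamental_gap G q_min \<le> fundamental_gap G q) \<and>
    (\<forall>q\<in>\<Lambda>. fundamental_gap G q \<le> fundamental_gap G q_max)"
proof -
  have M: "0 \<le> M" using assms(5) by simp
  have T: "T \<noteq> {}" using assms(4) by (simp add: tree_subgraph_def)
  have "\<Lambda> \<noteq> {}" using assms(6) zero_potential(1)[OF M] zero_potential(2)[OF M T] by blast
  moreover have "\<Lambda> \<subseteq> bounded_potentials G M"
    using assms(6) by (auto simp: convex_potentials_def single_well_potentials_def)
  moreover have "\<exists>r q. strict_mono r \<and> q \<in> \<Lambda> \<and> weakly_converges G (\<lambda>n. qs (r n)) q"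
    if qs: "\<And>n. qs n \<in> \<Lambda>" for qs :: "nat \<Rightarrow> ('v, 'e) point \<Rightarrow> real"
    using assms(6)
  proof
    assume \<Lambda>: "\<Lambda> = convex_potentials G \<P> M"
    show ?thesis
      by (rule convex_potentials_compact[OF assms(1,2) _ M qs[unfolded \<Lambda>]]) (use assms(3) \<Lambda> in auto)
  next
    assume \<Lambda>: "\<Lambda> = single_well_potentials G T M"
    show ?thesis
      by (rule single_well_potentials_compact[OF assms(1,4) M qs[unfolded \<Lambda>]]) (use \<Lambda> in auto)
  qed
  ultimately show ?thesis by (rule gap_extrema_attained[OF assms(1) M])
qed

end
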